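(* There is a constant $\beta>0$, independent of $h$, such that for $h$ sufficiently small the following holds: $$\sup_{\mathbf v_h\in\mathbf V_{h,\ast}}\frac{b(\lambda_h,\mathbf v_h)}{\|\mathbf v_h\|_1}\ge\beta\|\lambda_h\|_1\quad\text{for all }\lambda_h\in V_h.$$
   Context: Let $d\in\{2,3\}$ and let $\Omega\subset\mathbb R^d$ be a bounded connected open polygonal (polyhedral) domain with Lipschitz boundary. $\mathbf H^1(\Omega)=H^1(\Omega)^d$; $(\cdot,\cdot)_1$ and $\|\cdot\|_1$ are the standard $H^1$ inner product and norm (for scalar and vector functions: $L^2$ inner product of the functions plus that of their gradients). Let $k\ge1$ and let $\hat{\mathbf z}\in H^{k+1,\infty}(\Omega)^d$ with $\|\hat{\mathbf z}\|=1$ (Euclidean norm) a.e. on $\Omega$. Set $b(\lambda,\mathbf v)=(\lambda,\mathbf v\cdot\hat{\mathbf z})_1$ for $\lambda\in H^1(\Omega)$, $\mathbf v\in\mathbf H^1(\Omega)$. Let $K=\{\mathbf v\in\mathbf H^1(\Omega):\nabla\mathbf v+\nabla\mathbf v^T=0\}$ (rigid motions). Let $\{\mathcal T_h\}_{h>0}$ be a shape regular (not necessarily quasi-uniform) family of simplicial triangulations of $\Omega$ ($h$ is the mesh size), $V_h$ the space of continuous piecewise polynomials of degree $k$ on $\mathcal T_h$, $\mathbf V_h=V_h^d$. Set $\ker_h(b)=\{\mathbf v_h\in\mathbf V_h: b(\lambda_h,\mathbf v_h)=0\ \forall\lambda_h\in V_h\}$, $\mathcal K_{\hat{\mathbf z},h}=\ker_h(b)\cap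 K$, and $\mathbf V_{h,\ast}=\{\mathbf v_h\in\mathbf V_h:(\mathbf v_h,\mathbf w)_1=0\ \forall\mathbf w\in\mathcal K_{\hat{\mathbf z},h}\}$. The supremum is over nonzero $\mathbf v_h$. *)

theory Defs
  imports "HOL-Analysis.Analysis"
begin

section \<open>Test functions and weak derivatives\<close>

definition partial_deriv :: "'d::finite \<Rightarrow> (real^'d \<Rightarrow> real) \<Rightarrow> real^'d \<Rightarrow> real" where
  "partial_deriv i f = (\<lambda>x. frechet_derivative f (at x) (axis i 1))"

text \<open>A list of coordinate directions plays the role of a multi-index whose order is the length
  of the list; on smooth functions the order of the entries is irrelevant.\<close>

definition partial_derivs :: "'d::finite list \<Rightarrow> (real^'d \<Rightarrow> real) \<Rightarrow> real^'d \<Rightarrow> real" where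
  "partial_derivs ds f = foldr partial_deriv ds f"

definition test_function :: "(real^'d::finite) set \<Rightarrow> (real^'d \<Rightarrow> real) \<Rightarrow> bool" where
  "test_function \<Omega> \<phi> \<longleftrightarrow>
     (\<forall>ds x. partial_derivs ds \<phi> differentiable (at x)) \<and>
     compact (closure {x. \<phi> x \<noteq> 0}) \<and> closure {x. \<phi> x \<noteq> 0} \<subseteq> \<Omega>"

definition locally_integrable_on ::
    "(real^'d::finite) set \<Rightarrow> (real^'d \<Rightarrow> 'b::euclidean_space) \<Rightarrow> bool" where
  "locally_integrable_on \<Omega> f \<longleftrightarrow>
     (\<forall>C. compact C \<and> C \<subseteq> \<Omega> \<longrightarrow> integrable (lebesgue_on C) f)"

definition has_weak_deriv ::
    "(real^'d::finite) set \<Rightarrow> 'd list \<Rightarrow> (real^'d \<Rightarrow> 'b::euclidean_space) \<Rightarrow> (real^'d \<Rightarrow> 'b) \<Rightarrow> bool"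
  where
  "has_weak_deriv \<Omega> ds f g \<longleftrightarrow>
     locally_integrable_on \<Omega> f \<and> locally_integrable_on \<Omega> g \<and>
     (\<forall>\<phi>. test_function \<Omega> \<phi> \<longrightarrow>
        integral\<^sup>L (lebesgue_on \<Omega>) (\<lambda>x. partial_derivs ds \<phi> x *\<^sub>R f x) =
        (-1) ^ length ds *\<^sub>R integral\<^sup>L (lebesgue_on \<Omega>) (\<lambda>x. \<phi> x *\<^sub>R g x))"

text \<open>Some representative of the first weak derivative in direction \<open>i\<close>; it is determined only up
  to null sets, and meaningful only if the weak derivative exists.\<close>

definition weak_partial ::
    "(real^'d::finite) set \<Rightarrow> 'd \<Rightarrow> (real^'d \<Rightarrow> 'b::euclidean_space) \<Rightarrow> real^'d \<Rightarrow> 'b" where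
  "weak_partial \<Omega> i f = (SOME g. has_weak_deriv \<Omega> [i] f g)"

section \<open>Sobolev spaces\<close>

text \<open>Functions are total; only their values on \<open>\<Omega>\<close> matter. The codomain covers scalar functions
  (\<open>real\<close>, whose inner product is multiplication) and vector fields.\<close>

definition L2_space :: "(real^'d::finite) set \<Rightarrow> (real^'d \<Rightarrow> 'b::euclidean_space) set" where
  "L2_space \<Omega> = {f. f \<in> borel_measurable (lebesgue_on \<Omega>) \<and>
                     integrable (lebesgue_on \<Omega>) (\<lambda>x. (norm (f x))\<^sup>2)}"

definition Linf_space :: "(real^'d::finite) set \<Rightarrow> (real^'d \<Rightarrow> 'b::euclidean_space) set" where
  "Linf_space \<Omega> = {f. f \<in> borel_measurable (lebesgue_on \<Omega>) \<and>
                       (\<exists>C. AE x in lebesgue_on \<Omega>. norm (f x) \<le> C)}"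

definition H1_space :: "(real^'d::finite) set \<Rightarrow> (real^'d \<Rightarrow> 'b::euclidean_space) set" where
  "H1_space \<Omega> = {f \<in> L2_space \<Omega>. \<forall>i. \<exists>g \<in> L2_space \<Omega>. has_weak_deriv \<Omega> [i] f g}"

definition Winf_space ::
    "nat \<Rightarrow> (real^'d::finite) set \<Rightarrow> (real^'d \<Rightarrow> 'b::euclidean_space) set" where
  "Winf_space m \<Omega> =
     {f \<in> Linf_space \<Omega>.
        \<forall>ds. length ds \<le> m \<longrightarrow> (\<exists>g \<in> Linf_space \<Omega>. has_weak_deriv \<Omega> ds f g)}"

definition H1_inner ::
    "(real^'d::finite) set \<Rightarrow> (real^'d \<Rightarrow> 'b::euclidean_space) \<Rightarrow> (real^'d \<Rightarrow> 'b) \<Rightarrow> real" where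
  "H1_inner \<Omega> f g =
     integral\<^sup>L (lebesgue_on \<Omega>) (\<lambda>x. f x \<bullet> g x) +
     (\<Sum>i\<in>UNIV. integral\<^sup>L (lebesgue_on \<Omega>) (\<lambda>x. weak_partial \<Omega> i f x \<bullet> weak_partial \<Omega> i g x))"

definition H1_norm :: "(real^'d::finite) set \<Rightarrow> (real^'d \<Rightarrow> 'b::euclidean_space) \<Rightarrow> real" where
  "H1_norm \<Omega> f = sqrt (H1_inner \<Omega> f f)"

section \<open>Domains and meshes\<close>

text \<open>Near each boundary point, and after a rotation taking the last axis to \<open>n\<close>, the set is the
  strict epigraph of a Lipschitz function \<open>\<gamma>\<close> of the components orthogonal to \<open>n\<close>.\<close>

definition lipschitz_boundary :: "(real^'d::finite) set \<Rightarrow> bool" where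
  "lipschitz_boundary \<Omega> \<longleftrightarrow>
     (\<forall>x\<in>frontier \<Omega>. \<exists>r>0. \<exists>n. norm n = 1 \<and>
        (\<exists>L \<gamma>. L-lipschitz_on {y. y \<bullet> n = 0} \<gamma> \<and>
           \<Omega> \<inter> ball x r = {y \<in> ball x r. y \<bullet> n > \<gamma> (y - (y \<bullet> n) *\<^sub>R n)}))"

definition polyhedral_boundary :: "(real^'d::finite) set \<Rightarrow> bool" where
  "polyhedral_boundary \<Omega> \<longleftrightarrow>
     (\<exists>F. finite F \<and> (\<forall>P\<in>F. polytope P \<and> aff_dim P = int CARD('d) - 1) \<and> frontier \<Omega> = \<Union>F)"

definition triangulation_of :: "(real^'d::finite) set \<Rightarrow> (real^'d) set set \<Rightarrow> bool" where
  "triangulation_of \<Omega> \<T> \<longleftrightarrow>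
     triangulation \<T> \<and> (\<forall>T\<in>\<T>. int CARD('d) simplex T) \<and> \<Union>\<T> = closure \<Omega>"

definition mesh_size :: "(real^'d::finite) set set \<Rightarrow> real" where
  "mesh_size \<T> = Max (diameter ` \<T>)"

definition inball_diameter :: "(real^'d::finite) set \<Rightarrow> real" where
  "inball_diameter T = Sup {2 * r | r. 0 \<le> r \<and> (\<exists>x. cball x r \<subseteq> T)}"

definition shape_regular :: "(real^'d::finite) set set set \<Rightarrow> bool" where
  "shape_regular \<F> \<longleftrightarrow> (\<exists>\<sigma>. \<forall>\<T>\<in>\<F>. \<forall>T\<in>\<T>. diameter T \<le> \<sigma> * inball_diameter T)"

section \<open>Finite element spaces\<close>

definition polys_of_degree_le :: "nat \<Rightarrow> (real^'d::finite \<Rightarrow> real) set" where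
  "polys_of_degree_le k =
     {p. \<exists>c. \<forall>x. p x = (\<Sum>\<alpha> | (\<Sum>i\<in>UNIV. \<alpha> i) \<le> k. c \<alpha> * (\<Prod>i\<in>UNIV. (x $ i) ^ \<alpha> i))}"

definition fe_space ::
    "(real^'d::finite) set \<Rightarrow> nat \<Rightarrow> (real^'d) set set \<Rightarrow> (real^'d \<Rightarrow> real) set" where
  "fe_space \<Omega> k \<T> =
     {u. continuous_on (closure \<Omega>) u \<and> (\<forall>T\<in>\<T>. \<exists>p\<in>polys_of_degree_le k. \<forall>x\<in>T. u x = p x)}"

definition vec_fe_space ::
    "(real^'d::finite) set \<Rightarrow> nat \<Rightarrow> (real^'d) set set \<Rightarrow> (real^'d \<Rightarrow> real^'d) set" where
  "vec_fe_space \<Omega> k \<T> = {v. \<forall>j. (\<lambda>x. v x $ j) \<in> fe_space \<Omega> k \<T>}"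

section \<open>The bilinear form and its discrete kernel\<close>

definition b_form ::
    "(real^'d::finite) set \<Rightarrow> (real^'d \<Rightarrow> real^'d) \<Rightarrow> (real^'d \<Rightarrow> real) \<Rightarrow> (real^'d \<Rightarrow> real^'d) \<Rightarrow> real"
  where
  "b_form \<Omega> z \<mu> v = H1_inner \<Omega> \<mu> (\<lambda>x. v x \<bullet> z x)"

definition rigid_motions :: "(real^'d::finite) set \<Rightarrow> (real^'d \<Rightarrow> real^'d) set" where
  "rigid_motions \<Omega> =
     {v \<in> H1_space \<Omega>. \<forall>i j. AE x in lebesgue_on \<Omega>.
        weak_partial \<Omega> i v x $ j + weak_partial \<Omega> j v x $ i = 0}"

definition discrete_kernel ::
    "(real^'d::finite) set \<Rightarrow> nat \<Rightarrow> (real^'d \<Rightarrow> real^'d) \<Rightarrow> (real^'d) set set \<Rightarrow>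
     (real^'d \<Rightarrow> real^'d) set" where
  "discrete_kernel \<Omega> k z \<T> =
     {v \<in> vec_fe_space \<Omega> k \<T>. \<forall>\<mu>\<in>fe_space \<Omega> k \<T>. b_form \<Omega> z \<mu> v = 0}"

definition vec_fe_space_star ::
    "(real^'d::finite) set \<Rightarrow> nat \<Rightarrow> (real^'d \<Rightarrow> real^'d) \<Rightarrow> (real^'d) set set \<Rightarrow>
     (real^'d \<Rightarrow> real^'d) set" where
  "vec_fe_space_star \<Omega> k z \<T> =
     {v \<in> vec_fe_space \<Omega> k \<T>. \<forall>w \<in> discrete_kernel \<Omega> k z \<T> \<inter> rigid_motions \<Omega>. H1_inner \<Omega> v w = 0}"

end

(*
  Fix a mesh and mu in V_h. On a simplex with vertices a and barycentric coordinates t_a put, for a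
  component f of z, Z = sum_a t_a f(a), W = sum_a t_a (f(a) - Z) a and v = Z mu + (1/k) (grad mu) .
  W. In Bernstein form this multiplies each coefficient of mu by the value of Z at its lattice
  point. The terms of degree k + 1 cancel by Euler's identity, and v is continuous across faces
  because W is tangential to every face. Elementwise Taylor expansion and an inverse inequality give
  || v - f mu ||_1 <= C h || mu ||_1 without quasi-uniformity. Doing this for all components of z
  and using |z| = 1, v . z - mu is of size h || mu ||_1, so that b(mu, v) >= || mu ||_1^2 / 2 for
  small h while || v ||_1 <= C || mu ||_1. Subtracting the orthogonal projection onto the rigid
  motions in the discrete kernel puts v into the required space, does not change b(mu, v) and does
  not increase the norm.
*)
theory Submission
  imports Defs
begin

section \<open>Smooth cut-off functions\<close>

text \<open>\<open>H1_inner\<close> is built on \<open>weak_partial\<close>, an arbitrary choice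
  among weak derivatives, so nothing can be computed before weak derivatives are known to be unique
  a.e. and to agree with classical ones. The functions whose inner products are estimated are
  bounded and Lipschitz along segments after a change on a null set; \<open>lip_rep\<close> records
  such a representative together with its a.e. derivative, and estimates become pointwise
  inequalities between integrands. The field z is given only by essentially bounded weak
  derivatives, whereas the construction evaluates it at mesh vertices, possibly on the boundary.
  Mollification yields a representative with Lipschitz gradient, and the Lipschitz boundary gives it
  limits at boundary points. The error of the local construction involves second derivatives of z
  and the Hessian of mu weighted by the local diameter; the inverse inequality removes that Hessian
  element by element, which is why sizes of different elements are never compared.\<close>

fun Cn1 :: "nat \<Rightarrow> (real \<Rightarrow> real) \<Rightarrow> bool" where
  "Cn1 0 f = True"
| "Cn1 (Suc n) f = (\<exists>f'. (\<forall>t. (f has_real_derivative f' t) (at t)) \<and> Cn1 n f')"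

text \<open>n-fold Frechet differentiability with explicit gradient witnesses; level 0 asks for
  nothing, not even continuity. The existential form turns closure under products and composition
  into inductions in which the witnesses are written down, with no \<open>frechet_derivative\<close>
  to evaluate.\<close>

fun Cn :: "nat \<Rightarrow> (real^'d::finite \<Rightarrow> real) \<Rightarrow> bool" where
  "Cn 0 f = True"
| "Cn (Suc n) f = (\<exists>D. (\<forall>x. (f has_derivative (\<lambda>h. \<Sum>i\<in>UNIV. h $ i * D i x)) (at x)) \<and> (\<forall>i. Cn n (D i)))"

text \<open>The family p(1/t) exp(-1/t), extended by 0, is closed under differentiation, which is
  why the polynomial is a parameter. The case p = 1 is the standard smooth cut-off.\<close>

definition exp_cutoff :: "real poly \<Rightarrow> real \<Rightarrow> real" where
  "exp_cutoff p t = (if t \<le> 0 then 0 else poly p (1/t) * exp (- (1/t)))"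

lemma poly_div_exp_tendsto_0: "((\<lambda>s. poly p s / exp s) \<longlongrightarrow> (0::real)) at_top"
proof -
  have "((\<lambda>s. \<Sum>i\<le>degree p. coeff p i * (s ^ i / exp s)) \<longlongrightarrow> (\<Sum>i\<le>degree p. coeff p i * 0)) at_top"
    by (intro tendsto_sum tendsto_mult tendsto_const tendsto_power_div_exp_0)
  then show ?thesis by (simp add: poly_altdef sum_divide_distrib)
qed

declare Cn.simps [simp del]

lemma exp_cutoff_has_derivative:
  "(exp_cutoff p has_real_derivative exp_cutoff ([:0,0,1:] * (p - pderiv p)) t) (at t)"
proof -
  consider "t < 0" | "t = 0" | "t > 0" by linarith
  then show ?thesis
  proof cases
    case 1
    have "((\<lambda>t. 0) has_real_derivative 0) (at t)" by simp
    then have "(exp_cutoff p has_real_derivative 0) (at t)"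
      by (rule has_field_derivative_transform_within_open[where S="{..<0}"])
        (use 1 in \<open>auto simp: exp_cutoff_def\<close>)
    then show ?thesis using 1 by (simp add: exp_cutoff_def)
  next
    case 3
    have "((\<lambda>t. poly p (1/t)) has_real_derivative poly (pderiv p) (1/t) * (- 1 / t^2)) (at t)"
      by (rule DERIV_chain2[OF poly_DERIV]) (use 3 in \<open>auto intro!: derivative_eq_intros simp: power2_eq_square\<close>)
    moreover have "((\<lambda>t. exp (- (1/t))) has_real_derivative exp (- (1/t)) * (1 / t^2)) (at t)"
      by (rule derivative_eq_intros | use 3 in \<open>simp add: power2_eq_square\<close>)+
    ultimately have "((\<lambda>t. poly p (1/t) * exp (- (1/t))) has_real_derivative
            (poly (pderiv p) (1/t) * (- 1 / t^2)) * exp (- (1/t)) + exp (- (1/t)) * (1 / t^2) * poly p (1/t)) (at t)"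
      by (rule DERIV_mult)
    also have "(poly (pderiv p) (1/t) * (- 1 / t^2)) * exp (- (1/t)) + exp (- (1/t)) * (1 / t^2) * poly p (1/t)
      = exp_cutoff ([:0,0,1:] * (p - pderiv p)) t"
      using 3 by (simp add: exp_cutoff_def power2_eq_square algebra_simps)
    finally show ?thesis
      by (rule has_field_derivative_transform_within_open[where S="{0<..}"])
        (use 3 in \<open>auto simp: exp_cutoff_def\<close>)
  next
    case 2
    \<comment> \<open>The difference quotient at 0 is (1/h) p(1/h) exp(-1/h); with s = 1/h this is a
      polynomial in s divided by exp s.\<close>
    have "((\<lambda>h. poly ([:0,1:]*p) (inverse h) / exp (inverse h)) \<longlongrightarrow> (0::real)) (at_right 0)"
      by (rule filterlim_compose[OF poly_div_exp_tendsto_0 filterlim_inverse_at_top_right])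
    moreover have "\<forall>\<^sub>F h in at_right 0. poly ([:0,1:]*p) (inverse h) / exp (inverse h) = exp_cutoff p h / h"
      using eventually_at_right_less[of "0::real"]
      by eventually_elim (simp add: exp_cutoff_def exp_minus field_simps)
    ultimately have r: "((\<lambda>h. exp_cutoff p h / h) \<longlongrightarrow> (0::real)) (at_right 0)"
      by (rule Lim_transform_eventually)
    have l: "((\<lambda>h. exp_cutoff p h / h) \<longlongrightarrow> (0::real)) (at_left 0)"
      by (rule Lim_transform_eventually[OF tendsto_const])
        (simp add: exp_cutoff_def eventually_at_filter)
    have "((\<lambda>h. exp_cutoff p h / h) \<longlongrightarrow> (0::real)) (at 0)"
      using l r by (simp add: filterlim_split_at)
    then show ?thesis
      using 2 by (simp add: DERIV_def exp_cutoff_def[of _ 0])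
  qed
qed

lemma Cn1_exp_cutoff: "Cn1 n (exp_cutoff p)"
proof (induction n arbitrary: p)
  case (Suc n)
  show ?case
    unfolding Cn1.simps using exp_cutoff_has_derivative Suc by blast
qed simp

lemma Cn_Suc_imp: "Cn (Suc n) f \<Longrightarrow> Cn n f"
proof (induction n arbitrary: f)
  case 0
  show ?case by (simp add: Cn.simps)
next
  case (Suc n)
  then obtain D where "\<And>x. (f has_derivative (\<lambda>h. \<Sum>i\<in>UNIV. h $ i * D i x)) (at x)" "\<And>i. Cn (Suc n) (D i)"
    unfolding Cn.simps(2)[of "Suc n"] by metis
  with Suc.IH show ?case
    unfolding Cn.simps(2)[of n] by blast
qed

lemma Cn_const: "Cn n (\<lambda>x. c)"
proof (induction n arbitrary: c)
  case (Suc n)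
  show ?case by (auto simp: Cn.simps intro!: exI[of _ "\<lambda>i x. 0"] Suc)
qed (simp add: Cn.simps)

lemma Cn_add: "Cn n f \<Longrightarrow> Cn n g \<Longrightarrow> Cn n (\<lambda>x. f x + g x)"
proof (induction n arbitrary: f g)
  case (Suc n)
  obtain D E where D: "\<And>x. (f has_derivative (\<lambda>h. \<Sum>i\<in>UNIV. h $ i * D i x)) (at x)" "\<And>i. Cn n (D i)"
    and E: "\<And>x. (g has_derivative (\<lambda>h. \<Sum>i\<in>UNIV. h $ i * E i x)) (at x)" "\<And>i. Cn n (E i)"
    using Suc.prems by (auto simp: Cn.simps)
  show ?case
    unfolding Cn.simps
    by (rule exI[of _ "\<lambda>i x. D i x + E i x"])
      (auto intro!: derivative_eq_intros D E Suc.IH simp: sum.distrib distrib_left)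
qed (simp add: Cn.simps)

lemma Cn_mult: "Cn n f \<Longrightarrow> Cn n g \<Longrightarrow> Cn n (\<lambda>x. f x * g x)"
proof (induction n arbitrary: f g)
  case (Suc n)
  obtain D E where D: "\<And>x. (f has_derivative (\<lambda>h. \<Sum>i\<in>UNIV. h $ i * D i x)) (at x)" "\<And>i. Cn n (D i)"
    and E: "\<And>x. (g has_derivative (\<lambda>h. \<Sum>i\<in>UNIV. h $ i * E i x)) (at x)" "\<And>i. Cn n (E i)"
    using Suc.prems by (auto simp: Cn.simps)
  have "Cn n f" "Cn n g" using Suc.prems by (auto intro: Cn_Suc_imp)
  then show ?case
    unfolding Cn.simps
    by (intro exI[of _ "\<lambda>i x. f x * E i x + D i x * g x"])
      (auto intro!: derivative_eq_intros D E Suc.IH Cn_add simp: sum.distrib sum_distrib_left sum_distrib_right algebra_simps)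
qed (simp add: Cn.simps)

lemma Cn_prod: "finite A \<Longrightarrow> (\<And>a. a \<in> A \<Longrightarrow> Cn n (f a)) \<Longrightarrow> Cn n (\<lambda>x. \<Prod>a\<in>A. f a x)"
  by (induction rule: finite_induct) (simp_all add: Cn_const Cn_mult )

lemma Cn_compose: "Cn1 n f \<Longrightarrow> Cn n g \<Longrightarrow> Cn n (\<lambda>x. f (g x))"
proof (induction n arbitrary: f)
  case (Suc n)
  obtain f' where f': "\<And>t. (f has_real_derivative f' t) (at t)" "Cn1 n f'" using Suc.prems by (auto simp: Cn.simps)
  obtain E where E: "\<And>x. (g has_derivative (\<lambda>h. \<Sum>i\<in>UNIV. h $ i * E i x)) (at x)" "\<And>i. Cn n (E i)"
    using Suc.prems by (auto simp: Cn.simps)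
  have "Cn n g" using Suc.prems by (auto intro: Cn_Suc_imp)
  then have "Cn n (\<lambda>x. f' (g x))" by (rule Suc.IH[OF f'(2)])
  moreover have "((\<lambda>x. f (g x)) has_derivative (\<lambda>h. \<Sum>i\<in>UNIV. h $ i * (f' (g x) * E i x))) (at x)" for x
    by (rule has_derivative_eq_rhs[OF has_derivative_compose[OF E(1) f'(1)[unfolded has_field_derivative_def]]])
      (simp add: sum_distrib_left mult_ac)
  ultimately show ?case
    unfolding Cn.simps
    by (intro exI[of _ "\<lambda>i x. f' (g x) * E i x"]) (auto intro!: Cn_mult E)
qed (simp add: Cn.simps)

lemma Cn_component: "Cn n (\<lambda>x. x $ i)"
proof (cases n)
  case (Suc m)
  have "((\<lambda>x. x $ i) has_derivative (\<lambda>h. \<Sum>j\<in>UNIV. h $ j * (if j = i then 1 else 0))) (at x)" for x :: "real^'a"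
    by (rule has_derivative_eq_rhs[OF bounded_linear_imp_has_derivative[OF bounded_linear_vec_nth]])
      (simp add: mult_delta_right)
  moreover have "Cn m (\<lambda>x::real^'a. if j = i then 1 else 0)" for j
    by (rule Cn_const)
  ultimately show ?thesis
    unfolding Suc Cn.simps by (intro exI[of _ "\<lambda>j x. if j = i then 1 else 0"] conjI allI)
qed (simp add: Cn.simps)

lemma Cn_sum: "finite A \<Longrightarrow> (\<And>a. a \<in> A \<Longrightarrow> Cn n (f a)) \<Longrightarrow> Cn n (\<lambda>x. \<Sum>a\<in>A. f a x)"
  by (induction rule: finite_induct) (simp_all add: Cn_const Cn_add )

lemma Cn_diff:
  assumes "Cn n f" "Cn n g"
  shows "Cn n (\<lambda>x. f x - g x)"
proof -
  have "Cn n (\<lambda>x. (-1) * g x)" by (rule Cn_mult[OF Cn_const assms(2)])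
  from Cn_add[OF assms(1) this] show ?thesis by simp
qed

section \<open>Partial derivatives and test functions\<close>

lemma sum_axis: "(\<Sum>j\<in>UNIV. axis i (1::real) $ j * f j) = f (i::'d::finite)"
proof -
  have "(\<Sum>j\<in>UNIV. axis i (1::real) $ j * f j) = (\<Sum>j\<in>UNIV. if j = i then f j else 0)"
    by (rule sum.cong) (auto simp: axis_def)
  then show ?thesis by (simp only: sum.delta[OF finite] UNIV_I if_True)
qed

lemma partial_deriv_eq:
  assumes "(f has_derivative D) (at x)"
  shows "partial_deriv i f x = D (axis i 1)"
  unfolding partial_deriv_def using frechet_derivative_at[OF assms] by metis

text \<open>Links the witnesses of \<open>Cn\<close> to the concrete \<open>partial_derivs\<close>.
  Each derivative uses up one level; the surplus m keeps the induction going, since differentiating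
  once more needs the tail at level \<open>Suc m\<close>.\<close>

lemma Cn_partial_derivs: "Cn (length ds + m) f \<Longrightarrow> Cn m (partial_derivs ds f)"
proof (induction ds arbitrary: m)
  case (Cons i ds)
  have eq: "length (i # ds) + m = length ds + Suc m" by simp
  have "Cn (Suc m) (partial_derivs ds f)" by (rule Cons.IH[OF Cons.prems[unfolded eq]])
  then obtain D where D: "\<And>x. (partial_derivs ds f has_derivative (\<lambda>h. \<Sum>i\<in>UNIV. h $ i * D i x)) (at x)" "\<And>i. Cn m (D i)"
    unfolding Cn.simps by metis
  have "partial_derivs (i # ds) f = D i"
    by (rule ext) (use partial_deriv_eq[OF D(1)] in \<open>simp add: partial_derivs_def sum_axis\<close>)
  then show ?case using D(2) by metis
qed (simp add: partial_derivs_def)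

lemma test_functionI:
  assumes "\<And>n. Cn n f" "compact K" "K \<subseteq> \<Omega>" "\<And>x. f x \<noteq> 0 \<Longrightarrow> x \<in> K"
  shows "test_function \<Omega> f"
proof -
  have "closure {x. f x \<noteq> 0} \<subseteq> K"
    using assms by (intro closure_minimal) (auto simp: compact_imp_closed)
  then have "compact (closure {x. f x \<noteq> 0})"
    using compact_Int_closed[OF assms(2) closed_closure] by (metis Int_absorb1)
  moreover have "partial_derivs ds f differentiable (at x)" for ds x
  proof -
    have "Cn (Suc 0) (partial_derivs ds f)" by (intro Cn_partial_derivs assms)
    then show ?thesis by (auto simp: Cn.simps differentiable_def)
  qed
  ultimately show ?thesis
    using \<open>closure _ \<subseteq> K\<close> assms(3) by (auto simp: test_function_def)
qed

lemma test_function_compact_support: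
  assumes "test_function \<Omega> f"
  obtains K where "compact K" "K \<subseteq> \<Omega>" "\<And>x. x \<notin> K \<Longrightarrow> f x = 0"
proof (rule that)
  show "f x = 0" if "x \<notin> closure {x. f x \<noteq> 0}" for x
    using that closure_subset[of "{x. f x \<noteq> 0}"] by auto
qed (use assms in \<open>auto simp: test_function_def\<close>)

section \<open>Integrals over open sets as integrals over the whole space\<close>

lemma integral_lebesgue_on_eq:
  fixes f :: "'a::euclidean_space \<Rightarrow> 'b::{banach, second_countable_topology}"
  assumes "S \<in> sets lebesgue"
  shows "integral\<^sup>L (lebesgue_on S) f = integral\<^sup>L lebesgue (\<lambda>x. indicator S x *\<^sub>R f x)"
  using assms by (intro integral_restrict_space) simp

lemma integrable_lebesgue_on_iff:
  fixes f :: "'a::euclidean_space \<Rightarrow> 'b::{banach, second_countable_topology}"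
  assumes "S \<in> sets lebesgue"
  shows "integrable (lebesgue_on S) f \<longleftrightarrow> integrable lebesgue (\<lambda>x. indicator S x *\<^sub>R f x)"
  using assms by (intro integrable_restrict_space) simp

lemma AE_lebesgue_on_iff:
  assumes "S \<in> sets lebesgue"
  shows "(AE x in lebesgue_on S. P x) \<longleftrightarrow> (AE x in lebesgue. x \<in> S \<longrightarrow> P x)"
  using assms by (intro AE_restrict_space_iff) simp

lemma borel_measurable_lebesgue_on_iff:
  fixes f :: "'a::euclidean_space \<Rightarrow> 'b::real_normed_vector"
  assumes "S \<in> sets lebesgue"
  shows "f \<in> borel_measurable (lebesgue_on S) \<longleftrightarrow> (\<lambda>x. indicator S x *\<^sub>R f x) \<in> borel_measurable lebesgue"
  using assms by (intro borel_measurable_restrict_space_iff) simp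

lemma sets_lebesgue_open [intro]: "open S \<Longrightarrow> S \<in> sets lebesgue"
  by (metis borel_open sets_completionI_sets sets_lborel)

lemma sets_lebesgue_compact [intro]: "compact S \<Longrightarrow> S \<in> sets lebesgue" for S :: "'a::euclidean_space set"
  by (metis borel_closed compact_imp_closed sets_completionI_sets sets_lborel)

lemma Cn_exp_cutoff: "Cn n g \<Longrightarrow> Cn n (\<lambda>x. exp_cutoff p (g x))"
  by (rule Cn_compose[OF Cn1_exp_cutoff])

lemma test_function_has_derivative:
  assumes "test_function \<Omega> \<phi>"
  shows "(\<phi> has_derivative (\<lambda>h. \<Sum>i\<in>UNIV. h $ i * partial_derivs [i] \<phi> x)) (at x)"
proof -
  have "partial_derivs [] \<phi> differentiable (at x)"
    using assms unfolding test_function_def by blast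
  then have d: "(\<phi> has_derivative frechet_derivative \<phi> (at x)) (at x)"
    by (simp add: partial_derivs_def frechet_derivative_works)
  have "frechet_derivative \<phi> (at x) h = (\<Sum>i\<in>UNIV. h $ i * partial_derivs [i] \<phi> x)" for h
  proof -
    interpret linear "frechet_derivative \<phi> (at x)"
      using d has_derivative_linear by blast
    have "h = (\<Sum>i\<in>UNIV. h $ i *\<^sub>R axis i 1)"
      by (metis (no_types, lifting) basis_expansion scalar_mult_eq_scaleR sum.cong)
    then have "frechet_derivative \<phi> (at x) h = frechet_derivative \<phi> (at x) (\<Sum>i\<in>UNIV. h $ i *\<^sub>R axis i 1)"
      by simp
    also have "\<dots> = (\<Sum>i\<in>UNIV. h $ i * frechet_derivative \<phi> (at x) (axis i 1))"
      by (simp add: sum scale)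
    finally show ?thesis by (simp add: partial_derivs_def partial_deriv_def)
  qed
  then have "frechet_derivative \<phi> (at x) = (\<lambda>h. \<Sum>i\<in>UNIV. h $ i * partial_derivs [i] \<phi> x)" by (rule ext)
  with d show ?thesis by simp
qed

lemma test_function_continuous_derivs:
  assumes "test_function \<Omega> \<phi>"
  shows "continuous_on UNIV (partial_derivs ds \<phi>)"
proof (rule continuous_at_imp_continuous_on, rule ballI)
  fix x
  show "isCont (partial_derivs ds \<phi>) x"
    using assms unfolding test_function_def by (auto intro: differentiable_imp_continuous_within)
qed

lemma partial_derivs_Nil [simp]: "partial_derivs [] f = f"
  by (simp add: partial_derivs_def)

lemma partial_deriv_local_zero:
  assumes "open U" "x \<in> U" "\<And>y. y \<in> U \<Longrightarrow> f y = 0"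
  shows "partial_deriv i f x = 0"
proof -
  have "(f has_derivative (\<lambda>h. 0)) (at x)"
    by (rule has_derivative_transform_within_open[of "\<lambda>_. 0", OF _ assms(1,2)]) (auto simp: assms(3))
  from partial_deriv_eq[OF this] show ?thesis .
qed

lemma partial_derivs_local_zero:
  assumes "open U" "\<And>y. y \<in> U \<Longrightarrow> f y = 0" "x \<in> U"
  shows "partial_derivs ds f x = 0"
  using assms(3)
proof (induction ds arbitrary: x)
  case (Cons i ds)
  then show ?case
    using partial_deriv_local_zero[OF assms(1), of x "partial_derivs ds f" i]
    by (simp add: partial_derivs_def)
qed (simp add: assms)

lemma test_function_supports:
  assumes "test_function \<Omega> \<phi>"
  obtains K where "compact K" "K \<subseteq> \<Omega>" "\<And>ds x. x \<notin> K \<Longrightarrow> partial_derivs ds \<phi> x = 0"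
proof (rule that)
  let ?K = "closure {x. \<phi> x \<noteq> 0}"
  show "compact ?K" "?K \<subseteq> \<Omega>" using assms by (auto simp: test_function_def)
  fix ds x assume "x \<notin> ?K"
  have "\<phi> y = 0" if "y \<in> - ?K" for y
    using closure_subset[of "{x. \<phi> x \<noteq> 0}"] that by auto
  moreover have "open (- ?K)" by auto
  ultimately show "partial_derivs ds \<phi> x = 0"
    using partial_derivs_local_zero[of "- ?K" \<phi> x ds] \<open>x \<notin> ?K\<close> by blast
qed

text \<open>f need not be integrable up to the boundary of \<Omega>; local integrability is applied
  on the compact set K outside which \<phi> vanishes.\<close>

lemma integrable_mult_compact_support:
  fixes f :: "real^'d::finite \<Rightarrow> 'b::euclidean_space"
  assumes "open \<Omega>" "locally_integrable_on \<Omega> f" "compact K" "K \<subseteq> \<Omega>" "continuous_on UNIV \<phi>"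
    "\<And>x. x \<notin> K \<Longrightarrow> \<phi> x = 0"
  shows "integrable (lebesgue_on \<Omega>) (\<lambda>x. \<phi> x *\<^sub>R f x)"
proof -
  have eq: "(\<lambda>x. indicator \<Omega> x *\<^sub>R (\<phi> x *\<^sub>R f x)) = (\<lambda>x. \<phi> x *\<^sub>R (indicator K x *\<^sub>R f x))"
    using assms(4,6) by (auto simp: indicator_def fun_eq_iff)
  have i: "integrable lebesgue (\<lambda>x. indicator K x *\<^sub>R f x)"
    using assms(2,3,4) by (subst integrable_lebesgue_on_iff[symmetric]) (auto simp: locally_integrable_on_def)
  have "bounded (\<phi> ` K)"
    using assms(3,5) by (meson compact_continuous_image compact_imp_bounded continuous_on_subset subset_UNIV)
  then obtain B where B: "\<And>x. x \<in> K \<Longrightarrow> \<bar>\<phi> x\<bar> \<le> B"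
    unfolding bounded_iff by auto
  have m: "\<phi> \<in> borel_measurable lebesgue"
    using borel_measurable_continuous_onI[OF assms(5)] by (intro measurable_completion) simp
  have "integrable lebesgue (\<lambda>x. \<phi> x *\<^sub>R (indicator K x *\<^sub>R f x))"
  proof (rule Bochner_Integration.integrable_bound)
    show "integrable lebesgue (\<lambda>x. B *\<^sub>R (indicator K x *\<^sub>R f x))" using i by (rule integrable_scaleR_right)
    show "(\<lambda>x. \<phi> x *\<^sub>R (indicator K x *\<^sub>R f x)) \<in> borel_measurable lebesgue"
      using m borel_measurable_integrable[OF i] by (rule borel_measurable_scaleR)
    have "\<bar>\<phi> x\<bar> * norm (f x) \<le> \<bar>B\<bar> * norm (f x)" if "x \<in> K" for x
      using B[OF that] by (intro mult_right_mono) auto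
    then show "AE x in lebesgue. norm (\<phi> x *\<^sub>R indicat_real K x *\<^sub>R f x) \<le> norm (B *\<^sub>R indicat_real K x *\<^sub>R f x)"
      by (intro AE_I2) (auto simp: indicator_def)
  qed
  then show ?thesis
    unfolding integrable_lebesgue_on_iff[OF sets_lebesgue_open[OF assms(1)]] eq .
qed

lemma integrable_test_function:
  fixes f :: "real^'d::finite \<Rightarrow> 'b::euclidean_space"
  assumes "open \<Omega>" "locally_integrable_on \<Omega> f" "test_function \<Omega> \<phi>"
  shows "integrable (lebesgue_on \<Omega>) (\<lambda>x. partial_derivs ds \<phi> x *\<^sub>R f x)"
proof -
  obtain K where "compact K" "K \<subseteq> \<Omega>" "\<And>ds x. x \<notin> K \<Longrightarrow> partial_derivs ds \<phi> x = 0"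
    using test_function_supports[OF assms(3)] by blast
  then show ?thesis
    using assms by (intro integrable_mult_compact_support[of _ _ K]) (auto intro: test_function_continuous_derivs)
qed

text \<open>The product is positive inside the box and 0 outside. Applying
  \<open>exp_cutoff 1\<close> to m times its value s gives exp(-1/(m s)), which tends to 1 where s
  is positive and stays 0 elsewhere. So these smooth functions with values in [0, 1] converge
  pointwise to the indicator of the box.\<close>

definition box_bump :: "real^'d::finite \<Rightarrow> real^'d \<Rightarrow> nat \<Rightarrow> real^'d \<Rightarrow> real" where
  "box_bump a b m x =
     exp_cutoff 1 (of_nat m * (\<Prod>i\<in>UNIV. exp_cutoff 1 (x $ i - a $ i) * exp_cutoff 1 (b $ i - x $ i)))"

lemma exp_cutoff_1: "exp_cutoff 1 t = (if t \<le> 0 then 0 else exp (- (1/t)))"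
  by (simp add: exp_cutoff_def)

lemma box_bump_Cn: "Cn n (box_bump a b m)"
proof -
  have "Cn n (\<lambda>x. exp_cutoff 1 (x $ i - a $ i) * exp_cutoff 1 (b $ i - x $ i))" for i
    by (intro Cn_mult Cn_exp_cutoff Cn_diff Cn_component Cn_const)
  then have "Cn n (\<lambda>x. \<Prod>i\<in>UNIV. exp_cutoff 1 (x $ i - a $ i) * exp_cutoff 1 (b $ i - x $ i))"
    by (intro Cn_prod finite)
  from Cn_exp_cutoff[OF Cn_mult[OF Cn_const this]] show ?thesis
    unfolding box_bump_def[abs_def] .
qed

lemma box_bump_outside: "x \<notin> box a b \<Longrightarrow> box_bump a b m x = 0"
proof -
  assume "x \<notin> box a b"
  then obtain i where "x $ i \<le> a $ i \<or> b $ i \<le> x $ i"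
    by (auto simp: mem_box_cart not_less)
  then have "exp_cutoff 1 (x $ i - a $ i) * exp_cutoff 1 (b $ i - x $ i) = 0"
    by (auto simp: exp_cutoff_1)
  then have "(\<Prod>i\<in>UNIV. exp_cutoff 1 (x $ i - a $ i) * exp_cutoff 1 (b $ i - x $ i)) = 0"
    by (intro prod_zero) auto
  then show ?thesis
    unfolding box_bump_def by (simp only: mult_zero_right) (simp add: exp_cutoff_1)
qed

lemma box_bump_bounds: "0 \<le> box_bump a b m x" "box_bump a b m x \<le> 1"
  by (auto simp: box_bump_def exp_cutoff_1)

lemma box_bump_tendsto: "(\<lambda>m. box_bump a b m x) \<longlonglongrightarrow> indicator (box a b) x"
proof (cases "x \<in> box a b")
  case True
  define s where "s = (\<Prod>i\<in>UNIV. exp_cutoff 1 (x $ i - a $ i) * exp_cutoff 1 (b $ i - x $ i))"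
  have "s > 0"
    unfolding s_def
  proof (rule prod_pos)
    fix i
    have "a $ i < x $ i" "x $ i < b $ i" using True by (auto simp: mem_box_cart)
    then show "0 < exp_cutoff 1 (x $ i - a $ i) * exp_cutoff 1 (b $ i - x $ i)" by (simp add: exp_cutoff_1)
  qed
  have "(\<lambda>m. exp (- ((1/s) * (1 / real m)))) \<longlonglongrightarrow> exp (- ((1/s) * 0))"
    by (intro tendsto_exp tendsto_minus tendsto_mult tendsto_const lim_1_over_n)
  then have "(\<lambda>m. exp (- (1 / (real m * s)))) \<longlonglongrightarrow> 1"
    by (simp add: mult.commute)
  moreover have "\<forall>\<^sub>F m in sequentially. exp (- (1 / (real m * s))) = box_bump a b m x"
    using eventually_gt_at_top[of 0]
  proof eventually_elim
    case (elim m)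
    then have "real m * s > 0" using \<open>s > 0\<close> by simp
    then show ?case unfolding box_bump_def s_def[symmetric] by (simp add: exp_cutoff_1)
  qed
  ultimately have "(\<lambda>m. box_bump a b m x) \<longlonglongrightarrow> 1"
    by (rule Lim_transform_eventually)
  then show ?thesis using True by simp
qed (simp add: box_bump_outside)

lemma box_bump_test:
  assumes "cbox a b \<subseteq> \<Omega>"
  shows "test_function \<Omega> (box_bump a b m)"
proof (rule test_functionI[where K="cbox a b"])
  show "x \<in> cbox a b" if "box_bump a b m x \<noteq> 0" for x
    using that box_bump_outside[of x a b m] box_subset_cbox[of a b] by blast
qed (use assms box_bump_Cn in auto)

section \<open>The fundamental lemma of the calculus of variations\<close>

text \<open>Dominated convergence along \<open>box_bump\<close>. The closed box has to lie in
  \<Omega>: by compactness the restriction of f to it is integrable, and this restriction is the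
  majorant.\<close>

lemma integral_box_zero:
  fixes f :: "real^'d::finite \<Rightarrow> 'b::euclidean_space"
  assumes \<Omega>: "open \<Omega>" and f: "locally_integrable_on \<Omega> f"
    and z: "\<And>\<phi>. test_function \<Omega> \<phi> \<Longrightarrow> integral\<^sup>L (lebesgue_on \<Omega>) (\<lambda>x. \<phi> x *\<^sub>R f x) = 0"
    and ab: "cbox a b \<subseteq> \<Omega>"
  shows "integral\<^sup>L lebesgue (\<lambda>x. indicator (box a b) x *\<^sub>R f x) = 0"
proof -
  have i: "integrable lebesgue (\<lambda>x. indicator (cbox a b) x *\<^sub>R f x)"
    using f ab by (subst integrable_lebesgue_on_iff[symmetric]) (auto simp: locally_integrable_on_def)
  have eq: "indicator \<Omega> x *\<^sub>R (box_bump a b m x *\<^sub>R f x) = box_bump a b m x *\<^sub>R (indicator (cbox a b) x *\<^sub>R f x)" for m x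
    using ab box_bump_outside[of x a b m] box_subset_cbox[of a b] by (auto simp: indicator_def)
  have 0: "integral\<^sup>L lebesgue (\<lambda>x. box_bump a b m x *\<^sub>R (indicator (cbox a b) x *\<^sub>R f x)) = 0" for m
    using z[OF box_bump_test[OF ab], of m] unfolding integral_lebesgue_on_eq[OF sets_lebesgue_open[OF \<Omega>]] eq .
  have m: "box_bump a b m \<in> borel_measurable lebesgue" for m
    using borel_measurable_continuous_onI[OF test_function_continuous_derivs[OF box_bump_test[OF ab], of "[]" m]]
    by (intro measurable_completion) simp
  have "(\<lambda>m. integral\<^sup>L lebesgue (\<lambda>x. box_bump a b m x *\<^sub>R (indicator (cbox a b) x *\<^sub>R f x)))
      \<longlonglongrightarrow> integral\<^sup>L lebesgue (\<lambda>x. indicator (box a b) x *\<^sub>R (indicator (cbox a b) x *\<^sub>R f x))"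
  proof (rule integral_dominated_convergence[where w="\<lambda>x. norm (indicator (cbox a b) x *\<^sub>R f x)"])
    show "AE x in lebesgue. (\<lambda>m. box_bump a b m x *\<^sub>R (indicator (cbox a b) x *\<^sub>R f x))
          \<longlonglongrightarrow> indicator (box a b) x *\<^sub>R (indicator (cbox a b) x *\<^sub>R f x)"
      by (intro AE_I2 tendsto_scaleR box_bump_tendsto tendsto_const)
    show "AE x in lebesgue. norm (box_bump a b m x *\<^sub>R (indicator (cbox a b) x *\<^sub>R f x))
          \<le> norm (indicator (cbox a b) x *\<^sub>R f x)" for m
    proof (rule AE_I2)
      fix x
      have "box_bump a b m x * norm (indicat_real (cbox a b) x *\<^sub>R f x) \<le> 1 * norm (indicat_real (cbox a b) x *\<^sub>R f x)"
        by (intro mult_right_mono box_bump_bounds norm_ge_zero)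
      then show "norm (box_bump a b m x *\<^sub>R (indicator (cbox a b) x *\<^sub>R f x)) \<le> norm (indicator (cbox a b) x *\<^sub>R f x)"
        unfolding norm_scaleR[of "box_bump a b m x"] by (simp add: box_bump_bounds)
    qed
    show "integrable lebesgue (\<lambda>x. norm (indicator (cbox a b) x *\<^sub>R f x))"
      using i by (rule integrable_norm)
    show "(\<lambda>x. box_bump a b m x *\<^sub>R (indicator (cbox a b) x *\<^sub>R f x)) \<in> borel_measurable lebesgue" for m
      using m borel_measurable_integrable[OF i] by (rule borel_measurable_scaleR)
    have "(\<lambda>x. indicat_real (box a b) x) \<in> borel_measurable lebesgue"
      by (intro borel_measurable_indicator sets_lebesgue_open open_box)
    then show "(\<lambda>x. indicator (box a b) x *\<^sub>R (indicator (cbox a b) x *\<^sub>R f x)) \<in> borel_measurable lebesgue"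
      using borel_measurable_integrable[OF i] by (rule borel_measurable_scaleR)
  qed
  then have "integral\<^sup>L lebesgue (\<lambda>x. indicator (box a b) x *\<^sub>R (indicator (cbox a b) x *\<^sub>R f x)) = 0"
    unfolding 0 LIMSEQ_const_iff by (rule sym)
  moreover have "indicat_real (box a b) x *\<^sub>R (indicat_real (cbox a b) x *\<^sub>R f x) = indicator (box a b) x *\<^sub>R f x" for x
    using box_subset_cbox[of a b] by (auto simp: indicator_def)
  ultimately show ?thesis by (simp only:)
qed

text \<open>Open boxes form an intersection-stable generator of the Borel sets, so a Dynkin argument
  carries vanishing integrals from boxes to all Borel sets; F then has the same set integrals as the
  zero function.\<close>

lemma zero_of_boxes_real:
  fixes F :: "real^'d::finite \<Rightarrow> real"
  assumes F: "integrable lborel F" and z: "\<And>c d. (LINT x:box c d|lborel. F x) = 0"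
  shows "AE x in lborel. F x = 0"
proof -
  have si: "set_integrable lborel A F" if "A \<in> sets borel" for A
    unfolding set_integrable_def using F that by (intro integrable_mult_indicator) auto
  \<comment> \<open>The Dynkin step for complements needs the integral over the whole space, which
    is not itself a box but is exhausted by growing ones.\<close>
  have univ: "(LINT x:UNIV|lborel. F x) = 0"
  proof -
    define B where "B n = box (-(\<chi> i. real n)) ((\<chi> i. real n)::real^'d)" for n
    have B: "x \<in> B n \<longleftrightarrow> (\<forall>i. - real n < x $ i \<and> x $ i < real n)" for x n
      by (simp add: B_def mem_box_cart)
    have "incseq B"
    proof (rule incseq_SucI, rule subsetI)
      fix n x assume "x \<in> B n"
      then have "- real n < x $ i \<and> x $ i < real n" for i by (simp add: B)
      then show "x \<in> B (Suc n)" unfolding B of_nat_Suc by (smt (verit))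
    qed
    then have "(\<lambda>n. LINT x:B n|lborel. F x) \<longlonglongrightarrow> (LINT x:(\<Union>n. B n)|lborel. F x)"
      by (rule set_integral_cont_up[rotated]) (auto intro!: si simp: B_def)
    moreover have "(\<Union>n. B n) = UNIV"
    proof -
      have "\<exists>n. x \<in> B n" for x :: "real^'d"
      proof -
        obtain n where n: "norm x < real n" using reals_Archimedean2 by blast
        have "- real n < x $ i \<and> x $ i < real n" for i
          using component_le_norm_cart[of x i] n by linarith
        then show ?thesis unfolding B by blast
      qed
      then show ?thesis by auto
    qed
    moreover have "(LINT x:B n|lborel. F x) = 0" for n unfolding B_def by (rule z)
    ultimately show ?thesis by (simp add: LIMSEQ_const_iff)
  qed
  have "(LINT x:A|lborel. F x) = 0" if "A \<in> sets borel" for A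
  proof -
    have "Int_stable (range (\<lambda>(a, b). box a b :: (real^'d) set))"
      by (auto simp: Int_stable_def box_Int_box)
    moreover have "range (\<lambda>(a, b). box a b) \<subseteq> Pow (UNIV :: (real^'d) set)"
      by auto
    moreover have "A \<in> sigma_sets UNIV (range (\<lambda>(a, b). box a b))"
      using that unfolding borel_eq_box by simp
    ultimately show ?thesis
    proof (induction rule: sigma_sets_induct_disjoint)
      case (basic A) then show ?case using z by auto
    next
      case empty then show ?case by (simp add: set_lebesgue_integral_def)
    next
      case (compl A)
      then have A: "A \<in> sets borel" by (simp add: borel_eq_box)
      have "(LINT x:A \<union> (UNIV - A)|lborel. F x) = (LINT x:A|lborel. F x) + (LINT x:(UNIV - A)|lborel. F x)"
        using A by (intro set_integral_Un si) auto
      then show ?case using compl univ by (simp add: Un_Diff_cancel)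
    next
      case (union A)
      then have A: "A i \<in> sets borel" for i by (auto simp: borel_eq_box)
      have "(LINT x:(\<Union>i. A i)|lborel. F x) = (\<Sum>i. LINT x:A i|lborel. F x)"
        using union A by (intro lebesgue_integral_countable_add si) (auto simp: disjoint_family_on_def)
      then show ?case using union by simp
    qed
  qed
  then have "AE x in lborel. F x = (\<lambda>x. 0) x"
    by (intro density_unique_real F) (auto simp: set_lebesgue_integral_def)
  then show ?thesis by simp
qed

text \<open>Localised to closed boxes inside \<Omega>, where f is integrable. Countably many of them
  cover \<Omega>, so the exceptional sets add up to a null set.\<close>

theorem fundamental_lemma_real:
  fixes f :: "real^'d::finite \<Rightarrow> real"
  assumes \<Omega>: "open \<Omega>" and f: "locally_integrable_on \<Omega> f"
    and z: "\<And>\<phi>. test_function \<Omega> \<phi> \<Longrightarrow> integral\<^sup>L (lebesgue_on \<Omega>) (\<lambda>x. \<phi> x *\<^sub>R f x) = 0"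
  shows "AE x in lebesgue_on \<Omega>. f x = 0"
proof -
  have local: "AE x in lebesgue. x \<in> cbox a b \<longrightarrow> f x = 0" if ab: "cbox a b \<subseteq> \<Omega>" for a b
  proof -
    define F where "F = (\<lambda>x. indicator (cbox a b) x *\<^sub>R f x)"
    have F: "integrable lebesgue F"
      unfolding F_def using f ab by (subst integrable_lebesgue_on_iff[symmetric]) (auto simp: locally_integrable_on_def)
    \<comment> \<open>The Dynkin argument lives on Borel sets and \<open>lborel\<close>, whereas f
      is measurable only for the completion; G is a Borel version.\<close>
    obtain G where G: "G \<in> borel_measurable lborel" "AE x in lborel. F x = G x"
      using completion_ex_borel_measurable_real[OF borel_measurable_integrable[OF F]] by blast
    have Gc: "AE x in lebesgue. F x = G x" using G(2) by (rule AE_completion)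
    have Gm: "G \<in> borel_measurable lebesgue" using G(1) by (rule measurable_completion)
    have "integrable lebesgue G"
      using F Gc Gm by (subst integrable_cong_AE[where g=F]) (auto intro: borel_measurable_integrable simp: eq_commute)
    then have Gi: "integrable lborel G"
      using G(1) integrable_completion by blast
    have "(LINT x:box c d|lborel. G x) = 0" for c d
    proof -
      have 1: "(\<lambda>x. indicat_real (box c d) x *\<^sub>R G x) \<in> borel_measurable lborel"
        using G(1) by (intro borel_measurable_scaleR borel_measurable_indicator) auto
      have "(LINT x:box c d|lborel. G x) = integral\<^sup>L lebesgue (\<lambda>x. indicator (box c d) x *\<^sub>R G x)"
        unfolding set_lebesgue_integral_def using 1 by (rule integral_completion[symmetric])
      \<comment> \<open>Dropping the boundary of the closed box, a null set, leaves the intersection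
        of two open boxes. This is again an open box, and its closure stays inside
        \<open>cbox a b\<close>, as \<open>integral_box_zero\<close> requires.\<close>
      also have "\<dots> = integral\<^sup>L lebesgue (\<lambda>x. indicator (box c d \<inter> box a b) x *\<^sub>R f x)"
      proof (rule integral_cong_AE)
        have "AE x in lebesgue. x \<notin> cbox a b - box a b"
          using AE_completion[OF AE_not_in[OF null_sets_cbox_Diff_box]] .
        with Gc show "AE x in lebesgue. indicator (box c d) x *\<^sub>R G x = indicator (box c d \<inter> box a b) x *\<^sub>R f x"
        proof eventually_elim
          case (elim x)
          then show ?case using box_subset_cbox[of a b] unfolding F_def by (auto simp: indicator_def split: if_splits)
        qed
        show "(\<lambda>x. indicator (box c d) x *\<^sub>R G x) \<in> borel_measurable lebesgue"
          using 1 by (rule measurable_completion)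
        have "(\<lambda>x. indicator (box c d \<inter> box a b) x *\<^sub>R f x) = (\<lambda>x. indicator (box c d \<inter> box a b) x *\<^sub>R F x)"
          using box_subset_cbox[of a b] by (auto simp: F_def indicator_def fun_eq_iff)
        then show "(\<lambda>x. indicator (box c d \<inter> box a b) x *\<^sub>R f x) \<in> borel_measurable lebesgue"
          using borel_measurable_integrable[OF F] 
          by (simp only:) (intro borel_measurable_scaleR borel_measurable_indicator sets_lebesgue_open open_Int open_box)
      qed
      also have "\<dots> = 0"
      proof (cases "box c d \<inter> box a b = {}")
        case False
        obtain p q where pq: "box c d \<inter> box a b = box p q"
          using box_Int_box by blast
        have "cbox p q = closure (box p q)" using False pq by (simp add: closure_box)
        also have "\<dots> \<subseteq> cbox a b"
          using pq box_subset_cbox[of a b] by (intro closure_minimal) auto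
        finally show ?thesis
          unfolding pq using ab by (intro integral_box_zero[OF \<Omega> f z]) auto
      qed simp
      finally show ?thesis .
    qed
    then have "AE x in lborel. G x = 0"
      by (intro zero_of_boxes_real Gi)
    then have "AE x in lebesgue. G x = 0" by (rule AE_completion)
    with Gc show ?thesis
      by eventually_elim (auto simp: F_def indicator_def)
  qed
  obtain \<D> where D: "countable \<D>" "\<D> \<subseteq> Pow \<Omega>" "\<And>X. X \<in> \<D> \<Longrightarrow> \<exists>a b. X = cbox a b" "\<Union>\<D> = \<Omega>"
    using open_countable_Union_open_cbox[OF \<Omega>] by metis
  have "AE x in lebesgue. \<forall>X\<in>\<D>. x \<in> X \<longrightarrow> f x = 0"
  proof (subst AE_ball_countable[OF D(1)], intro ballI)
    fix X assume "X \<in> \<D>"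
    then obtain a b where "X = cbox a b" using D(3) by blast
    then show "AE x in lebesgue. x \<in> X \<longrightarrow> f x = 0"
      using local[of a b] D(2) \<open>X \<in> \<D>\<close> by blast
  qed
  then have "AE x in lebesgue. x \<in> \<Omega> \<longrightarrow> f x = 0"
    using D(4) by (auto elim: eventually_mono)
  then show ?thesis using \<Omega> by (simp add: AE_lebesgue_on_iff sets_lebesgue_open)
qed

lemma locally_integrable_bounded_linear:
  assumes "bounded_linear T" "locally_integrable_on \<Omega> f"
  shows "locally_integrable_on \<Omega> (\<lambda>x. T (f x))"
  using assms integrable_bounded_linear[OF assms(1)] by (auto simp: locally_integrable_on_def)

lemma locally_integrable_diff:
  "locally_integrable_on \<Omega> f \<Longrightarrow> locally_integrable_on \<Omega> g \<Longrightarrow> locally_integrable_on \<Omega> (\<lambda>x. f x - g x)"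
  by (auto simp: locally_integrable_on_def)

lemma integral_test_bounded_linear:
  fixes f :: "real^'d::finite \<Rightarrow> 'b::euclidean_space"
  assumes "open \<Omega>" "locally_integrable_on \<Omega> f" "test_function \<Omega> \<phi>" "bounded_linear (T :: 'b \<Rightarrow> 'c::euclidean_space)"
  shows "integral\<^sup>L (lebesgue_on \<Omega>) (\<lambda>x. partial_derivs ds \<phi> x *\<^sub>R T (f x))
       = T (integral\<^sup>L (lebesgue_on \<Omega>) (\<lambda>x. partial_derivs ds \<phi> x *\<^sub>R f x))"
proof -
  interpret T: bounded_linear T by fact
  show ?thesis
    using integral_bounded_linear[OF assms(4) integrable_test_function[OF assms(1-3), of ds]]
    by (simp add: T.scaleR)
qed

lemma fundamental_lemma:
  fixes f :: "real^'d::finite \<Rightarrow> 'b::euclidean_space"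
  assumes \<Omega>: "open \<Omega>" and f: "locally_integrable_on \<Omega> f"
    and z: "\<And>\<phi>. test_function \<Omega> \<phi> \<Longrightarrow> integral\<^sup>L (lebesgue_on \<Omega>) (\<lambda>x. \<phi> x *\<^sub>R f x) = 0"
  shows "AE x in lebesgue_on \<Omega>. f x = 0"
proof -
  have "AE x in lebesgue_on \<Omega>. f x \<bullet> b = 0" if "b \<in> Basis" for b
  proof (rule fundamental_lemma_real[OF \<Omega>])
    show "locally_integrable_on \<Omega> (\<lambda>x. f x \<bullet> b)"
      by (rule locally_integrable_bounded_linear[OF bounded_linear_inner_left f])
    show "integral\<^sup>L (lebesgue_on \<Omega>) (\<lambda>x. \<phi> x *\<^sub>R (f x \<bullet> b)) = 0" if "test_function \<Omega> \<phi>" for \<phi>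
      using integral_test_bounded_linear[OF \<Omega> f that bounded_linear_inner_left[of b], of "[]"] z[OF that] by simp
  qed
  then have "AE x in lebesgue_on \<Omega>. \<forall>b\<in>Basis. f x \<bullet> b = 0"
    by (intro AE_ball_countable[THEN iffD2]) (auto simp: uncountable_infinite intro: countable_finite)
  then show ?thesis
    by (rule eventually_mono) (simp add: euclidean_all_zero_iff)
qed

section \<open>Uniqueness of weak derivatives\<close>

lemma has_weak_derivD:
  assumes "has_weak_deriv \<Omega> ds f g"
  shows "locally_integrable_on \<Omega> f" "locally_integrable_on \<Omega> g"
    "test_function \<Omega> \<phi> \<Longrightarrow> integral\<^sup>L (lebesgue_on \<Omega>) (\<lambda>x. partial_derivs ds \<phi> x *\<^sub>R f x) =
        (-1) ^ length ds *\<^sub>R integral\<^sup>L (lebesgue_on \<Omega>) (\<lambda>x. \<phi> x *\<^sub>R g x)"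
  using assms unfolding has_weak_deriv_def by blast+

lemma has_weak_deriv_unique:
  fixes f :: "real^'d::finite \<Rightarrow> 'b::euclidean_space"
  assumes \<Omega>: "open \<Omega>" and "has_weak_deriv \<Omega> ds f g" "has_weak_deriv \<Omega> ds f g'"
  shows "AE x in lebesgue_on \<Omega>. g x = g' x"
proof -
  have l: "locally_integrable_on \<Omega> g" "locally_integrable_on \<Omega> g'"
    using assms(2,3) by (blast dest: has_weak_derivD(2))+
  have "AE x in lebesgue_on \<Omega>. g x - g' x = 0"
  proof (rule fundamental_lemma[OF \<Omega>])
    show "locally_integrable_on \<Omega> (\<lambda>x. g x - g' x)" using l by (rule locally_integrable_diff)
    fix \<phi> assume \<phi>: "test_function \<Omega> \<phi>"
    have i: "integrable (lebesgue_on \<Omega>) (\<lambda>x. \<phi> x *\<^sub>R g x)" "integrable (lebesgue_on \<Omega>) (\<lambda>x. \<phi> x *\<^sub>R g' x)"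
      using integrable_test_function[OF \<Omega> l(1) \<phi>, of "[]"] integrable_test_function[OF \<Omega> l(2) \<phi>, of "[]"] by auto
    have "(-1) ^ length ds *\<^sub>R integral\<^sup>L (lebesgue_on \<Omega>) (\<lambda>x. \<phi> x *\<^sub>R g x)
        = (-1) ^ length ds *\<^sub>R integral\<^sup>L (lebesgue_on \<Omega>) (\<lambda>x. \<phi> x *\<^sub>R g' x)"
      using has_weak_derivD(3)[OF assms(2) \<phi>] has_weak_derivD(3)[OF assms(3) \<phi>] by (rule trans[OF sym])
    then show "integral\<^sup>L (lebesgue_on \<Omega>) (\<lambda>x. \<phi> x *\<^sub>R (g x - g' x)) = 0"
      using i by (simp add: scaleR_diff_right)
  qed
  then show ?thesis by simp
qed

text \<open>\<open>weak_partial\<close> picks some weak derivative; uniqueness makes the pick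
  irrelevant up to null sets.\<close>

lemma weak_partial_AE:
  assumes "open \<Omega>" "has_weak_deriv \<Omega> [i] f g"
  shows "AE x in lebesgue_on \<Omega>. weak_partial \<Omega> i f x = g x"
  unfolding weak_partial_def
  by (rule has_weak_deriv_unique[OF assms(1) someI[of "has_weak_deriv \<Omega> [i] f"]]) (rule assms(2))+

lemma has_weak_deriv_bounded_linear:
  assumes "open \<Omega>" "bounded_linear T" "has_weak_deriv \<Omega> ds f g"
  shows "has_weak_deriv \<Omega> ds (\<lambda>x. T (f x)) (\<lambda>x. T (g x))"
proof -
  interpret T: bounded_linear T by fact
  note l = has_weak_derivD(1,2)[OF assms(3)]
  show ?thesis
    unfolding has_weak_deriv_def
  proof (intro conjI allI impI locally_integrable_bounded_linear[OF assms(2)] l)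
    fix \<phi> assume \<phi>: "test_function \<Omega> \<phi>"
    show "integral\<^sup>L (lebesgue_on \<Omega>) (\<lambda>x. partial_derivs ds \<phi> x *\<^sub>R T (f x)) =
        (-1) ^ length ds *\<^sub>R integral\<^sup>L (lebesgue_on \<Omega>) (\<lambda>x. \<phi> x *\<^sub>R T (g x))"
      unfolding integral_test_bounded_linear[OF assms(1) l(1) \<phi> assms(2), of ds]
        has_weak_derivD(3)[OF assms(3) \<phi>] T.scaleR
        integral_test_bounded_linear[OF assms(1) l(2) \<phi> assms(2), of "[]", unfolded partial_derivs_Nil] ..
  qed
qed

text \<open>Completeness of Lebesgue measure. It later gives measurability of integrands that
  contain \<open>weak_partial\<close>, about which only a.e. equalities are known.\<close>

lemma borel_measurable_lebesgue_on_AE: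
  fixes f :: "'a::euclidean_space \<Rightarrow> 'b::euclidean_space"
  assumes "S \<in> sets lebesgue" "f \<in> borel_measurable (lebesgue_on S)" "AE x in lebesgue_on S. f x = g x"
  shows "g \<in> borel_measurable (lebesgue_on S)"
proof -
  have "AE x in lebesgue. indicator S x *\<^sub>R f x = indicator S x *\<^sub>R g x"
    using assms(3) unfolding AE_lebesgue_on_iff[OF assms(1)] by (auto simp: indicator_def elim: eventually_mono)
  from borel_measurable_AE[OF assms(2)[unfolded borel_measurable_lebesgue_on_iff[OF assms(1)]] this]
  show ?thesis
    unfolding borel_measurable_lebesgue_on_iff[OF assms(1)] .
qed

section \<open>Essentially bounded functions\<close>

lemma Linf_spaceI:
  fixes f :: "real^'d::finite \<Rightarrow> 'b::euclidean_space"
  assumes "f \<in> borel_measurable (lebesgue_on \<Omega>)" "AE x in lebesgue_on \<Omega>. norm (f x) \<le> C"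
  shows "f \<in> Linf_space \<Omega>"
  using assms by (auto simp: Linf_space_def)

lemma Linf_bilinear:
  fixes f :: "real^'d::finite \<Rightarrow> 'b::euclidean_space" and g :: "real^'d \<Rightarrow> 'c::euclidean_space"
    and p :: "'b \<Rightarrow> 'c \<Rightarrow> 'e::euclidean_space"
  assumes "bounded_bilinear p" "f \<in> Linf_space \<Omega>" "g \<in> Linf_space \<Omega>"
  shows "(\<lambda>x. p (f x) (g x)) \<in> Linf_space \<Omega>"
proof -
  interpret p: bounded_bilinear p by fact
  obtain K where K: "\<And>a b. norm (p a b) \<le> norm a * norm b * K" "K \<ge> 0" using p.nonneg_bounded by blast
  obtain B C where B: "AE x in lebesgue_on \<Omega>. norm (f x) \<le> B" and C: "AE x in lebesgue_on \<Omega>. norm (g x) \<le> C"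
    and m: "f \<in> borel_measurable (lebesgue_on \<Omega>)" "g \<in> borel_measurable (lebesgue_on \<Omega>)"
    using assms by (auto simp: Linf_space_def)
  have "continuous_on UNIV (\<lambda>y. p (fst y) (snd y))"
    by (intro p.continuous_on continuous_intros)
  then have "(\<lambda>x. p (f x) (g x)) \<in> borel_measurable (lebesgue_on \<Omega>)"
    using borel_measurable_continuous_Pair[OF m, of p] by (simp add: split_def)
  moreover from B C have "AE x in lebesgue_on \<Omega>. norm (p (f x) (g x)) \<le> B * C * K"
  proof eventually_elim
    case (elim x)
    have "0 \<le> B" using order_trans[OF norm_ge_zero elim(1)] .
    have "norm (p (f x) (g x)) \<le> norm (f x) * norm (g x) * K" by (rule K)
    also have "\<dots> \<le> B * C * K" using elim K(2) \<open>0 \<le> B\<close> by (intro mult_right_mono mult_mono) auto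
    finally show ?case .
  qed
  ultimately show ?thesis by (rule Linf_spaceI)
qed

lemma Linf_add:
  fixes f g :: "real^'d::finite \<Rightarrow> 'b::euclidean_space"
  assumes "f \<in> Linf_space \<Omega>" "g \<in> Linf_space \<Omega>"
  shows "(\<lambda>x. f x + g x) \<in> Linf_space \<Omega>"
proof -
  obtain B C where B: "AE x in lebesgue_on \<Omega>. norm (f x) \<le> B" and C: "AE x in lebesgue_on \<Omega>. norm (g x) \<le> C"
    and m: "f \<in> borel_measurable (lebesgue_on \<Omega>)" "g \<in> borel_measurable (lebesgue_on \<Omega>)"
    using assms by (auto simp: Linf_space_def)
  from B C have "AE x in lebesgue_on \<Omega>. norm (f x + g x) \<le> B + C"
    by eventually_elim (rule norm_triangle_le, simp)
  then show ?thesis using m by (intro Linf_spaceI) auto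
qed

lemma Linf_integrable:
  fixes f :: "real^'d::finite \<Rightarrow> 'b::euclidean_space"
  assumes "f \<in> Linf_space \<Omega>" "open \<Omega>" "bounded \<Omega>"
  shows "integrable (lebesgue_on \<Omega>) f"
proof -
  interpret finite_measure "lebesgue_on \<Omega>"
    using assms by (intro finite_measure_lebesgue_on) (simp add: lmeasurable_open)
  show ?thesis using assms by (auto simp: Linf_space_def intro: integrable_const_bound)
qed

lemma Linf_cong_AE:
  fixes f :: "real^'d::finite \<Rightarrow> 'b::euclidean_space"
  assumes "open \<Omega>" "f \<in> Linf_space \<Omega>" "AE x in lebesgue_on \<Omega>. f x = g x"
  shows "g \<in> Linf_space \<Omega>"
proof -
  obtain B where B: "AE x in lebesgue_on \<Omega>. norm (f x) \<le> B" "f \<in> borel_measurable (lebesgue_on \<Omega>)"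
    using assms by (auto simp: Linf_space_def)
  from B(1) assms(3) have "AE x in lebesgue_on \<Omega>. norm (g x) \<le> B" by eventually_elim simp
  then show ?thesis
    using borel_measurable_lebesgue_on_AE[OF sets_lebesgue_open[OF assms(1)] B(2) assms(3)] by (intro Linf_spaceI)
qed

lemma Linf_subset:
  fixes f :: "real^'d::finite \<Rightarrow> 'b::euclidean_space"
  assumes "f \<in> Linf_space \<Omega>" "open \<Omega>" "bounded \<Omega>" 
  shows "locally_integrable_on \<Omega> f"
  unfolding locally_integrable_on_def
proof (intro allI impI)
  fix C assume C: "compact C \<and> C \<subseteq> \<Omega>"
  have "integrable lebesgue (\<lambda>x. indicator \<Omega> x *\<^sub>R f x)"
    using Linf_integrable[OF assms] assms by (subst (asm) integrable_lebesgue_on_iff) auto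
  then have "integrable lebesgue (\<lambda>x. indicator C x *\<^sub>R (indicator \<Omega> x *\<^sub>R f x))"
    by (rule integrable_mult_indicator[rotated]) (use C in auto)
  also have "(\<lambda>x. indicator C x *\<^sub>R (indicator \<Omega> x *\<^sub>R f x)) = (\<lambda>x. indicator C x *\<^sub>R f x)"
    using C by (auto simp: indicator_def fun_eq_iff)
  finally show "integrable (lebesgue_on C) f"
    using C by (subst integrable_lebesgue_on_iff) auto
qed


section \<open>Functions with a locally Lipschitz representative\<close>

text \<open>A concrete substitute for bounded functions with bounded weak gradient. The
  representative g is Lipschitz only along segments inside \<Omega>, since \<Omega> need not be
  convex. Differentiability off N is part of the data, so no theorem on a.e. differentiability of
  Lipschitz functions is invoked, and D is a parameter so that calculus rules can name the
  derivative; on N its values are arbitrary.\<close>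

definition lip_rep :: "(real^'d::finite) set \<Rightarrow> (real^'d \<Rightarrow> 'b::euclidean_space) \<Rightarrow> (real^'d \<Rightarrow> real^'d \<Rightarrow> 'b) \<Rightarrow> bool" where
  "lip_rep \<Omega> f D \<longleftrightarrow> (\<exists>g N M. negligible N \<and>
     (\<forall>x\<in>\<Omega> - N. f x = g x \<and> (g has_derivative D x) (at x)) \<and>
     (\<forall>x\<in>\<Omega>. norm (g x) \<le> M) \<and>
     (\<forall>x y. closed_segment x y \<subseteq> \<Omega> \<longrightarrow> norm (g x - g y) \<le> M * norm (x - y)))"

lemma lip_repI:
  assumes "negligible N" "\<And>x. x \<in> \<Omega> - N \<Longrightarrow> f x = g x" "\<And>x. x \<in> \<Omega> - N \<Longrightarrow> (g has_derivative D x) (at x)"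
    "\<And>x. x \<in> \<Omega> \<Longrightarrow> norm (g x) \<le> M"
    "\<And>x y. closed_segment x y \<subseteq> \<Omega> \<Longrightarrow> norm (g x - g y) \<le> M * norm (x - y)"
  shows "lip_rep \<Omega> f D"
  unfolding lip_rep_def using assms by blast

lemma lip_repE:
  assumes "lip_rep \<Omega> f D"
  obtains N g M where "negligible N" "\<And>x. x \<in> \<Omega> - N \<Longrightarrow> f x = g x" "\<And>x. x \<in> \<Omega> - N \<Longrightarrow> (g has_derivative D x) (at x)"
    "\<And>x. x \<in> \<Omega> \<Longrightarrow> norm (g x) \<le> M"
    "\<And>x y. closed_segment x y \<subseteq> \<Omega> \<Longrightarrow> norm (g x - g y) \<le> M * norm (x - y)" "M \<ge> 0"
proof -
  obtain g N M where g: "negligible N" "\<forall>x\<in>\<Omega> - N. f x = g x \<and> (g has_derivative D x) (at x)"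
     "\<forall>x\<in>\<Omega>. norm (g x) \<le> M"
     "\<forall>x y. closed_segment x y \<subseteq> \<Omega> \<longrightarrow> norm (g x - g y) \<le> M * norm (x - y)"
    using assms unfolding lip_rep_def by blast
  have le: "M \<le> max M 0" by simp
  show ?thesis
  proof (rule that[of N g "max M 0"])
    show "norm (g x - g y) \<le> max M 0 * norm (x - y)" if "closed_segment x y \<subseteq> \<Omega>" for x y
      using g(4)[rule_format, OF that] mult_right_mono[OF le norm_ge_zero[of "x - y"]] by linarith
    show "norm (g x) \<le> max M 0" if "x \<in> \<Omega>" for x using g(3) that by fastforce
  qed (use g in auto)
qed

text \<open>One Leibniz rule for products and for inner products. The factor 2 in the constant
  counts the two terms into which a difference of products splits.\<close>

lemma lip_rep_bilinear:
  fixes f :: "real^'d::finite \<Rightarrow> 'b::euclidean_space" and g :: "real^'d \<Rightarrow> 'c::euclidean_space"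
    and p :: "'b \<Rightarrow> 'c \<Rightarrow> 'e::euclidean_space"
  assumes "bounded_bilinear p" "lip_rep \<Omega> f Df" "lip_rep \<Omega> g Dg"
  shows "lip_rep \<Omega> (\<lambda>x. p (f x) (g x)) (\<lambda>x h. p (f x) (Dg x h) + p (Df x h) (g x))"
proof -
  interpret p: bounded_bilinear p by fact
  obtain K where K: "\<And>a b. norm (p a b) \<le> norm a * norm b * K" "K \<ge> 0" using p.nonneg_bounded by blast
  obtain N1 f1 M1 where f: "negligible N1" "\<And>x. x \<in> \<Omega> - N1 \<Longrightarrow> f x = f1 x" "\<And>x. x \<in> \<Omega> - N1 \<Longrightarrow> (f1 has_derivative Df x) (at x)"
    "\<And>x. x \<in> \<Omega> \<Longrightarrow> norm (f1 x) \<le> M1"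
    "\<And>x y. closed_segment x y \<subseteq> \<Omega> \<Longrightarrow> norm (f1 x - f1 y) \<le> M1 * norm (x - y)" "M1 \<ge> 0"
    by (rule lip_repE[OF assms(2)], rule that)
  obtain N2 g1 M2 where g: "negligible N2" "\<And>x. x \<in> \<Omega> - N2 \<Longrightarrow> g x = g1 x" "\<And>x. x \<in> \<Omega> - N2 \<Longrightarrow> (g1 has_derivative Dg x) (at x)"
    "\<And>x. x \<in> \<Omega> \<Longrightarrow> norm (g1 x) \<le> M2"
    "\<And>x y. closed_segment x y \<subseteq> \<Omega> \<Longrightarrow> norm (g1 x - g1 y) \<le> M2 * norm (x - y)" "M2 \<ge> 0"
    by (rule lip_repE[OF assms(3)], rule that)
  have bd: "norm (p a b) \<le> M1 * M2 * K" if "norm a \<le> M1" "norm b \<le> M2" for a b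
    using K(1)[of a b] mult_right_mono[OF mult_mono[OF that f(6) norm_ge_zero] K(2)] by linarith
  have nn: "0 \<le> M1 * M2 * K" using f(6) g(6) K(2) by simp
  show ?thesis
  proof (rule lip_repI[where N="N1 \<union> N2" and g="\<lambda>x. p (f1 x) (g1 x)" and M="2 * (M1 * M2 * K)"])
    show "negligible (N1 \<union> N2)" using f(1) g(1) by simp
    fix x assume x: "x \<in> \<Omega> - (N1 \<union> N2)"
    show "p (f x) (g x) = p (f1 x) (g1 x)" using f(2) g(2) x by simp
    show "((\<lambda>x. p (f1 x) (g1 x)) has_derivative (\<lambda>h. p (f x) (Dg x h) + p (Df x h) (g x))) (at x)"
      using p.FDERIV[OF f(3) g(3), of x] f(2)[of x] g(2)[of x] x by simp
  next
    fix x assume "x \<in> \<Omega>"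
    then show "norm (p (f1 x) (g1 x)) \<le> 2 * (M1 * M2 * K)" using bd[OF f(4) g(4), of x x] nn by linarith
  next
    fix x y assume s: "closed_segment x y \<subseteq> \<Omega>"
    then have xy: "x \<in> \<Omega>" "y \<in> \<Omega>" by auto
    have eq: "p (f1 x) (g1 x) - p (f1 y) (g1 y) = p (f1 x - f1 y) (g1 x) + p (f1 y) (g1 x - g1 y)"
      by (simp add: p.diff_left p.diff_right)
    have "norm (p (f1 x - f1 y) (g1 x)) \<le> (M1 * norm (x - y)) * M2 * K"
      using K(1)[of "f1 x - f1 y" "g1 x"] mult_right_mono[OF mult_mono[OF f(5)[OF s] g(4)[OF xy(1)]] K(2)] f(6)
      by (simp add: order_trans)
    moreover have "norm (p (f1 y) (g1 x - g1 y)) \<le> M1 * (M2 * norm (x - y)) * K"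
      using K(1)[of "f1 y" "g1 x - g1 y"] mult_right_mono[OF mult_mono[OF f(4)[OF xy(2)] g(5)[OF s]] K(2)] f(6)
      by (simp add: order_trans)
    moreover have "(M1 * norm (x - y)) * M2 * K + M1 * (M2 * norm (x - y)) * K = 2 * (M1 * M2 * K) * norm (x - y)"
      by simp
    ultimately show "norm (p (f1 x) (g1 x) - p (f1 y) (g1 y)) \<le> 2 * (M1 * M2 * K) * norm (x - y)"
      unfolding eq using norm_triangle_ineq[of "p (f1 x - f1 y) (g1 x)" "p (f1 y) (g1 x - g1 y)"] by linarith
  qed
qed

lemma lip_rep_bounded_linear:
  fixes f :: "real^'d::finite \<Rightarrow> 'b::euclidean_space" and T :: "'b \<Rightarrow> 'c::euclidean_space"
  assumes "bounded_linear T" "lip_rep \<Omega> f Df"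
  shows "lip_rep \<Omega> (\<lambda>x. T (f x)) (\<lambda>x h. T (Df x h))"
proof -
  interpret T: bounded_linear T by fact
  obtain K where K: "\<And>a. norm (T a) \<le> norm a * K" "K \<ge> 0" using T.nonneg_bounded by blast
  obtain N g M where g: "negligible N" "\<And>x. x \<in> \<Omega> - N \<Longrightarrow> f x = g x" "\<And>x. x \<in> \<Omega> - N \<Longrightarrow> (g has_derivative Df x) (at x)"
    "\<And>x. x \<in> \<Omega> \<Longrightarrow> norm (g x) \<le> M"
    "\<And>x y. closed_segment x y \<subseteq> \<Omega> \<Longrightarrow> norm (g x - g y) \<le> M * norm (x - y)" "M \<ge> 0"
    by (rule lip_repE[OF assms(2)], rule that)
  show ?thesis
  proof (rule lip_repI[where N=N and g="\<lambda>x. T (g x)" and M="M * K"])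
    fix x assume "x \<in> \<Omega> - N"
    then show "T (f x) = T (g x)" "((\<lambda>x. T (g x)) has_derivative (\<lambda>h. T (Df x h))) (at x)"
      using g(2,3) by (auto intro: T.has_derivative)
  next
    fix x assume "x \<in> \<Omega>"
    then show "norm (T (g x)) \<le> M * K"
      using K(1)[of "g x"] mult_right_mono[OF g(4) K(2), of x] by linarith
  next
    fix x y assume "closed_segment x y \<subseteq> \<Omega>"
    then show "norm (T (g x) - T (g y)) \<le> M * K * norm (x - y)"
      using K(1)[of "g x - g y"] mult_right_mono[OF g(5) K(2), of x y] by (simp add: T.diff mult_ac)
  qed (use g in auto)
qed

lemma lip_rep_add:
  fixes f g :: "real^'d::finite \<Rightarrow> 'b::euclidean_space"
  assumes "lip_rep \<Omega> f Df" "lip_rep \<Omega> g Dg"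
  shows "lip_rep \<Omega> (\<lambda>x. f x + g x) (\<lambda>x h. Df x h + Dg x h)"
proof -
  obtain N1 f1 M1 where f: "negligible N1" "\<And>x. x \<in> \<Omega> - N1 \<Longrightarrow> f x = f1 x" "\<And>x. x \<in> \<Omega> - N1 \<Longrightarrow> (f1 has_derivative Df x) (at x)"
    "\<And>x. x \<in> \<Omega> \<Longrightarrow> norm (f1 x) \<le> M1"
    "\<And>x y. closed_segment x y \<subseteq> \<Omega> \<Longrightarrow> norm (f1 x - f1 y) \<le> M1 * norm (x - y)" "M1 \<ge> 0"
    by (rule lip_repE[OF assms(1)], rule that)
  obtain N2 g1 M2 where g: "negligible N2" "\<And>x. x \<in> \<Omega> - N2 \<Longrightarrow> g x = g1 x" "\<And>x. x \<in> \<Omega> - N2 \<Longrightarrow> (g1 has_derivative Dg x) (at x)"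
    "\<And>x. x \<in> \<Omega> \<Longrightarrow> norm (g1 x) \<le> M2"
    "\<And>x y. closed_segment x y \<subseteq> \<Omega> \<Longrightarrow> norm (g1 x - g1 y) \<le> M2 * norm (x - y)" "M2 \<ge> 0"
    by (rule lip_repE[OF assms(2)], rule that)
  show ?thesis
  proof (rule lip_repI[where N="N1 \<union> N2" and g="\<lambda>x. f1 x + g1 x" and M="M1 + M2"])
    show "negligible (N1 \<union> N2)" using f(1) g(1) by simp
    fix x assume x: "x \<in> \<Omega> - (N1 \<union> N2)"
    show "f x + g x = f1 x + g1 x" using f(2) g(2) x by simp
    show "((\<lambda>x. f1 x + g1 x) has_derivative (\<lambda>h. Df x h + Dg x h)) (at x)"
      using x by (intro has_derivative_add f(3) g(3)) auto
  next
    fix x assume "x \<in> \<Omega>"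
    then show "norm (f1 x + g1 x) \<le> M1 + M2" using f(4)[of x] g(4)[of x] by (intro norm_triangle_le) simp
  next
    fix x y assume s: "closed_segment x y \<subseteq> \<Omega>"
    have "norm ((f1 x - f1 y) + (g1 x - g1 y)) \<le> M1 * norm (x - y) + M2 * norm (x - y)"
      using f(5)[OF s] g(5)[OF s] by (intro norm_triangle_le) simp
    then show "norm (f1 x + g1 x - (f1 y + g1 y)) \<le> (M1 + M2) * norm (x - y)"
      by (simp add: algebra_simps)
  qed
qed

lemma lip_rep_scaleR:
  fixes f :: "real^'d::finite \<Rightarrow> 'b::euclidean_space"
  shows "lip_rep \<Omega> f Df \<Longrightarrow> lip_rep \<Omega> (\<lambda>x. c *\<^sub>R f x) (\<lambda>x h. c *\<^sub>R Df x h)"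
  by (rule lip_rep_bounded_linear[OF bounded_linear_scaleR_right])

lemma lip_rep_zero:
  fixes f :: "real^'d::finite \<Rightarrow> 'b::euclidean_space"
  assumes "negligible N" "\<And>x. x \<in> \<Omega> - N \<Longrightarrow> f x = 0"
  shows "lip_rep \<Omega> f (\<lambda>x h. 0)"
  by (rule lip_repI[OF assms(1), of _ _ "\<lambda>_. 0" _ 0]) (auto simp: assms)

lemma lip_rep_sum:
  fixes f :: "'i \<Rightarrow> real^'d::finite \<Rightarrow> 'b::euclidean_space"
  assumes "finite A" "\<And>i. i \<in> A \<Longrightarrow> lip_rep \<Omega> (f i) (Df i)"
  shows "lip_rep \<Omega> (\<lambda>x. \<Sum>i\<in>A. f i x) (\<lambda>x h. \<Sum>i\<in>A. Df i x h)"
  using assms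
proof (induction rule: finite_induct)
  case empty
  show ?case using lip_rep_zero[of "{}" \<Omega> "\<lambda>_. 0"] by simp
next
  case (insert i A)
  then have "lip_rep \<Omega> (\<lambda>x. f i x + (\<Sum>i\<in>A. f i x)) (\<lambda>x h. Df i x h + (\<Sum>i\<in>A. Df i x h))"
    by (intro lip_rep_add) auto
  then show ?case using insert by simp
qed

lemma lip_rep_vec:
  fixes v :: "real^'d::finite \<Rightarrow> real^'n::finite"
  assumes "\<And>j. lip_rep \<Omega> (\<lambda>x. v x $ j) (D j)"
  shows "lip_rep \<Omega> v (\<lambda>x h. \<chi> j. D j x h)"
proof -
  have "lip_rep \<Omega> (\<lambda>x. \<Sum>j\<in>UNIV. v x $ j *\<^sub>R axis j 1) (\<lambda>x h. \<Sum>j\<in>UNIV. D j x h *\<^sub>R (axis j 1 :: real^'n))"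
    by (intro lip_rep_sum lip_rep_bounded_linear[OF bounded_linear_scaleR_left] assms finite)
  moreover have "(\<Sum>j\<in>UNIV. w j *\<^sub>R axis j 1) = (\<chi> j. w j)" for w :: "'n \<Rightarrow> real"
    by (auto simp: vec_eq_iff axis_def if_distrib cong: if_cong)
  ultimately show ?thesis by (simp add: vec_lambda_eta)
qed

lemma lip_rep_component:
  fixes v :: "real^'d::finite \<Rightarrow> real^'n::finite"
  assumes "lip_rep \<Omega> v D"
  shows "lip_rep \<Omega> (\<lambda>x. v x $ j) (\<lambda>x h. D x h $ j)"
  by (rule lip_rep_bounded_linear[OF bounded_linear_vec_nth assms])

lemma lip_rep_cong_AE:
  assumes "lip_rep \<Omega> f D" "negligible N" "\<And>x. x \<in> \<Omega> - N \<Longrightarrow> f' x = f x"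
  shows "lip_rep \<Omega> f' D"
proof -
  obtain N' g M where g: "negligible N'" "\<And>x. x \<in> \<Omega> - N' \<Longrightarrow> f x = g x" "\<And>x. x \<in> \<Omega> - N' \<Longrightarrow> (g has_derivative D x) (at x)"
    "\<And>x. x \<in> \<Omega> \<Longrightarrow> norm (g x) \<le> M"
    "\<And>x y. closed_segment x y \<subseteq> \<Omega> \<Longrightarrow> norm (g x - g y) \<le> M * norm (x - y)" "M \<ge> 0"
    by (rule lip_repE[OF assms(1)], rule that)
  show ?thesis
    by (rule lip_repI[where N="N \<union> N'" and g=g and M=M]) (use g assms(2,3) in auto)
qed

text \<open>Sequential difference quotients, because measurability of limits and dominated
  convergence are both statements about sequences. The offset m keeps all step lengths below a
  prescribed bound.\<close>

lemma has_derivative_LIMSEQ: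
  fixes f :: "'a::real_normed_vector \<Rightarrow> 'b::real_normed_vector"
  assumes "(f has_derivative D) (at x)"
  shows "(\<lambda>n. real (n + m) *\<^sub>R (f (x + inverse (real (n + m)) *\<^sub>R h) - f x)) \<longlonglongrightarrow> D h"
proof (cases "h = 0")
  case True
  interpret D: bounded_linear D by (rule has_derivative_bounded_linear[OF assms])
  show ?thesis using True by (simp add: D.zero)
next
  case False
  interpret D: bounded_linear D by (rule has_derivative_bounded_linear[OF assms])
  have lim: "((\<lambda>k. norm (f (x + k) - f x - D k) / norm k) \<longlongrightarrow> 0) (at 0)"
    using assms by (simp add: has_derivative_at)
  have "(\<lambda>n. inverse (real (n + m)) *\<^sub>R h) \<longlonglongrightarrow> 0 *\<^sub>R h"
    by (intro tendsto_intros LIMSEQ_ignore_initial_segment lim_inverse_n)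
  moreover have "\<forall>\<^sub>F n in sequentially. inverse (real (n + m)) *\<^sub>R h \<noteq> 0"
    using eventually_gt_at_top[of 0] by eventually_elim (use False in auto)
  ultimately have "filterlim (\<lambda>n. inverse (real (n + m)) *\<^sub>R h) (at 0) sequentially"
    by (simp add: filterlim_at)
  from tendsto_mult_left[OF filterlim_compose[OF lim this], of "norm h"]
  have "(\<lambda>n. norm h * (norm (f (x + inverse (real (n + m)) *\<^sub>R h) - f x - D (inverse (real (n + m)) *\<^sub>R h)) / norm (inverse (real (n + m)) *\<^sub>R h))) \<longlonglongrightarrow> 0"
    by simp
  moreover have "\<forall>\<^sub>F n in sequentially. norm h * (norm (f (x + inverse (real (n + m)) *\<^sub>R h) - f x - D (inverse (real (n + m)) *\<^sub>R h)) / norm (inverse (real (n + m)) *\<^sub>R h))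
      = norm (real (n + m) *\<^sub>R (f (x + inverse (real (n + m)) *\<^sub>R h) - f x) - D h)"
    using eventually_gt_at_top[of 0]
  proof eventually_elim
    case (elim n)
    define r where "r = real (n + m)"
    have r: "r > 0" using elim by (simp add: r_def)
    have "r *\<^sub>R (f (x + inverse r *\<^sub>R h) - f x) - D h = r *\<^sub>R (f (x + inverse r *\<^sub>R h) - f x - D (inverse r *\<^sub>R h))"
      using r by (simp add: D.scaleR scaleR_diff_right)
    then have "norm (r *\<^sub>R (f (x + inverse r *\<^sub>R h) - f x) - D h) = r * norm (f (x + inverse r *\<^sub>R h) - f x - D (inverse r *\<^sub>R h))"
      using r by simp
    then show ?case
      using r False unfolding r_def[symmetric] by (simp add: field_simps)
  qed
  ultimately have "(\<lambda>n. norm (real (n + m) *\<^sub>R (f (x + inverse (real (n + m)) *\<^sub>R h) - f x) - D h)) \<longlonglongrightarrow> 0"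
    by (rule Lim_transform_eventually)
  then show ?thesis by (simp add: LIM_zero_iff tendsto_norm_zero_iff)
qed

lemma derivative_norm_le_of_local_lipschitz:
  fixes g :: "'a::real_normed_vector \<Rightarrow> 'b::real_normed_vector"
  assumes "(g has_derivative D) (at x)" "open \<Omega>" "x \<in> \<Omega>"
    "\<And>x y. closed_segment x y \<subseteq> \<Omega> \<Longrightarrow> norm (g x - g y) \<le> M * norm (x - y)"
  shows "norm (D h) \<le> M * norm h"
proof -
  obtain e where e: "e > 0" "ball x e \<subseteq> \<Omega>" using assms(2,3) openE by blast
  have l: "(\<lambda>n. norm (real (n + 0) *\<^sub>R (g (x + inverse (real (n + 0)) *\<^sub>R h) - g x))) \<longlonglongrightarrow> norm (D h)"
    by (rule tendsto_norm[OF has_derivative_LIMSEQ[OF assms(1)]])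
  have "(\<lambda>n. inverse (real n) *\<^sub>R h) \<longlonglongrightarrow> 0 *\<^sub>R h"
    by (intro tendsto_intros lim_inverse_n)
  then have "\<forall>\<^sub>F n in sequentially. norm (inverse (real n) *\<^sub>R h) < e"
    using e(1) by (auto simp: tendsto_iff)
  with eventually_gt_at_top[of 0]
  have "\<forall>\<^sub>F n in sequentially. norm (real (n + 0) *\<^sub>R (g (x + inverse (real (n + 0)) *\<^sub>R h) - g x)) \<le> M * norm h"
  proof eventually_elim
    case (elim n)
    have "closed_segment (x + inverse (real n) *\<^sub>R h) x \<subseteq> ball x e"
      using elim e(1) by (intro closed_segment_subset) (auto simp: dist_norm)
    then have "norm (g (x + inverse (real n) *\<^sub>R h) - g x) \<le> M * norm (inverse (real n) *\<^sub>R h)"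
      using assms(4)[of "x + inverse (real n) *\<^sub>R h" x] e(2) by auto
    then show ?case unfolding norm_scaleR using elim by (simp add: field_simps)
  qed
  from tendsto_upperbound[OF l this] show ?thesis by simp
qed

lemma local_lipschitz_continuous_on:
  fixes g :: "'a::real_normed_vector \<Rightarrow> 'b::real_normed_vector"
  assumes "open \<Omega>" "\<And>x y. closed_segment x y \<subseteq> \<Omega> \<Longrightarrow> norm (g x - g y) \<le> M * norm (x - y)"
  shows "continuous_on \<Omega> g"
proof (rule continuous_at_imp_continuous_on, rule ballI)
  fix x assume "x \<in> \<Omega>"
  then obtain e where e: "e > 0" "ball x e \<subseteq> \<Omega>" using assms(1) openE by blast
  have "norm (g y - g x) \<le> M * norm (y - x)" if "y \<in> ball x e" for y
  proof -
    have "closed_segment y x \<subseteq> ball x e" using that e(1) by (intro closed_segment_subset) auto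
    then show ?thesis using e(2) by (intro assms(2)) auto
  qed
  then have ev: "\<forall>\<^sub>F y in at x. norm (g y - g x) \<le> norm (y - x) * M"
    using e(1) by (auto simp: eventually_at dist_commute mult.commute intro!: exI[of _ e])
  have "((\<lambda>y. norm (y - x) * M) \<longlongrightarrow> norm (x - x) * M) (at x)"
    by (intro tendsto_intros)
  then have "((\<lambda>y. g y - g x) \<longlongrightarrow> 0) (at x)"
    using Lim_null_comparison[OF ev] by simp
  then show "isCont g x" unfolding isCont_def by (simp add: LIM_zero_iff)
qed

lemma lip_rep_AE_eq:
  assumes "negligible N" "\<And>x. x \<in> \<Omega> - N \<Longrightarrow> P x" "open \<Omega>"
  shows "AE x in lebesgue_on \<Omega>. P x"
proof -
  have "AE x in lebesgue. x \<notin> N"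
    using assms(1) by (intro AE_not_in) (simp add: negligible_iff_null_sets)
  then show ?thesis
    unfolding AE_lebesgue_on_iff[OF sets_lebesgue_open[OF assms(3)]]
    by (rule eventually_mono) (use assms(2) in auto)
qed

lemma lip_rep_Linf:
  fixes f :: "real^'d::finite \<Rightarrow> 'b::euclidean_space"
  assumes "open \<Omega>" "lip_rep \<Omega> f D"
  shows "f \<in> Linf_space \<Omega>"
proof -
  obtain N g M where g: "negligible N" "\<And>x. x \<in> \<Omega> - N \<Longrightarrow> f x = g x" "\<And>x. x \<in> \<Omega> - N \<Longrightarrow> (g has_derivative D x) (at x)"
    "\<And>x. x \<in> \<Omega> \<Longrightarrow> norm (g x) \<le> M"
    "\<And>x y. closed_segment x y \<subseteq> \<Omega> \<Longrightarrow> norm (g x - g y) \<le> M * norm (x - y)" "M \<ge> 0"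
    by (rule lip_repE[OF assms(2)], rule that)
  have "continuous_on \<Omega> g" by (rule local_lipschitz_continuous_on[OF assms(1) g(5)])
  then have "g \<in> borel_measurable (lebesgue_on \<Omega>)"
    using continuous_imp_measurable_on_sets_lebesgue assms(1) by blast
  then have "g \<in> Linf_space \<Omega>"
    using g(4) by (intro Linf_spaceI AE_I2) auto
  then show ?thesis
    by (rule Linf_cong_AE[OF assms(1)]) (rule lip_rep_AE_eq[OF g(1) _ assms(1)], simp add: g(2))
qed

lemma lip_rep_derivative_bound:
  fixes f :: "real^'d::finite \<Rightarrow> 'b::euclidean_space"
  assumes "open \<Omega>" "lip_rep \<Omega> f D"
  obtains M where "AE x in lebesgue_on \<Omega>. \<forall>h. norm (D x h) \<le> M * norm h"
proof -
  obtain N g M where g: "negligible N" "\<And>x. x \<in> \<Omega> - N \<Longrightarrow> f x = g x" "\<And>x. x \<in> \<Omega> - N \<Longrightarrow> (g has_derivative D x) (at x)"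
    "\<And>x. x \<in> \<Omega> \<Longrightarrow> norm (g x) \<le> M"
    "\<And>x y. closed_segment x y \<subseteq> \<Omega> \<Longrightarrow> norm (g x - g y) \<le> M * norm (x - y)" "M \<ge> 0"
    by (rule lip_repE[OF assms(2)], rule that)
  show ?thesis
    by (rule that, rule lip_rep_AE_eq[OF g(1) _ assms(1)])
      (use g(3,5) derivative_norm_le_of_local_lipschitz[OF g(3) assms(1) _ g(5)] in blast)
qed

text \<open>Off N the derivative is a pointwise limit of difference quotients of a Borel function,
  hence measurable; it is bounded by the Lipschitz constant along segments.\<close>

lemma lip_rep_derivative_Linf:
  fixes f :: "real^'d::finite \<Rightarrow> 'b::euclidean_space"
  assumes \<Omega>: "open \<Omega>" and f: "lip_rep \<Omega> f D"
  shows "(\<lambda>x. D x h) \<in> Linf_space \<Omega>"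
proof -
  obtain N g M where g: "negligible N" "\<And>x. x \<in> \<Omega> - N \<Longrightarrow> f x = g x" "\<And>x. x \<in> \<Omega> - N \<Longrightarrow> (g has_derivative D x) (at x)"
    "\<And>x. x \<in> \<Omega> \<Longrightarrow> norm (g x) \<le> M"
    "\<And>x y. closed_segment x y \<subseteq> \<Omega> \<Longrightarrow> norm (g x - g y) \<le> M * norm (x - y)" "M \<ge> 0"
    by (rule lip_repE[OF f], rule that)
  \<comment> \<open>Extension by 0, so that the quotients are defined and Borel on the whole space;
    near a point of the open set \<Omega> it agrees with g.\<close>
  define G where "G = (\<lambda>x. indicator \<Omega> x *\<^sub>R g x)"
  have c: "continuous_on \<Omega> g" by (rule local_lipschitz_continuous_on[OF \<Omega> g(5)])
  have G: "G \<in> borel_measurable borel"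
    unfolding G_def using borel_measurable_continuous_on_indicator[OF _ c] \<Omega> by auto
  define q where "q n x = real (n + 0) *\<^sub>R (G (x + inverse (real (n + 0)) *\<^sub>R h) - G x)" for n x
  have "q n \<in> borel_measurable borel" for n
    unfolding q_def by (intro borel_measurable_scaleR borel_measurable_diff borel_measurable_const G measurable_compose[OF _ G])
      (auto intro!: borel_measurable_continuous_onI continuous_intros)
  then have qm: "q n \<in> borel_measurable lebesgue" for n by (intro measurable_completion) simp
  have Nm: "\<Omega> - N \<in> sets lebesgue"
    using g(1) \<Omega> by (intro sets.Diff) (auto dest: negligible_imp_sets)
  have "(\<lambda>x. indicator (\<Omega> - N) x *\<^sub>R D x h) \<in> borel_measurable lebesgue"
  proof (rule borel_measurable_LIMSEQ_metric)
    show "(\<lambda>x. indicator (\<Omega> - N) x *\<^sub>R q n x) \<in> borel_measurable lebesgue" for n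
      by (intro borel_measurable_scaleR qm borel_measurable_indicator Nm)
    fix x
    show "(\<lambda>n. indicat_real (\<Omega> - N) x *\<^sub>R q n x) \<longlonglongrightarrow> indicat_real (\<Omega> - N) x *\<^sub>R D x h"
    proof (cases "x \<in> \<Omega> - N")
      case True
      have "(G has_derivative D x) (at x)"
        by (rule has_derivative_transform_within_open[OF g(3)[OF True] \<Omega>]) (use True in \<open>auto simp: G_def\<close>)
      then have "(\<lambda>n. q n x) \<longlonglongrightarrow> D x h" unfolding q_def by (rule has_derivative_LIMSEQ)
      then show ?thesis by (intro tendsto_scaleR tendsto_const)
    qed simp
  qed
  then have "(\<lambda>x. indicator \<Omega> x *\<^sub>R D x h) \<in> borel_measurable lebesgue"
  proof (rule borel_measurable_AE)
    have "AE x in lebesgue. x \<notin> N"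
      using g(1) by (intro AE_not_in) (simp add: negligible_iff_null_sets)
    then show "AE x in lebesgue. indicat_real (\<Omega> - N) x *\<^sub>R D x h = indicat_real \<Omega> x *\<^sub>R D x h"
      by (rule eventually_mono) (simp add: indicator_def)
  qed
  then have m: "(\<lambda>x. D x h) \<in> borel_measurable (lebesgue_on \<Omega>)"
    unfolding borel_measurable_lebesgue_on_iff[OF sets_lebesgue_open[OF \<Omega>]] .
  obtain M where "AE x in lebesgue_on \<Omega>. \<forall>h. norm (D x h) \<le> M * norm h"
    by (rule lip_rep_derivative_bound[OF \<Omega> f])
  then have "AE x in lebesgue_on \<Omega>. norm (D x h) \<le> M * norm h" by (rule eventually_mono) simp
  with m show ?thesis by (rule Linf_spaceI)
qed


section \<open>Integration by parts for functions with a Lipschitz representative\<close>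

lemma test_function_bounded:
  assumes "test_function \<Omega> \<phi>"
  obtains B where "B \<ge> 0" "\<And>x. \<bar>partial_derivs ds \<phi> x\<bar> \<le> B"
proof -
  obtain K where K: "compact K" "K \<subseteq> \<Omega>" "\<And>ds x. x \<notin> K \<Longrightarrow> partial_derivs ds \<phi> x = 0"
    using test_function_supports[OF assms] by blast
  have "bounded (partial_derivs ds \<phi> ` K)"
    by (intro compact_imp_bounded compact_continuous_image K(1)
        continuous_on_subset[OF test_function_continuous_derivs[OF assms]]) auto
  then obtain B where B: "\<And>x. x \<in> K \<Longrightarrow> \<bar>partial_derivs ds \<phi> x\<bar> \<le> B"
    unfolding bounded_iff by auto
  show ?thesis
  proof (rule that[of "max B 0"])
    show "\<bar>partial_derivs ds \<phi> x\<bar> \<le> max B 0" for x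
      using B[of x] K(3)[of x ds] by (cases "x \<in> K") auto
  qed simp
qed

lemma gradient_bound_imp_lipschitz:
  fixes f :: "real^'d::finite \<Rightarrow> real"
  assumes "convex S" "\<And>x. x \<in> S \<Longrightarrow> (f has_derivative (\<lambda>h. \<Sum>i\<in>UNIV. h $ i * g i x)) (at x within S)"
    "\<And>x i. x \<in> S \<Longrightarrow> \<bar>g i x\<bar> \<le> B i" "x \<in> S" "y \<in> S"
  shows "\<bar>f x - f y\<bar> \<le> (\<Sum>i\<in>UNIV. B i) * norm (x - y)"
proof -
  have "norm (f x - f y) \<le> (\<Sum>i\<in>UNIV. B i) * norm (x - y)"
  proof (rule differentiable_bound[OF assms(1,2) _ assms(4,5)])
    fix x assume x: "x \<in> S"
    show "onorm (\<lambda>h. \<Sum>i\<in>UNIV. h $ i * g i x) \<le> (\<Sum>i\<in>UNIV. B i)"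
    proof (rule onorm_le)
      fix h :: "real^'d"
      have "\<bar>\<Sum>i\<in>UNIV. h $ i * g i x\<bar> \<le> (\<Sum>i\<in>UNIV. norm h * B i)"
      proof (rule order_trans[OF sum_abs sum_mono])
        fix i
        show "\<bar>h $ i * g i x\<bar> \<le> norm h * B i"
          unfolding abs_mult using component_le_norm_cart[of h i] assms(3)[OF x, of i] by (intro mult_mono) auto
      qed
      then show "norm (\<Sum>i\<in>UNIV. h $ i * g i x) \<le> (\<Sum>i\<in>UNIV. B i) * norm h"
        by (simp add: sum_distrib_left mult.commute)
    qed
  qed
  then show ?thesis by simp
qed

lemma test_function_lipschitz:
  assumes "test_function \<Omega> (\<phi> :: real^'d::finite \<Rightarrow> real)"
  obtains L where "L \<ge> 0" "\<And>x y. \<bar>\<phi> x - \<phi> y\<bar> \<le> L * norm (x - y)"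
proof -
  have "\<exists>B\<ge>0. \<forall>x. \<bar>partial_derivs [i] \<phi> x\<bar> \<le> B" for i
    by (rule test_function_bounded[OF assms, of "[i]"]) blast
  then obtain B where B: "\<And>i. 0 \<le> B i" "\<And>i x. \<bar>partial_derivs [i] \<phi> x\<bar> \<le> B i" by metis
  show ?thesis
  proof (rule that[of "\<Sum>i\<in>UNIV. B i"])
    show "(\<Sum>i\<in>UNIV. B i) \<ge> 0" by (intro sum_nonneg B)
    show "\<bar>\<phi> x - \<phi> y\<bar> \<le> (\<Sum>i\<in>UNIV. B i) * norm (x - y)" for x y
      by (rule gradient_bound_imp_lipschitz[of UNIV _ "\<lambda>i. partial_derivs [i] \<phi>"])
        (auto intro: B(2) test_function_has_derivative[OF assms])
  qed
qed

text \<open>Translation invariance of Lebesgue measure.\<close>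

lemma integral_difference_zero:
  fixes w :: "real^'d::finite \<Rightarrow> 'b::euclidean_space"
  assumes "integrable lborel w"
  shows "integrable lborel (\<lambda>x. c *\<^sub>R (w (x + t) - w x))" "integral\<^sup>L lborel (\<lambda>x. c *\<^sub>R (w (x + t) - w x)) = 0"
proof -
  have m: "w \<in> borel_measurable borel" using assms by auto
  have t: "(+) t \<in> measurable lborel borel" by simp
  have i: "integrable lborel (\<lambda>x. w (t + x))"
    using integrable_distr_eq[OF t m] assms by (simp add: lborel_distr_plus)
  have e: "integral\<^sup>L lborel (\<lambda>x. w (t + x)) = integral\<^sup>L lborel w"
    using integral_distr[OF t m] by (simp add: lborel_distr_plus)
  show "integrable lborel (\<lambda>x. c *\<^sub>R (w (x + t) - w x))" "integral\<^sup>L lborel (\<lambda>x. c *\<^sub>R (w (x + t) - w x)) = 0"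
    using i assms e by (auto simp: add.commute)
qed

text \<open>The difference quotients of \<phi> g, extended by 0, integrate to 0 by translation
  invariance. They converge a.e. to the derivative of the product and are dominated because of the
  Lipschitz bounds. Iterated integrals and absolute continuity on lines are thereby avoided.\<close>

lemma lip_rep_integration_by_parts:
  fixes f :: "real^'d::finite \<Rightarrow> 'b::euclidean_space"
  assumes \<Omega>: "open \<Omega>" "bounded \<Omega>" and f: "lip_rep \<Omega> f D" and \<phi>: "test_function \<Omega> \<phi>"
  shows "integral\<^sup>L (lebesgue_on \<Omega>) (\<lambda>x. partial_derivs [i] \<phi> x *\<^sub>R f x + \<phi> x *\<^sub>R D x (axis i 1)) = 0"
proof -
  obtain N g M where g: "negligible N" "\<And>x. x \<in> \<Omega> - N \<Longrightarrow> f x = g x" "\<And>x. x \<in> \<Omega> - N \<Longrightarrow> (g has_derivative D x) (at x)"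
    "\<And>x. x \<in> \<Omega> \<Longrightarrow> norm (g x) \<le> M"
    "\<And>x y. closed_segment x y \<subseteq> \<Omega> \<Longrightarrow> norm (g x - g y) \<le> M * norm (x - y)" "M \<ge> 0"
    by (rule lip_repE[OF f], rule that)
  obtain K where K: "compact K" "K \<subseteq> \<Omega>" "\<And>ds x. x \<notin> K \<Longrightarrow> partial_derivs ds \<phi> x = 0"
    using test_function_supports[OF \<phi>] by blast
  have K0: "\<And>x. x \<notin> K \<Longrightarrow> \<phi> x = 0" using K(3)[of _ "[]"] by simp
  obtain B where B: "B \<ge> 0" "\<And>x. \<bar>\<phi> x\<bar> \<le> B"
    using test_function_bounded[OF \<phi>, of "[]"] by auto
  obtain L where L: "L \<ge> 0" "\<And>x y. \<bar>\<phi> x - \<phi> y\<bar> \<le> L * norm (x - y)"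
    by (rule test_function_lipschitz[OF \<phi>], rule that)
  \<comment> \<open>Shifts of length below e that start or end in the support K run inside \<Omega>,
    where the Lipschitz bound along segments applies.\<close>
  obtain e where e: "e > 0" "(\<Union>x\<in>K. ball x e) \<subseteq> \<Omega>"
    using compact_subset_open_imp_ball_epsilon_subset[OF K(1) \<Omega>(1) K(2)] by blast
  obtain m where m: "inverse (real m) < e" "m > 0"
    using ex_inverse_of_nat_less[OF e(1)] by auto
  obtain R where R: "\<And>x. x \<in> \<Omega> \<Longrightarrow> norm x \<le> R" using \<Omega>(2) bounded_iff by blast
  define h where "h = (axis i 1 :: real^'d)"
  have h: "norm h = 1" by (simp add: h_def)
  define w where "w = (\<lambda>x. indicator \<Omega> x *\<^sub>R (\<phi> x *\<^sub>R g x))"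
  have w0: "w x = 0" if "x \<notin> K" for x using K0[OF that] by (simp add: w_def)
  have c: "continuous_on \<Omega> g" by (rule local_lipschitz_continuous_on[OF \<Omega>(1) g(5)])
  have c\<phi>: "continuous_on UNIV \<phi>" using test_function_continuous_derivs[OF \<phi>, of "[]"] by simp
  have wm: "w \<in> borel_measurable borel"
    unfolding w_def
    by (rule borel_measurable_continuous_on_indicator)
      (use \<Omega>(1) in \<open>auto intro!: continuous_intros c continuous_on_subset[OF c\<phi>]\<close>)
  have wi: "integrable lborel w"
  proof -
    have "integrable lborel (\<lambda>x. indicator (cball 0 R) x *\<^sub>R w x)"
    proof (rule Bochner_Integration.integrable_bound)
      show "integrable lborel (\<lambda>x::real^'d. indicat_real (cball 0 R) x * (B * M))"
        by (intro integrable_mult_left) (auto intro!: integrable_real_indicator emeasure_lborel_cball_finite)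
      show "AE x in lborel. norm (indicat_real (cball 0 R) x *\<^sub>R w x) \<le> norm (indicat_real (cball 0 R) x * (B * M))"
        using B(1) g(6) by (intro AE_I2) (auto simp: w_def indicator_def intro!: mult_mono B(2) g(4))
    qed (simp add: wm borel_measurable_scaleR borel_measurable_indicator)
    also have "(\<lambda>x. indicator (cball 0 R) x *\<^sub>R w x) = w"
      using R by (auto simp: w_def indicator_def fun_eq_iff)
    finally show ?thesis .
  qed
  define q where "q n x = real (n + m) *\<^sub>R (w (x + inverse (real (n + m)) *\<^sub>R h) - w x)" for n x
  have qi: "integrable lborel (q n)" "integral\<^sup>L lborel (q n) = 0" for n
    using integral_difference_zero[OF wi] unfolding q_def by auto
  \<comment> \<open>Product rule for differences: the Lipschitz constant of \<phi> times the bound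
    of g, plus the bound of \<phi> times the Lipschitz constant of g. The step length cancels
    against the factor \<open>real (n + m)\<close>.\<close>
  have qb: "norm (q n x) \<le> indicat_real (cball 0 (R + 1)) x * ((L + B) * M)" for n x
  proof -
    define s where "s = inverse (real (n + m))"
    have s: "0 < s" "s < e" "s \<le> 1" "real (n + m) * s = 1"
    proof -
      have "s \<le> inverse (real m)" unfolding s_def using m by (intro le_imp_inverse_le) auto
      then show "s < e" using m by simp
      show "s \<le> 1" unfolding s_def using m by (intro inverse_le_1_iff[THEN iffD2]) auto
      show "0 < s" "real (n + m) * s = 1" using m by (auto simp: s_def)
    qed
    show ?thesis
    proof (cases "x \<in> K \<or> x + s *\<^sub>R h \<in> K")
      case False
      then have "q n x = 0" using w0 by (simp add: q_def s_def)
      moreover have "(L + B) * M \<ge> 0" using L(1) B(1) g(6) by simp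
      ultimately show ?thesis by simp
    next
      case True
      have "closed_segment (x + s *\<^sub>R h) x \<subseteq> \<Omega>"
        using True
      proof
        assume "x \<in> K"
        have "closed_segment (x + s *\<^sub>R h) x \<subseteq> ball x e"
          using s h e(1) by (intro closed_segment_subset) (auto simp: dist_norm)
        then show ?thesis using e(2) \<open>x \<in> K\<close> by blast
      next
        assume "x + s *\<^sub>R h \<in> K"
        have "closed_segment (x + s *\<^sub>R h) x \<subseteq> ball (x + s *\<^sub>R h) e"
          using s h e(1) by (intro closed_segment_subset) (auto simp: dist_norm)
        then show ?thesis using e(2) \<open>x + s *\<^sub>R h \<in> K\<close> by blast
      qed
      then have in\<Omega>: "x \<in> \<Omega>" "x + s *\<^sub>R h \<in> \<Omega>" and gl: "norm (g (x + s *\<^sub>R h) - g x) \<le> M * s"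
        using g(5)[of "x + s *\<^sub>R h" x] s h by auto
      have "w (x + s *\<^sub>R h) - w x = (\<phi> (x + s *\<^sub>R h) - \<phi> x) *\<^sub>R g (x + s *\<^sub>R h) + \<phi> x *\<^sub>R (g (x + s *\<^sub>R h) - g x)"
        using in\<Omega> by (simp add: w_def algebra_simps)
      moreover have "norm ((\<phi> (x + s *\<^sub>R h) - \<phi> x) *\<^sub>R g (x + s *\<^sub>R h)) \<le> (L * s) * M"
        unfolding norm_scaleR using L(2)[of "x + s *\<^sub>R h" x] s h L(1) in\<Omega> by (intro mult_mono g(4)) auto
      moreover have "norm (\<phi> x *\<^sub>R (g (x + s *\<^sub>R h) - g x)) \<le> B * (M * s)"
        unfolding norm_scaleR using gl B by (intro mult_mono) auto
      ultimately have "norm (w (x + s *\<^sub>R h) - w x) \<le> (L * s) * M + B * (M * s)"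
        by (metis norm_triangle_mono)
      then have "real (n + m) * norm (w (x + s *\<^sub>R h) - w x) \<le> real (n + m) * ((L * s) * M + B * (M * s))"
        by (intro mult_left_mono) auto
      also have "\<dots> = (real (n + m) * s) * ((L + B) * M)" by (simp add: algebra_simps)
      finally have "norm (q n x) \<le> (L + B) * M"
        unfolding q_def s_def[symmetric] norm_scaleR using s(4) by simp
      moreover have "x \<in> cball 0 (R + 1)" using R[OF in\<Omega>(1)] by simp
      ultimately show ?thesis by simp
    qed
  qed
  define G where "G = (\<lambda>x. indicator \<Omega> x *\<^sub>R (partial_derivs [i] \<phi> x *\<^sub>R f x + \<phi> x *\<^sub>R D x (axis i 1)))"
  have ae: "AE x in lebesgue. x \<notin> N"
    using g(1) by (intro AE_not_in) (simp add: negligible_iff_null_sets)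
  have lim: "(\<lambda>n. q n x) \<longlonglongrightarrow> G x" if "x \<notin> N" for x
  proof (cases "x \<in> \<Omega>")
    case True
    have "((\<lambda>x. \<phi> x *\<^sub>R g x) has_derivative (\<lambda>h. \<phi> x *\<^sub>R D x h + (\<Sum>i\<in>UNIV. h $ i * partial_derivs [i] \<phi> x) *\<^sub>R g x)) (at x)"
      using True that by (intro has_derivative_scaleR test_function_has_derivative[OF \<phi>] g(3)) auto
    then have "(w has_derivative (\<lambda>h. \<phi> x *\<^sub>R D x h + (\<Sum>i\<in>UNIV. h $ i * partial_derivs [i] \<phi> x) *\<^sub>R g x)) (at x)"
      by (rule has_derivative_transform_within_open[OF _ \<Omega>(1) True]) (simp add: w_def)
    from has_derivative_LIMSEQ[OF this, of m h] show ?thesis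
      using True that g(2)[of x] by (simp add: q_def G_def h_def sum_axis add.commute)
  next
    case False
    \<comment> \<open>Outside \<Omega>, boundary points included, the complement of K is an open
      neighbourhood on which w vanishes.\<close>
    then have "x \<in> - K" using K(2) by auto
    have "((\<lambda>_. 0) has_derivative (\<lambda>h. 0)) (at x)" by simp
    then have "(w has_derivative (\<lambda>h. 0)) (at x)"
      by (rule has_derivative_transform_within_open[OF _ _ \<open>x \<in> - K\<close>])
        (use K(1) w0 in \<open>auto simp: compact_imp_closed open_Compl\<close>)
    from has_derivative_LIMSEQ[OF this, of m h] show ?thesis
      using False by (simp add: q_def G_def)
  qed
  have Gm: "G \<in> borel_measurable lebesgue"
  proof -
    have "f \<in> borel_measurable (lebesgue_on \<Omega>)" "(\<lambda>x. D x (axis i 1)) \<in> borel_measurable (lebesgue_on \<Omega>)"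
      using lip_rep_Linf[OF \<Omega>(1) f] lip_rep_derivative_Linf[OF \<Omega>(1) f] by (auto simp: Linf_space_def)
    moreover have "partial_derivs ds \<phi> \<in> borel_measurable (lebesgue_on \<Omega>)" for ds
      using continuous_imp_measurable_on_sets_lebesgue[OF continuous_on_subset[OF test_function_continuous_derivs[OF \<phi>]]] \<Omega>(1)
      by auto
    from this[of "[i]"] this[of "[]"] calculation
    show ?thesis
      unfolding G_def borel_measurable_lebesgue_on_iff[OF sets_lebesgue_open[OF \<Omega>(1)], symmetric]
      by (intro borel_measurable_add borel_measurable_scaleR) auto
  qed
  have "(\<lambda>n. integral\<^sup>L lebesgue (q n)) \<longlonglongrightarrow> integral\<^sup>L lebesgue G"
  proof (rule integral_dominated_convergence[OF Gm, where w="\<lambda>x. indicat_real (cball 0 (R + 1)) x * ((L + B) * M)"])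
    have "integrable lborel (\<lambda>x::real^'d. indicat_real (cball 0 (R + 1)) x * ((L + B) * M))"
      by (intro integrable_mult_left) (auto intro!: integrable_real_indicator emeasure_lborel_cball_finite)
    then show "integrable lebesgue (\<lambda>x::real^'d. indicat_real (cball 0 (R + 1)) x * ((L + B) * M))"
      by (subst integrable_completion) auto
    show "AE x in lebesgue. (\<lambda>n. q n x) \<longlonglongrightarrow> G x" using ae by (rule eventually_mono) (rule lim)
    show "AE x in lebesgue. norm (q n x) \<le> indicat_real (cball 0 (R + 1)) x * ((L + B) * M)" for n
      by (intro AE_I2 qb)
    show "q n \<in> borel_measurable lebesgue" for n
      using qi(1)[of n] by (intro measurable_completion) auto
  qed
  moreover have "integral\<^sup>L lebesgue (q n) = 0" for n
    using integral_completion[of "q n" lborel] qi[of n] by auto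
  ultimately have "integral\<^sup>L lebesgue G = 0" by (simp add: LIMSEQ_const_iff)
  then show ?thesis
    unfolding G_def integral_lebesgue_on_eq[OF sets_lebesgue_open[OF \<Omega>(1)]] .
qed

lemma lip_rep_weak_deriv:
  fixes f :: "real^'d::finite \<Rightarrow> 'b::euclidean_space"
  assumes \<Omega>: "open \<Omega>" "bounded \<Omega>" and f: "lip_rep \<Omega> f D"
  shows "has_weak_deriv \<Omega> [i] f (\<lambda>x. D x (axis i 1))"
proof -
  have l: "locally_integrable_on \<Omega> f" "locally_integrable_on \<Omega> (\<lambda>x. D x (axis i 1))"
    using lip_rep_Linf[OF \<Omega>(1) f] lip_rep_derivative_Linf[OF \<Omega>(1) f] \<Omega> by (auto intro: Linf_subset)
  show ?thesis
    unfolding has_weak_deriv_def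
  proof (intro conjI l allI impI)
    fix \<phi> assume \<phi>: "test_function \<Omega> \<phi>"
    have "integral\<^sup>L (lebesgue_on \<Omega>) (\<lambda>x. partial_derivs [i] \<phi> x *\<^sub>R f x) + integral\<^sup>L (lebesgue_on \<Omega>) (\<lambda>x. \<phi> x *\<^sub>R D x (axis i 1)) = 0"
      using lip_rep_integration_by_parts[OF \<Omega> f \<phi>, of i]
        integrable_test_function[OF \<Omega>(1) l(1) \<phi>, of "[i]"] integrable_test_function[OF \<Omega>(1) l(2) \<phi>, of "[]"]
      by (simp add: Bochner_Integration.integral_add)
    then show "integral\<^sup>L (lebesgue_on \<Omega>) (\<lambda>x. partial_derivs [i] \<phi> x *\<^sub>R f x) =
        (-1) ^ length [i] *\<^sub>R integral\<^sup>L (lebesgue_on \<Omega>) (\<lambda>x. \<phi> x *\<^sub>R D x (axis i 1))"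
      by (simp add: eq_neg_iff_add_eq_0)
  qed
qed

section \<open>The \<open>H\<^sup>1\<close> inner product\<close>

lemma lip_rep_weak_partial:
  fixes f :: "real^'d::finite \<Rightarrow> 'b::euclidean_space"
  assumes "open \<Omega>" "bounded \<Omega>" "lip_rep \<Omega> f D"
  shows "AE x in lebesgue_on \<Omega>. weak_partial \<Omega> i f x = D x (axis i 1)"
  by (rule weak_partial_AE[OF assms(1) lip_rep_weak_deriv[OF assms]])

text \<open>The pointwise integrand of the inner product, with the derivatives passed explicitly in
  place of \<open>weak_partial\<close>; norm estimates become inequalities between such
  integrands.\<close>

definition H1_density :: "(real^'d::finite \<Rightarrow> 'b::euclidean_space) \<Rightarrow> (real^'d \<Rightarrow> real^'d \<Rightarrow> 'b) \<Rightarrow>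
    (real^'d \<Rightarrow> 'b) \<Rightarrow> (real^'d \<Rightarrow> real^'d \<Rightarrow> 'b) \<Rightarrow> real^'d \<Rightarrow> real" where
  "H1_density f Df g Dg x = f x \<bullet> g x + (\<Sum>i\<in>UNIV. Df x (axis i 1) \<bullet> Dg x (axis i 1))"

lemma Linf_sum:
  fixes f :: "'i \<Rightarrow> real^'d::finite \<Rightarrow> 'b::euclidean_space"
  assumes "finite A" "\<And>i. i \<in> A \<Longrightarrow> f i \<in> Linf_space \<Omega>"
  shows "(\<lambda>x. \<Sum>i\<in>A. f i x) \<in> Linf_space \<Omega>"
  using assms
proof (induction rule: finite_induct)
  case empty
  show ?case by (auto intro!: Linf_spaceI[where C=0])
next
  case (insert i A)
  then have "(\<lambda>x. f i x + (\<Sum>i\<in>A. f i x)) \<in> Linf_space \<Omega>"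
    by (intro Linf_add) auto
  then show ?case using insert by simp
qed

lemma H1_density_Linf:
  fixes f g :: "real^'d::finite \<Rightarrow> 'b::euclidean_space"
  assumes "open \<Omega>" "lip_rep \<Omega> f Df" "lip_rep \<Omega> g Dg"
  shows "H1_density f Df g Dg \<in> Linf_space \<Omega>"
  unfolding H1_density_def[abs_def]
  by (intro Linf_add Linf_sum Linf_bilinear[OF bounded_bilinear_inner] finite
      lip_rep_Linf[OF assms(1,2)] lip_rep_Linf[OF assms(1,3)]
      lip_rep_derivative_Linf[OF assms(1,2)] lip_rep_derivative_Linf[OF assms(1,3)])

text \<open>Under the integral the chosen \<open>weak_partial\<close> may be replaced by D, which
  equals it a.e. Essential boundedness on the bounded set \<Omega> makes every term integrable, so
  the sum of integrals is one integral.\<close>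

lemma H1_inner_eq:
  fixes f g :: "real^'d::finite \<Rightarrow> 'b::euclidean_space"
  assumes \<Omega>: "open \<Omega>" "bounded \<Omega>" and f: "lip_rep \<Omega> f Df" and g: "lip_rep \<Omega> g Dg"
  shows "H1_inner \<Omega> f g = integral\<^sup>L (lebesgue_on \<Omega>) (H1_density f Df g Dg)"
proof -
  have ii: "integrable (lebesgue_on \<Omega>) (\<lambda>x. f x \<bullet> g x)"
    by (intro Linf_integrable[OF _ \<Omega>] Linf_bilinear[OF bounded_bilinear_inner] lip_rep_Linf[OF \<Omega>(1) f] lip_rep_Linf[OF \<Omega>(1) g])
  have id: "integrable (lebesgue_on \<Omega>) (\<lambda>x. Df x (axis i 1) \<bullet> Dg x (axis i 1))" for i
    by (intro Linf_integrable[OF _ \<Omega>] Linf_bilinear[OF bounded_bilinear_inner]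
      lip_rep_derivative_Linf[OF \<Omega>(1) f] lip_rep_derivative_Linf[OF \<Omega>(1) g])
  have "integral\<^sup>L (lebesgue_on \<Omega>) (\<lambda>x. weak_partial \<Omega> i f x \<bullet> weak_partial \<Omega> i g x)
      = integral\<^sup>L (lebesgue_on \<Omega>) (\<lambda>x. Df x (axis i 1) \<bullet> Dg x (axis i 1))" for i
  proof -
    have ae: "AE x in lebesgue_on \<Omega>. Df x (axis i 1) \<bullet> Dg x (axis i 1) = weak_partial \<Omega> i f x \<bullet> weak_partial \<Omega> i g x"
      using lip_rep_weak_partial[OF \<Omega> f, of i] lip_rep_weak_partial[OF \<Omega> g, of i] by eventually_elim simp
    have m: "(\<lambda>x. Df x (axis i 1) \<bullet> Dg x (axis i 1)) \<in> borel_measurable (lebesgue_on \<Omega>)"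
      using id by auto
    have m': "(\<lambda>x. weak_partial \<Omega> i f x \<bullet> weak_partial \<Omega> i g x) \<in> borel_measurable (lebesgue_on \<Omega>)"
      by (rule borel_measurable_lebesgue_on_AE[OF sets_lebesgue_open[OF \<Omega>(1)] m ae])
    from integral_cong_AE[OF m m' ae] show ?thesis by (rule sym)
  qed
  then have "H1_inner \<Omega> f g = integral\<^sup>L (lebesgue_on \<Omega>) (\<lambda>x. f x \<bullet> g x) +
      (\<Sum>i\<in>UNIV. integral\<^sup>L (lebesgue_on \<Omega>) (\<lambda>x. Df x (axis i 1) \<bullet> Dg x (axis i 1)))"
    unfolding H1_inner_def by simp
  also have "\<dots> = integral\<^sup>L (lebesgue_on \<Omega>) (H1_density f Df g Dg)"
    unfolding H1_density_def[abs_def]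
    by (subst Bochner_Integration.integral_add[OF ii Bochner_Integration.integrable_sum[OF id]], subst Bochner_Integration.integral_sum)
      (rule id, rule refl)
  finally show ?thesis .
qed

text \<open>On functions without weak derivatives \<open>H1_inner\<close> carries no information.
  This class is closed under linear combinations and inner products, and on it the form is
  symmetric, bilinear and positive semidefinite.\<close>

definition H1_lip :: "(real^'d::finite) set \<Rightarrow> (real^'d \<Rightarrow> 'b::euclidean_space) set" where
  "H1_lip \<Omega> = {f. \<exists>D. lip_rep \<Omega> f D}"

lemma H1_lipI: "lip_rep \<Omega> f D \<Longrightarrow> f \<in> H1_lip \<Omega>"
  by (auto simp: H1_lip_def)

lemma H1_lip_lincomb:
  assumes "f \<in> H1_lip \<Omega>" "g \<in> H1_lip \<Omega>"
  shows "(\<lambda>x. a *\<^sub>R f x + b *\<^sub>R g x) \<in> H1_lip \<Omega>"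
proof -
  obtain Df Dg where "lip_rep \<Omega> f Df" "lip_rep \<Omega> g Dg" using assms by (auto simp: H1_lip_def)
  from lip_rep_add[OF lip_rep_scaleR[OF this(1)] lip_rep_scaleR[OF this(2)]]
  show ?thesis by (rule H1_lipI)
qed

lemma H1_lip_inner:
  assumes "f \<in> H1_lip \<Omega>" "g \<in> H1_lip \<Omega>"
  shows "(\<lambda>x. f x \<bullet> g x) \<in> H1_lip \<Omega>"
proof -
  obtain Df Dg where "lip_rep \<Omega> f Df" "lip_rep \<Omega> g Dg" using assms by (auto simp: H1_lip_def)
  from lip_rep_bilinear[OF bounded_bilinear_inner this] show ?thesis by (rule H1_lipI)
qed

context
  fixes \<Omega> :: "(real^'d::finite) set"
  assumes \<Omega>: "open \<Omega>" "bounded \<Omega>"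
begin

lemma H1_inner_commute:
  fixes f g :: "real^'d::finite \<Rightarrow> 'b::euclidean_space"
  shows "H1_inner \<Omega> f g = H1_inner \<Omega> g f"
  by (simp add: H1_inner_def inner_commute)

lemma H1_inner_lincomb_right:
  fixes f g h :: "real^'d::finite \<Rightarrow> 'b::euclidean_space"
  assumes "f \<in> H1_lip \<Omega>" "g \<in> H1_lip \<Omega>" "h \<in> H1_lip \<Omega>"
  shows "H1_inner \<Omega> f (\<lambda>x. a *\<^sub>R g x + b *\<^sub>R h x) = a * H1_inner \<Omega> f g + b * H1_inner \<Omega> f h"
proof -
  obtain Df Dg Dh where D: "lip_rep \<Omega> f Df" "lip_rep \<Omega> g Dg" "lip_rep \<Omega> h Dh"
    using assms by (auto simp: H1_lip_def)
  have s: "lip_rep \<Omega> (\<lambda>x. a *\<^sub>R g x + b *\<^sub>R h x) (\<lambda>x k. a *\<^sub>R Dg x k + b *\<^sub>R Dh x k)"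
    by (intro lip_rep_add lip_rep_scaleR D)
  have "H1_inner \<Omega> f (\<lambda>x. a *\<^sub>R g x + b *\<^sub>R h x) =
      integral\<^sup>L (lebesgue_on \<Omega>) (\<lambda>x. a * H1_density f Df g Dg x + b * H1_density f Df h Dh x)"
    unfolding H1_inner_eq[OF \<Omega> D(1) s]
    by (rule arg_cong[where f="integral\<^sup>L (lebesgue_on \<Omega>)"])
      (auto simp: H1_density_def fun_eq_iff inner_add_right sum.distrib sum_distrib_left algebra_simps)
  also have "\<dots> = a * H1_inner \<Omega> f g + b * H1_inner \<Omega> f h"
    unfolding H1_inner_eq[OF \<Omega> D(1,2)] H1_inner_eq[OF \<Omega> D(1,3)]
    using Linf_integrable[OF H1_density_Linf[OF \<Omega>(1) D(1,2)] \<Omega>] Linf_integrable[OF H1_density_Linf[OF \<Omega>(1) D(1,3)] \<Omega>]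
    by simp
  finally show ?thesis .
qed

lemma H1_density_nonneg: "H1_density f Df f Df x \<ge> 0"
  unfolding H1_density_def by (intro add_nonneg_nonneg sum_nonneg) auto

lemma H1_inner_self_nonneg:
  fixes f :: "real^'d::finite \<Rightarrow> 'b::euclidean_space"
  assumes "f \<in> H1_lip \<Omega>"
  shows "H1_inner \<Omega> f f \<ge> 0"
proof -
  obtain D where D: "lip_rep \<Omega> f D" using assms by (auto simp: H1_lip_def)
  show ?thesis unfolding H1_inner_eq[OF \<Omega> D D] by (intro integral_nonneg_AE AE_I2 H1_density_nonneg)
qed

text \<open>Such an f has the representative 0, so its weak gradient vanishes as well. Hence the
  form does not see changes on null sets.\<close>

lemma H1_inner_zero:
  fixes f g :: "real^'d::finite \<Rightarrow> 'b::euclidean_space"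
  assumes "negligible N" "\<And>x. x \<in> \<Omega> - N \<Longrightarrow> f x = 0" "g \<in> H1_lip \<Omega>"
  shows "H1_inner \<Omega> f g = 0"
proof -
  obtain D where D: "lip_rep \<Omega> g D" using assms(3) by (auto simp: H1_lip_def)
  have f: "lip_rep \<Omega> f (\<lambda>x h. 0)" using assms(1,2) by (rule lip_rep_zero)
  have "AE x in lebesgue_on \<Omega>. H1_density f (\<lambda>x h. 0) g D x = 0"
    by (rule lip_rep_AE_eq[OF assms(1) _ \<Omega>(1)]) (simp add: H1_density_def assms(2))
  then show ?thesis
    unfolding H1_inner_eq[OF \<Omega> f D] by (rule integral_eq_zero_AE)
qed

lemma H1_inner_self_zero_imp:
  fixes f :: "real^'d::finite \<Rightarrow> 'b::euclidean_space"
  assumes "f \<in> H1_lip \<Omega>" "H1_inner \<Omega> f f = 0"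
  obtains N where "negligible N" "\<And>x. x \<in> \<Omega> - N \<Longrightarrow> f x = 0"
proof -
  obtain D where D: "lip_rep \<Omega> f D" using assms by (auto simp: H1_lip_def)
  have "AE x in lebesgue_on \<Omega>. H1_density f D f D x = 0"
    using assms(2) integral_nonneg_eq_0_iff_AE[OF Linf_integrable[OF H1_density_Linf[OF \<Omega>(1) D D] \<Omega>] AE_I2[OF H1_density_nonneg]]
    unfolding H1_inner_eq[OF \<Omega> D D] by simp
  then have "AE x in lebesgue. x \<in> \<Omega> \<longrightarrow> H1_density f D f D x = 0"
    unfolding AE_lebesgue_on_iff[OF sets_lebesgue_open[OF \<Omega>(1)]] .
  then have "AE x in lebesgue. x \<in> \<Omega> \<longrightarrow> f x = 0"
  proof (rule eventually_mono, intro impI)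
    fix x assume a: "x \<in> \<Omega> \<longrightarrow> H1_density f D f D x = 0" "x \<in> \<Omega>"
    have "f x \<bullet> f x + (\<Sum>i\<in>UNIV. D x (axis i 1) \<bullet> D x (axis i 1)) = 0" using a by (simp add: H1_density_def)
    moreover have "(\<Sum>i\<in>UNIV. D x (axis i 1) \<bullet> D x (axis i 1)) \<ge> 0" by (intro sum_nonneg) auto
    ultimately have "f x \<bullet> f x \<le> 0" by linarith
    then show "f x = 0" by (metis inner_gt_zero_iff not_le)
  qed
  then obtain N where "N \<in> null_sets lebesgue" "{x \<in> space lebesgue. \<not> (x \<in> \<Omega> \<longrightarrow> f x = 0)} \<subseteq> N"
    by (elim AE_E3) auto
  then show ?thesis by (intro that[of N]) (auto simp: negligible_iff_null_sets)
qed

end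

section \<open>Orthogonal projection onto a finitely spanned subspace\<close>

text \<open>Only semidefinite: functions are total, so an element of V may vanish at all relevant
  points X without being the zero function. The last axiom says that the form sees only values on
  X.\<close>

locale semi_inner =
  fixes V :: "('a \<Rightarrow> 'b::real_vector) set" and ip :: "('a \<Rightarrow> 'b) \<Rightarrow> ('a \<Rightarrow> 'b) \<Rightarrow> real" and X :: "'a set"
  assumes lin: "\<And>u v a b. u \<in> V \<Longrightarrow> v \<in> V \<Longrightarrow> (\<lambda>x. a *\<^sub>R u x + b *\<^sub>R v x) \<in> V"
    and sym: "\<And>u v. ip u v = ip v u"
    and ip_lin: "\<And>u v w a b. u \<in> V \<Longrightarrow> v \<in> V \<Longrightarrow> w \<in> V \<Longrightarrow> ip w (\<lambda>x. a *\<^sub>R u x + b *\<^sub>R v x) = a * ip w u + b * ip w v"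
    and nn: "\<And>u. u \<in> V \<Longrightarrow> ip u u \<ge> 0"
    and ip_zero: "\<And>u v. u \<in> V \<Longrightarrow> v \<in> V \<Longrightarrow> (\<And>x. x \<in> X \<Longrightarrow> u x = 0) \<Longrightarrow> ip u v = 0"
begin

lemma ip_lin': "u \<in> V \<Longrightarrow> v \<in> V \<Longrightarrow> w \<in> V \<Longrightarrow> ip (\<lambda>x. a *\<^sub>R u x + b *\<^sub>R v x) w = a * ip u w + b * ip v w"
  using ip_lin sym by metis

text \<open>When e is null, the square of v + t e is affine in t; being nonnegative for all t, it
  has slope 0.\<close>

lemma null_orthogonal:
  assumes "e \<in> V" "v \<in> V" "ip e e = 0"
  shows "ip v e = 0"
proof (rule ccontr)
  assume n: "ip v e \<noteq> 0"
  \<comment> \<open>Chosen to make that square equal to -1.\<close>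
  define t where "t = - (ip v v + 1) / (2 * ip v e)"
  have m: "(\<lambda>x. 1 *\<^sub>R v x + t *\<^sub>R e x) \<in> V" by (rule lin[OF assms(2,1)])
  have "ip (\<lambda>x. 1 *\<^sub>R v x + t *\<^sub>R e x) (\<lambda>x. 1 *\<^sub>R v x + t *\<^sub>R e x) = ip v v + 2 * t * ip v e"
    using ip_lin[OF assms(2,1) m, of 1 t] ip_lin'[OF assms(2,1) assms(2), of 1 t] ip_lin'[OF assms(2,1) assms(1), of 1 t]
      assms(3) sym[of e v] by (simp add: algebra_simps)
  also have "\<dots> = -1" using n by (simp add: t_def field_simps)
  finally show False using nn[OF m] by linarith
qed

text \<open>Gram-Schmidt by induction over the spanning set: N' collects the elements of N that do
  without s0, and it misses at most one direction of N. S may consist of functions outside V, which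
  allows discontinuous spanning functions.\<close>

lemma projection_exists:
  assumes "finite S" "N \<subseteq> V" "N \<noteq> {}" "\<And>u v a b. u \<in> N \<Longrightarrow> v \<in> N \<Longrightarrow> (\<lambda>x. a *\<^sub>R u x + b *\<^sub>R v x) \<in> N"
    "\<And>u. u \<in> N \<Longrightarrow> \<exists>c. \<forall>x\<in>X. u x = (\<Sum>s\<in>S. c s *\<^sub>R s x)" "v \<in> V"
  shows "\<exists>w\<in>N. \<forall>n\<in>N. ip v n = ip w n"
  using assms
proof (induction S arbitrary: N v rule: finite_induct)
  case empty
  obtain w where w: "w \<in> N" using empty(2) by auto
  have "ip u n = 0" if "u \<in> N" "n \<in> V" for u n
    using empty.prems(1,4) that by (intro ip_zero) auto
  then show ?case using w empty.prems(1,5) by (metis subsetD sym)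
next
  case (insert s0 S)
  define N' where "N' = {n \<in> N. \<exists>c. \<forall>x\<in>X. n x = (\<Sum>s\<in>S. c s *\<^sub>R s x)}"
  have N'N: "N' \<subseteq> N" and N'V: "N' \<subseteq> V" using insert.prems(1) by (auto simp: N'_def)
  have N'lin: "(\<lambda>x. a *\<^sub>R u x + b *\<^sub>R v x) \<in> N'" if uv: "u \<in> N'" "v \<in> N'" for u v a b
  proof -
    obtain c d where c: "\<forall>x\<in>X. u x = (\<Sum>s\<in>S. c s *\<^sub>R s x)" and d: "\<forall>x\<in>X. v x = (\<Sum>s\<in>S. d s *\<^sub>R s x)"
      using uv by (auto simp: N'_def)
    have "\<forall>x\<in>X. a *\<^sub>R u x + b *\<^sub>R v x = (\<Sum>s\<in>S. (a * c s + b * d s) *\<^sub>R s x)"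
      using c d by (auto simp: scaleR_sum_right sum.distrib scaleR_add_left)
    moreover have "(\<lambda>x. a *\<^sub>R u x + b *\<^sub>R v x) \<in> N" using uv N'N by (intro insert.prems(3)) auto
    ultimately show ?thesis unfolding N'_def by (auto intro!: exI[of _ "\<lambda>s. a * c s + b * d s"])
  qed
  obtain n0 where n0: "n0 \<in> N" using insert.prems(2) by auto
  have "(\<lambda>x. 0 *\<^sub>R n0 x + 0 *\<^sub>R n0 x) \<in> N'"
    unfolding N'_def using insert.prems(3)[OF n0 n0, of 0 0] by (auto intro!: exI[of _ "\<lambda>_. 0"])
  then have N'ne: "N' \<noteq> {}" by auto
  have IH: "\<exists>w\<in>N'. \<forall>n\<in>N'. ip v n = ip w n" if "v \<in> V" for v
    by (rule insert.IH[OF N'V N'ne N'lin _ that]) (auto simp: N'_def)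
  show ?case
  proof (cases "N' = N")
    case True
    then show ?thesis using IH[OF insert.prems(5)] by simp
  next
    case False
    then obtain e where e: "e \<in> N" "e \<notin> N'" using N'N by auto
    obtain c where c: "\<forall>x\<in>X. e x = (\<Sum>s\<in>insert s0 S. c s *\<^sub>R s x)" using insert.prems(4)[OF e(1)] by auto
    have c0: "c s0 \<noteq> 0"
    proof
      assume "c s0 = 0"
      then have "e \<in> N'" using c e(1) insert.hyps unfolding N'_def by auto
      then show False using e(2) by simp
    qed
    have eV: "e \<in> V" using e(1) insert.prems(1) by auto
    obtain p where p: "p \<in> N'" "\<forall>n\<in>N'. ip e n = ip p n" using IH[OF eV] by auto
    define e' where "e' = (\<lambda>x. 1 *\<^sub>R e x + (-1) *\<^sub>R p x)"
    have e'N: "e' \<in> N" unfolding e'_def using e(1) p(1) N'N by (intro insert.prems(3)) auto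
    then have e'V: "e' \<in> V" using insert.prems(1) by auto
    have orth: "ip e' n = 0" if "n \<in> N'" for n
      unfolding e'_def using ip_lin'[OF eV _ , of p n 1 "-1"] p that N'V by auto
    obtain w' where w': "w' \<in> N'" "\<forall>n\<in>N'. ip v n = ip w' n" using IH[OF insert.prems(5)] by auto
    have w'V: "w' \<in> V" using w' N'V by auto
    \<comment> \<open>If e' is null, the quotient is 0 by the convention for division, and
      \<open>null_orthogonal\<close> shows that this is the right coefficient.\<close>
    define \<alpha> where "\<alpha> = ip v e' / ip e' e'"
    have \<alpha>: "\<alpha> * ip e' e' = ip v e'"
      using null_orthogonal[OF e'V insert.prems(5)] by (cases "ip e' e' = 0") (auto simp: \<alpha>_def)
    define w where "w = (\<lambda>x. 1 *\<^sub>R w' x + \<alpha> *\<^sub>R e' x)"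
    have wN: "w \<in> N" unfolding w_def using w'(1) e'N N'N by (intro insert.prems(3)) auto
    have wip: "ip w n = ip w' n + \<alpha> * ip e' n" if "n \<in> V" for n
      unfolding w_def using ip_lin'[OF w'V e'V that, of 1 \<alpha>] by simp
    have "ip v n = ip w n" if n: "n \<in> N" for n
    proof -
      obtain d where d: "\<forall>x\<in>X. n x = (\<Sum>s\<in>insert s0 S. d s *\<^sub>R s x)" using insert.prems(4)[OF n] by auto
      \<comment> \<open>Cancels the s0 coefficient, so that n - t e belongs to N'. Writing e as e' +
        p then splits n into an element of N' and t e'.\<close>
      define t where "t = d s0 / c s0"
      define n1 where "n1 = (\<lambda>x. 1 *\<^sub>R n x + (-t) *\<^sub>R e x)"
      have "n1 x = (\<Sum>s\<in>S. (d s - t * c s) *\<^sub>R s x)" if "x \<in> X" for x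
      proof -
        have "n1 x = (\<Sum>s\<in>insert s0 S. d s *\<^sub>R s x) - t *\<^sub>R (\<Sum>s\<in>insert s0 S. c s *\<^sub>R s x)"
          using c d that by (simp add: n1_def)
        also have "\<dots> = (\<Sum>s\<in>insert s0 S. (d s - t * c s) *\<^sub>R s x)"
          by (simp add: scaleR_sum_right sum_subtractf scaleR_diff_left)
        also have "\<dots> = (\<Sum>s\<in>S. (d s - t * c s) *\<^sub>R s x)"
          using insert.hyps c0 by (simp add: t_def)
        finally show ?thesis .
      qed
      moreover have "n1 \<in> N" unfolding n1_def by (intro insert.prems(3) n e)
      ultimately have n1: "n1 \<in> N'" unfolding N'_def by (auto intro!: exI[of _ "\<lambda>s. d s - t * c s"])
      define n2 where "n2 = (\<lambda>x. 1 *\<^sub>R n1 x + t *\<^sub>R p x)"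
      have n2: "n2 \<in> N'" unfolding n2_def by (intro N'lin n1 p)
      have n2V: "n2 \<in> V" using n2 N'V by auto
      have eq: "n = (\<lambda>x. 1 *\<^sub>R n2 x + t *\<^sub>R e' x)"
        by (auto simp: n2_def n1_def e'_def fun_eq_iff algebra_simps)
      have "ip u n = ip u n2 + t * ip u e'" if "u \<in> V" for u
        using ip_lin[OF n2V e'V that, of 1 t] unfolding eq[symmetric] by simp
      then have "ip v n = ip v n2 + t * ip v e'" "ip w n = ip w n2 + t * ip w e'"
        using insert.prems(1,5) wN by auto
      moreover have "ip w n2 = ip v n2" using wip[OF n2V] orth[OF n2] w'(2) n2 by simp
      moreover have "ip w e' = ip v e'"
        using wip[OF e'V] orth[OF w'(1)] sym[of e' w'] \<alpha> by simp
      ultimately show ?thesis by simp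
    qed
    then show ?thesis using wN by blast
  qed
qed

end

section \<open>Mollification\<close>

lemma lborel_integral_reflect:
  fixes f :: "'a::euclidean_space \<Rightarrow> 'b::euclidean_space"
  assumes "f \<in> borel_measurable borel"
  shows "integral\<^sup>L lborel (\<lambda>t. f (a - t)) = integral\<^sup>L lborel f"
    and "integrable lborel (\<lambda>t. f (a - t)) \<longleftrightarrow> integrable lborel f"
proof -
  have m: "(\<lambda>t. a - t) \<in> measurable lborel borel" by measurable
  have d: "distr lborel borel (\<lambda>x. a - x) = (lborel :: 'a measure)"
    using lborel_affine[of "-1" a] by (simp add: density_1)
  show "integral\<^sup>L lborel (\<lambda>t. f (a - t)) = integral\<^sup>L lborel f"
    using integral_distr[OF m assms] unfolding d by simp
  show "integrable lborel (\<lambda>t. f (a - t)) \<longleftrightarrow> integrable lborel f"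
    using integrable_distr_eq[OF m assms] unfolding d by simp
qed

definition bump :: "real \<Rightarrow> real^'d::finite \<Rightarrow> real" where
  "bump \<epsilon> u = exp_cutoff 1 (\<epsilon>\<^sup>2 - u \<bullet> u)"

definition mollifier :: "real \<Rightarrow> real^'d::finite \<Rightarrow> real" where
  "mollifier \<epsilon> u = bump \<epsilon> u / integral\<^sup>L lborel (bump \<epsilon> :: real^'d \<Rightarrow> real)"

definition mollify :: "real \<Rightarrow> (real^'d::finite \<Rightarrow> real) \<Rightarrow> real^'d \<Rightarrow> real" where
  "mollify \<epsilon> F x = integral\<^sup>L lborel (\<lambda>y. F y * mollifier \<epsilon> (x - y))"

lemma bump_Cn: "Cn n (\<lambda>y. bump \<epsilon> (x - y))"
proof -
  have "Cn n (\<lambda>y. \<Sum>i\<in>UNIV. (x $ i - y $ i) * (x $ i - y $ i))"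
    by (intro Cn_sum finite Cn_mult Cn_diff Cn_const Cn_component)
  from Cn_exp_cutoff[OF Cn_diff[OF Cn_const this]] show ?thesis
    unfolding bump_def inner_vec_def by simp
qed

lemma mollifier_Cn: "Cn n (\<lambda>y. mollifier \<epsilon> (x - y))"
  using Cn_mult[OF Cn_const bump_Cn, of n "inverse (integral\<^sup>L lborel (bump \<epsilon>))" \<epsilon> x]
  unfolding mollifier_def by (simp add: field_simps)

lemma bump_nonneg: "bump \<epsilon> u \<ge> 0"
  by (simp add: bump_def exp_cutoff_1)

lemma bump_le_1: "bump \<epsilon> u \<le> 1"
  by (simp add: bump_def exp_cutoff_1)

lemma bump_pos_iff: "\<epsilon> > 0 \<Longrightarrow> bump \<epsilon> u > 0 \<longleftrightarrow> norm u < \<epsilon>"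
proof -
  assume "\<epsilon> > 0"
  have "bump \<epsilon> u > 0 \<longleftrightarrow> (norm u)\<^sup>2 < \<epsilon>\<^sup>2"
    by (auto simp: bump_def exp_cutoff_1 power2_norm_eq_inner)
  also have "\<dots> \<longleftrightarrow> norm u < \<epsilon>"
    using \<open>\<epsilon> > 0\<close> by (metis abs_norm_cancel abs_of_pos power2_less_eq_zero_iff power2_le_iff_abs_le power_strict_mono norm_ge_zero not_less order_less_imp_le zero_less_numeral)
  finally show ?thesis .
qed

lemma bump_outside: "\<epsilon> > 0 \<Longrightarrow> norm u \<ge> \<epsilon> \<Longrightarrow> bump \<epsilon> u = 0"
  using bump_pos_iff[of \<epsilon> u] bump_nonneg[of \<epsilon> u] by linarith

lemma bump_minus [simp]: "bump \<epsilon> (- u) = bump \<epsilon> u"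
  by (simp add: bump_def)

lemma mollifier_minus [simp]: "mollifier \<epsilon> (- u) = mollifier \<epsilon> u"
  by (simp add: mollifier_def)

lemma mollifier_commute: "mollifier \<epsilon> (x - y) = mollifier \<epsilon> (y - x)"
  using mollifier_minus[of \<epsilon> "x - y"] by simp

context
  fixes \<epsilon> :: real
  assumes \<epsilon>: "\<epsilon> > 0"
begin

lemma mollifier_test:
  assumes "cball x \<epsilon> \<subseteq> \<Omega>"
  shows "test_function \<Omega> (\<lambda>y. mollifier \<epsilon> (x - y))"
proof (rule test_functionI[OF mollifier_Cn _ assms])
  show "y \<in> cball x \<epsilon>" if "mollifier \<epsilon> (x - y) \<noteq> 0" for y
    using that bump_outside[OF \<epsilon>, of "x - y"] by (cases "norm (x - y) \<le> \<epsilon>") (auto simp: mollifier_def dist_norm)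
qed auto

lemma mollifier_test_UNIV: "test_function UNIV (mollifier \<epsilon>)"
  using mollifier_test[of 0 UNIV] by simp

lemma bump_continuous: "continuous_on UNIV (bump \<epsilon>)"
proof -
  have "test_function UNIV (\<lambda>y. bump \<epsilon> (0 - y))"
  proof (rule test_functionI[OF bump_Cn, of "cball 0 \<epsilon>"])
    show "y \<in> cball 0 \<epsilon>" if "bump \<epsilon> (0 - y) \<noteq> 0" for y
      using that bump_outside[OF \<epsilon>, of "y"] by (cases "norm y \<le> \<epsilon>") auto
  qed auto
  from test_function_continuous_derivs[OF this, of "[]"] show ?thesis by simp
qed

lemma bump_measurable: "bump \<epsilon> \<in> borel_measurable borel"
  by (rule borel_measurable_continuous_onI[OF bump_continuous])

lemma bump_integrable: "integrable lborel (bump \<epsilon>)"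
proof (rule Bochner_Integration.integrable_bound)
  show "integrable lborel (indicat_real (cball 0 \<epsilon>))"
    by (auto intro!: integrable_real_indicator emeasure_lborel_cball_finite)
  show "AE x in lborel. norm (bump \<epsilon> x) \<le> norm (indicat_real (cball 0 \<epsilon>) x)"
  proof (rule AE_I2)
    fix x
    show "norm (bump \<epsilon> x) \<le> norm (indicat_real (cball 0 \<epsilon>) x)"
      using bump_outside[OF \<epsilon>, of x] bump_nonneg[of \<epsilon> x] bump_le_1[of \<epsilon> x] by (cases "norm x \<le> \<epsilon>") auto
  qed
qed (use bump_measurable in simp)

text \<open>The bump is positive on a ball, which is not a null set; this legitimises the
  normalisation in \<open>mollifier\<close>.\<close>

lemma bump_integral_pos: "integral\<^sup>L lborel (bump \<epsilon> :: real^'d::finite \<Rightarrow> real) > 0"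
proof -
  have "integral\<^sup>L lborel (bump \<epsilon> :: real^'d \<Rightarrow> real) \<noteq> 0"
  proof
    assume "integral\<^sup>L lborel (bump \<epsilon> :: real^'d \<Rightarrow> real) = 0"
    then have "AE x in lborel. bump \<epsilon> (x::real^'d) = 0"
      using integral_nonneg_eq_0_iff_AE[OF bump_integrable] bump_nonneg by auto
    then have "AE x in lborel. (x::real^'d) \<notin> ball 0 \<epsilon>"
      by (rule eventually_mono) (use bump_pos_iff[OF \<epsilon>] in force)
    then have "emeasure lborel (ball (0::real^'d) \<epsilon>) = 0"
      by (subst (asm) AE_iff_measurable[where N="ball 0 \<epsilon>"]) auto
    moreover have "emeasure lborel (ball (0::real^'d) \<epsilon>) > 0"
      using \<epsilon> open_not_negligible[of "ball (0::real^'d) \<epsilon>"]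
      by (auto simp: negligible_iff_emeasure0 zero_less_iff_neq_zero)
    ultimately show False by simp
  qed
  moreover have "integral\<^sup>L lborel (bump \<epsilon> :: real^'d \<Rightarrow> real) \<ge> 0"
    by (intro integral_nonneg_AE AE_I2 bump_nonneg)
  ultimately show ?thesis by linarith
qed

lemma mollifier_nonneg: "mollifier \<epsilon> u \<ge> 0"
  unfolding mollifier_def by (rule divide_nonneg_nonneg[OF bump_nonneg less_imp_le[OF bump_integral_pos]])

lemma mollifier_outside: "norm u \<ge> \<epsilon> \<Longrightarrow> mollifier \<epsilon> u = 0"
  by (simp add: mollifier_def bump_outside[OF \<epsilon>])

lemma mollifier_measurable: "mollifier \<epsilon> \<in> borel_measurable borel"
  unfolding mollifier_def[abs_def] using bump_measurable by measurable

lemma mollifier_integrable: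
  "integrable lborel (mollifier \<epsilon> :: real^'d::finite \<Rightarrow> real)"
  "integral\<^sup>L lborel (mollifier \<epsilon> :: real^'d \<Rightarrow> real) = 1"
  unfolding mollifier_def[abs_def]
  using bump_integrable[where 'a='d] bump_integral_pos[where 'd='d] by auto

lemma mollifier_integrable_shift:
  "integrable lborel (\<lambda>y. mollifier \<epsilon> (x - y))" "integral\<^sup>L lborel (\<lambda>y. mollifier \<epsilon> (x - y)) = 1"
  using lborel_integral_reflect[OF mollifier_measurable, of x] mollifier_integrable by auto

lemma mollifier_bounded: obtains C where "C \<ge> 0" "\<And>u::real^'d::finite. mollifier \<epsilon> u \<le> C"
proof -
  obtain C where "C \<ge> 0" "\<And>u::real^'d. \<bar>partial_derivs [] (mollifier \<epsilon>) u\<bar> \<le> C"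
    by (rule test_function_bounded[OF mollifier_test_UNIV], rule that)
  then show ?thesis by (intro that[of C]) (auto dest: abs_le_D1)
qed

lemma mollify_integrable:
  assumes "integrable lborel F"
  shows "integrable lborel (\<lambda>y. F y * mollifier \<epsilon> (x - y))"
proof -
  obtain C where C: "C \<ge> 0" "\<And>u::real^'a. mollifier \<epsilon> u \<le> C" by (rule mollifier_bounded, rule that)
  show ?thesis
  proof (rule Bochner_Integration.integrable_bound)
    show "integrable lborel (\<lambda>y. C * F y)" using assms by simp
    show "(\<lambda>y. F y * mollifier \<epsilon> (x - y)) \<in> borel_measurable lborel"
      using assms mollifier_measurable by measurable
    show "AE y in lborel. norm (F y * mollifier \<epsilon> (x - y)) \<le> norm (C * F y)"
    proof (rule AE_I2)
      fix y
      have "\<bar>F y\<bar> * mollifier \<epsilon> (x - y) \<le> \<bar>F y\<bar> * C" by (intro mult_left_mono C) simp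
      then show "norm (F y * mollifier \<epsilon> (x - y)) \<le> norm (C * F y)"
        using C(1) mollifier_nonneg[of "x - y"] by (simp add: abs_mult mult.commute)
    qed
  qed
qed

text \<open>The kernel is nonnegative with mass 1 and supported in a ball of radius \<epsilon>, so
  mollification is an average over that ball and c may be subtracted under the integral.\<close>

lemma mollify_diff_bound:
  assumes "integrable lborel (\<lambda>y. F y * mollifier \<epsilon> (x - y))" "\<And>y. norm (x - y) < \<epsilon> \<Longrightarrow> \<bar>F y - c\<bar> \<le> B"
  shows "\<bar>mollify \<epsilon> F x - c\<bar> \<le> B"
proof -
  have i: "integrable lborel (\<lambda>y. (F y - c) * mollifier \<epsilon> (x - y))"
    using assms(1) mollifier_integrable_shift(1)[of x] by (simp add: left_diff_distrib)
  have "mollify \<epsilon> F x - c = integral\<^sup>L lborel (\<lambda>y. (F y - c) * mollifier \<epsilon> (x - y))"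
    unfolding mollify_def left_diff_distrib using assms(1) mollifier_integrable_shift[of x] by simp
  also have "\<bar>\<dots>\<bar> \<le> integral\<^sup>L lborel (\<lambda>y. B * mollifier \<epsilon> (x - y))"
  proof (rule integral_abs_bound_integral[OF i])
    show "integrable lborel (\<lambda>y. B * mollifier \<epsilon> (x - y))" using mollifier_integrable_shift(1)[of x] by simp
    fix y
    show "\<bar>(F y - c) * mollifier \<epsilon> (x - y)\<bar> \<le> B * mollifier \<epsilon> (x - y)"
      using assms(2)[of y] mollifier_nonneg[of "x - y"] mollifier_outside[of "x - y"]
      by (cases "norm (x - y) < \<epsilon>") (auto simp: abs_mult intro!: mult_right_mono)
  qed
  also have "\<dots> = B" using mollifier_integrable_shift[of x] by simp
  finally show ?thesis .
qed

lemma mollify_bound: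
  assumes "integrable lborel F" "\<And>y. \<bar>F y\<bar> \<le> B"
  shows "\<bar>mollify \<epsilon> F x\<bar> \<le> B"
  using mollify_diff_bound[OF mollify_integrable[OF assms(1)], of x 0 B] assms(2) by simp

end

text \<open>Mean value inequality for f minus its linearisation at x. The usual factor 1/2 is lost
  because only the supremum of the gradient difference is used.\<close>

lemma taylor_lipschitz_gradient:
  fixes f :: "real^'d::finite \<Rightarrow> real"
  assumes "convex S" "\<And>u. u \<in> S \<Longrightarrow> (f has_derivative (\<lambda>h. \<Sum>i\<in>UNIV. h $ i * g i u)) (at u within S)"
    "x \<in> S" "y \<in> S" "\<And>u i. u \<in> S \<Longrightarrow> \<bar>g i u - g i x\<bar> \<le> L i * norm (u - x)" "\<And>i. L i \<ge> 0"
  shows "\<bar>f y - f x - (\<Sum>i\<in>UNIV. (y - x) $ i * g i x)\<bar> \<le> (\<Sum>i\<in>UNIV. L i) * (norm (y - x))\<^sup>2"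
proof -
  \<comment> \<open>On this smaller convex set no point u is farther from x than y is, so the
    gradient differs from that at x by at most \<open>L i * norm (y - x)\<close> throughout.\<close>
  define T where "T = S \<inter> cball x (norm (y - x))"
  have T: "convex T" "x \<in> T" "y \<in> T" using assms by (auto simp: T_def convex_Int dist_norm norm_minus_commute)
  define G where "G = (\<lambda>u. f u - (\<Sum>i\<in>UNIV. (u - x) $ i * g i x))"
  have dG: "(G has_derivative (\<lambda>h. \<Sum>i\<in>UNIV. h $ i * (g i u - g i x))) (at u within T)" if "u \<in> T" for u
  proof -
    have 1: "(f has_derivative (\<lambda>h. \<Sum>i\<in>UNIV. h $ i * g i u)) (at u within T)"
      using that by (intro has_derivative_subset[OF assms(2)]) (auto simp: T_def)
    have 2: "((\<lambda>u. \<Sum>i\<in>UNIV. (u - x) $ i * g i x) has_derivative (\<lambda>h. \<Sum>i\<in>UNIV. h $ i * g i x)) (at u within T)"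
      by (auto intro!: derivative_eq_intros bounded_linear_imp_has_derivative[OF bounded_linear_vec_nth])
    show ?thesis
      unfolding G_def using has_derivative_diff[OF 1 2] by (simp add: right_diff_distrib sum_subtractf)
  qed
  have bd: "\<bar>g i u - g i x\<bar> \<le> L i * norm (y - x)" if "u \<in> T" for u i
  proof -
    have "\<bar>g i u - g i x\<bar> \<le> L i * norm (u - x)" using that by (intro assms(5)) (simp add: T_def)
    also have "\<dots> \<le> L i * norm (y - x)"
      using that assms(6)[of i] by (intro mult_left_mono) (auto simp: T_def dist_norm norm_minus_commute)
    finally show ?thesis .
  qed
  have "\<bar>G y - G x\<bar> \<le> (\<Sum>i\<in>UNIV. L i * norm (y - x)) * norm (y - x)"
    by (rule gradient_bound_imp_lipschitz[OF T(1) dG bd T(3,2)])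
  then show ?thesis by (simp add: G_def sum_distrib_right power2_eq_square mult.assoc)
qed

lemma has_derivative_of_quadratic_remainder:
  fixes f :: "'a::real_normed_vector \<Rightarrow> 'b::real_normed_vector"
  assumes "bounded_linear D" "r > 0" "\<And>k. norm k < r \<Longrightarrow> norm (f (x + k) - f x - D k) \<le> C * (norm k)\<^sup>2"
  shows "(f has_derivative D) (at x)"
  unfolding has_derivative_at
proof (intro conjI assms(1))
  have ev: "\<forall>\<^sub>F k in at 0. norm (norm (f (x + k) - f x - D k) / norm k) \<le> norm k * C"
  proof -
    have "\<forall>\<^sub>F k in at (0::'a). norm k < r \<and> k \<noteq> 0"
      using assms(2) by (auto simp: eventually_at intro!: exI[of _ r])
    then show ?thesis
    proof eventually_elim
      case (elim k)
      then have "norm (f (x + k) - f x - D k) / norm k \<le> C * (norm k)\<^sup>2 / norm k"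
        by (intro divide_right_mono assms(3)) auto
      then show ?case using elim by (simp add: power2_eq_square mult.commute)
    qed
  qed
  have "((\<lambda>k::'a. norm k * C) \<longlongrightarrow> norm (0::'a) * C) (at 0)" by (intro tendsto_intros)
  then have "((\<lambda>k::'a. norm k * C) \<longlongrightarrow> 0) (at 0)" by simp
  from Lim_null_comparison[OF ev this] show "((\<lambda>k. norm (f (x + k) - f x - D k) / norm k) \<longlongrightarrow> 0) (at 0)" .
qed


text \<open>Fubini together with the evenness of the kernel: mollification is self-adjoint.\<close>

lemma mollify_swap:
  assumes \<epsilon>: "\<epsilon> > 0" and F: "integrable lborel F" and \<phi>: "integrable lborel (\<phi> :: real^'d::finite \<Rightarrow> real)"
  shows "integral\<^sup>L lborel (\<lambda>x. mollify \<epsilon> F x * \<phi> x) = integral\<^sup>L lborel (\<lambda>y. F y * mollify \<epsilon> \<phi> y)"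
    and "integrable lborel (\<lambda>x. mollify \<epsilon> F x * \<phi> x)"
proof -
  obtain C where C: "C \<ge> 0" "\<And>u::real^'d. mollifier \<epsilon> u \<le> C" by (rule mollifier_bounded[OF \<epsilon>], rule that)
  define h where "h = (\<lambda>(x, y). (F y * mollifier \<epsilon> (x - y)) * \<phi> x)"
  have mm: "mollifier \<epsilon> \<in> borel_measurable borel" by (rule mollifier_measurable[OF \<epsilon>])
  have Fm: "F \<in> borel_measurable borel" "\<phi> \<in> borel_measurable borel" using F \<phi> by auto
  have i0: "integrable (lborel \<Otimes>\<^sub>M lborel) (\<lambda>(x, y). \<phi> x * F y)"
  proof (rule lborel_pair.Fubini_integrable)
    show "(\<lambda>(x, y). \<phi> x * F y) \<in> borel_measurable (lborel \<Otimes>\<^sub>M lborel)"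
      using Fm by measurable
    show "integrable lborel (\<lambda>x. \<integral>y. norm (case (x, y) of (x, y) \<Rightarrow> \<phi> x * F y) \<partial>lborel)"
      using \<phi> by (simp add: abs_mult)
    show "AE x in lborel. integrable lborel (\<lambda>y. case (x, y) of (x, y) \<Rightarrow> \<phi> x * F y)"
      using F by simp
  qed
  have i1: "integrable (lborel \<Otimes>\<^sub>M lborel) h"
  proof (rule Bochner_Integration.integrable_bound)
    show "integrable (lborel \<Otimes>\<^sub>M lborel) (\<lambda>z. C * (case z of (x, y) \<Rightarrow> \<phi> x * F y))" using i0 by simp
    show "h \<in> borel_measurable (lborel \<Otimes>\<^sub>M lborel)"
      unfolding h_def using Fm mm by measurable
    show "AE z in lborel \<Otimes>\<^sub>M lborel. norm (h z) \<le> norm (C * (case z of (x, y) \<Rightarrow> \<phi> x * F y))"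
    proof (rule AE_I2)
      fix z :: "(real^'d) \<times> (real^'d)"
      obtain x y where z: "z = (x, y)" by (cases z)
      have "mollifier \<epsilon> (x - y) * \<bar>\<phi> x * F y\<bar> \<le> C * \<bar>\<phi> x * F y\<bar>"
        using C(2) by (intro mult_right_mono) auto
      then show "norm (h z) \<le> norm (C * (case z of (x, y) \<Rightarrow> \<phi> x * F y))"
        using mollifier_nonneg[OF \<epsilon>, of "x - y"] C(1) by (simp add: z h_def abs_mult mult_ac)
    qed
  qed
  have e1: "(\<lambda>x. mollify \<epsilon> F x * \<phi> x) = (\<lambda>x. \<integral>y. h (x, y) \<partial>lborel)"
    by (rule ext) (simp add: mollify_def h_def)
  have e2: "(\<lambda>y. F y * mollify \<epsilon> \<phi> y) = (\<lambda>y. \<integral>x. h (x, y) \<partial>lborel)"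
  proof (rule ext)
    fix y
    have "(\<integral>x. h (x, y) \<partial>lborel) = (\<integral>x. F y * (\<phi> x * mollifier \<epsilon> (y - x)) \<partial>lborel)"
      by (rule Bochner_Integration.integral_cong) (auto simp: h_def mollifier_commute[of \<epsilon> y])
    then show "F y * mollify \<epsilon> \<phi> y = (\<integral>x. h (x, y) \<partial>lborel)"
      by (simp add: mollify_def)
  qed
  show "integrable lborel (\<lambda>x. mollify \<epsilon> F x * \<phi> x)" unfolding e1 by (rule lborel_pair.integrable_fst'[OF i1])
  show "integral\<^sup>L lborel (\<lambda>x. mollify \<epsilon> F x * \<phi> x) = integral\<^sup>L lborel (\<lambda>y. F y * mollify \<epsilon> \<phi> y)"
    unfolding e1 e2 using lborel_pair.Fubini_integral[of "\<lambda>x y. h (x, y)"] i1 by simp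
qed

text \<open>By self-adjointness the claim reduces to a symmetry of the composed kernel, which the
  reflection t -> x + y - t exhibits.\<close>

lemma mollify_mollify:
  assumes \<epsilon>: "\<epsilon> > 0" "\<delta> > 0" and F: "integrable lborel (F :: real^'d::finite \<Rightarrow> real)"
  shows "mollify \<delta> (mollify \<epsilon> F) x = mollify \<epsilon> (mollify \<delta> F) x"
proof -
  have k: "mollify \<epsilon> (\<lambda>t. mollifier \<delta> (x - t)) y = mollify \<delta> (\<lambda>t. mollifier \<epsilon> (x - t)) y" for y :: "real^'d"
  proof -
    have m: "(\<lambda>t. mollifier \<delta> (x - t) * mollifier \<epsilon> (y - t)) \<in> borel_measurable borel"
      using mollifier_measurable[OF \<epsilon>(1)] mollifier_measurable[OF \<epsilon>(2)] by measurable
    have "mollify \<epsilon> (\<lambda>t. mollifier \<delta> (x - t)) y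
        = integral\<^sup>L lborel (\<lambda>t. mollifier \<delta> (x - (x + y - t)) * mollifier \<epsilon> (y - (x + y - t)))"
      unfolding mollify_def by (rule lborel_integral_reflect(1)[OF m, symmetric])
    also have "\<dots> = mollify \<delta> (\<lambda>t. mollifier \<epsilon> (x - t)) y"
      unfolding mollify_def
      by (rule Bochner_Integration.integral_cong) (auto simp: mollifier_commute[of _ "y"] mollifier_commute[of _ "x"])
    finally show ?thesis .
  qed
  have "mollify \<delta> (mollify \<epsilon> F) x = integral\<^sup>L lborel (\<lambda>y. F y * mollify \<epsilon> (\<lambda>t. mollifier \<delta> (x - t)) y)"
    unfolding mollify_def[of \<delta> "mollify \<epsilon> F"]
    by (rule mollify_swap(1)[OF \<epsilon>(1) F mollifier_integrable_shift(1)[OF \<epsilon>(2)]])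
  also have "\<dots> = integral\<^sup>L lborel (\<lambda>y. F y * mollify \<delta> (\<lambda>t. mollifier \<epsilon> (x - t)) y)" unfolding k ..
  also have "\<dots> = mollify \<epsilon> (mollify \<delta> F) x"
    unfolding mollify_def[of \<epsilon> "mollify \<delta> F"]
    by (rule mollify_swap(1)[OF \<epsilon>(2) F mollifier_integrable_shift(1)[OF \<epsilon>(1)], symmetric])
  finally show ?thesis .
qed

section \<open>Mollification of weakly differentiable functions\<close>

lemma partial_derivs_append: "partial_derivs (ds @ es) f = partial_derivs ds (partial_derivs es f)"
  by (simp add: partial_derivs_def)

lemma test_function_partial:
  assumes "test_function \<Omega> \<phi>"
  shows "test_function \<Omega> (partial_derivs es \<phi>)"
proof -
  have "partial_derivs es \<phi> y = 0" if "y \<in> - closure {x. \<phi> x \<noteq> 0}" for y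
  proof (rule partial_derivs_local_zero[OF _ _ that])
    show "\<phi> u = 0" if "u \<in> - closure {x. \<phi> x \<noteq> 0}" for u
      using that closure_subset[of "{x. \<phi> x \<noteq> 0}"] by auto
  qed auto
  then have sub: "closure {x. partial_derivs es \<phi> x \<noteq> 0} \<subseteq> closure {x. \<phi> x \<noteq> 0}"
    by (intro closure_minimal) auto
  moreover have "compact (closure {x. partial_derivs es \<phi> x \<noteq> 0})"
    using compact_Int_closed[OF _ closed_closure] assms sub unfolding test_function_def by (metis Int_absorb1)
  moreover have "partial_derivs ds (partial_derivs es \<phi>) differentiable at x" for ds x
    using assms unfolding test_function_def partial_derivs_append[symmetric] by blast
  ultimately show ?thesis using assms unfolding test_function_def by blast
qed

text \<open>Functions on the whole space, bounded everywhere by a common B, with G a weak gradient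
  of F on \<Omega>. Bounds everywhere and integrability over \<open>lborel\<close> are what
  convolution and Fubini work with; \<Omega> enters only through the test functions.\<close>

definition weak_pair :: "(real^'d::finite) set \<Rightarrow> (real^'d \<Rightarrow> real) \<Rightarrow> ('d \<Rightarrow> real^'d \<Rightarrow> real) \<Rightarrow> real \<Rightarrow> bool" where
  "weak_pair \<Omega> F G B \<longleftrightarrow> integrable lborel F \<and> (\<forall>i. integrable lborel (G i)) \<and>
     (\<forall>x. \<bar>F x\<bar> \<le> B) \<and> (\<forall>i x. \<bar>G i x\<bar> \<le> B) \<and>
     (\<forall>\<phi> i. test_function \<Omega> \<phi> \<longrightarrow>
        integral\<^sup>L lborel (\<lambda>y. F y * partial_derivs [i] \<phi> y) = - integral\<^sup>L lborel (\<lambda>y. G i y * \<phi> y))"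

lemma partial_deriv_mollifier_reflect:
  fixes x y :: "real^'d::finite"
  assumes "\<epsilon> > 0"
  shows "partial_derivs [i] (\<lambda>y. mollifier \<epsilon> (x - y)) y = - partial_derivs [i] (mollifier \<epsilon>) (x - y)"
proof -
  note d = test_function_has_derivative[OF mollifier_test_UNIV[OF assms], of "x - y"]
  have "((\<lambda>y. mollifier \<epsilon> (x - y)) has_derivative (\<lambda>h. \<Sum>j\<in>UNIV. (- h) $ j * partial_derivs [j] (mollifier \<epsilon>) (x - y))) (at y)"
    by (rule has_derivative_compose[where f="\<lambda>y. x - y", OF _ d]) (auto intro!: derivative_eq_intros)
  from partial_deriv_eq[OF this, of i] show ?thesis
    by (simp add: partial_derivs_def sum_negf sum_axis)
qed

text \<open>Differentiation falls on the kernel and is moved to G by the weak relation; the sign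
  from reflecting the kernel cancels the sign from integrating by parts. The ball condition makes
  the shifted kernel a test function of \<Omega>.\<close>

lemma mollify_has_derivative:
  assumes \<epsilon>: "\<epsilon> > 0" and w: "weak_pair \<Omega> F G B" and x: "cball x \<epsilon> \<subseteq> \<Omega>"
  shows "(mollify \<epsilon> F has_derivative (\<lambda>k. \<Sum>i\<in>UNIV. k $ i * mollify \<epsilon> (G i) x)) (at x)"
proof -
  have F: "integrable lborel F" using w by (simp add: weak_pair_def)
  have "\<exists>L\<ge>0. \<forall>u v. \<bar>partial_derivs [i] (mollifier \<epsilon>) u - partial_derivs [i] (mollifier \<epsilon>) v\<bar> \<le> L * norm (u - v)" for i :: 'a
    by (rule test_function_lipschitz[OF test_function_partial[OF mollifier_test_UNIV[OF \<epsilon>]]]) blast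
  then obtain L where L: "\<And>i::'a. L i \<ge> 0"
    "\<And>i u v. \<bar>partial_derivs [i] (mollifier \<epsilon>) u - partial_derivs [i] (mollifier \<epsilon>) v\<bar> \<le> L i * norm (u - v)"
    by metis
  define d where "d i y = partial_derivs [i] (mollifier \<epsilon>) (x - y)" for i y
  have di: "integrable lborel (\<lambda>y. F y * d i y)" and de: "integral\<^sup>L lborel (\<lambda>y. F y * d i y) = mollify \<epsilon> (G i) x" for i
  proof -
    have t: "test_function \<Omega> (\<lambda>y. mollifier \<epsilon> (x - y))" by (rule mollifier_test[OF \<epsilon> x])
    have dm: "d i = (\<lambda>y. - partial_derivs [i] (\<lambda>y. mollifier \<epsilon> (x - y)) y)"
      unfolding d_def by (rule ext) (simp add: partial_deriv_mollifier_reflect[OF \<epsilon>])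
    obtain C where C: "C \<ge> 0" "\<And>y. \<bar>partial_derivs [i] (\<lambda>y. mollifier \<epsilon> (x - y)) y\<bar> \<le> C"
      by (rule test_function_bounded[OF t], rule that)
    have c: "continuous_on UNIV (partial_derivs [i] (\<lambda>y. mollifier \<epsilon> (x - y)))"
      by (rule test_function_continuous_derivs[OF t])
    show "integrable lborel (\<lambda>y. F y * d i y)"
    proof (rule Bochner_Integration.integrable_bound)
      show "integrable lborel (\<lambda>y. C * F y)" using F by simp
      show "(\<lambda>y. F y * d i y) \<in> borel_measurable lborel"
        unfolding dm using borel_measurable_continuous_onI[OF c] F by measurable
      show "AE y in lborel. norm (F y * d i y) \<le> norm (C * F y)"
      proof (rule AE_I2)
        fix y
        have "\<bar>F y\<bar> * \<bar>d i y\<bar> \<le> \<bar>F y\<bar> * C" using C(2)[of y] by (intro mult_left_mono) (auto simp: dm)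
        then show "norm (F y * d i y) \<le> norm (C * F y)" using C(1) by (simp add: abs_mult mult.commute)
      qed
    qed
    have "integral\<^sup>L lborel (\<lambda>y. F y * partial_derivs [i] (\<lambda>y. mollifier \<epsilon> (x - y)) y)
        = - integral\<^sup>L lborel (\<lambda>y. G i y * mollifier \<epsilon> (x - y))"
      using w t unfolding weak_pair_def by blast
    then show "integral\<^sup>L lborel (\<lambda>y. F y * d i y) = mollify \<epsilon> (G i) x"
      by (simp add: dm mollify_def)
  qed
  show ?thesis
  proof (rule has_derivative_of_quadratic_remainder[where r=1 and C="(\<Sum>i\<in>UNIV. L i) * integral\<^sup>L lborel (\<lambda>y. \<bar>F y\<bar>)"])
    show "bounded_linear (\<lambda>k. \<Sum>i\<in>UNIV. k $ i * mollify \<epsilon> (G i) x)"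
      by (intro bounded_linear_sum bounded_linear_compose[OF bounded_linear_mult_left bounded_linear_vec_nth])
    fix k :: "real^'a"
    \<comment> \<open>Taylor remainder of the kernel. It is quadratic in k uniformly in y, which
      allows differentiation under the integral without a limit theorem.\<close>
    define R where "R y = mollifier \<epsilon> (x + k - y) - mollifier \<epsilon> (x - y) - (\<Sum>i\<in>UNIV. k $ i * d i y)" for y
    have Rb: "\<bar>R y\<bar> \<le> (\<Sum>i\<in>UNIV. L i) * (norm k)\<^sup>2" for y
      using taylor_lipschitz_gradient[OF convex_UNIV test_function_has_derivative[OF mollifier_test_UNIV[OF \<epsilon>]]
          UNIV_I UNIV_I L(2) L(1), of "x + k - y" "x - y"]
      by (simp add: R_def d_def)
    have Fi: "integrable lborel (\<lambda>y. F y * mollifier \<epsilon> (x + k - y))" "integrable lborel (\<lambda>y. F y * mollifier \<epsilon> (x - y))"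
      by (intro mollify_integrable[OF \<epsilon> F])+
    have Re: "F y * R y = F y * mollifier \<epsilon> (x + k - y) - F y * mollifier \<epsilon> (x - y) - (\<Sum>i\<in>UNIV. k $ i * (F y * d i y))" for y
      by (simp add: R_def right_diff_distrib sum_distrib_left mult_ac)
    have Ri: "integrable lborel (\<lambda>y. F y * R y)"
      unfolding Re using Fi di by (intro Bochner_Integration.integrable_diff Bochner_Integration.integrable_sum) auto
    have "mollify \<epsilon> F (x + k) - mollify \<epsilon> F x - (\<Sum>i\<in>UNIV. k $ i * mollify \<epsilon> (G i) x)
        = integral\<^sup>L lborel (\<lambda>y. F y * R y)"
      unfolding Re using Fi di by (simp add: mollify_def[of \<epsilon> F] de[symmetric] Bochner_Integration.integral_sum)
    also have "\<bar>\<dots>\<bar> \<le> integral\<^sup>L lborel (\<lambda>y. ((\<Sum>i\<in>UNIV. L i) * (norm k)\<^sup>2) * \<bar>F y\<bar>)"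
    proof (rule integral_abs_bound_integral[OF Ri])
      show "integrable lborel (\<lambda>y. ((\<Sum>i\<in>UNIV. L i) * (norm k)\<^sup>2) * \<bar>F y\<bar>)" using F by simp
      show "\<bar>F y * R y\<bar> \<le> ((\<Sum>i\<in>UNIV. L i) * (norm k)\<^sup>2) * \<bar>F y\<bar>" for y
        unfolding abs_mult mult.commute[of "\<bar>F y\<bar>"] by (intro mult_right_mono Rb) simp
    qed
    finally show "norm (mollify \<epsilon> F (x + k) - mollify \<epsilon> F x - (\<Sum>i\<in>UNIV. k $ i * mollify \<epsilon> (G i) x))
        \<le> (\<Sum>i\<in>UNIV. L i) * integral\<^sup>L lborel (\<lambda>y. \<bar>F y\<bar>) * (norm k)\<^sup>2"
      by (simp add: mult_ac)
  qed simp
qed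

lemma weak_pair_D:
  assumes "weak_pair \<Omega> F G B"
  shows "integrable lborel F" "integrable lborel (G i)" "\<bar>F x\<bar> \<le> B" "\<bar>G i x\<bar> \<le> B" "0 \<le> B"
proof -
  show "\<bar>F x\<bar> \<le> B" for x using assms by (simp add: weak_pair_def)
  from this[of undefined] show "0 \<le> B" by linarith
qed (use assms in \<open>simp_all add: weak_pair_def\<close>)

text \<open>The mollified gradient inherits the bound B, so the constant does not depend on
  \<epsilon>; the passages to the limit rest on this uniformity.\<close>

lemma mollify_lipschitz:
  fixes F :: "real^'d::finite \<Rightarrow> real"
  assumes \<epsilon>: "\<epsilon> > 0" and w: "weak_pair \<Omega> F G B" and S: "convex S" "\<And>x. x \<in> S \<Longrightarrow> cball x \<epsilon> \<subseteq> \<Omega>" and xy: "x \<in> S" "y \<in> S"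
  shows "\<bar>mollify \<epsilon> F x - mollify \<epsilon> F y\<bar> \<le> (real CARD('d) * B) * norm (x - y)"
proof -
  have "\<bar>mollify \<epsilon> F x - mollify \<epsilon> F y\<bar> \<le> (\<Sum>i\<in>(UNIV::'d set). B) * norm (x - y)"
  proof (rule gradient_bound_imp_lipschitz[OF S(1) _ _ xy, where g="\<lambda>i u. mollify \<epsilon> (G i) u"])
    fix u assume "u \<in> S"
    show "(mollify \<epsilon> F has_derivative (\<lambda>h. \<Sum>i\<in>UNIV. h $ i * mollify \<epsilon> (G i) u)) (at u within S)"
      by (rule has_derivative_at_withinI[OF mollify_has_derivative[OF \<epsilon> w S(2)[OF \<open>u \<in> S\<close>]]])
    show "\<bar>mollify \<epsilon> (G i) u\<bar> \<le> B" for i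
      by (rule mollify_bound[OF \<epsilon> weak_pair_D(2)[OF w] weak_pair_D(4)[OF w]])
  qed
  then show ?thesis by simp
qed

text \<open>Both mollifications are compared with the twice mollified function: mollifying a
  Lipschitz function with radius b moves it by at most a constant times b, and the order of two
  mollifications is irrelevant.\<close>

lemma mollify_cauchy:
  fixes F :: "real^'d::finite \<Rightarrow> real"
  assumes \<epsilon>: "\<epsilon> > 0" "\<delta> > 0" and w: "weak_pair \<Omega> F G B" and x: "cball x (\<epsilon> + \<delta>) \<subseteq> \<Omega>"
  shows "\<bar>mollify \<epsilon> F x - mollify \<delta> F x\<bar> \<le> (real CARD('d) * B) * (\<epsilon> + \<delta>)"
proof -
  have a: "\<bar>mollify b (mollify a F) x - mollify a F x\<bar> \<le> (real CARD('d) * B) * b" if ab: "a > 0" "b > 0" "cball x (a + b) \<subseteq> \<Omega>" for a b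
  proof (rule mollify_diff_bound[OF ab(2)])
    show "integrable lborel (\<lambda>y. mollify a F y * mollifier b (x - y))"
      by (rule mollify_swap(2)[OF ab(1) weak_pair_D(1)[OF w] mollifier_integrable_shift(1)[OF ab(2)]])
    fix y assume y: "norm (x - y) < b"
    have "cball u a \<subseteq> \<Omega>" if "u \<in> ball x b" for u
    proof
      fix v assume "v \<in> cball u a"
      then have "dist x v \<le> a + b" using that dist_triangle[of x v u] by auto
      then show "v \<in> \<Omega>" using ab(3) by auto
    qed
    then have "\<bar>mollify a F y - mollify a F x\<bar> \<le> (real CARD('d) * B) * norm (y - x)"
      using ab y by (intro mollify_lipschitz[OF ab(1) w convex_ball[of x b]]) (auto simp: dist_norm)
    also have "\<dots> \<le> (real CARD('d) * B) * b"
      using y weak_pair_D(5)[OF w] by (intro mult_left_mono) (auto simp: norm_minus_commute)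
    finally show "\<bar>mollify a F y - mollify a F x\<bar> \<le> (real CARD('d) * B) * b" .
  qed
  have "\<bar>mollify \<delta> (mollify \<epsilon> F) x - mollify \<epsilon> F x\<bar> \<le> (real CARD('d) * B) * \<delta>"
    by (rule a[OF \<epsilon> x])
  moreover have "\<bar>mollify \<epsilon> (mollify \<delta> F) x - mollify \<delta> F x\<bar> \<le> (real CARD('d) * B) * \<epsilon>"
    using x by (intro a[OF \<epsilon>(2,1)]) (simp add: add.commute)
  moreover have "mollify \<delta> (mollify \<epsilon> F) x = mollify \<epsilon> (mollify \<delta> F) x"
    by (rule mollify_mollify[OF \<epsilon> weak_pair_D(1)[OF w]])
  ultimately show ?thesis by (simp add: distrib_left)
qed

section \<open>The limit of the mollifications and its regularity\<close>

definition mollify_limit :: "(real^'d::finite \<Rightarrow> real) \<Rightarrow> real^'d \<Rightarrow> real" where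
  "mollify_limit F x = lim (\<lambda>n. mollify (inverse (real (Suc n))) F x)"

lemma eventually_cball_subset:
  assumes "open \<Omega>" "x \<in> \<Omega>"
  shows "\<forall>\<^sub>F n in sequentially. cball x (c * inverse (real (Suc n))) \<subseteq> \<Omega>"
proof -
  obtain e where e: "e > 0" "cball x e \<subseteq> \<Omega>" using assms open_contains_cball by blast
  have "(\<lambda>n. c * inverse (real (Suc n))) \<longlonglongrightarrow> c * 0"
    by (intro tendsto_mult tendsto_const LIMSEQ_inverse_real_of_nat)
  then have "\<forall>\<^sub>F n in sequentially. c * inverse (real (Suc n)) < e"
    using e(1) by (intro order_tendstoD(2)[where y=0]) auto
  then show ?thesis
    by (rule eventually_mono) (use e(2) in force)
qed

lemma mollify_limit_LIMSEQ:
  fixes F :: "real^'d::finite \<Rightarrow> real"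
  assumes \<Omega>: "open \<Omega>" and w: "weak_pair \<Omega> F G B" and x: "x \<in> \<Omega>"
  shows "(\<lambda>n. mollify (inverse (real (Suc n))) F x) \<longlonglongrightarrow> mollify_limit F x"
proof -
  define L where "L = real CARD('d) * B"
  have L: "L \<ge> 0" using weak_pair_D(5)[OF w] by (simp add: L_def)
  have "Cauchy (\<lambda>n. mollify (inverse (real (Suc n))) F x)"
  proof (rule CauchyI)
    fix e :: real assume e: "e > 0"
    have "(\<lambda>n. L * (2 * inverse (real (Suc n)))) \<longlonglongrightarrow> L * (2 * 0)"
      by (intro tendsto_mult tendsto_const LIMSEQ_inverse_real_of_nat)
    then have "\<forall>\<^sub>F n in sequentially. L * (2 * inverse (real (Suc n))) < e"
      using e by (intro order_tendstoD(2)[where y="L * (2 * 0)"]) auto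
    then have "\<forall>\<^sub>F n in sequentially. L * (2 * inverse (real (Suc n))) < e \<and> cball x (2 * inverse (real (Suc n))) \<subseteq> \<Omega>"
      using eventually_cball_subset[OF \<Omega> x, of 2] by (rule eventually_conj)
    \<comment> \<open>The ball of twice the radius contains every ball whose radius is the sum of
      two later radii, as \<open>mollify_cauchy\<close> requires.\<close>
    then obtain M where M: "L * (2 * inverse (real (Suc M))) < e" "cball x (2 * inverse (real (Suc M))) \<subseteq> \<Omega>"
      unfolding eventually_sequentially by blast
    show "\<exists>M. \<forall>m\<ge>M. \<forall>n\<ge>M. norm (mollify (inverse (real (Suc m))) F x - mollify (inverse (real (Suc n))) F x) < e"
    proof (intro exI[of _ M] allI impI)
      fix m n assume mn: "m \<ge> M" "n \<ge> M"
      have le: "inverse (real (Suc m)) \<le> inverse (real (Suc M))" "inverse (real (Suc n)) \<le> inverse (real (Suc M))"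
        using mn by (intro le_imp_inverse_le; simp)+
      then have le2: "inverse (real (Suc m)) + inverse (real (Suc n)) \<le> 2 * inverse (real (Suc M))" by linarith
      have "\<bar>mollify (inverse (real (Suc m))) F x - mollify (inverse (real (Suc n))) F x\<bar>
          \<le> L * (inverse (real (Suc m)) + inverse (real (Suc n)))"
        unfolding L_def using le2 M(2) by (intro mollify_cauchy[OF _ _ w]) force+
      also have "\<dots> \<le> L * (2 * inverse (real (Suc M)))" by (rule mult_left_mono[OF le2 L])
      finally show "norm (mollify (inverse (real (Suc m))) F x - mollify (inverse (real (Suc n))) F x) < e"
        using M(1) by simp
    qed
  qed
  then show ?thesis
    unfolding mollify_limit_def using Cauchy_convergent_iff convergent_LIMSEQ_iff by blast
qed

lemma mollify_limit_bound:
  assumes "open \<Omega>" "weak_pair \<Omega> F G B" "x \<in> \<Omega>"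
  shows "\<bar>mollify_limit F x\<bar> \<le> B"
  by (rule tendsto_upperbound[OF tendsto_rabs[OF mollify_limit_LIMSEQ[OF assms]] always_eventually])
    (auto intro!: mollify_bound weak_pair_D[OF assms(2)])

text \<open>A compact segment keeps a positive distance from the complement of \<Omega>, so for
  small radii the uniform Lipschitz bound holds along all of it.\<close>

lemma mollify_limit_lipschitz:
  fixes F :: "real^'d::finite \<Rightarrow> real"
  assumes \<Omega>: "open \<Omega>" and w: "weak_pair \<Omega> F G B" and s: "closed_segment x y \<subseteq> \<Omega>"
  shows "\<bar>mollify_limit F x - mollify_limit F y\<bar> \<le> (real CARD('d) * B) * norm (x - y)"
proof -
  have xy: "x \<in> \<Omega>" "y \<in> \<Omega>" using s by auto
  obtain e where e: "e > 0" "(\<Union>u\<in>closed_segment x y. ball u e) \<subseteq> \<Omega>"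
    using compact_subset_open_imp_ball_epsilon_subset[OF compact_segment \<Omega> s] by blast
  have "(\<lambda>n. inverse (real (Suc n))) \<longlonglongrightarrow> 0" by (rule LIMSEQ_inverse_real_of_nat)
  then have "\<forall>\<^sub>F n in sequentially. inverse (real (Suc n)) < e"
    using e(1) by (intro order_tendstoD(2)[where y=0]) auto
  then have ev: "\<forall>\<^sub>F n in sequentially. \<bar>mollify (inverse (real (Suc n))) F x - mollify (inverse (real (Suc n))) F y\<bar>
      \<le> (real CARD('d) * B) * norm (x - y)"
  proof eventually_elim
    case (elim n)
    have "cball u (inverse (real (Suc n))) \<subseteq> \<Omega>" if "u \<in> closed_segment x y" for u
      using e(2) that elim by (smt (verit, ccfv_SIG) UN_I mem_ball mem_cball subset_iff)
    then show ?case by (intro mollify_lipschitz[OF _ w convex_closed_segment]) auto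
  qed
  show ?thesis
    by (rule tendsto_upperbound[OF tendsto_rabs[OF tendsto_diff[OF mollify_limit_LIMSEQ[OF \<Omega> w xy(1)] mollify_limit_LIMSEQ[OF \<Omega> w xy(2)]]] ev]) simp
qed

text \<open>Here second weak derivatives enter: they make the mollified gradients Lipschitz
  uniformly in the radius, so the quadratic Taylor remainder survives the limit.\<close>

lemma mollify_limit_has_derivative:
  fixes F :: "real^'d::finite \<Rightarrow> real"
  assumes \<Omega>: "open \<Omega>" and w: "weak_pair \<Omega> F G B" and w2: "\<And>i. weak_pair \<Omega> (G i) (H i) C" and x: "x \<in> \<Omega>"
  shows "(mollify_limit F has_derivative (\<lambda>k. \<Sum>i\<in>UNIV. k $ i * mollify_limit (G i) x)) (at x)"
proof -
  define L where "L = real CARD('d) * C"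
  have L: "L \<ge> 0" using weak_pair_D(5)[OF w2] by (simp add: L_def)
  \<comment> \<open>Radius 2 r leaves room for a point at distance below r from x and for a kernel
    of radius below r around it.\<close>
  obtain r where r: "r > 0" "cball x (2 * r) \<subseteq> \<Omega>"
  proof -
    obtain e where "e > 0" "cball x e \<subseteq> \<Omega>" using \<Omega> x open_contains_cball by blast
    then show ?thesis by (intro that[of "e / 2"]) auto
  qed
  show ?thesis
  proof (rule has_derivative_of_quadratic_remainder[OF _ r(1), where C="\<Sum>i\<in>(UNIV::'d set). L"])
    show "bounded_linear (\<lambda>k. \<Sum>i\<in>UNIV. k $ i * mollify_limit (G i) x)"
      by (intro bounded_linear_sum bounded_linear_compose[OF bounded_linear_mult_left bounded_linear_vec_nth])
    fix k :: "real^'d" assume k: "norm k < r"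
    have xk: "x + k \<in> \<Omega>" using r k by (intro subsetD[OF r(2)]) (auto simp: dist_norm)
    have "(\<lambda>n. inverse (real (Suc n))) \<longlonglongrightarrow> 0" by (rule LIMSEQ_inverse_real_of_nat)
    then have "\<forall>\<^sub>F n in sequentially. inverse (real (Suc n)) < r"
      using r(1) by (intro order_tendstoD(2)[where y=0]) auto
    then have ev: "\<forall>\<^sub>F n in sequentially.
        \<bar>mollify (inverse (real (Suc n))) F (x + k) - mollify (inverse (real (Suc n))) F x
          - (\<Sum>i\<in>UNIV. k $ i * mollify (inverse (real (Suc n))) (G i) x)\<bar> \<le> (\<Sum>i\<in>(UNIV::'d set). L) * (norm k)\<^sup>2"
    proof eventually_elim
      case (elim n)
      define e where "e = inverse (real (Suc n))"
      have e: "e > 0" "e < r" using elim by (auto simp: e_def)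
      have sub: "cball u e \<subseteq> \<Omega>" if "u \<in> ball x r" for u
      proof
        fix v assume "v \<in> cball u e"
        then have "dist x v \<le> 2 * r" using that e dist_triangle[of x v u] by auto
        then show "v \<in> \<Omega>" using r(2) by auto
      qed
      have xr: "x \<in> ball x r" "x + k \<in> ball x r" using r(1) k by (auto simp: dist_norm)
      have "\<bar>mollify e F (x + k) - mollify e F x - (\<Sum>i\<in>UNIV. (x + k - x) $ i * mollify e (G i) x)\<bar>
          \<le> (\<Sum>i\<in>(UNIV::'d set). L) * (norm (x + k - x))\<^sup>2"
      proof (rule taylor_lipschitz_gradient[OF convex_ball _ xr])
        fix u i assume u: "u \<in> ball x r"
        show "(mollify e F has_derivative (\<lambda>h. \<Sum>i\<in>UNIV. h $ i * mollify e (G i) u)) (at u within ball x r)"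
          by (rule has_derivative_at_withinI[OF mollify_has_derivative[OF e(1) w sub[OF u]]])
        show "\<bar>mollify e (G i) u - mollify e (G i) x\<bar> \<le> L * norm (u - x)"
          unfolding L_def by (rule mollify_lipschitz[OF e(1) w2 convex_ball sub u xr(1)])
      qed (use L in auto)
      then show ?case by (simp add: e_def)
    qed
    show "norm (mollify_limit F (x + k) - mollify_limit F x - (\<Sum>i\<in>UNIV. k $ i * mollify_limit (G i) x))
        \<le> (\<Sum>i\<in>(UNIV::'d set). L) * (norm k)\<^sup>2"
      unfolding real_norm_def
      by (rule tendsto_upperbound[OF tendsto_rabs[OF tendsto_diff[OF tendsto_diff[OF
                mollify_limit_LIMSEQ[OF \<Omega> w xk] mollify_limit_LIMSEQ[OF \<Omega> w x]]
              tendsto_sum[OF tendsto_mult[OF tendsto_const mollify_limit_LIMSEQ[OF \<Omega> w2 x]]]]] ev]) simp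
  qed
qed

lemma mollify_tendsto_test:
  assumes \<phi>: "test_function \<Omega> \<phi>" and i: "integrable lborel \<phi>"
  shows "(\<lambda>n. mollify (inverse (real (Suc n))) \<phi> y) \<longlonglongrightarrow> \<phi> y"
proof -
  obtain L where L: "L \<ge> 0" "\<And>x y. \<bar>\<phi> x - \<phi> y\<bar> \<le> L * norm (x - y)"
    by (rule test_function_lipschitz[OF \<phi>], rule that)
  have b: "\<bar>mollify e \<phi> y - \<phi> y\<bar> \<le> L * e" if e: "e > 0" for e
  proof (rule mollify_diff_bound[OF e mollify_integrable[OF e i]])
    fix u assume "norm (y - u) < e"
    then show "\<bar>\<phi> u - \<phi> y\<bar> \<le> L * e"
      using L(2)[of u y] mult_left_mono[OF _ L(1), of "norm (u - y)" e] by (simp add: norm_minus_commute)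
  qed
  have "(\<lambda>n. L * inverse (real (Suc n))) \<longlonglongrightarrow> L * 0"
    by (intro tendsto_mult tendsto_const LIMSEQ_inverse_real_of_nat)
  then have lim0: "(\<lambda>n. L * inverse (real (Suc n))) \<longlonglongrightarrow> 0" by simp
  have "(\<lambda>n. mollify (inverse (real (Suc n))) \<phi> y - \<phi> y) \<longlonglongrightarrow> 0"
    by (rule Lim_null_comparison[OF always_eventually lim0]) (use b in auto)
  then show ?thesis by (simp add: LIM_zero_iff)
qed

lemma test_function_integrable:
  assumes "test_function \<Omega> \<phi>"
  shows "integrable lborel \<phi>"
proof -
  obtain K where K: "compact K" "K \<subseteq> \<Omega>" "\<And>ds x. x \<notin> K \<Longrightarrow> partial_derivs ds \<phi> x = 0"
    using test_function_supports[OF assms] by blast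
  obtain B where B: "B \<ge> 0" "\<And>x. \<bar>partial_derivs [] \<phi> x\<bar> \<le> B"
    by (rule test_function_bounded[OF assms], rule that)
  show ?thesis
  proof (rule Bochner_Integration.integrable_bound)
    show "integrable lborel (\<lambda>x. B * indicat_real K x)"
      using K(1) by (intro integrable_mult_right integrable_real_indicator)
        (auto simp: compact_imp_closed emeasure_bounded_finite[OF compact_imp_bounded, unfolded infinity_ennreal_def])
    show "\<phi> \<in> borel_measurable lborel"
      using borel_measurable_continuous_onI[OF test_function_continuous_derivs[OF assms, of "[]"]] by simp
    show "AE x in lborel. norm (\<phi> x) \<le> norm (B * indicat_real K x)"
    proof (rule AE_I2)
      fix x show "norm (\<phi> x) \<le> norm (B * indicat_real K x)"
        using B(2)[of x] K(3)[of x "[]"] by (cases "x \<in> K") auto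
    qed
  qed
qed

text \<open>Tested against \<phi>, the mollification can be moved onto \<phi>. Both sides converge
  by dominated convergence, and the fundamental lemma identifies F with the limit.\<close>

lemma mollify_limit_AE:
  fixes F :: "real^'d::finite \<Rightarrow> real"
  assumes \<Omega>: "open \<Omega>" "bounded \<Omega>" and w: "weak_pair \<Omega> F G B"
  shows "AE x in lebesgue_on \<Omega>. F x = mollify_limit F x"
proof -
  note F = weak_pair_D(1)[OF w]
  have cont: "continuous_on \<Omega> (mollify_limit F)"
  proof (rule local_lipschitz_continuous_on[OF \<Omega>(1)])
    show "norm (mollify_limit F x - mollify_limit F y) \<le> (real CARD('d) * B) * norm (x - y)" if "closed_segment x y \<subseteq> \<Omega>" for x y
      using mollify_limit_lipschitz[OF \<Omega>(1) w that] by simp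
  qed
  define f where "f = (\<lambda>x. indicat_real \<Omega> x *\<^sub>R mollify_limit F x)"
  have fm: "f \<in> borel_measurable borel"
    unfolding f_def using borel_measurable_continuous_on_indicator[OF _ cont] \<Omega> by auto
  have fb: "\<bar>f x\<bar> \<le> B" for x
    using mollify_limit_bound[OF \<Omega>(1) w, of x] weak_pair_D(5)[OF w] by (auto simp: f_def indicator_def)
  have FL: "F \<in> Linf_space \<Omega>" "f \<in> Linf_space \<Omega>"
  proof -
    have "F \<in> borel_measurable lebesgue" "f \<in> borel_measurable lebesgue"
      using F fm by (auto intro!: measurable_completion)
    then have "F \<in> borel_measurable (lebesgue_on \<Omega>)" "f \<in> borel_measurable (lebesgue_on \<Omega>)"
      by (auto intro: measurable_restrict_space1)
    then show "F \<in> Linf_space \<Omega>" "f \<in> Linf_space \<Omega>"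
      using fb weak_pair_D(3)[OF w] by (auto intro!: Linf_spaceI[where C=B])
  qed
  have "AE x in lebesgue_on \<Omega>. F x - f x = 0"
  proof (rule fundamental_lemma[OF \<Omega>(1)])
    show "locally_integrable_on \<Omega> (\<lambda>x. F x - f x)"
      using FL \<Omega> by (intro locally_integrable_diff Linf_subset)
    fix \<phi> assume \<phi>: "test_function \<Omega> \<phi>"
    have \<phi>i: "integrable lborel \<phi>" by (rule test_function_integrable[OF \<phi>])
    obtain K where K: "compact K" "K \<subseteq> \<Omega>" "\<And>x. x \<notin> K \<Longrightarrow> \<phi> x = 0"
      using test_function_compact_support[OF \<phi>] by blast
    obtain C where C: "C \<ge> 0" "\<And>x. \<bar>partial_derivs [] \<phi> x\<bar> \<le> C"
      by (rule test_function_bounded[OF \<phi>], rule that)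
    note \<epsilon> = positive_imp_inverse_positive[OF of_nat_0_less_iff[THEN iffD2, OF zero_less_Suc]]
    have mm: "(\<lambda>x. mollify (inverse (real (Suc n))) F x * \<phi> x) \<in> borel_measurable lborel"
        "(\<lambda>y. F y * mollify (inverse (real (Suc n))) \<phi> y) \<in> borel_measurable lborel" for n
      using mollify_swap(2)[OF \<epsilon> F \<phi>i, of n] mollify_swap(2)[OF \<epsilon> \<phi>i F, of n] by (auto simp: mult.commute)
    have fi: "integrable lborel (\<lambda>x. f x * \<phi> x)"
    proof (rule Bochner_Integration.integrable_bound)
      show "integrable lborel (\<lambda>x. B * \<phi> x)" using \<phi>i by simp
      show "(\<lambda>x. f x * \<phi> x) \<in> borel_measurable lborel" using fm \<phi>i by measurable
      show "AE x in lborel. norm (f x * \<phi> x) \<le> norm (B * \<phi> x)"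
      proof (rule AE_I2)
        fix x show "norm (f x * \<phi> x) \<le> norm (B * \<phi> x)"
          using mult_right_mono[OF fb[of x] abs_ge_zero[of "\<phi> x"]] weak_pair_D(5)[OF w] by (simp add: abs_mult)
      qed
    qed
    have Fi: "integrable lborel (\<lambda>x. F x * \<phi> x)"
    proof (rule Bochner_Integration.integrable_bound)
      show "integrable lborel (\<lambda>x. B * \<phi> x)" using \<phi>i by simp
      show "(\<lambda>x. F x * \<phi> x) \<in> borel_measurable lborel" using F \<phi>i by measurable
      show "AE x in lborel. norm (F x * \<phi> x) \<le> norm (B * \<phi> x)"
      proof (rule AE_I2)
        fix x show "norm (F x * \<phi> x) \<le> norm (B * \<phi> x)"
          using mult_right_mono[OF weak_pair_D(3)[OF w, of x] abs_ge_zero[of "\<phi> x"]] weak_pair_D(5)[OF w] by (simp add: abs_mult)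
      qed
    qed
    have l1: "(\<lambda>n. integral\<^sup>L lborel (\<lambda>x. mollify (inverse (real (Suc n))) F x * \<phi> x)) \<longlonglongrightarrow> integral\<^sup>L lborel (\<lambda>x. f x * \<phi> x)"
    proof (rule integral_dominated_convergence[where w="\<lambda>x. B * \<bar>\<phi> x\<bar>"])
      show "AE x in lborel. (\<lambda>n. mollify (inverse (real (Suc n))) F x * \<phi> x) \<longlonglongrightarrow> f x * \<phi> x"
      proof (rule AE_I2)
        fix x
        show "(\<lambda>n. mollify (inverse (real (Suc n))) F x * \<phi> x) \<longlonglongrightarrow> f x * \<phi> x"
        proof (cases "x \<in> \<Omega>")
          case True
          then have "f x = mollify_limit F x" by (simp add: f_def)
          then show ?thesis using mollify_limit_LIMSEQ[OF \<Omega>(1) w True] by (auto intro: tendsto_mult)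
        next
          case False
          then have "\<phi> x = 0" using K by auto
          then show ?thesis by simp
        qed
      qed
      show "AE x in lborel. norm (mollify (inverse (real (Suc n))) F x * \<phi> x) \<le> B * \<bar>\<phi> x\<bar>" for n
      proof (rule AE_I2)
        fix x
        from mult_right_mono[OF mollify_bound[OF \<epsilon> F weak_pair_D(3)[OF w]] abs_ge_zero[of "\<phi> x"]]
        show "norm (mollify (inverse (real (Suc n))) F x * \<phi> x) \<le> B * \<bar>\<phi> x\<bar>"
          unfolding real_norm_def abs_mult .
      qed
    qed (use \<phi>i fi mm in auto)
    have l2: "(\<lambda>n. integral\<^sup>L lborel (\<lambda>y. F y * mollify (inverse (real (Suc n))) \<phi> y)) \<longlonglongrightarrow> integral\<^sup>L lborel (\<lambda>y. F y * \<phi> y)"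
    proof (rule integral_dominated_convergence[where w="\<lambda>x. C * \<bar>F x\<bar>"])
      show "AE y in lborel. (\<lambda>n. F y * mollify (inverse (real (Suc n))) \<phi> y) \<longlonglongrightarrow> F y * \<phi> y"
        by (intro AE_I2 tendsto_mult tendsto_const mollify_tendsto_test[OF \<phi> \<phi>i])
      show "AE y in lborel. norm (F y * mollify (inverse (real (Suc n))) \<phi> y) \<le> C * \<bar>F y\<bar>" for n
      proof (rule AE_I2)
        fix y
        have "\<bar>mollify (inverse (real (Suc n))) \<phi> y\<bar> \<le> C"
          using C(2) by (intro mollify_bound[OF \<epsilon> \<phi>i]) simp
        from mult_right_mono[OF this abs_ge_zero[of "F y"]]
        show "norm (F y * mollify (inverse (real (Suc n))) \<phi> y) \<le> C * \<bar>F y\<bar>"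
          by (simp add: abs_mult mult.commute)
      qed
    qed (use F Fi mm in auto)
    have eq: "integral\<^sup>L lborel (\<lambda>x. f x * \<phi> x) = integral\<^sup>L lborel (\<lambda>y. F y * \<phi> y)"
      using LIMSEQ_unique[OF l1] l2 unfolding mollify_swap(1)[OF \<epsilon> F \<phi>i] by blast
    have Di: "integrable lborel (\<lambda>x. \<phi> x * (F x - f x))" "integral\<^sup>L lborel (\<lambda>x. \<phi> x * (F x - f x)) = 0"
      using eq fi Fi by (auto simp: right_diff_distrib mult.commute)
    have "(\<lambda>x. indicat_real \<Omega> x *\<^sub>R (\<phi> x *\<^sub>R (F x - f x))) = (\<lambda>x. \<phi> x * (F x - f x))"
      using K by (auto simp: indicator_def fun_eq_iff)
    then show "integral\<^sup>L (lebesgue_on \<Omega>) (\<lambda>x. \<phi> x *\<^sub>R (F x - f x)) = 0"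
      unfolding integral_lebesgue_on_eq[OF sets_lebesgue_open[OF \<Omega>(1)]]
      using integral_completion[of "\<lambda>x. \<phi> x * (F x - f x)" lborel] Di by auto
  qed
  moreover have "AE x in lebesgue_on \<Omega>. x \<in> \<Omega>" by (rule AE_I2) simp
  ultimately show ?thesis by eventually_elim (simp add: f_def)
qed


text \<open>Passes from an essentially bounded Lebesgue function on \<Omega> to a Borel function on
  the whole space. Agreement of integrals is stated for continuous \<phi>, which covers test
  functions and all their derivatives.\<close>

lemma Linf_borel_version:
  fixes f :: "real^'d::finite \<Rightarrow> real"
  assumes \<Omega>: "open \<Omega>" "bounded \<Omega>" and f: "f \<in> Linf_space \<Omega>"
  obtains F B where "integrable lborel F" "\<And>x. \<bar>F x\<bar> \<le> B" "AE x in lebesgue_on \<Omega>. F x = f x"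
    "\<And>\<phi>. continuous_on UNIV \<phi> \<Longrightarrow> integral\<^sup>L (lebesgue_on \<Omega>) (\<lambda>x. \<phi> x *\<^sub>R f x) = integral\<^sup>L lborel (\<lambda>x. F x * \<phi> x)"
proof -
  obtain B0 where B0: "AE x in lebesgue_on \<Omega>. norm (f x) \<le> B0" and fm: "f \<in> borel_measurable (lebesgue_on \<Omega>)"
    using f by (auto simp: Linf_space_def)
  define B where "B = max B0 0"
  have s\<Omega>: "\<Omega> \<in> sets lebesgue" "\<Omega> \<in> sets borel" using \<Omega> by auto
  have "(\<lambda>x. indicator \<Omega> x *\<^sub>R f x) \<in> borel_measurable lebesgue"
    using fm borel_measurable_lebesgue_on_iff[OF s\<Omega>(1)] by blast
  then obtain F0 where F0: "F0 \<in> borel_measurable lborel" "AE x in lborel. indicator \<Omega> x *\<^sub>R f x = F0 x"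
    using completion_ex_borel_measurable_real by blast
  \<comment> \<open>Truncation at B turns the essential bound into a bound everywhere; the indicator
    of the bounded set \<Omega> makes F integrable.\<close>
  define F where "F = (\<lambda>x. indicat_real \<Omega> x * max (- B) (min B (F0 x)))"
  have Fm: "F \<in> borel_measurable borel" using F0(1) s\<Omega>(2) unfolding F_def by measurable
  have Fb: "\<bar>F x\<bar> \<le> B" for x by (auto simp: F_def B_def indicator_def)
  have Fi: "integrable lborel F"
  proof (rule Bochner_Integration.integrable_bound)
    show "integrable lborel (\<lambda>x. B * indicat_real \<Omega> x)"
      using \<Omega> s\<Omega> by (intro integrable_mult_right integrable_real_indicator) (auto simp: emeasure_bounded_finite[unfolded infinity_ennreal_def])
    show "AE x in lborel. norm (F x) \<le> norm (B * indicat_real \<Omega> x)"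
      by (rule AE_I2) (auto simp: F_def B_def indicator_def)
  qed (use Fm in simp)
  have ae: "AE x in lebesgue. indicator \<Omega> x *\<^sub>R f x = F x"
  proof -
    have "AE x in lebesgue. x \<in> \<Omega> \<longrightarrow> norm (f x) \<le> B0"
      using B0 unfolding AE_lebesgue_on_iff[OF s\<Omega>(1)] .
    with AE_completion[OF F0(2)] show ?thesis
      by eventually_elim (auto simp: F_def B_def indicator_def split: if_splits)
  qed
  show ?thesis
  proof (rule that[OF Fi Fb])
    show "AE x in lebesgue_on \<Omega>. F x = f x"
      unfolding AE_lebesgue_on_iff[OF s\<Omega>(1)] using ae by (rule eventually_mono) auto
    fix \<phi> :: "real^'d \<Rightarrow> real" assume c: "continuous_on UNIV \<phi>"
    have cm: "\<phi> \<in> borel_measurable borel" by (rule borel_measurable_continuous_onI[OF c])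
    have m: "(\<lambda>x. F x * \<phi> x) \<in> borel_measurable lborel" using Fm cm by measurable
    have m1: "(\<lambda>x. F x * \<phi> x) \<in> borel_measurable lebesgue" using m by (rule measurable_completion)
    have ae': "AE x in lebesgue. F x * \<phi> x = indicator \<Omega> x *\<^sub>R (\<phi> x *\<^sub>R f x)"
      using ae by (rule eventually_mono) (auto simp: mult_ac)
    have "integral\<^sup>L (lebesgue_on \<Omega>) (\<lambda>x. \<phi> x *\<^sub>R f x) = integral\<^sup>L lebesgue (\<lambda>x. F x * \<phi> x)"
      unfolding integral_lebesgue_on_eq[OF s\<Omega>(1)]
      by (rule integral_cong_AE[OF m1 borel_measurable_AE[OF m1 ae'] ae', symmetric])
    also have "\<dots> = integral\<^sup>L lborel (\<lambda>x. F x * \<phi> x)" by (rule integral_completion[OF m])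
    finally show "integral\<^sup>L (lebesgue_on \<Omega>) (\<lambda>x. \<phi> x *\<^sub>R f x) = integral\<^sup>L lborel (\<lambda>x. F x * \<phi> x)" .
  qed
qed

text \<open>Derivatives of test functions are test functions, so the derivative of \<phi> in
  direction i may be inserted into the relation for j. In the list \<open>[j, i]\<close> the entry i
  acts first, which is the order this needs.\<close>

lemma has_weak_deriv_Cons:
  fixes f :: "real^'d::finite \<Rightarrow> 'b::euclidean_space"
  assumes "has_weak_deriv \<Omega> [j] f g" "has_weak_deriv \<Omega> [j, i] f h"
  shows "has_weak_deriv \<Omega> [i] g h"
  unfolding has_weak_deriv_def
proof (intro conjI has_weak_derivD(2)[OF assms(1)] has_weak_derivD(2)[OF assms(2)] allI impI)
  fix \<phi> assume \<phi>: "test_function \<Omega> \<phi>"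
  have "partial_derivs [j] (partial_derivs [i] \<phi>) = partial_derivs [j, i] \<phi>"
    using partial_derivs_append[of "[j]" "[i]" \<phi>] by simp
  then have "- integral\<^sup>L (lebesgue_on \<Omega>) (\<lambda>x. partial_derivs [i] \<phi> x *\<^sub>R g x) = integral\<^sup>L (lebesgue_on \<Omega>) (\<lambda>x. \<phi> x *\<^sub>R h x)"
    using has_weak_derivD(3)[OF assms(1) test_function_partial[OF \<phi>, of "[i]"]] has_weak_derivD(3)[OF assms(2) \<phi>]
    by simp
  then show "integral\<^sup>L (lebesgue_on \<Omega>) (\<lambda>x. partial_derivs [i] \<phi> x *\<^sub>R g x) =
      (- 1) ^ length [i] *\<^sub>R integral\<^sup>L (lebesgue_on \<Omega>) (\<lambda>x. \<phi> x *\<^sub>R h x)"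
    by (simp add: minus_equation_iff)
qed

lemma weak_pair_exists:
  fixes f :: "real^'d::finite \<Rightarrow> real"
  assumes \<Omega>: "open \<Omega>" "bounded \<Omega>" and F: "integrable lborel F" "\<And>x. \<bar>F x\<bar> \<le> B"
    "\<And>\<phi>. continuous_on UNIV \<phi> \<Longrightarrow> integral\<^sup>L (lebesgue_on \<Omega>) (\<lambda>x. \<phi> x *\<^sub>R f x) = integral\<^sup>L lborel (\<lambda>x. F x * \<phi> x)"
    and G: "\<And>i. integrable lborel (G i)" "\<And>i x. \<bar>G i x\<bar> \<le> B"
    "\<And>i \<phi>. continuous_on UNIV \<phi> \<Longrightarrow> integral\<^sup>L (lebesgue_on \<Omega>) (\<lambda>x. \<phi> x *\<^sub>R g i x) = integral\<^sup>L lborel (\<lambda>x. G i x * \<phi> x)"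
    and w: "\<And>i. has_weak_deriv \<Omega> [i] f (g i)"
  shows "weak_pair \<Omega> F G B"
  unfolding weak_pair_def
proof (intro conjI allI impI F(1,2) G(1,2))
  fix \<phi> i assume \<phi>: "test_function \<Omega> \<phi>"
  have "integral\<^sup>L lborel (\<lambda>y. F y * partial_derivs [i] \<phi> y) = integral\<^sup>L (lebesgue_on \<Omega>) (\<lambda>x. partial_derivs [i] \<phi> x *\<^sub>R f x)"
    by (rule F(3)[OF test_function_continuous_derivs[OF \<phi>], symmetric])
  also have "\<dots> = - integral\<^sup>L (lebesgue_on \<Omega>) (\<lambda>x. \<phi> x *\<^sub>R g i x)"
    using has_weak_derivD(3)[OF w \<phi>] by simp
  also have "\<dots> = - integral\<^sup>L lborel (\<lambda>y. G i y * \<phi> y)"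
    using G(3)[OF test_function_continuous_derivs[OF \<phi>, of "[]"]] by simp
  finally show "integral\<^sup>L lborel (\<lambda>y. F y * partial_derivs [i] \<phi> y) = - integral\<^sup>L lborel (\<lambda>y. G i y * \<phi> y)" .
qed

text \<open>Two uses of the mollification limit: for f with its gradient, and for each gradient
  component with the second derivatives. The result is a differentiable representative with locally
  Lipschitz gradient, for which point values and Taylor expansions make sense.\<close>

lemma Winf_2_representative:
  fixes f :: "real^'d::finite \<Rightarrow> real"
  assumes \<Omega>: "open \<Omega>" "bounded \<Omega>" and f: "f \<in> Winf_space m \<Omega>" "m \<ge> 2"
  obtains u g M where "M \<ge> 0" "AE x in lebesgue_on \<Omega>. f x = u x"
    "\<And>x. x \<in> \<Omega> \<Longrightarrow> (u has_derivative (\<lambda>k. \<Sum>i\<in>UNIV. k $ i * g i x)) (at x)"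
    "\<And>x. x \<in> \<Omega> \<Longrightarrow> \<bar>u x\<bar> \<le> M" "\<And>i x. x \<in> \<Omega> \<Longrightarrow> \<bar>g i x\<bar> \<le> M"
    "\<And>x y. closed_segment x y \<subseteq> \<Omega> \<Longrightarrow> \<bar>u x - u y\<bar> \<le> M * norm (x - y)"
    "\<And>i x y. closed_segment x y \<subseteq> \<Omega> \<Longrightarrow> \<bar>g i x - g i y\<bar> \<le> M * norm (x - y)"
proof -
  have fL: "f \<in> Linf_space \<Omega>" and fw: "\<And>ds. length ds \<le> m \<Longrightarrow> \<exists>g\<in>Linf_space \<Omega>. has_weak_deriv \<Omega> ds f g"
    using f(1) by (auto simp: Winf_space_def)
  have "\<exists>g\<in>Linf_space \<Omega>. has_weak_deriv \<Omega> [i] f g" for i using fw[of "[i]"] f(2) by simp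
  then obtain g where g: "\<And>i. g i \<in> Linf_space \<Omega>" "\<And>i. has_weak_deriv \<Omega> [i] f (g i)" by metis
  have "\<exists>h\<in>Linf_space \<Omega>. has_weak_deriv \<Omega> [i, j] f h" for i j using fw[of "[i, j]"] f(2) by simp
  then obtain h where h: "\<And>i j. h i j \<in> Linf_space \<Omega>" "\<And>i j. has_weak_deriv \<Omega> [i, j] f (h i j)" by metis
  have hw: "has_weak_deriv \<Omega> [j] (g i) (h i j)" for i j by (rule has_weak_deriv_Cons[OF g(2) h(2)])
  define v where "v F f \<longleftrightarrow> integrable lborel F \<and> (\<exists>B. \<forall>x. \<bar>F x\<bar> \<le> B) \<and> (AE x in lebesgue_on \<Omega>. F x = f x) \<and>
    (\<forall>\<phi>. continuous_on UNIV \<phi> \<longrightarrow> integral\<^sup>L (lebesgue_on \<Omega>) (\<lambda>x. \<phi> x *\<^sub>R f x) = integral\<^sup>L lborel (\<lambda>x. F x * \<phi> x))" for F f :: "real^'d \<Rightarrow> real"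
  have vex: "\<exists>F. v F f" if "f \<in> Linf_space \<Omega>" for f
    by (rule Linf_borel_version[OF \<Omega> that]) (unfold v_def, blast)
  obtain F where F: "v F f" using vex[OF fL] by blast
  obtain G where G: "\<And>i. v (G i) (g i)" using vex[OF g(1)] by metis
  obtain HH where HH: "\<And>i j. v (HH i j) (h i j)" using vex[OF h(1)] by metis
  obtain BF where BF: "\<And>x. \<bar>F x\<bar> \<le> BF" using F unfolding v_def by blast
  obtain BG where BG: "\<And>i x. \<bar>G i x\<bar> \<le> BG i" using G unfolding v_def by metis
  obtain BH where BH: "\<And>i j x. \<bar>HH i j x\<bar> \<le> BH i j" using HH unfolding v_def by metis
  \<comment> \<open>One bound for f, all first and all second derivatives, since
    \<open>weak_pair\<close> asks for a common one.\<close>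
  define B where "B = \<bar>BF\<bar> + (\<Sum>i\<in>UNIV. \<bar>BG i\<bar>) + (\<Sum>i\<in>UNIV. \<Sum>j\<in>UNIV. \<bar>BH i j\<bar>)"
  have nn: "(\<Sum>i\<in>UNIV. \<bar>BG i\<bar>) \<ge> 0" "(\<Sum>i\<in>UNIV. \<Sum>j\<in>UNIV. \<bar>BH i j\<bar>) \<ge> 0" by (intro sum_nonneg; simp)+
  have bF: "\<bar>F x\<bar> \<le> B" for x unfolding B_def using BF[of x] nn by linarith
  have bG: "\<bar>G i x\<bar> \<le> B" for i x
  proof -
    have "\<bar>BG i\<bar> \<le> (\<Sum>i\<in>UNIV. \<bar>BG i\<bar>)" by (rule member_le_sum) auto
    then show ?thesis unfolding B_def using BG[of i x] nn by linarith
  qed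
  have bH: "\<bar>HH i j x\<bar> \<le> B" for i j x
  proof -
    have "\<bar>BH i j\<bar> \<le> (\<Sum>j\<in>UNIV. \<bar>BH i j\<bar>)" by (rule member_le_sum) auto
    also have "\<dots> \<le> (\<Sum>i\<in>UNIV. \<Sum>j\<in>UNIV. \<bar>BH i j\<bar>)" by (rule member_le_sum) (auto intro: sum_nonneg)
    finally show ?thesis unfolding B_def using BH[of i j x] nn by linarith
  qed
  have w1: "weak_pair \<Omega> F G B"
    by (rule weak_pair_exists[OF \<Omega> _ bF _ _ bG _ g(2)]) (use F G in \<open>simp_all add: v_def\<close>)
  have w2: "weak_pair \<Omega> (G i) (HH i) B" for i
    by (rule weak_pair_exists[OF \<Omega> _ bG _ _ bH _ hw]) (use HH G in \<open>simp_all add: v_def\<close>)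
  define M where "M = B + real CARD('d) * B"
  have B0: "B \<ge> 0" by (rule weak_pair_D(5)[OF w1])
  have dB: "real CARD('d) * B \<ge> 0" using B0 by simp
  have le: "B \<le> M" "real CARD('d) * B \<le> M" using B0 dB unfolding M_def by linarith+
  show ?thesis
  proof (rule that[of M "mollify_limit F" "\<lambda>i. mollify_limit (G i)"])
    show "M \<ge> 0" using B0 le by linarith
    have "AE x in lebesgue_on \<Omega>. F x = f x" using F by (simp add: v_def)
    with mollify_limit_AE[OF \<Omega> w1] show "AE x in lebesgue_on \<Omega>. f x = mollify_limit F x"
      by eventually_elim simp
    show "(mollify_limit F has_derivative (\<lambda>k. \<Sum>i\<in>UNIV. k $ i * mollify_limit (G i) x)) (at x)" if "x \<in> \<Omega>" for x
      by (rule mollify_limit_has_derivative[OF \<Omega>(1) w1 w2 that])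
    show "\<bar>mollify_limit F x\<bar> \<le> M" if "x \<in> \<Omega>" for x
      using mollify_limit_bound[OF \<Omega>(1) w1 that] le by linarith
    show "\<bar>mollify_limit (G i) x\<bar> \<le> M" if "x \<in> \<Omega>" for x i
      using mollify_limit_bound[OF \<Omega>(1) w2 that, of i] le by linarith
    show "\<bar>mollify_limit F x - mollify_limit F y\<bar> \<le> M * norm (x - y)" if "closed_segment x y \<subseteq> \<Omega>" for x y
      using mollify_limit_lipschitz[OF \<Omega>(1) w1 that] mult_right_mono[OF le(2) norm_ge_zero[of "x - y"]] by linarith
    show "\<bar>mollify_limit (G i) x - mollify_limit (G i) y\<bar> \<le> M * norm (x - y)" if "closed_segment x y \<subseteq> \<Omega>" for x y i
      using mollify_limit_lipschitz[OF \<Omega>(1) w2 that, of i] mult_right_mono[OF le(2) norm_ge_zero[of "x - y"]] by linarith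
  qed
qed

lemma Winf_bounded_linear:
  fixes f :: "real^'d::finite \<Rightarrow> 'b::euclidean_space" and T :: "'b \<Rightarrow> 'c::euclidean_space"
  assumes \<Omega>: "open \<Omega>" and T: "bounded_linear T" and f: "f \<in> Winf_space m \<Omega>"
  shows "(\<lambda>x. T (f x)) \<in> Winf_space m \<Omega>"
proof -
  interpret T: bounded_linear T by fact
  obtain K where K: "\<And>a. norm (T a) \<le> norm a * K" "K \<ge> 0" using T.nonneg_bounded by blast
  have L: "(\<lambda>x. T (g x)) \<in> Linf_space \<Omega>" if gL: "g \<in> Linf_space \<Omega>" for g :: "real^'d \<Rightarrow> 'b"
  proof -
    obtain C where C: "AE x in lebesgue_on \<Omega>. norm (g x) \<le> C" "g \<in> borel_measurable (lebesgue_on \<Omega>)"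
      using gL by (auto simp: Linf_space_def)
    have "T \<in> borel_measurable borel" by (rule borel_measurable_continuous_onI[OF T.continuous_on[OF continuous_on_id]])
    then have "(\<lambda>x. T (g x)) \<in> borel_measurable (lebesgue_on \<Omega>)" using C(2) by (rule measurable_compose[rotated])
    moreover from C(1) have "AE x in lebesgue_on \<Omega>. norm (T (g x)) \<le> C * K"
    proof eventually_elim
      case (elim x)
      then show ?case using K(1)[of "g x"] mult_right_mono[OF elim K(2)] by linarith
    qed
    ultimately show ?thesis by (rule Linf_spaceI)
  qed
  show ?thesis
    unfolding Winf_space_def
  proof (intro CollectI conjI allI impI)
    show "(\<lambda>x. T (f x)) \<in> Linf_space \<Omega>" using f by (intro L) (simp add: Winf_space_def)
    fix ds :: "'d list" assume "length ds \<le> m"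
    then obtain g where g: "g \<in> Linf_space \<Omega>" "has_weak_deriv \<Omega> ds f g"
      using f unfolding Winf_space_def by blast
    show "\<exists>g\<in>Linf_space \<Omega>. has_weak_deriv \<Omega> ds (\<lambda>x. T (f x)) g"
    proof (rule bexI)
      show "has_weak_deriv \<Omega> ds (\<lambda>x. T (f x)) (\<lambda>x. T (g x))"
        by (rule has_weak_deriv_bounded_linear[OF \<Omega> T g(2)])
      show "(\<lambda>x. T (g x)) \<in> Linf_space \<Omega>" by (rule L[OF g(1)])
    qed
  qed
qed

section \<open>Polynomials\<close>

definition monomial :: "('d::finite \<Rightarrow> nat) \<Rightarrow> real^'d \<Rightarrow> real" where
  "monomial \<alpha> x = (\<Prod>i\<in>UNIV. (x $ i) ^ \<alpha> i)"

lemma finite_multi_indices: "finite {\<alpha> :: 'd::finite \<Rightarrow> nat. (\<Sum>i\<in>UNIV. \<alpha> i) \<le> k}"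
proof (rule finite_subset)
  show "{\<alpha> :: 'd \<Rightarrow> nat. (\<Sum>i\<in>UNIV. \<alpha> i) \<le> k} \<subseteq> (UNIV :: 'd set) \<rightarrow>\<^sub>E {..k}"
  proof
    fix \<alpha> :: "'d \<Rightarrow> nat" assume "\<alpha> \<in> {\<alpha>. (\<Sum>i\<in>UNIV. \<alpha> i) \<le> k}"
    then have "\<alpha> i \<le> k" for i
      using member_le_sum[of i UNIV \<alpha>] by (auto intro: order_trans)
    then show "\<alpha> \<in> (UNIV :: 'd set) \<rightarrow>\<^sub>E {..k}" by auto
  qed
  show "finite ((UNIV :: 'd set) \<rightarrow>\<^sub>E {..k})" by (intro finite_PiE) auto
qed

lemma polys_altdef: "p \<in> polys_of_degree_le k \<longleftrightarrow> (\<exists>c. \<forall>x. p x = (\<Sum>\<alpha> | (\<Sum>i\<in>UNIV. \<alpha> i) \<le> k. c \<alpha> * monomial \<alpha> x))"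
  by (simp add: polys_of_degree_le_def monomial_def)

lemma polys_lincomb:
  assumes "p \<in> polys_of_degree_le k" "q \<in> polys_of_degree_le k"
  shows "(\<lambda>x. a * p x + b * q x) \<in> polys_of_degree_le k"
proof -
  obtain c d where "\<forall>x. p x = (\<Sum>\<alpha> | (\<Sum>i\<in>UNIV. \<alpha> i) \<le> k. c \<alpha> * monomial \<alpha> x)" "\<forall>x. q x = (\<Sum>\<alpha> | (\<Sum>i\<in>UNIV. \<alpha> i) \<le> k. d \<alpha> * monomial \<alpha> x)"
    using assms unfolding polys_altdef by blast
  then show ?thesis
    unfolding polys_altdef
    by (intro exI[of _ "\<lambda>\<alpha>. a * c \<alpha> + b * d \<alpha>"]) (simp add: sum.distrib sum_distrib_left algebra_simps)
qed

lemma polys_add: "p \<in> polys_of_degree_le k \<Longrightarrow> q \<in> polys_of_degree_le k \<Longrightarrow> (\<lambda>x. p x + q x) \<in> polys_of_degree_le k"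
  using polys_lincomb[of p k q 1 1] by simp

lemma polys_cmult: "p \<in> polys_of_degree_le k \<Longrightarrow> (\<lambda>x. a * p x) \<in> polys_of_degree_le k"
  using polys_lincomb[of p k p a 0] by simp

lemma polys_zero: "(\<lambda>x. 0) \<in> polys_of_degree_le k"
  unfolding polys_altdef by (intro exI[of _ "\<lambda>_. 0"]) simp

lemma polys_sum:
  "finite A \<Longrightarrow> (\<And>i. i \<in> A \<Longrightarrow> p i \<in> polys_of_degree_le k) \<Longrightarrow> (\<lambda>x. \<Sum>i\<in>A. p i x) \<in> polys_of_degree_le k"
  by (induction rule: finite_induct) (auto intro: polys_zero polys_add)

lemma monomial_in_polys: "(\<Sum>i\<in>UNIV. \<alpha> i) \<le> k \<Longrightarrow> monomial \<alpha> \<in> polys_of_degree_le k"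
proof -
  assume a: "(\<Sum>i\<in>UNIV. \<alpha> i) \<le> k"
  show ?thesis
    unfolding polys_altdef
  proof (intro exI[of _ "\<lambda>\<beta>. if \<beta> = \<alpha> then 1 else 0"] allI)
    fix x
    show "monomial \<alpha> x = (\<Sum>\<beta> | (\<Sum>i\<in>UNIV. \<beta> i) \<le> k. (if \<beta> = \<alpha> then 1 else 0) * monomial \<beta> x)"
    proof -
      have "(\<Sum>\<beta> | (\<Sum>i\<in>UNIV. \<beta> i) \<le> k. (if \<beta> = \<alpha> then 1 else 0) * monomial \<beta> x)
          = (\<Sum>\<beta> | (\<Sum>i\<in>UNIV. \<beta> i) \<le> k. if \<beta> = \<alpha> then monomial \<beta> x else 0)"
        by (rule sum.cong) auto
      also have "\<dots> = monomial \<alpha> x"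
        unfolding sum.delta[OF finite_multi_indices] using a by simp
      finally show ?thesis by (rule sym)
    qed
  qed
qed

text \<open>Lets statements that are linear in p be checked on monomials. Membership of the partial
  sums is proved alongside because the addition case assumes it.\<close>

lemma polys_induct [consumes 1, case_names monomial add cmult zero]:
  assumes "p \<in> polys_of_degree_le k"
    and monomial: "\<And>\<alpha>. (\<Sum>i\<in>UNIV. \<alpha> i) \<le> k \<Longrightarrow> P (monomial \<alpha>)"
    and add: "\<And>p q. p \<in> polys_of_degree_le k \<Longrightarrow> q \<in> polys_of_degree_le k \<Longrightarrow> P p \<Longrightarrow> P q \<Longrightarrow> P (\<lambda>x. p x + q x)"
    and cmult: "\<And>c p. p \<in> polys_of_degree_le k \<Longrightarrow> P p \<Longrightarrow> P (\<lambda>x. c * p x)"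
    and zero: "P (\<lambda>x. 0)"
  shows "P p"
proof -
  obtain c where c: "\<forall>x. p x = (\<Sum>\<alpha> | (\<Sum>i\<in>UNIV. \<alpha> i) \<le> k. c \<alpha> * monomial \<alpha> x)"
    using assms(1) unfolding polys_altdef by blast
  have "P (\<lambda>x. \<Sum>\<alpha>\<in>A. c \<alpha> * monomial \<alpha> x) \<and> (\<lambda>x. \<Sum>\<alpha>\<in>A. c \<alpha> * monomial \<alpha> x) \<in> polys_of_degree_le k"
    if "finite A" "A \<subseteq> {\<alpha>. (\<Sum>i\<in>UNIV. \<alpha> i) \<le> k}" for A
    using that
  proof (induction rule: finite_induct)
    case (insert \<alpha> A)
    have 1: "monomial \<alpha> \<in> polys_of_degree_le k" "P (monomial \<alpha>)" using insert.prems by (auto intro: monomial_in_polys monomial)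
    have 2: "P (\<lambda>x. \<Sum>\<alpha>\<in>A. c \<alpha> * monomial \<alpha> x)" "(\<lambda>x. \<Sum>\<alpha>\<in>A. c \<alpha> * monomial \<alpha> x) \<in> polys_of_degree_le k"
      using insert by auto
    have "P (\<lambda>x. c \<alpha> * monomial \<alpha> x + (\<Sum>\<alpha>\<in>A. c \<alpha> * monomial \<alpha> x))"
      by (rule add[OF polys_cmult[OF 1(1)] 2(2) cmult[OF 1] 2(1)])
    moreover have "(\<lambda>x. c \<alpha> * monomial \<alpha> x + (\<Sum>\<alpha>\<in>A. c \<alpha> * monomial \<alpha> x)) \<in> polys_of_degree_le k"
      by (rule polys_add[OF polys_cmult[OF 1(1)] 2(2)])
    ultimately show ?case using insert.hyps by simp
  qed (simp add: zero polys_zero)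
  from this[OF finite_multi_indices order_refl] have "P (\<lambda>x. \<Sum>\<alpha> | (\<Sum>i\<in>UNIV. \<alpha> i) \<le> k. c \<alpha> * monomial \<alpha> x)" by blast
  moreover have "p = (\<lambda>x. \<Sum>\<alpha> | (\<Sum>i\<in>UNIV. \<alpha> i) \<le> k. c \<alpha> * monomial \<alpha> x)" using c by auto
  ultimately show ?thesis by simp
qed

lemma polys_degree_mono:
  assumes "p \<in> polys_of_degree_le k" "k \<le> l"
  shows "p \<in> polys_of_degree_le l"
  using assms(1)
proof (induction rule: polys_induct)
  case (monomial \<alpha>)
  then show ?case using assms(2) by (intro monomial_in_polys) simp
qed (auto intro: polys_add polys_cmult polys_zero)

lemma monomial_mult_component: "x $ j * monomial \<alpha> x = monomial (\<alpha>(j := Suc (\<alpha> j))) x"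
proof -
  have "monomial (\<alpha>(j := Suc (\<alpha> j))) x = (x $ j) ^ Suc (\<alpha> j) * (\<Prod>i\<in>UNIV - {j}. (x $ i) ^ \<alpha> i)"
    unfolding monomial_def by (subst prod.remove[of _ j]) auto
  also have "\<dots> = x $ j * ((x $ j) ^ \<alpha> j * (\<Prod>i\<in>UNIV - {j}. (x $ i) ^ \<alpha> i))" by simp
  also have "(x $ j) ^ \<alpha> j * (\<Prod>i\<in>UNIV - {j}. (x $ i) ^ \<alpha> i) = monomial \<alpha> x"
    unfolding monomial_def by (rule prod.remove[symmetric]) auto
  finally show ?thesis by (rule sym)
qed

lemma sum_upd: "(\<Sum>i\<in>UNIV. (\<alpha>(j := n)) i) = n + (\<Sum>i\<in>UNIV - {j}. \<alpha> i)" for \<alpha> :: "'d::finite \<Rightarrow> nat"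
  by (subst sum.remove[of _ j]) auto

lemma sum_split: "(\<Sum>i\<in>UNIV. \<alpha> i) = \<alpha> j + (\<Sum>i\<in>UNIV - {j}. \<alpha> i)" for \<alpha> :: "'d::finite \<Rightarrow> nat"
  by (rule sum.remove) auto

lemma polys_mult_component:
  assumes "p \<in> polys_of_degree_le k"
  shows "(\<lambda>x. x $ j * p x) \<in> polys_of_degree_le (Suc k)"
  using assms
proof (induction rule: polys_induct)
  case (monomial \<alpha>)
  then show ?case
    unfolding monomial_mult_component by (intro monomial_in_polys) (simp add: sum_upd sum_split[of \<alpha> j] del: fun_upd_apply)
next
  case (add p q)
  then show ?case using polys_add[OF add(3,4)] by (simp add: distrib_left)
next
  case (cmult c p)
  then show ?case using polys_cmult[OF cmult(2), of c] by (simp add: mult_ac)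
qed (simp add: polys_zero)

lemma polys_mult_affine:
  assumes "p \<in> polys_of_degree_le k"
  shows "(\<lambda>x. (c + a \<bullet> x) * p x) \<in> polys_of_degree_le (Suc k)"
proof -
  have "(\<lambda>x. c * p x + (\<Sum>j\<in>UNIV. a $ j * (x $ j * p x))) \<in> polys_of_degree_le (Suc k)"
    by (intro polys_add polys_sum polys_cmult polys_mult_component assms finite polys_degree_mono[OF assms]) simp
  then show ?thesis by (simp add: inner_vec_def distrib_right sum_distrib_right mult.assoc)
qed

section \<open>Derivatives of polynomials and Euler's identity\<close>

definition dmonomial :: "'d::finite \<Rightarrow> ('d \<Rightarrow> nat) \<Rightarrow> real^'d \<Rightarrow> real" where
  "dmonomial j \<alpha> x = real (\<alpha> j) * monomial (\<alpha>(j := \<alpha> j - 1)) x"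

lemma monomial_has_derivative: "(monomial \<alpha> has_derivative (\<lambda>h. \<Sum>j\<in>UNIV. h $ j * dmonomial j \<alpha> x)) (at x)"
proof -
  have "((\<lambda>x. \<Prod>i\<in>UNIV. (x $ i) ^ \<alpha> i) has_derivative
      (\<lambda>h. \<Sum>j\<in>UNIV. (of_nat (\<alpha> j) * h $ j * (x $ j) ^ (\<alpha> j - 1)) * (\<Prod>i\<in>UNIV - {j}. (x $ i) ^ \<alpha> i))) (at x)"
    by (rule has_derivative_prod)
      (intro has_derivative_power bounded_linear_imp_has_derivative[OF bounded_linear_vec_nth])
  moreover have "(of_nat (\<alpha> j) * h $ j * (x $ j) ^ (\<alpha> j - 1)) * (\<Prod>i\<in>UNIV - {j}. (x $ i) ^ \<alpha> i) = h $ j * dmonomial j \<alpha> x" for h j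
  proof -
    have "monomial (\<alpha>(j := \<alpha> j - 1)) x = (x $ j) ^ (\<alpha> j - 1) * (\<Prod>i\<in>UNIV - {j}. (x $ i) ^ \<alpha> i)"
      unfolding monomial_def by (subst prod.remove[of _ j]) auto
    then show ?thesis by (simp add: dmonomial_def)
  qed
  ultimately show ?thesis unfolding monomial_def[abs_def] by (simp only:)
qed

lemma dmonomial_degree:
  assumes "(\<Sum>i\<in>UNIV. \<alpha> i) \<le> k"
  shows "dmonomial j \<alpha> \<in> polys_of_degree_le (k - 1)"
proof (cases "\<alpha> j = 0")
  case True
  then show ?thesis unfolding dmonomial_def[abs_def] by (simp add: polys_zero)
next
  case False
  show ?thesis
    unfolding dmonomial_def[abs_def] using assms False
    by (intro polys_cmult monomial_in_polys) (simp add: sum_upd sum_split[of \<alpha> j] del: fun_upd_apply)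
qed

lemma monomial_euler: "(\<Sum>j\<in>UNIV. x $ j * dmonomial j \<alpha> x) = real (\<Sum>i\<in>UNIV. \<alpha> i) * monomial \<alpha> x"
proof -
  have "x $ j * dmonomial j \<alpha> x = real (\<alpha> j) * monomial \<alpha> x" for j
  proof (cases "\<alpha> j = 0")
    case False
    have "x $ j * monomial (\<alpha>(j := \<alpha> j - 1)) x = monomial \<alpha> x"
      using False by (simp add: monomial_mult_component)
    then show ?thesis by (simp add: dmonomial_def)
  qed (simp add: dmonomial_def)
  then show ?thesis by (simp add: sum_distrib_right)
qed

text \<open>The terms of degree \<open>k + 1\<close> cancel because of Euler's identity for homogeneous polynomials.\<close>

lemma euler_degree_reduction:
  fixes p :: "real^'d::finite \<Rightarrow> real"
  assumes "p \<in> polys_of_degree_le k" "k \<ge> 1"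
    and A: "\<And>x. \<forall>j. A x $ j = A0 j + A1 j \<bullet> x" and Z: "\<And>x. Z x = Z0 + Z1 \<bullet> x"
  shows "\<exists>q. (\<forall>x. (p has_derivative (\<lambda>h. \<Sum>j\<in>UNIV. h $ j * q j x)) (at x)) \<and> (\<forall>j. q j \<in> polys_of_degree_le (k - 1)) \<and>
     (\<lambda>x. Z x * p x + (1 / real k) * (\<Sum>j\<in>UNIV. (A x - Z x *\<^sub>R x) $ j * q j x)) \<in> polys_of_degree_le k"
  using assms(1)
proof (induction rule: polys_induct)
  case (monomial \<alpha>)
  define m where "m = (\<Sum>i\<in>UNIV. \<alpha> i)"
  have m: "m \<le> k" using monomial by (simp add: m_def)
  have eq: "Z x * monomial \<alpha> x + (1 / real k) * (\<Sum>j\<in>UNIV. (A x - Z x *\<^sub>R x) $ j * dmonomial j \<alpha> x)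
     = (1 - real m / real k) * ((Z0 + Z1 \<bullet> x) * monomial \<alpha> x) + (1 / real k) * (\<Sum>j\<in>UNIV. (A0 j + A1 j \<bullet> x) * dmonomial j \<alpha> x)" for x
  proof -
    have "(\<Sum>j\<in>UNIV. (A x - Z x *\<^sub>R x) $ j * dmonomial j \<alpha> x) = (\<Sum>j\<in>UNIV. A x $ j * dmonomial j \<alpha> x) - Z x * (\<Sum>j\<in>UNIV. x $ j * dmonomial j \<alpha> x)"
      by (simp add: left_diff_distrib sum_subtractf sum_distrib_left mult.assoc)
    also have "\<dots> = (\<Sum>j\<in>UNIV. (A0 j + A1 j \<bullet> x) * dmonomial j \<alpha> x) - Z x * (real m * monomial \<alpha> x)"
      using A[of x] by (simp add: monomial_euler m_def)
    finally show ?thesis using Z[of x] assms(2) by (simp add: field_simps)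
  qed
  \<comment> \<open>For m = k the factor vanishes; for m < k the product with an affine function has
    degree m + 1, still at most k.\<close>
  have "(\<lambda>x. (1 - real m / real k) * ((Z0 + Z1 \<bullet> x) * monomial \<alpha> x)) \<in> polys_of_degree_le k"
  proof (cases "m = k")
    case True
    then show ?thesis using assms(2) by (simp add: polys_zero)
  next
    case False
    then have "(\<lambda>x. (Z0 + Z1 \<bullet> x) * monomial \<alpha> x) \<in> polys_of_degree_le (Suc m)"
      by (intro polys_mult_affine monomial_in_polys) (simp add: m_def)
    then have "(\<lambda>x. (Z0 + Z1 \<bullet> x) * monomial \<alpha> x) \<in> polys_of_degree_le k"
      by (rule polys_degree_mono) (use False m in simp)
    then show ?thesis by (rule polys_cmult)
  qed
  moreover have "(\<lambda>x. (1 / real k) * (\<Sum>j\<in>UNIV. (A0 j + A1 j \<bullet> x) * dmonomial j \<alpha> x)) \<in> polys_of_degree_le k"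
    using polys_mult_affine[OF dmonomial_degree[of \<alpha> k]] monomial assms(2)
    by (intro polys_cmult polys_sum) auto
  ultimately have "(\<lambda>x. Z x * monomial \<alpha> x + (1 / real k) * (\<Sum>j\<in>UNIV. (A x - Z x *\<^sub>R x) $ j * dmonomial j \<alpha> x)) \<in> polys_of_degree_le k"
    unfolding eq by (rule polys_add)
  then show ?case using monomial_has_derivative dmonomial_degree[OF monomial] by (intro exI[of _ "\<lambda>j. dmonomial j \<alpha>"]) blast
next
  case (add p1 p2)
  obtain q1 where q1: "\<And>x. (p1 has_derivative (\<lambda>h. \<Sum>j\<in>UNIV. h $ j * q1 j x)) (at x)" "\<And>j. q1 j \<in> polys_of_degree_le (k - 1)"
     "(\<lambda>x. Z x * p1 x + (1 / real k) * (\<Sum>j\<in>UNIV. (A x - Z x *\<^sub>R x) $ j * q1 j x)) \<in> polys_of_degree_le k"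
    using add(3) by blast
  obtain q2 where q2: "\<And>x. (p2 has_derivative (\<lambda>h. \<Sum>j\<in>UNIV. h $ j * q2 j x)) (at x)" "\<And>j. q2 j \<in> polys_of_degree_le (k - 1)"
     "(\<lambda>x. Z x * p2 x + (1 / real k) * (\<Sum>j\<in>UNIV. (A x - Z x *\<^sub>R x) $ j * q2 j x)) \<in> polys_of_degree_le k"
    using add(4) by blast
  have "((\<lambda>x. p1 x + p2 x) has_derivative (\<lambda>h. \<Sum>j\<in>UNIV. h $ j * (q1 j x + q2 j x))) (at x)" for x
    using has_derivative_add[OF q1(1) q2(1)] by (simp add: distrib_left sum.distrib)
  moreover have "(\<lambda>x. Z x * (p1 x + p2 x) + (1 / real k) * (\<Sum>j\<in>UNIV. (A x - Z x *\<^sub>R x) $ j * (q1 j x + q2 j x))) \<in> polys_of_degree_le k"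
    using polys_add[OF q1(3) q2(3)] by (simp only: distrib_left sum.distrib add_ac)
  ultimately show ?case using polys_add[OF q1(2) q2(2)] by (intro exI[of _ "\<lambda>j x. q1 j x + q2 j x"]) blast
next
  case (cmult c p1)
  obtain q1 where q1: "\<And>x. (p1 has_derivative (\<lambda>h. \<Sum>j\<in>UNIV. h $ j * q1 j x)) (at x)" "\<And>j. q1 j \<in> polys_of_degree_le (k - 1)"
     "(\<lambda>x. Z x * p1 x + (1 / real k) * (\<Sum>j\<in>UNIV. (A x - Z x *\<^sub>R x) $ j * q1 j x)) \<in> polys_of_degree_le k"
    using cmult(2) by blast
  have "((\<lambda>x. c * p1 x) has_derivative (\<lambda>h. \<Sum>j\<in>UNIV. h $ j * (c * q1 j x))) (at x)" for x
    using has_derivative_mult_right[OF q1(1), of c] by (simp add: sum_distrib_left mult_ac)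
  moreover have "(\<lambda>x. Z x * (c * p1 x) + (1 / real k) * (\<Sum>j\<in>UNIV. (A x - Z x *\<^sub>R x) $ j * (c * q1 j x))) \<in> polys_of_degree_le k"
    using polys_cmult[OF q1(3), of c] by (simp only: distrib_left sum_distrib_left mult.left_commute[of _ c])
  ultimately show ?case using polys_cmult[OF q1(2)] by (intro exI[of _ "\<lambda>j x. c * q1 j x"]) blast
next
  case zero
  show ?case by (intro exI[of _ "\<lambda>j x. 0"]) (simp add: polys_zero)
qed

section \<open>Inverse inequality\<close>

text \<open>Solvability of a Vandermonde system for arbitrary moments \<Lambda>, by induction on the
  number of nodes instead of a determinant: with a the new node, the products of the weight with
  \<theta> n - a must have the moments \<Lambda> (j + 1) - a \<Lambda> j on the old nodes.\<close>

lemma quadrature_weights_exist: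
  fixes \<theta> :: "nat \<Rightarrow> real"
  assumes "inj_on \<theta> {..k}"
  shows "\<exists>w. \<forall>j\<le>k. (\<Sum>n\<le>k. w n * \<theta> n ^ j) = \<Lambda> j"
  using assms
proof (induction k arbitrary: \<Lambda>)
  case 0
  show ?case by (intro exI[of _ "\<lambda>_. \<Lambda> 0"]) simp
next
  case (Suc k)
  let ?a = "\<theta> (Suc k)"
  have "inj_on \<theta> {..k}" using Suc.prems by (rule inj_on_subset) auto
  then obtain w where w: "\<And>j. j \<le> k \<Longrightarrow> (\<Sum>n\<le>k. w n * \<theta> n ^ j) = \<Lambda> (Suc j) - ?a * \<Lambda> j"
    using Suc.IH[of "\<lambda>j. \<Lambda> (Suc j) - ?a * \<Lambda> j"] by blast
  have ne: "\<theta> n \<noteq> ?a" if "n \<le> k" for n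
    using inj_onD[OF Suc.prems, of n "Suc k"] that by auto
  \<comment> \<open>The weight of the new node drops out of those conditions and is fixed by the
    moment of order 0.\<close>
  define u where "u n = (if n = Suc k then \<Lambda> 0 - (\<Sum>n\<le>k. w n / (\<theta> n - ?a)) else w n / (\<theta> n - ?a))" for n
  have ind: "(\<Sum>n\<le>Suc k. u n * \<theta> n ^ j) = \<Lambda> j" if "j \<le> Suc k" for j
    using that
  proof (induction j)
    case 0
    have "(\<Sum>n\<le>k. u n) = (\<Sum>n\<le>k. w n / (\<theta> n - ?a))" by (rule sum.cong) (auto simp: u_def)
    then show ?case by (simp add: u_def)
  next
    case (Suc j)
    have "(\<Sum>n\<le>Suc k. u n * \<theta> n ^ Suc j) - ?a * (\<Sum>n\<le>Suc k. u n * \<theta> n ^ j) = (\<Sum>n\<le>Suc k. u n * (\<theta> n - ?a) * \<theta> n ^ j)"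
      unfolding sum_distrib_left sum_subtractf[symmetric] by (rule sum.cong) (auto simp: algebra_simps)
    also have "\<dots> = (\<Sum>n\<le>k. u n * (\<theta> n - ?a) * \<theta> n ^ j)" by simp
    also have "\<dots> = (\<Sum>n\<le>k. w n * \<theta> n ^ j)" by (rule sum.cong) (use ne in \<open>auto simp: u_def\<close>)
    also have "\<dots> = \<Lambda> (Suc j) - ?a * \<Lambda> j" using Suc.prems by (intro w) simp
    finally show ?case using Suc by simp
  qed
  then show ?case by blast
qed

lemma polys_on_line:
  fixes p :: "real^'d::finite \<Rightarrow> real"
  assumes "p \<in> polys_of_degree_le k"
  shows "\<exists>b. \<forall>t. p (c + t *\<^sub>R y) = (\<Sum>j\<le>k. b j * t ^ j)"
  using assms
proof (induction rule: polys_induct)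
  case (monomial \<alpha>)
  \<comment> \<open>The restriction to the line as a univariate polynomial; each factor has degree
    at most its exponent.\<close>
  define q where "q = (\<Prod>i\<in>UNIV. [:c $ i, y $ i:] ^ \<alpha> i)"
  have "degree q \<le> (\<Sum>i\<in>UNIV. degree ([:c $ i, y $ i:] ^ \<alpha> i))"
    unfolding q_def by (rule order_trans[OF degree_prod_sum_le]) (auto simp: o_def)
  also have "\<dots> \<le> (\<Sum>i\<in>UNIV. \<alpha> i)"
  proof (rule sum_mono)
    fix i
    have "degree ([:c $ i, y $ i:] ^ \<alpha> i) \<le> degree [:c $ i, y $ i:] * \<alpha> i" by (rule degree_power_le)
    also have "\<dots> \<le> 1 * \<alpha> i" by (intro mult_right_mono) auto
    finally show "degree ([:c $ i, y $ i:] ^ \<alpha> i) \<le> \<alpha> i" by simp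
  qed
  finally have d: "degree q \<le> k" using monomial by simp
  have "monomial \<alpha> (c + t *\<^sub>R y) = (\<Sum>j\<le>k. coeff q j * t ^ j)" for t
  proof -
    have "monomial \<alpha> (c + t *\<^sub>R y) = poly q t"
      unfolding q_def monomial_def by (simp add: poly_prod)
    also have "\<dots> = (\<Sum>j\<le>k. coeff q j * t ^ j)"
      unfolding poly_altdef by (rule sum.mono_neutral_left) (use d in \<open>auto intro: coeff_eq_0\<close>)
    finally show ?thesis .
  qed
  then show ?case by blast
next
  case (add p q)
  obtain b where b: "\<And>t. p (c + t *\<^sub>R y) = (\<Sum>j\<le>k. b j * t ^ j)" using add(3) by blast
  obtain b' where b': "\<And>t. q (c + t *\<^sub>R y) = (\<Sum>j\<le>k. b' j * t ^ j)" using add(4) by blast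
  show ?case by (intro exI[of _ "\<lambda>j. b j + b' j"]) (simp add: b b' distrib_right sum.distrib)
next
  case (cmult a p)
  obtain b where b: "\<And>t. p (c + t *\<^sub>R y) = (\<Sum>j\<le>k. b j * t ^ j)" using cmult(2) by blast
  show ?case by (intro exI[of _ "\<lambda>j. a * b j"]) (simp add: b sum_distrib_left mult.assoc)
next
  case zero
  show ?case by (intro exI[of _ "\<lambda>_. 0"]) simp
qed

text \<open>Extrapolation: on a line p is a polynomial in one variable, so its value at c + y is a
  fixed combination of its values at points pulled towards c by the factors \<theta>.\<close>

lemma quadrature_on_line:
  fixes p :: "real^'d::finite \<Rightarrow> real"
  assumes "p \<in> polys_of_degree_le k" "\<And>j. j \<le> k \<Longrightarrow> (\<Sum>n\<le>k. w n * \<theta> n ^ j) = 1"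
  shows "p (c + y) = (\<Sum>n\<le>k. w n * p (c + \<theta> n *\<^sub>R y))"
proof -
  obtain b where b: "\<And>t. p (c + t *\<^sub>R y) = (\<Sum>j\<le>k. b j * t ^ j)" using polys_on_line[OF assms(1)] by blast
  have "(\<Sum>n\<le>k. w n * p (c + \<theta> n *\<^sub>R y)) = (\<Sum>n\<le>k. \<Sum>j\<le>k. b j * (w n * \<theta> n ^ j))"
    by (simp add: b sum_distrib_left mult_ac)
  also have "\<dots> = (\<Sum>j\<le>k. b j * (\<Sum>n\<le>k. w n * \<theta> n ^ j))"
    by (subst sum.swap) (simp add: sum_distrib_left)
  also have "\<dots> = (\<Sum>j\<le>k. b j)" using assms(2) by simp
  also have "\<dots> = p (c + y)" using b[of 1] by simp
  finally show ?thesis by simp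
qed

text \<open>A finite difference formula that is exact up to degree k: the weights v single out the
  coefficient of t.\<close>

lemma derivative_quadrature_on_line:
  fixes p :: "real^'d::finite \<Rightarrow> real"
  assumes p: "p \<in> polys_of_degree_le k" "k \<ge> 1" and v: "\<And>j. j \<le> k \<Longrightarrow> (\<Sum>m\<le>k. v m * real m ^ j) = (if j = 1 then 1 else 0)"
    and d: "(p has_derivative D) (at x)"
  shows "D y = (\<Sum>m\<le>k. v m * p (x + real m *\<^sub>R y))"
proof -
  obtain b where b: "\<And>t. p (x + t *\<^sub>R y) = (\<Sum>j\<le>k. b j * t ^ j)" using polys_on_line[OF p(1)] by blast
  have "(\<Sum>m\<le>k. v m * p (x + real m *\<^sub>R y)) = (\<Sum>m\<le>k. \<Sum>j\<le>k. b j * (v m * real m ^ j))"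
    by (simp add: b sum_distrib_left mult_ac)
  also have "\<dots> = (\<Sum>j\<le>k. b j * (\<Sum>m\<le>k. v m * real m ^ j))"
    by (subst sum.swap) (simp add: sum_distrib_left)
  also have "\<dots> = (\<Sum>j\<le>k. if j = 1 then b j else 0)" by (rule sum.cong) (simp_all add: v)
  also have "\<dots> = b 1" using p(2) by simp
  finally have e: "(\<Sum>m\<le>k. v m * p (x + real m *\<^sub>R y)) = b 1" .
  have d0: "(p has_derivative D) (at (x + 0 *\<^sub>R y))" using d by simp
  have "((\<lambda>t. p (x + t *\<^sub>R y)) has_derivative (\<lambda>t. D (t *\<^sub>R y))) (at 0)"
    by (rule has_derivative_compose[where f="\<lambda>t. x + t *\<^sub>R y", OF _ d0]) (auto intro!: derivative_eq_intros)
  moreover have "((\<lambda>t. p (x + t *\<^sub>R y)) has_derivative (\<lambda>t. t * b 1)) (at 0)"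
  proof -
    have "((\<lambda>t. \<Sum>j\<le>k. b j * t ^ j) has_real_derivative (\<Sum>j\<le>k. b j * (real j * 0 ^ (j - 1)))) (at 0)"
      by (auto intro!: derivative_eq_intros sum.cong simp: mult_ac)
    also have "(\<Sum>j\<le>k. b j * (real j * 0 ^ (j - 1))) = (\<Sum>j\<le>k. if j = 1 then b j else 0)"
      by (rule sum.cong) auto
    also have "\<dots> = b 1" using p(2) by simp
    finally have "((\<lambda>t. \<Sum>j\<le>k. b j * t ^ j) has_derivative (*) (b 1)) (at 0)" unfolding has_field_derivative_def .
    moreover have "(*) (b 1) = (\<lambda>t. t * b 1)" by (simp add: fun_eq_iff)
    ultimately show ?thesis unfolding b by (simp only:)
  qed
  ultimately have "(\<lambda>t. D (t *\<^sub>R y)) = (\<lambda>t. t * b 1)" by (rule has_derivative_unique)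
  from fun_cong[OF this, of 1] have "D y = b 1" by simp
  then show ?thesis using e by simp
qed

lemma lborel_integral_affine:
  fixes f :: "'a::euclidean_space \<Rightarrow> real"
  assumes f: "f \<in> borel_measurable borel" and c: "c > 0"
  shows "integral\<^sup>L lborel (\<lambda>x. f (t + c *\<^sub>R x)) = inverse (c ^ DIM('a)) * integral\<^sup>L lborel f"
    and "integrable lborel f \<Longrightarrow> integrable lborel (\<lambda>x. f (t + c *\<^sub>R x))"
proof -
  have m: "(\<lambda>x. t + c *\<^sub>R x) \<in> measurable lborel borel" by measurable
  have "integral\<^sup>L lborel f = integral\<^sup>L (density (distr lborel borel (\<lambda>x. t + c *\<^sub>R x)) (\<lambda>_. ennreal (\<bar>c\<bar> ^ DIM('a)))) f"
    using lborel_affine[of c t] c by simp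
  also have "\<dots> = integral\<^sup>L (distr lborel borel (\<lambda>x. t + c *\<^sub>R x)) (\<lambda>x. (c ^ DIM('a)) *\<^sub>R f x)"
    using f c by (subst integral_density) (auto)
  also have "\<dots> = c ^ DIM('a) * integral\<^sup>L lborel (\<lambda>x. f (t + c *\<^sub>R x))"
    using f by (subst integral_distr[OF m]) auto
  finally show "integral\<^sup>L lborel (\<lambda>x. f (t + c *\<^sub>R x)) = inverse (c ^ DIM('a)) * integral\<^sup>L lborel f"
    using c by simp
  assume i: "integrable lborel f"
  then have "integrable (density (distr lborel borel (\<lambda>x. t + c *\<^sub>R x)) (\<lambda>_. ennreal (\<bar>c\<bar> ^ DIM('a)))) f"
    using lborel_affine[of c t] c by simp
  then have "integrable (distr lborel borel (\<lambda>x. t + c *\<^sub>R x)) (\<lambda>x. (c ^ DIM('a)) *\<^sub>R f x)"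
    using f c by (subst (asm) integrable_density) auto
  then have "integrable lborel (\<lambda>x. (c ^ DIM('a)) *\<^sub>R f (t + c *\<^sub>R x))"
    using f by (subst (asm) integrable_distr_eq[OF m]) auto
  then show "integrable lborel (\<lambda>x. f (t + c *\<^sub>R x))"
    using c by simp
qed

lemma polys_continuous:
  assumes "p \<in> polys_of_degree_le k"
  shows "continuous_on S p"
  using assms
proof (induction rule: polys_induct)
  case (monomial \<alpha>)
  show ?case unfolding monomial_def[abs_def] by (intro continuous_intros)
qed (auto intro!: continuous_intros)

lemma integrable_on_cball:
  fixes f :: "'a::euclidean_space \<Rightarrow> real"
  assumes "continuous_on UNIV f"
  shows "integrable lborel (\<lambda>x. indicat_real (cball c r) x * f x)"
proof -
  have "integrable lborel (\<lambda>x. indicat_real (cball c r) x *\<^sub>R f x)"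
    by (rule borel_integrable_compact) (auto intro: continuous_on_subset[OF assms])
  then show ?thesis by simp
qed

text \<open>A derivative at x is a combination of values of p at the points x + m y, and each such
  value is extrapolated from a point of the small ball; Cauchy-Schwarz and a change of variables
  then give the claim. The constant depends on k, \<kappa> and the dimension, not on p, the centre
  or the radii: concentric balls take the place of a reference element.\<close>

lemma inverse_inequality:
  assumes "k \<ge> 1"
  obtains C where "C \<ge> 0"
    "\<And>(p :: real^'d::finite \<Rightarrow> real) q c r \<delta> i. p \<in> polys_of_degree_le k \<Longrightarrow>
       (\<And>x. (p has_derivative (\<lambda>h. \<Sum>j\<in>UNIV. h $ j * q j x)) (at x)) \<Longrightarrow> continuous_on UNIV (q i) \<Longrightarrow>
       0 < r \<Longrightarrow> 0 < \<delta> \<Longrightarrow> \<delta> \<le> \<kappa> * r \<Longrightarrow>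
       integral\<^sup>L lborel (\<lambda>x. indicat_real (cball c \<delta>) x * (\<delta> * q i x)\<^sup>2)
       \<le> C * integral\<^sup>L lborel (\<lambda>x. indicat_real (cball c r) x * (p x)\<^sup>2)"
proof -
  define \<kappa>' where "\<kappa>' = max \<kappa> 1"
  have \<kappa>': "\<kappa>' > 0" "\<kappa> \<le> \<kappa>'" by (auto simp: \<kappa>'_def)
  \<comment> \<open>Distinct factors with
    \<open>\<theta> n * (real k + 1) \<le> inverse \<kappa>'\<close>: points within distance (k + 1)
    \<delta> of c are pulled into the ball of radius r.\<close>
  define \<theta> where "\<theta> n = inverse (\<kappa>' * (real k + 1) * (real n + 1))" for n :: nat
  have \<theta>pos: "\<theta> n > 0" for n using \<kappa>' by (simp add: \<theta>_def add_pos_pos)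
  have \<theta>le: "\<theta> n * (real k + 1) \<le> inverse \<kappa>'" for n
  proof -
    have "\<theta> n * (real k + 1) = inverse \<kappa>' * inverse (real n + 1)"
    proof -
      have "\<theta> n * (real k + 1) = inverse \<kappa>' * inverse (real n + 1) * (inverse (real k + 1) * (real k + 1))"
        by (simp only: \<theta>_def inverse_mult_distrib mult_ac)
      moreover have "inverse (real k + 1) * (real k + 1) = 1" by (rule left_inverse) linarith
      ultimately show ?thesis by simp
    qed
    also have "\<dots> \<le> inverse \<kappa>' * 1" using \<kappa>' by (intro mult_left_mono) (auto simp: inverse_le_1_iff)
    finally show ?thesis by simp
  qed
  have "inj_on \<theta> {..k}"
    using \<kappa>' by (intro inj_onI) (auto simp: \<theta>_def)
  then obtain w where w: "\<And>j. j \<le> k \<Longrightarrow> (\<Sum>n\<le>k. w n * \<theta> n ^ j) = 1"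
    using quadrature_weights_exist[of \<theta> k "\<lambda>_. 1"] by blast
  have "inj_on real {..k}" by (rule inj_on_of_nat)
  then obtain v where v: "\<And>j. j \<le> k \<Longrightarrow> (\<Sum>m\<le>k. v m * real m ^ j) = (if j = 1 then 1 else 0)"
    using quadrature_weights_exist[of real k "\<lambda>j. if j = 1 then 1 else 0"] by blast
  define I where "I = {..k} \<times> {..k}"
  define a where "a = (\<lambda>(m, n). v m * w n)"
  define A where "A = (\<Sum>z\<in>I. (a z)\<^sup>2)"
  \<comment> \<open>A comes from Cauchy-Schwarz over the weights, the inverse powers of \<theta>
    from the Jacobians of the contractions.\<close>
  define C where "C = A * (\<Sum>z\<in>I. inverse (\<theta> (snd z) ^ DIM(real^'d)))"
  have A0: "A \<ge> 0" unfolding A_def by (intro sum_nonneg) simp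
  show ?thesis
  proof (rule that[of C])
    show "C \<ge> 0" unfolding C_def using A0 \<theta>pos by (intro mult_nonneg_nonneg sum_nonneg) (auto intro: less_imp_le)
    fix p :: "real^'d \<Rightarrow> real" and q c r \<delta> i
    assume p: "p \<in> polys_of_degree_le k" and q: "\<And>x. (p has_derivative (\<lambda>h. \<Sum>j\<in>UNIV. h $ j * q j x)) (at x)"
      and qc: "continuous_on UNIV (q i)" and r: "0 < r" and \<delta>: "0 < \<delta>" "\<delta> \<le> \<kappa> * r"
    define y where "y = \<delta> *\<^sub>R (axis i 1 :: real^'d)"
    \<comment> \<open>The contraction of x + m y towards c, written as a translation plus a dilation
      of x to fit \<open>lborel_integral_affine\<close>.\<close>
    define P where "P = (\<lambda>(m :: nat, n) x. (c + \<theta> n *\<^sub>R (real m *\<^sub>R y - c)) + \<theta> n *\<^sub>R x)"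
    have rep: "\<delta> * q i x = (\<Sum>z\<in>I. a z * p (P z x))" for x
    proof -
      have "\<delta> * q i x = (\<Sum>j\<in>UNIV. y $ j * q j x)"
        unfolding y_def vector_scaleR_component real_scaleR_def mult.assoc sum_distrib_left[symmetric] sum_axis ..
      also have "\<dots> = (\<Sum>m\<le>k. v m * p (x + real m *\<^sub>R y))"
        by (rule derivative_quadrature_on_line[OF p assms v q])
      also have "\<dots> = (\<Sum>m\<le>k. \<Sum>n\<le>k. v m * (w n * p (c + \<theta> n *\<^sub>R (x + real m *\<^sub>R y - c))))"
      proof (rule sum.cong[OF refl])
        fix m
        have "p (x + real m *\<^sub>R y) = (\<Sum>n\<le>k. w n * p (c + \<theta> n *\<^sub>R (x + real m *\<^sub>R y - c)))"
          using quadrature_on_line[OF p w, of c "x + real m *\<^sub>R y - c"] by simp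
        then show "v m * p (x + real m *\<^sub>R y) = (\<Sum>n\<le>k. v m * (w n * p (c + \<theta> n *\<^sub>R (x + real m *\<^sub>R y - c))))"
          by (simp add: sum_distrib_left)
      qed
      also have "\<dots> = (\<Sum>z\<in>I. a z * p (P z x))"
        unfolding I_def sum.cartesian_product by (rule sum.cong) (auto simp: a_def P_def algebra_simps)
      finally show ?thesis .
    qed
    define f where "f x = indicat_real (cball c r) x * (p x)\<^sup>2" for x
    have fi: "integrable lborel f"
      unfolding f_def[abs_def] by (intro integrable_on_cball continuous_intros polys_continuous[OF p])
    have fm: "f \<in> borel_measurable borel" using fi by auto
    have fP: "integrable lborel (\<lambda>x. f (P z x))"
      "integral\<^sup>L lborel (\<lambda>x. f (P z x)) = inverse (\<theta> (snd z) ^ DIM(real^'d)) * integral\<^sup>L lborel f" for z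
      unfolding P_def split_beta
      using lborel_integral_affine(2)[OF fm \<theta>pos fi] lborel_integral_affine(1)[OF fm \<theta>pos] by auto
    have inb: "P z x \<in> cball c r" if xz: "x \<in> cball c \<delta>" "z \<in> I" for x z
    proof -
      obtain m n where z: "z = (m, n)" "m \<le> k" "n \<le> k" using xz(2) by (auto simp: I_def)
      have "P z x - c = \<theta> n *\<^sub>R (x - c + real m *\<^sub>R y)" by (simp add: z P_def algebra_simps)
      then have "norm (P z x - c) = \<theta> n * norm (x - c + real m *\<^sub>R y)" using \<theta>pos[of n] by simp
      also have "\<dots> \<le> \<theta> n * (\<delta> + real k * \<delta>)"
      proof (intro mult_left_mono norm_triangle_le add_mono)
        show "norm (x - c) \<le> \<delta>" using xz(1) by (simp add: dist_norm norm_minus_commute)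
        show "norm (real m *\<^sub>R y) \<le> real k * \<delta>" using z(2) \<delta>(1) by (simp add: y_def mult_right_mono)
      qed (use \<theta>pos[of n] in simp)
      also have "\<dots> = (\<theta> n * (real k + 1)) * \<delta>" by (simp add: algebra_simps)
      also have "\<dots> \<le> inverse \<kappa>' * \<delta>" using \<theta>le[of n] \<delta>(1) by (intro mult_right_mono) auto
      also have "\<dots> \<le> r"
      proof -
        have "\<delta> \<le> \<kappa>' * r" using \<delta>(2) mult_right_mono[OF \<kappa>'(2), of r] r by linarith
        then show ?thesis using \<kappa>'(1) by (simp add: field_simps)
      qed
      finally show ?thesis by (simp add: dist_norm norm_minus_commute)
    qed
    have "integral\<^sup>L lborel (\<lambda>x. indicat_real (cball c \<delta>) x * (\<delta> * q i x)\<^sup>2) \<le> integral\<^sup>L lborel (\<lambda>x. A * (\<Sum>z\<in>I. f (P z x)))"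
    proof (rule integral_mono)
      show "integrable lborel (\<lambda>x. indicat_real (cball c \<delta>) x * (\<delta> * q i x)\<^sup>2)"
        by (intro integrable_on_cball continuous_intros qc)
      show "integrable lborel (\<lambda>x. A * (\<Sum>z\<in>I. f (P z x)))" using fP(1) by simp
      fix x
      have f0: "f (P z x) \<ge> 0" for z by (simp add: f_def)
      show "indicat_real (cball c \<delta>) x * (\<delta> * q i x)\<^sup>2 \<le> A * (\<Sum>z\<in>I. f (P z x))"
      proof (cases "x \<in> cball c \<delta>")
        case True
        have "(\<delta> * q i x)\<^sup>2 \<le> A * (\<Sum>z\<in>I. (p (P z x))\<^sup>2)"
          unfolding rep A_def by (rule Cauchy_Schwarz_ineq_sum)
        also have "(\<Sum>z\<in>I. (p (P z x))\<^sup>2) = (\<Sum>z\<in>I. f (P z x))"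
          by (rule sum.cong) (use inb[OF True] in \<open>auto simp: f_def\<close>)
        finally show ?thesis using True by simp
      next
        case False
        then show ?thesis using A0 f0 by (auto intro!: mult_nonneg_nonneg sum_nonneg)
      qed
    qed
    also have "\<dots> = C * integral\<^sup>L lborel f"
      using fP by (simp add: C_def sum_distrib_right)
    finally show "integral\<^sup>L lborel (\<lambda>x. indicat_real (cball c \<delta>) x * (\<delta> * q i x)\<^sup>2)
       \<le> C * integral\<^sup>L lborel (\<lambda>x. indicat_real (cball c r) x * (p x)\<^sup>2)"
      unfolding f_def[abs_def] .
  qed
qed

section \<open>Lipschitz domains\<close>

definition drop_dir :: "real^'d::finite \<Rightarrow> real^'d \<Rightarrow> real^'d" where
  "drop_dir n y = y - (y \<bullet> n) *\<^sub>R n"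

lemma drop_dir:
  assumes "norm n = 1"
  shows "drop_dir n y \<bullet> n = 0" "drop_dir n (y + s *\<^sub>R n) = drop_dir n y" "(y + s *\<^sub>R n) \<bullet> n = y \<bullet> n + s"
    "norm (drop_dir n x - drop_dir n y) \<le> norm (x - y)"
proof -
  have nn: "n \<bullet> n = 1" using assms by (simp add: norm_eq_1)
  show "drop_dir n y \<bullet> n = 0" "drop_dir n (y + s *\<^sub>R n) = drop_dir n y" "(y + s *\<^sub>R n) \<bullet> n = y \<bullet> n + s"
    by (simp_all add: drop_dir_def inner_diff_left inner_add_left nn algebra_simps)
  define w where "w = x - y"
  have e: "drop_dir n x - drop_dir n y = w - (w \<bullet> n) *\<^sub>R n" by (simp add: drop_dir_def w_def inner_diff_left algebra_simps)
  have "(norm (w - (w \<bullet> n) *\<^sub>R n))\<^sup>2 = (norm w)\<^sup>2 - (w \<bullet> n)\<^sup>2"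
    unfolding power2_norm_eq_inner by (simp add: inner_diff_left inner_diff_right nn inner_commute power2_eq_square)
  then have "(norm (w - (w \<bullet> n) *\<^sub>R n))\<^sup>2 \<le> (norm w)\<^sup>2" by simp
  then have "norm (w - (w \<bullet> n) *\<^sub>R n) \<le> norm w" by (rule power2_le_imp_le) simp
  then show "norm (drop_dir n x - drop_dir n y) \<le> norm (x - y)" unfolding e w_def .
qed

lemma lipschitz_boundaryE:
  fixes \<Omega> :: "(real^'d::finite) set"
  assumes "lipschitz_boundary \<Omega>" "a \<in> frontier \<Omega>"
  obtains r n L \<gamma> where "r > 0" "norm n = 1" "L \<ge> 0"
    "\<And>x y. \<bar>\<gamma> (drop_dir n x) - \<gamma> (drop_dir n y)\<bar> \<le> L * norm (x - y)"
    "\<And>y. y \<in> ball a r \<Longrightarrow> y \<in> \<Omega> \<longleftrightarrow> y \<bullet> n > \<gamma> (drop_dir n y)"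
proof -
  obtain r n L \<gamma> where r: "r > 0" "norm n = 1" and l: "L-lipschitz_on {y. y \<bullet> n = 0} \<gamma>"
    and e: "\<Omega> \<inter> ball a r = {y \<in> ball a r. y \<bullet> n > \<gamma> (y - (y \<bullet> n) *\<^sub>R n)}"
    using assms unfolding lipschitz_boundary_def by blast
  show ?thesis
  proof (rule that[OF r])
    show L: "L \<ge> 0" using l by (rule lipschitz_on_nonneg)
    show "\<bar>\<gamma> (drop_dir n x) - \<gamma> (drop_dir n y)\<bar> \<le> L * norm (x - y)" for x y
    proof -
      have "dist (\<gamma> (drop_dir n x)) (\<gamma> (drop_dir n y)) \<le> L * dist (drop_dir n x) (drop_dir n y)"
        by (rule lipschitz_onD[OF l]) (simp_all add: drop_dir(1)[OF r(2)])
      also have "\<dots> \<le> L * norm (x - y)"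
        unfolding dist_norm by (intro mult_left_mono drop_dir(4)[OF r(2)] L)
      finally show ?thesis by (simp add: dist_real_def)
    qed
    show "y \<in> \<Omega> \<longleftrightarrow> y \<bullet> n > \<gamma> (drop_dir n y)" if "y \<in> ball a r" for y
    proof -
      have "y \<in> \<Omega> \<inter> ball a r \<longleftrightarrow> y \<bullet> n > \<gamma> (drop_dir n y)" unfolding e drop_dir_def using that by simp
      then show ?thesis using that by simp
    qed
  qed
qed

text \<open>Near a boundary point the domain lies on one side of a graph, so points just below have
  neighbourhoods that miss \<Omega>; slits are excluded. Meshes cover the closure of \<Omega>, and
  this puts their open simplices into \<Omega> itself.\<close>

lemma interior_closure_lipschitz_boundary:
  fixes \<Omega> :: "(real^'d::finite) set"
  assumes "open \<Omega>" "lipschitz_boundary \<Omega>"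
  shows "interior (closure \<Omega>) \<subseteq> \<Omega>"
proof
  fix a assume a: "a \<in> interior (closure \<Omega>)"
  show "a \<in> \<Omega>"
  proof (rule ccontr)
    assume na: "a \<notin> \<Omega>"
    have "a \<in> closure \<Omega>" using a interior_subset by blast
    then have fr: "a \<in> frontier \<Omega>" using na assms(1) by (simp add: frontier_def interior_open)
    obtain r n L \<gamma> where r: "r > 0" and n: "norm n = 1" and L: "L \<ge> 0"
      and lip: "\<And>x y. \<bar>\<gamma> (drop_dir n x) - \<gamma> (drop_dir n y)\<bar> \<le> L * norm (x - y)"
      and mem: "\<And>y. y \<in> ball a r \<Longrightarrow> y \<in> \<Omega> \<longleftrightarrow> y \<bullet> n > \<gamma> (drop_dir n y)"
      by (rule lipschitz_boundaryE[OF assms(2) fr], rule that)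
    obtain e where e: "e > 0" "ball a e \<subseteq> closure \<Omega>" using a unfolding mem_interior by blast
    define s where "s = min e r / 2"
    have s: "s > 0" "s < e" "s < r" using e r by (auto simp: s_def)
    define y where "y = a + (- s) *\<^sub>R n"
    have yb: "y \<in> ball a e" "y \<in> ball a r" using s n by (auto simp: y_def dist_norm)
    have ya: "y \<bullet> n = a \<bullet> n - s" "drop_dir n y = drop_dir n a"
      unfolding y_def drop_dir(2)[OF n] drop_dir(3)[OF n] by simp_all
    have "a \<bullet> n \<le> \<gamma> (drop_dir n a)" using mem[of a] na r by simp
    then have lt: "y \<bullet> n < \<gamma> (drop_dir n y)" using ya s by simp
    define U where "U = {w \<in> ball a r. w \<bullet> n < \<gamma> (drop_dir n w)}"
    have c: "continuous_on UNIV (\<lambda>w. \<gamma> (drop_dir n w))"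
      by (rule lipschitz_on_continuous_on[OF lipschitz_onI[of UNIV _ L]]) (use lip L in \<open>auto simp: dist_norm\<close>)
    have "U = ball a r \<inter> {w. w \<bullet> n < \<gamma> (drop_dir n w)}" by (auto simp: U_def)
    moreover have "continuous_on UNIV (\<lambda>w. w \<bullet> n)" by (intro continuous_intros)
    ultimately have "open U" using open_Collect_less[OF _ c, of "\<lambda>w. w \<bullet> n"] by auto
    moreover have "y \<in> U" using yb lt by (simp add: U_def)
    moreover have "U \<inter> \<Omega> = {}" using mem by (auto simp: U_def)
    ultimately have "y \<notin> closure \<Omega>" by (metis IntI empty_iff open_Int_closure_eq_empty)
    then show False using e yb by auto
  qed
qed

text \<open>The straight segment between two points may leave \<Omega>. Lifting both by s, a
  multiple of their distance that exceeds what the graph can rise, gives a path of three segments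
  inside \<Omega> of comparable length.\<close>

lemma lipschitz_boundary_local_lipschitz:
  fixes \<Omega> :: "(real^'d::finite) set" and f :: "real^'d \<Rightarrow> real"
  assumes "lipschitz_boundary \<Omega>" "a \<in> frontier \<Omega>" "M \<ge> 0"
    "\<And>x y. closed_segment x y \<subseteq> \<Omega> \<Longrightarrow> \<bar>f x - f y\<bar> \<le> M * norm (x - y)"
  obtains r M' where "r > 0" "M' \<ge> 0" "\<And>x y. x \<in> \<Omega> \<inter> ball a r \<Longrightarrow> y \<in> \<Omega> \<inter> ball a r \<Longrightarrow> \<bar>f x - f y\<bar> \<le> M' * norm (x - y)"
proof -
  obtain r n L \<gamma> where r: "r > 0" and n: "norm n = 1" and L: "L \<ge> 0"
    and lip: "\<And>x y. \<bar>\<gamma> (drop_dir n x) - \<gamma> (drop_dir n y)\<bar> \<le> L * norm (x - y)"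
    and mem: "\<And>y. y \<in> ball a r \<Longrightarrow> y \<in> \<Omega> \<longleftrightarrow> y \<bullet> n > \<gamma> (drop_dir n y)"
    by (rule lipschitz_boundaryE[OF assms(1,2)], rule that)
  \<comment> \<open>Since s is at most 2 (L + 1) \<rho>, the lifted path stays within \<rho> (2 L +
    3) of a, hence inside the ball of radius r.\<close>
  define \<rho> where "\<rho> = r / (2 * L + 4)"
  have \<rho>: "\<rho> > 0" using r L by (simp add: \<rho>_def)
  have \<rho>r: "\<rho> * (2 * L + 4) = r" using L by (simp add: \<rho>_def)
  show ?thesis
  proof (rule that[of \<rho> "M * (2 * (L + 1) + 1)"])
    fix u v assume u: "u \<in> \<Omega> \<inter> ball a \<rho>" and v: "v \<in> \<Omega> \<inter> ball a \<rho>"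
    define s where "s = (L + 1) * norm (u - v)"
    have s0: "s \<ge> 0" using L by (simp add: s_def)
    have "norm (u - v) < 2 * \<rho>"
      using u v dist_triangle[of u v a] by (simp add: dist_norm norm_minus_commute)
    then have "s \<le> (L + 1) * (2 * \<rho>)" unfolding s_def using L by (intro mult_left_mono) auto
    then have sr: "\<rho> + s < r" using \<rho> \<rho>r by (simp add: algebra_simps)
    have uo: "u \<bullet> n > \<gamma> (drop_dir n u)" and vo: "v \<bullet> n > \<gamma> (drop_dir n v)"
    proof -
      have "u \<in> ball a r" "v \<in> ball a r" using u v sr s0 by auto
      then show "u \<bullet> n > \<gamma> (drop_dir n u)" "v \<bullet> n > \<gamma> (drop_dir n v)" using mem u v by auto
    qed
    have inball: "w + t *\<^sub>R n \<in> ball a r" if "w \<in> ball a \<rho>" "0 \<le> t" "t \<le> s" for w t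
    proof -
      have "dist a (w + t *\<^sub>R n) \<le> dist a w + t"
        using dist_triangle[of a "w + t *\<^sub>R n" w] n that(2) by (simp add: dist_norm)
      then show ?thesis using that sr by auto
    qed
    have vert: "closed_segment w (w + s *\<^sub>R n) \<subseteq> \<Omega>" if w: "w \<in> ball a \<rho>" "w \<bullet> n > \<gamma> (drop_dir n w)" for w
    proof
      fix y assume "y \<in> closed_segment w (w + s *\<^sub>R n)"
      then obtain t where t: "0 \<le> t" "t \<le> 1" "y = (1 - t) *\<^sub>R w + t *\<^sub>R (w + s *\<^sub>R n)" by (auto simp: in_segment)
      then have y: "y = w + (t * s) *\<^sub>R n" by (simp add: algebra_simps)
      have ts: "0 \<le> t * s" "t * s \<le> s" using t s0 by (auto intro: mult_left_le_one_le)
      have "y \<bullet> n > \<gamma> (drop_dir n y)" unfolding y drop_dir(2)[OF n] drop_dir(3)[OF n] using w(2) ts by linarith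
      then show "y \<in> \<Omega>" using mem[OF inball[OF w(1) ts]] y by simp
    qed
    have horiz: "closed_segment (u + s *\<^sub>R n) (v + s *\<^sub>R n) \<subseteq> \<Omega>"
    proof
      fix y assume "y \<in> closed_segment (u + s *\<^sub>R n) (v + s *\<^sub>R n)"
      then obtain t where t: "0 \<le> t" "t \<le> 1" "y = (1 - t) *\<^sub>R (u + s *\<^sub>R n) + t *\<^sub>R (v + s *\<^sub>R n)" by (auto simp: in_segment)
      define w where "w = (1 - t) *\<^sub>R u + t *\<^sub>R v"
      have y: "y = w + s *\<^sub>R n" using t(3) by (simp add: w_def algebra_simps)
      have wb: "w \<in> ball a \<rho>"
        unfolding w_def using u v t by (intro convexD[OF convex_ball]) auto
      have wu: "norm (w - u) \<le> norm (u - v)" "norm (w - v) \<le> norm (u - v)"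
      proof -
        have "w - u = t *\<^sub>R (v - u)" "w - v = (1 - t) *\<^sub>R (u - v)" by (simp_all add: w_def algebra_simps)
        then show "norm (w - u) \<le> norm (u - v)" "norm (w - v) \<le> norm (u - v)"
          using t by (simp_all add: norm_minus_commute mult_left_le_one_le)
      qed
      have 1: "\<gamma> (drop_dir n w) - L * norm (u - v) < u \<bullet> n"
        using lip[of w u] uo mult_left_mono[OF wu(1) L] by linarith
      have 2: "\<gamma> (drop_dir n w) - L * norm (u - v) < v \<bullet> n"
        using lip[of w v] vo mult_left_mono[OF wu(2) L] by linarith
      \<comment> \<open>A point between u and v is at least as high as the lower of the two, while
        the graph rises by at most \<open>L * norm (u - v)\<close> on the way; the lift by s makes
        up for that.\<close>
      define m where "m = min (u \<bullet> n) (v \<bullet> n)"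
      have "m = (1 - t) * m + t * m" by (simp add: algebra_simps)
      also have "\<dots> \<le> (1 - t) * (u \<bullet> n) + t * (v \<bullet> n)"
        using t by (intro add_mono mult_left_mono) (auto simp: m_def)
      also have "\<dots> = w \<bullet> n" by (simp add: w_def inner_add_left)
      finally have "m \<le> w \<bullet> n" .
      moreover have "\<gamma> (drop_dir n w) - L * norm (u - v) < m" using 1 2 by (simp add: m_def)
      moreover have "L * norm (u - v) \<le> s" by (simp add: s_def distrib_right)
      ultimately have "y \<bullet> n > \<gamma> (drop_dir n y)" unfolding y drop_dir(2)[OF n] drop_dir(3)[OF n] by linarith
      then show "y \<in> \<Omega>" using mem[OF inball[OF wb s0 order_refl]] y by simp
    qed
    have ub: "u \<in> ball a \<rho>" "v \<in> ball a \<rho>" using u v by auto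
    have "\<bar>f u - f (u + s *\<^sub>R n)\<bar> \<le> M * s" using assms(4)[OF vert[OF ub(1) uo]] n s0 by simp
    moreover have "\<bar>f v - f (v + s *\<^sub>R n)\<bar> \<le> M * s" using assms(4)[OF vert[OF ub(2) vo]] n s0 by simp
    moreover have "\<bar>f (u + s *\<^sub>R n) - f (v + s *\<^sub>R n)\<bar> \<le> M * norm (u - v)" using assms(4)[OF horiz] by simp
    moreover have "M * (2 * (L + 1) + 1) * norm (u - v) = M * s + M * s + M * norm (u - v)" by (simp add: s_def algebra_simps)
    ultimately show "\<bar>f u - f v\<bar> \<le> M * (2 * (L + 1) + 1) * norm (u - v)" by linarith
  qed (use \<rho> L assms(3) in auto)
qed

text \<open>Provides nodal values at vertices on the boundary, where nothing is known of the
  function itself: near such a point it is uniformly continuous on \<Omega>.\<close>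

lemma lipschitz_domain_limit_exists:
  fixes \<Omega> :: "(real^'d::finite) set" and f :: "real^'d \<Rightarrow> real"
  assumes "open \<Omega>" "lipschitz_boundary \<Omega>" "M \<ge> 0" "a \<in> closure \<Omega>"
    and f: "\<And>x y. closed_segment x y \<subseteq> \<Omega> \<Longrightarrow> \<bar>f x - f y\<bar> \<le> M * norm (x - y)"
  shows "\<exists>l. (f \<longlongrightarrow> l) (at a within \<Omega>)"
proof (cases "a \<in> \<Omega>")
  case True
  have "continuous_on \<Omega> f" by (rule local_lipschitz_continuous_on[OF assms(1), of f M]) (use f in simp)
  then show ?thesis using True unfolding continuous_on_def by blast
next
  case False
  then have fr: "a \<in> frontier \<Omega>" using assms(1,4) by (simp add: frontier_def interior_open)
  obtain r M' where r: "r > 0" "M' \<ge> 0"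
    "\<And>x y. x \<in> \<Omega> \<inter> ball a r \<Longrightarrow> y \<in> \<Omega> \<inter> ball a r \<Longrightarrow> \<bar>f x - f y\<bar> \<le> M' * norm (x - y)"
    by (rule lipschitz_boundary_local_lipschitz[where f=f, OF assms(2) fr assms(3) f], assumption, rule that)
  have "uniformly_continuous_on (\<Omega> \<inter> ball a r) f"
    by (rule lipschitz_on_uniformly_continuous[OF lipschitz_onI[of _ _ M']]) (use r in \<open>auto simp: dist_norm\<close>)
  note uc = this
  have "a \<in> closure (ball a r \<inter> \<Omega>)"
    using open_Int_closure_subset[of "ball a r" \<Omega>] assms(4) r(1) by auto
  then have ac: "a \<in> closure (\<Omega> \<inter> ball a r)" by (simp add: Int_commute)
  obtain l where "(f \<longlongrightarrow> l) (at a within \<Omega> \<inter> ball a r)"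
    by (rule uniformly_continuous_on_extension_at_closure[OF uc ac])
  moreover have "at a within \<Omega> \<inter> ball a r = at a within \<Omega>"
    by (rule at_within_nhd[of a "ball a r"]) (use r(1) in auto)
  ultimately show ?thesis by auto
qed


section \<open>Barycentric coordinates\<close>

text \<open>Barycentric coordinates as affine functions dual to the vertices: \<open>g a\<close> is
  the constant gradient of the coordinate of a, \<open>e a\<close> its value at the origin. In this
  form derivatives and degrees can be read off.\<close>

locale barycentric =
  fixes C :: "(real^'d::finite) set" and g :: "real^'d \<Rightarrow> real^'d" and e :: "real^'d \<Rightarrow> real"
  assumes fin: "finite C"
    and full: "\<And>x. \<exists>u. sum u C = 1 \<and> (\<Sum>a\<in>C. u a *\<^sub>R a) = x"
    and delta: "\<And>a b. a \<in> C \<Longrightarrow> b \<in> C \<Longrightarrow> e a + g a \<bullet> b = (if a = b then 1 else 0)"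
begin

definition coord :: "real^'d \<Rightarrow> real^'d \<Rightarrow> real" where
  "coord a x = e a + g a \<bullet> x"

lemma coord_unique:
  assumes "sum u C = 1" "(\<Sum>a\<in>C. u a *\<^sub>R a) = x" "a \<in> C"
  shows "coord a x = u a"
proof -
  have "coord a x = (\<Sum>b\<in>C. u b * (e a + g a \<bullet> b))"
    unfolding coord_def assms(2)[symmetric]
    using assms(1) by (simp add: inner_sum_right distrib_left sum.distrib sum_distrib_right[symmetric])
  also have "\<dots> = (\<Sum>b\<in>C. if b = a then u b else 0)"
    by (rule sum.cong) (use delta assms(3) in auto)
  also have "\<dots> = u a" using fin assms(3) by simp
  finally show ?thesis .
qed

lemma coord_sum: "(\<Sum>a\<in>C. coord a x) = 1" and coord_combination: "(\<Sum>a\<in>C. coord a x *\<^sub>R a) = x"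
proof -
  obtain u where u: "sum u C = 1" "(\<Sum>a\<in>C. u a *\<^sub>R a) = x" using full by blast
  have "(\<Sum>a\<in>C. coord a x) = sum u C" "(\<Sum>a\<in>C. coord a x *\<^sub>R a) = (\<Sum>a\<in>C. u a *\<^sub>R a)"
    by (rule sum.cong; simp add: coord_unique[OF u])+
  then show "(\<Sum>a\<in>C. coord a x) = 1" "(\<Sum>a\<in>C. coord a x *\<^sub>R a) = x" using u by simp_all
qed

lemma coord_hull:
  assumes "D \<subseteq> C" "x \<in> convex hull D"
  shows "\<And>a. a \<in> D \<Longrightarrow> coord a x \<ge> 0" "\<And>a. a \<in> C - D \<Longrightarrow> coord a x = 0"
proof -
  have fD: "finite D" using assms(1) fin by (rule finite_subset)
  obtain u where u: "\<forall>a\<in>D. 0 \<le> u a" "sum u D = 1" "(\<Sum>a\<in>D. u a *\<^sub>R a) = x"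
    using assms(2) unfolding convex_hull_finite[OF fD] by blast
  define v where "v a = (if a \<in> D then u a else 0)" for a
  have "sum v C = sum u D" "(\<Sum>a\<in>C. v a *\<^sub>R a) = (\<Sum>a\<in>D. u a *\<^sub>R a)"
    unfolding v_def using assms(1) fin by (auto intro!: sum.mono_neutral_cong_right)
  then have v: "sum v C = 1" "(\<Sum>a\<in>C. v a *\<^sub>R a) = x" using u by simp_all
  show "coord a x \<ge> 0" if "a \<in> D" for a
    using coord_unique[OF v, of a] that assms(1) u(1) by (auto simp: v_def)
  show "coord a x = 0" if "a \<in> C - D" for a
    using coord_unique[OF v, of a] that by (auto simp: v_def)
qed

lemma coord_add: "coord a (x + h) = coord a x + g a \<bullet> h"
  by (simp add: coord_def inner_add_right)

lemma gradient_sum: "(\<Sum>a\<in>C. g a \<bullet> h) = 0" and gradient_combination: "(\<Sum>a\<in>C. (g a \<bullet> h) *\<^sub>R a) = h"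
proof -
  have "(\<Sum>a\<in>C. coord a 0) + (\<Sum>a\<in>C. g a \<bullet> h) = 1"
    using coord_sum[of "0 + h"] unfolding coord_add by (simp add: sum.distrib)
  then show "(\<Sum>a\<in>C. g a \<bullet> h) = 0" using coord_sum[of 0] by simp
  have "(\<Sum>a\<in>C. coord a 0 *\<^sub>R a) + (\<Sum>a\<in>C. (g a \<bullet> h) *\<^sub>R a) = h"
    using coord_combination[of "0 + h"] unfolding coord_add by (simp add: sum.distrib scaleR_add_left)
  then show "(\<Sum>a\<in>C. (g a \<bullet> h) *\<^sub>R a) = h" using coord_combination[of 0] by simp
qed

text \<open>From the centre c, where the coordinate is nonnegative, a step of length r along its
  gradient raises it by \<open>r * norm (g a)\<close>, and the result cannot exceed 1.\<close>

lemma gradient_bound: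
  assumes "a \<in> C" "cball c r \<subseteq> convex hull C" "r > 0"
  shows "norm (g a) \<le> 1 / r"
proof (cases "g a = 0")
  case False
  have le1: "coord a x \<le> 1" if x: "x \<in> convex hull C" for x
  proof -
    have "coord a x \<le> (\<Sum>a\<in>C. coord a x)"
      using fin assms(1) coord_hull(1)[OF order_refl x] by (intro member_le_sum) auto
    then show ?thesis by (simp add: coord_sum)
  qed
  have c: "c \<in> convex hull C" using assms(2,3) by auto
  define x where "x = c + (r / norm (g a)) *\<^sub>R g a"
  have "norm ((r / norm (g a)) *\<^sub>R g a) = r" using False assms(3) by simp
  then have "x \<in> convex hull C" using assms(2) unfolding x_def by (intro subsetD[OF assms(2)]) (simp add: dist_norm)
  then have "coord a x \<le> 1" by (rule le1)
  moreover have "coord a x = coord a c + r * norm (g a)"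
    unfolding x_def coord_add using False by (simp add: dot_square_norm power2_eq_square)
  moreover have "coord a c \<ge> 0" using coord_hull(1)[OF order_refl c assms(1)] .
  ultimately have "r * norm (g a) \<le> 1" by linarith
  then show ?thesis using assms(3) by (simp add: field_simps)
qed (use assms(3) in simp)

definition interp :: "(real^'d \<Rightarrow> real) \<Rightarrow> real^'d \<Rightarrow> real" where
  "interp \<zeta> x = (\<Sum>a\<in>C. coord a x * \<zeta> a)"

definition shift :: "(real^'d \<Rightarrow> real) \<Rightarrow> real^'d \<Rightarrow> real^'d" where
  "shift \<zeta> x = (\<Sum>a\<in>C. (coord a x * (\<zeta> a - interp \<zeta> x)) *\<^sub>R a)"

lemma coord_has_derivative: "(coord a has_derivative (\<lambda>h. g a \<bullet> h)) (at x)"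
  unfolding coord_def[abs_def] by (auto intro!: derivative_eq_intros)

lemma interp_has_derivative: "(interp \<zeta> has_derivative (\<lambda>h. \<Sum>a\<in>C. (g a \<bullet> h) * \<zeta> a)) (at x)"
  unfolding interp_def[abs_def] by (intro has_derivative_sum has_derivative_mult_left coord_has_derivative)

text \<open>The derivative of the interpolant contributes a multiple of x, which recentres the sum
  at x. On an element of diameter \<delta> each summand then has factors of size 1/\<delta>,
  \<delta> and \<delta>.\<close>

lemma shift_has_derivative:
  "(shift \<zeta> has_derivative (\<lambda>h. \<Sum>a\<in>C. ((g a \<bullet> h) * (\<zeta> a - interp \<zeta> x)) *\<^sub>R (a - x))) (at x)"
proof -
  define DZ where "DZ = (\<lambda>h. \<Sum>a\<in>C. (g a \<bullet> h) * \<zeta> a)"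
  have "((\<lambda>x. (coord a x * (\<zeta> a - interp \<zeta> x)) *\<^sub>R a) has_derivative
     (\<lambda>h. (coord a x * (0 - DZ h) + (g a \<bullet> h) * (\<zeta> a - interp \<zeta> x)) *\<^sub>R a)) (at x)" for a
    unfolding DZ_def
    by (intro has_derivative_scaleR_left has_derivative_mult has_derivative_diff coord_has_derivative interp_has_derivative has_derivative_const)
  then have "(shift \<zeta> has_derivative (\<lambda>h. \<Sum>a\<in>C. (coord a x * (0 - DZ h) + (g a \<bullet> h) * (\<zeta> a - interp \<zeta> x)) *\<^sub>R a)) (at x)"
    unfolding shift_def[abs_def] by (intro has_derivative_sum)
  moreover have "(\<Sum>a\<in>C. (coord a x * (0 - DZ h) + (g a \<bullet> h) * (\<zeta> a - interp \<zeta> x)) *\<^sub>R a)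
      = (\<Sum>a\<in>C. ((g a \<bullet> h) * (\<zeta> a - interp \<zeta> x)) *\<^sub>R (a - x))" for h
  proof -
    have "(\<Sum>a\<in>C. (coord a x * (0 - DZ h)) *\<^sub>R a) = (0 - DZ h) *\<^sub>R (\<Sum>a\<in>C. coord a x *\<^sub>R a)"
      by (simp add: scaleR_sum_right mult.commute)
    then have 1: "(\<Sum>a\<in>C. (coord a x * (0 - DZ h)) *\<^sub>R a) = - DZ h *\<^sub>R x" by (simp add: coord_combination)
    have "(\<Sum>a\<in>C. (g a \<bullet> h) * (\<zeta> a - interp \<zeta> x)) = DZ h - (\<Sum>a\<in>C. g a \<bullet> h) * interp \<zeta> x"
      by (simp add: DZ_def right_diff_distrib sum_subtractf sum_distrib_right)
    then have 2: "(\<Sum>a\<in>C. (g a \<bullet> h) * (\<zeta> a - interp \<zeta> x)) = DZ h" by (simp add: gradient_sum)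
    have "(\<Sum>a\<in>C. ((g a \<bullet> h) * (\<zeta> a - interp \<zeta> x)) *\<^sub>R (a - x)) = (\<Sum>a\<in>C. ((g a \<bullet> h) * (\<zeta> a - interp \<zeta> x)) *\<^sub>R a) - DZ h *\<^sub>R x"
      unfolding scaleR_diff_right sum_subtractf 2[symmetric] scaleR_sum_left ..
    moreover have "(\<Sum>a\<in>C. (coord a x * (0 - DZ h) + (g a \<bullet> h) * (\<zeta> a - interp \<zeta> x)) *\<^sub>R a)
        = - DZ h *\<^sub>R x + (\<Sum>a\<in>C. ((g a \<bullet> h) * (\<zeta> a - interp \<zeta> x)) *\<^sub>R a)"
      unfolding scaleR_add_left sum.distrib 1 ..
    ultimately show ?thesis by simp
  qed
  ultimately show ?thesis by simp
qed

text \<open>The form required by \<open>euler_degree_reduction\<close>: an affine field minus the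
  interpolant times x.\<close>

lemma shift_eq: "shift \<zeta> x = (\<Sum>a\<in>C. (coord a x * \<zeta> a) *\<^sub>R a) - interp \<zeta> x *\<^sub>R x"
proof -
  have "shift \<zeta> x = (\<Sum>a\<in>C. (coord a x * \<zeta> a) *\<^sub>R a) - (\<Sum>a\<in>C. (coord a x * interp \<zeta> x) *\<^sub>R a)"
    by (simp add: shift_def right_diff_distrib scaleR_diff_left sum_subtractf)
  also have "(\<Sum>a\<in>C. (coord a x * interp \<zeta> x) *\<^sub>R a) = interp \<zeta> x *\<^sub>R (\<Sum>a\<in>C. coord a x *\<^sub>R a)"
    by (simp add: scaleR_sum_right mult.commute)
  finally show ?thesis by (simp add: coord_combination)
qed

text \<open>The weights sum to 0, so the origin may be replaced by x. This exhibits the size: an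
  oscillation times a distance, both of the order of the diameter.\<close>

lemma shift_centred: "shift \<zeta> x = (\<Sum>a\<in>C. (coord a x * (\<zeta> a - interp \<zeta> x)) *\<^sub>R (a - x))"
proof -
  have "(\<Sum>a\<in>C. coord a x * (\<zeta> a - interp \<zeta> x)) = interp \<zeta> x - (\<Sum>a\<in>C. coord a x) * interp \<zeta> x"
    by (simp add: interp_def right_diff_distrib sum_subtractf sum_distrib_right)
  then have 0: "(\<Sum>a\<in>C. coord a x * (\<zeta> a - interp \<zeta> x)) = 0" by (simp add: coord_sum)
  have "(\<Sum>a\<in>C. (coord a x * (\<zeta> a - interp \<zeta> x)) *\<^sub>R (a - x)) = shift \<zeta> x - (\<Sum>a\<in>C. coord a x * (\<zeta> a - interp \<zeta> x)) *\<^sub>R x"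
    unfolding shift_def scaleR_diff_right sum_subtractf scaleR_sum_left ..
  then show ?thesis by (simp add: 0)
qed

text \<open>Affine functions are reproduced exactly and the weights are convex, so only the Taylor
  remainders at the vertices survive.\<close>

lemma interp_error:
  assumes "x \<in> convex hull C" "\<And>a. a \<in> C \<Longrightarrow> \<bar>\<zeta> a - y - G \<bullet> (a - x)\<bar> \<le> \<eta>"
  shows "\<bar>interp \<zeta> x - y\<bar> \<le> \<eta>"
proof -
  have "(\<Sum>a\<in>C. coord a x * (\<zeta> a - y - G \<bullet> (a - x))) = interp \<zeta> x - (\<Sum>a\<in>C. coord a x) * y - G \<bullet> ((\<Sum>a\<in>C. coord a x *\<^sub>R a) - (\<Sum>a\<in>C. coord a x) *\<^sub>R x)"
    by (simp add: interp_def right_diff_distrib sum_subtractf sum_distrib_right inner_diff_right inner_sum_right scaleR_sum_left)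
  then have "interp \<zeta> x - y = (\<Sum>a\<in>C. coord a x * (\<zeta> a - y - G \<bullet> (a - x)))"
    by (simp add: coord_sum coord_combination)
  also have "\<bar>\<dots>\<bar> \<le> (\<Sum>a\<in>C. coord a x * \<eta>)"
  proof (rule order_trans[OF sum_abs sum_mono])
    fix a assume a: "a \<in> C"
    show "\<bar>coord a x * (\<zeta> a - y - G \<bullet> (a - x))\<bar> \<le> coord a x * \<eta>"
      using coord_hull(1)[OF order_refl assms(1) a] assms(2)[OF a] by (simp add: abs_mult mult_left_mono)
  qed
  also have "\<dots> = \<eta>" by (simp add: sum_distrib_right[symmetric] coord_sum)
  finally show ?thesis .
qed

text \<open>The same cancellation for the gradient: the weights \<open>g a \<bullet> h\<close> sum
  to 0 and reproduce h.\<close>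

lemma interp_derivative_error:
  assumes "\<And>a. a \<in> C \<Longrightarrow> \<bar>\<zeta> a - y - G \<bullet> (a - x)\<bar> \<le> \<eta>" "\<And>a. a \<in> C \<Longrightarrow> norm (g a) \<le> K"
  shows "\<bar>(\<Sum>a\<in>C. (g a \<bullet> h) * \<zeta> a) - G \<bullet> h\<bar> \<le> real (card C) * (K * norm h * \<eta>)"
proof -
  have "(\<Sum>a\<in>C. (g a \<bullet> h) * (\<zeta> a - y - G \<bullet> (a - x)))
      = (\<Sum>a\<in>C. (g a \<bullet> h) * \<zeta> a) - (\<Sum>a\<in>C. g a \<bullet> h) * y - G \<bullet> ((\<Sum>a\<in>C. (g a \<bullet> h) *\<^sub>R a) - (\<Sum>a\<in>C. g a \<bullet> h) *\<^sub>R x)"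
    by (simp add: right_diff_distrib sum_subtractf sum_distrib_right inner_diff_right inner_sum_right scaleR_sum_left)
  then have "(\<Sum>a\<in>C. (g a \<bullet> h) * \<zeta> a) - G \<bullet> h = (\<Sum>a\<in>C. (g a \<bullet> h) * (\<zeta> a - y - G \<bullet> (a - x)))"
    by (simp add: gradient_sum gradient_combination)
  also have "\<bar>\<dots>\<bar> \<le> (\<Sum>a\<in>C. K * norm h * \<eta>)"
  proof (rule order_trans[OF sum_abs sum_mono])
    fix a assume a: "a \<in> C"
    have "\<bar>g a \<bullet> h\<bar> \<le> K * norm h"
      using Cauchy_Schwarz_ineq2[of "g a" h] mult_right_mono[OF assms(2)[OF a] norm_ge_zero[of h]] by linarith
    then show "\<bar>(g a \<bullet> h) * (\<zeta> a - y - G \<bullet> (a - x))\<bar> \<le> K * norm h * \<eta>"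
      unfolding abs_mult using assms(1)[OF a] by (intro mult_mono) auto
  qed
  finally show ?thesis by simp
qed

section \<open>The local multiplication operator and its error\<close>

definition local_op :: "real \<Rightarrow> (real^'d \<Rightarrow> real) \<Rightarrow> (real^'d \<Rightarrow> real) \<Rightarrow> (real^'d \<Rightarrow> real^'d) \<Rightarrow> real^'d \<Rightarrow> real" where
  "local_op \<kappa> \<zeta> p q x = interp \<zeta> x * p x + \<kappa> * (shift \<zeta> x \<bullet> q x)"

text \<open>Orders in the diameter \<delta>: the interpolation error is quadratic and its gradient
  linear, \<open>shift\<close> is quadratic and its derivative linear. The dangerous term is the
  Hessian of p, bounded by s, which arises when q is differentiated; it is multiplied by
  \<open>shift\<close> and so appears as \<delta> times \<delta> s, the weighted form that an
  inverse inequality absorbs. The condition \<delta> \<le> 1 lets quadratic terms be counted as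
  linear ones.\<close>

lemma local_op_estimate:
  assumes x: "x \<in> convex hull C"
    and \<zeta>: "\<And>a. a \<in> C \<Longrightarrow> \<bar>\<zeta> a - y - G \<bullet> (a - x)\<bar> \<le> M * \<delta>\<^sup>2"
    and \<delta>: "\<And>a. a \<in> C \<Longrightarrow> norm (a - x) \<le> \<delta>" "0 < \<delta>" "\<delta> \<le> 1"
    and G: "norm G \<le> M" and K: "\<And>a. a \<in> C \<Longrightarrow> norm (g a) \<le> K / \<delta>" "K \<ge> 0" and \<kappa>: "0 \<le> \<kappa>" "\<kappa> \<le> 1"
    and p: "(p has_derivative (\<lambda>h. q x \<bullet> h)) (at x)" and q: "(q has_derivative Q) (at x)" "\<And>h. norm (Q h) \<le> s * norm h" "s \<ge> 0"
  obtains D where "(local_op \<kappa> \<zeta> p q has_derivative D) (at x)"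
    "\<bar>local_op \<kappa> \<zeta> p q x - y * p x\<bar> \<le> (3 * real (card C) * K + 3) * M * \<delta> * (\<bar>p x\<bar> + norm (q x) + \<delta> * s)"
    "\<And>h. \<bar>D h - (y * (q x \<bullet> h) + (G \<bullet> h) * p x)\<bar>
        \<le> (3 * real (card C) * K + 3) * M * \<delta> * (\<bar>p x\<bar> + norm (q x) + \<delta> * s) * norm h"
proof -
  let ?Z = "interp \<zeta> x" and ?n = "real (card C)"
  define DZ where "DZ h = (\<Sum>a\<in>C. (g a \<bullet> h) * \<zeta> a)" for h
  define DW where "DW h = (\<Sum>a\<in>C. ((g a \<bullet> h) * (\<zeta> a - ?Z)) *\<^sub>R (a - x))" for h
  have M: "M \<ge> 0" using order_trans[OF norm_ge_zero G] .
  have \<delta>2: "\<delta>\<^sup>2 \<le> \<delta>" using \<delta>(2,3) by (simp add: power2_eq_square mult_left_le_one_le)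
  have M\<delta>2: "M * \<delta>\<^sup>2 \<le> M * \<delta>" by (rule mult_left_mono[OF \<delta>2 M])
  have E1: "\<bar>?Z - y\<bar> \<le> M * \<delta>\<^sup>2" by (rule interp_error[OF x \<zeta>])
  have E2: "\<bar>DZ h - G \<bullet> h\<bar> \<le> ?n * K * M * \<delta> * norm h" for h
  proof -
    have "\<bar>DZ h - G \<bullet> h\<bar> \<le> ?n * ((K / \<delta>) * norm h * (M * \<delta>\<^sup>2))"
      unfolding DZ_def by (rule interp_derivative_error[OF \<zeta> K(1)])
    also have "\<dots> = ?n * K * M * \<delta> * norm h" using \<delta>(2) by (simp add: power2_eq_square)
    finally show ?thesis .
  qed
  \<comment> \<open>First order only: here the linear part of the expansion does not cancel.\<close>
  have E3: "\<bar>\<zeta> a - ?Z\<bar> \<le> 3 * (M * \<delta>)" if a: "a \<in> C" for a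
  proof -
    have "\<bar>G \<bullet> (a - x)\<bar> \<le> M * \<delta>"
      using Cauchy_Schwarz_ineq2[of G "a - x"] mult_mono[OF G \<delta>(1)[OF a] M norm_ge_zero] by linarith
    then show ?thesis using \<zeta>[OF a] E1 M\<delta>2 by linarith
  qed
  have E4: "norm (shift \<zeta> x) \<le> 3 * M * \<delta>\<^sup>2"
  proof -
    have "norm (shift \<zeta> x) \<le> (\<Sum>a\<in>C. coord a x * (3 * M * \<delta>\<^sup>2))"
      unfolding shift_centred
    proof (rule sum_norm_le)
      fix a assume a: "a \<in> C"
      have c: "coord a x \<ge> 0" by (rule coord_hull(1)[OF order_refl x a])
      have "\<bar>\<zeta> a - ?Z\<bar> * norm (a - x) \<le> (3 * (M * \<delta>)) * \<delta>"
        using E3[OF a] \<delta>(1)[OF a] M \<delta>(2) by (intro mult_mono) auto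
      also have "\<dots> = 3 * M * \<delta>\<^sup>2" by (simp add: power2_eq_square)
      finally show "norm ((coord a x * (\<zeta> a - ?Z)) *\<^sub>R (a - x)) \<le> coord a x * (3 * M * \<delta>\<^sup>2)"
        using c by (simp add: abs_mult mult.assoc mult_left_mono)
    qed
    also have "\<dots> = 3 * M * \<delta>\<^sup>2" by (simp add: sum_distrib_right[symmetric] coord_sum)
    finally show ?thesis .
  qed
  have E5: "norm (DW h) \<le> 3 * ?n * K * M * \<delta> * norm h" for h
  proof -
    have "norm (DW h) \<le> (\<Sum>a\<in>C. (K / \<delta>) * norm h * (3 * (M * \<delta>)) * \<delta>)"
      unfolding DW_def
    proof (rule sum_norm_le)
      fix a assume a: "a \<in> C"
      have "\<bar>g a \<bullet> h\<bar> \<le> (K / \<delta>) * norm h"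
        using Cauchy_Schwarz_ineq2[of "g a" h] mult_right_mono[OF K(1)[OF a] norm_ge_zero[of h]] by linarith
      then show "norm (((g a \<bullet> h) * (\<zeta> a - ?Z)) *\<^sub>R (a - x)) \<le> (K / \<delta>) * norm h * (3 * (M * \<delta>)) * \<delta>"
        unfolding norm_scaleR abs_mult using E3[OF a] \<delta>(1)[OF a] K(2) M \<delta>(2) by (intro mult_mono) auto
    qed
    also have "\<dots> = 3 * ?n * K * M * \<delta> * norm h" using \<delta>(2) by simp
    finally show ?thesis .
  qed
  define D where "D h = ?Z * (q x \<bullet> h) + DZ h * p x + \<kappa> * (shift \<zeta> x \<bullet> Q h + DW h \<bullet> q x)" for h
  have iZ: "(interp \<zeta> has_derivative DZ) (at x)" unfolding DZ_def[abs_def] by (rule interp_has_derivative)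
  have iW: "(shift \<zeta> has_derivative DW) (at x)" unfolding DW_def[abs_def] by (rule shift_has_derivative)
  have dD: "(local_op \<kappa> \<zeta> p q has_derivative D) (at x)"
    unfolding local_op_def[abs_def] D_def[abs_def]
    by (intro has_derivative_add has_derivative_mult[OF iZ p] has_derivative_mult_right has_derivative_inner[OF iW q(1)])
  define B where "B = \<bar>p x\<bar> + norm (q x) + \<delta> * s"
  have B: "\<bar>p x\<bar> \<le> B" "norm (q x) \<le> B" "\<delta> * s \<le> B" "B \<ge> 0" using \<delta>(2) q(3) by (auto simp: B_def)
  have nK: "?n * K \<ge> 0" using K(2) by simp
  show ?thesis
  proof (rule that[OF dD])
    have "\<bar>local_op \<kappa> \<zeta> p q x - y * p x\<bar> \<le> \<bar>(?Z - y) * p x\<bar> + \<bar>\<kappa> * (shift \<zeta> x \<bullet> q x)\<bar>"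
      unfolding local_op_def left_diff_distrib by linarith
    also have "\<bar>(?Z - y) * p x\<bar> \<le> (M * \<delta>) * \<bar>p x\<bar>" unfolding abs_mult using E1 M\<delta>2 by (intro mult_right_mono) auto
    also have "\<bar>\<kappa> * (shift \<zeta> x \<bullet> q x)\<bar> \<le> 1 * ((3 * (M * \<delta>)) * norm (q x))"
      unfolding abs_mult
    proof (intro mult_mono)
      show "\<bar>shift \<zeta> x \<bullet> q x\<bar> \<le> (3 * (M * \<delta>)) * norm (q x)"
        using Cauchy_Schwarz_ineq2[of "shift \<zeta> x" "q x"] mult_right_mono[OF order_trans[OF E4], of "3 * (M * \<delta>)" "norm (q x)"] M\<delta>2
        by simp
    qed (use \<kappa> in auto)
    also have "(M * \<delta>) * \<bar>p x\<bar> + 1 * ((3 * (M * \<delta>)) * norm (q x)) \<le> (3 * (M * \<delta>)) * B"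
    proof -
      have "(M * \<delta>) * \<bar>p x\<bar> \<le> (3 * (M * \<delta>)) * \<bar>p x\<bar>" using M \<delta>(2) by (intro mult_right_mono) auto
      moreover have "(3 * (M * \<delta>)) * (\<bar>p x\<bar> + norm (q x)) \<le> (3 * (M * \<delta>)) * B"
        using M \<delta>(2) q(3) by (intro mult_left_mono) (auto simp: B_def)
      ultimately show ?thesis by (simp add: distrib_left)
    qed
    also have "\<dots> \<le> (3 * ?n * K + 3) * M * \<delta> * B"
    proof -
      have "3 \<le> 3 * ?n * K + 3" using nK by linarith
      moreover have "0 \<le> M * \<delta> * B" using M \<delta>(2) B(4) by simp
      ultimately have "3 * (M * \<delta> * B) \<le> (3 * ?n * K + 3) * (M * \<delta> * B)" by (rule mult_right_mono)
      then show ?thesis by (simp add: mult_ac)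
    qed
    finally show "\<bar>local_op \<kappa> \<zeta> p q x - y * p x\<bar> \<le> (3 * ?n * K + 3) * M * \<delta> * (\<bar>p x\<bar> + norm (q x) + \<delta> * s)"
      unfolding B_def by simp
  next
    fix h :: "real^'d"
    define H where "H = M * \<delta> * norm h"
    have H: "H \<ge> 0" using M \<delta>(2) by (simp add: H_def)
    have "\<bar>D h - (y * (q x \<bullet> h) + (G \<bullet> h) * p x)\<bar>
        \<le> \<bar>(?Z - y) * (q x \<bullet> h)\<bar> + \<bar>(DZ h - G \<bullet> h) * p x\<bar> + (\<bar>\<kappa> * (shift \<zeta> x \<bullet> Q h)\<bar> + \<bar>\<kappa> * (DW h \<bullet> q x)\<bar>)"
      unfolding D_def left_diff_distrib distrib_left by linarith
    also have "\<dots> \<le> H * norm (q x) + ?n * K * H * \<bar>p x\<bar> + (3 * H * (\<delta> * s) + 3 * ?n * K * H * norm (q x))"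
    proof (intro add_mono)
      have "\<bar>(?Z - y) * (q x \<bullet> h)\<bar> \<le> (M * \<delta>) * (norm (q x) * norm h)"
        unfolding abs_mult using E1 M\<delta>2 Cauchy_Schwarz_ineq2[of "q x" h] M \<delta>(2) by (intro mult_mono) auto
      then show "\<bar>(?Z - y) * (q x \<bullet> h)\<bar> \<le> H * norm (q x)" by (simp add: H_def mult_ac)
      show "\<bar>(DZ h - G \<bullet> h) * p x\<bar> \<le> ?n * K * H * \<bar>p x\<bar>"
        unfolding abs_mult H_def using mult_right_mono[OF E2[of h] abs_ge_zero[of "p x"]] by (simp add: mult_ac)
      have "\<bar>shift \<zeta> x \<bullet> Q h\<bar> \<le> (3 * M * \<delta>\<^sup>2) * (s * norm h)"
        using Cauchy_Schwarz_ineq2[of "shift \<zeta> x" "Q h"] mult_mono[OF E4 q(2)[of h]] M by (auto intro: order_trans)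
      then have "\<bar>shift \<zeta> x \<bullet> Q h\<bar> \<le> 3 * H * (\<delta> * s)" by (simp add: H_def power2_eq_square mult_ac)
      moreover have "\<bar>\<kappa> * (shift \<zeta> x \<bullet> Q h)\<bar> \<le> 1 * \<bar>shift \<zeta> x \<bullet> Q h\<bar>"
        unfolding abs_mult using \<kappa> by (intro mult_right_mono) auto
      ultimately show "\<bar>\<kappa> * (shift \<zeta> x \<bullet> Q h)\<bar> \<le> 3 * H * (\<delta> * s)" by linarith
      have "\<bar>DW h \<bullet> q x\<bar> \<le> 3 * ?n * K * H * norm (q x)"
        using Cauchy_Schwarz_ineq2[of "DW h" "q x"] mult_right_mono[OF E5[of h] norm_ge_zero[of "q x"]] by (simp add: H_def mult_ac)
      moreover have "\<bar>\<kappa> * (DW h \<bullet> q x)\<bar> \<le> 1 * \<bar>DW h \<bullet> q x\<bar>"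
        unfolding abs_mult using \<kappa> by (intro mult_right_mono) auto
      ultimately show "\<bar>\<kappa> * (DW h \<bullet> q x)\<bar> \<le> 3 * ?n * K * H * norm (q x)" by linarith
    qed
    also have "\<dots> \<le> (3 * ?n * K + 3) * H * B"
    proof -
      have nKH: "?n * K * H \<ge> 0" using nK H by simp
      define X where "X = ?n * K * H"
      have nKH: "X \<ge> 0" using nKH by (simp only: X_def)
      have "X * \<bar>p x\<bar> \<le> 3 * X * \<bar>p x\<bar>" using nKH by (intro mult_right_mono) auto
      moreover have "H * norm (q x) \<le> 3 * H * norm (q x)" using H by (intro mult_right_mono) auto
      moreover have "3 * X * (\<bar>p x\<bar> + norm (q x)) \<le> 3 * X * B"
        using nKH \<delta>(2) q(3) by (intro mult_left_mono) (auto simp: B_def)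
      moreover have "3 * H * (norm (q x) + \<delta> * s) \<le> 3 * H * B"
        using H by (intro mult_left_mono) (auto simp: B_def)
      moreover have e: "?n * K * H * \<bar>p x\<bar> = X * \<bar>p x\<bar>" "3 * ?n * K * H * norm (q x) = 3 * X * norm (q x)"
          "(3 * ?n * K + 3) * H * B = 3 * X * B + 3 * H * B"
        by (simp_all add: X_def distrib_right)
      ultimately show ?thesis unfolding e distrib_left by linarith
    qed
    finally show "\<bar>D h - (y * (q x \<bullet> h) + (G \<bullet> h) * p x)\<bar>
        \<le> (3 * ?n * K + 3) * M * \<delta> * (\<bar>p x\<bar> + norm (q x) + \<delta> * s) * norm h"
      unfolding H_def B_def by (simp add: mult_ac)
  qed
qed

end

text \<open>The facet opposite a spans a hyperplane that misses a; the equation of that hyperplane,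
  normalised at a, is the coordinate of a.\<close>

lemma barycentric_exists:
  fixes C :: "(real^'d::finite) set"
  assumes "\<not> affine_dependent C" "card C = CARD('d) + 1"
  shows "\<exists>g e. barycentric C g e"
proof -
  have fin: "finite C" using assms(1) by (rule aff_independent_finite)
  have "aff_dim C = int (card C) - 1" using aff_dim_affine_independent[OF assms(1)] by simp
  then have "affine hull C = UNIV" using assms(2) by (simp add: aff_dim_eq_full[symmetric])
  then have full: "\<exists>u. sum u C = 1 \<and> (\<Sum>a\<in>C. u a *\<^sub>R a) = x" for x
    using affine_hull_finite[OF fin] by auto
  have "\<exists>g e. \<forall>b\<in>C. e + g \<bullet> b = (if a = b then 1 else 0)" if a: "a \<in> C" for a
  proof -
    have ind: "\<not> affine_dependent (C - {a})"
      using assms(1) by (rule affine_independent_subset) auto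
    have "aff_dim (C - {a}) = int (card (C - {a})) - 1"
      using aff_dim_affine_independent[OF ind] by simp
    then have "aff_dim (C - {a}) = DIM(real^'d) - 1" using assms(2) a fin by simp
    then obtain n c where n: "affine hull (C - {a}) = {x. n \<bullet> x = c}" "n \<noteq> 0"
      using aff_dim_eq_hyperplane by metis
    have "a \<notin> affine hull (C - {a})" using assms(1) a unfolding affine_dependent_def by blast
    then have ne: "n \<bullet> a - c \<noteq> 0" using n by auto
    have "n \<bullet> b = c" if "b \<in> C" "b \<noteq> a" for b
      using hull_inc[of b "C - {a}"] that n by auto
    then have "\<forall>b\<in>C. - c / (n \<bullet> a - c) + ((1 / (n \<bullet> a - c)) *\<^sub>R n) \<bullet> b = (if a = b then 1 else 0)"
      using ne by (auto simp: diff_divide_distrib[symmetric] divide_simps)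
    then show ?thesis by blast
  qed
  then obtain g e where "\<And>a b. a \<in> C \<Longrightarrow> b \<in> C \<Longrightarrow> e a + g a \<bullet> b = (if a = b then 1 else 0)" by metis
  then have "barycentric C g e" using fin full by unfold_locales
  then show ?thesis by blast
qed

section \<open>Finite element functions on a mesh\<close>

text \<open>Degree reduction with zero data, kept for the gradient and its degree.\<close>

lemma polys_gradient:
  assumes "p \<in> polys_of_degree_le k" "k \<ge> 1"
  obtains q where "\<And>x. (p has_derivative (\<lambda>h. \<Sum>j\<in>UNIV. h $ j * q j x)) (at x)" "\<And>j. q j \<in> polys_of_degree_le (k - 1)"
  using euler_degree_reduction[OF assms, of "\<lambda>_. 0" "\<lambda>_. 0" "\<lambda>_. 0" "\<lambda>_. 0" 0 0] by auto

lemma polys_lipschitz_on_compact: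
  fixes T :: "(real^'d::finite) set"
  assumes "p \<in> polys_of_degree_le k" "k \<ge> 1" "compact T" "convex T"
  obtains L where "L \<ge> 0" "\<And>x. x \<in> T \<Longrightarrow> \<bar>p x\<bar> \<le> L" "\<And>x y. x \<in> T \<Longrightarrow> y \<in> T \<Longrightarrow> \<bar>p x - p y\<bar> \<le> L * norm (x - y)"
proof -
  obtain q where q: "\<And>x. (p has_derivative (\<lambda>h. \<Sum>j\<in>UNIV. h $ j * q j x)) (at x)" "\<And>j. q j \<in> polys_of_degree_le (k - 1)"
    by (rule polys_gradient[OF assms(1,2)], rule that)
  have bd: "\<exists>B\<ge>0. \<forall>x\<in>T. \<bar>w x\<bar> \<le> B" if "continuous_on T w" for w :: "real^'d \<Rightarrow> real"
  proof -
    have "bounded (w ` T)" using compact_continuous_image[OF that assms(3)] by (rule compact_imp_bounded)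
    then obtain B where "\<And>x. x \<in> T \<Longrightarrow> \<bar>w x\<bar> \<le> B" unfolding bounded_iff by auto
    then show ?thesis by (intro exI[of _ "max B 0"]) (auto intro: max.coboundedI1)
  qed
  obtain B0 where B0: "B0 \<ge> 0" "\<And>x. x \<in> T \<Longrightarrow> \<bar>p x\<bar> \<le> B0" using bd[OF polys_continuous[OF assms(1)]] by blast
  have "\<exists>B\<ge>0. \<forall>x\<in>T. \<bar>q j x\<bar> \<le> B" for j by (rule bd[OF polys_continuous[OF q(2)]])
  then obtain B where B: "\<And>j. B j \<ge> 0" "\<And>j x. x \<in> T \<Longrightarrow> \<bar>q j x\<bar> \<le> B j" by metis
  have s: "(\<Sum>j\<in>UNIV. B j) \<ge> 0" using B(1) by (intro sum_nonneg) auto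
  show ?thesis
  proof (rule that[of "B0 + (\<Sum>j\<in>UNIV. B j)"])
    fix x y assume xy: "x \<in> T" "y \<in> T"
    have "\<bar>p x - p y\<bar> \<le> (\<Sum>j\<in>UNIV. B j) * norm (x - y)"
      by (rule gradient_bound_imp_lipschitz[OF assms(4) has_derivative_at_withinI[OF q(1)] B(2) xy])
    moreover have "0 \<le> B0 * norm (x - y)" using B0(1) by simp
    ultimately show "\<bar>p x - p y\<bar> \<le> (B0 + (\<Sum>j\<in>UNIV. B j)) * norm (x - y)" by (simp add: distrib_right)
  qed (use B0 s in \<open>auto intro: add_increasing2\<close>)
qed

locale fe_mesh =
  fixes \<Omega> :: "(real^'d::finite) set" and k :: nat and \<T> :: "(real^'d) set set"
  assumes \<Omega>: "open \<Omega>" "bounded \<Omega>" "lipschitz_boundary \<Omega>" and tri: "triangulation_of \<Omega> \<T>" and k: "k \<ge> 1"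
begin

lemma finite_mesh: "finite \<T>" and Union_mesh: "\<Union>\<T> = closure \<Omega>"
  and face_mesh: "T \<in> \<T> \<Longrightarrow> T' \<in> \<T> \<Longrightarrow> (T \<inter> T') face_of T"
  using tri unfolding triangulation_of_def triangulation_def by auto

lemma simplex_mesh:
  assumes "T \<in> \<T>"
  obtains C g e where "\<not> affine_dependent C" "card C = CARD('d) + 1" "T = convex hull C" "barycentric C g e"
proof -
  have "int CARD('d) simplex T" using tri assms unfolding triangulation_of_def by blast
  then obtain C where C: "\<not> affine_dependent C" "int (card C) = int CARD('d) + 1" "T = convex hull C"
    unfolding simplex_def by blast
  moreover have c: "card C = CARD('d) + 1" using C(2) by linarith
  ultimately show ?thesis using barycentric_exists[OF C(1) c] that by blast
qed

lemma mesh_compact_convex: "T \<in> \<T> \<Longrightarrow> compact T" "T \<in> \<T> \<Longrightarrow> convex T"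
proof -
  assume "T \<in> \<T>"
  then obtain C g e where C: "\<not> affine_dependent C" "T = convex hull C" by (rule simplex_mesh)
  then show "compact T" "convex T"
    using finite_imp_compact_convex_hull[OF aff_independent_finite[OF C(1)]] by auto
qed

lemma interior_mesh: "T \<in> \<T> \<Longrightarrow> interior T \<subseteq> \<Omega>"
  using interior_closure_lipschitz_boundary[OF \<Omega>(1,3)] interior_mono[of T "closure \<Omega>"] Union_mesh by auto

text \<open>A null set off which every point of \<Omega> has a neighbourhood inside one element,
  where finite element functions are polynomials.\<close>

definition skeleton :: "(real^'d) set" where
  "skeleton = (\<Union>T\<in>\<T>. frontier T)"

lemma negligible_skeleton: "negligible skeleton"
  unfolding skeleton_def using finite_mesh mesh_compact_convex(2)
  by (intro negligible_Union) (auto intro: negligible_convex_frontier)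

lemma off_skeleton: "x \<in> \<Omega> - skeleton \<Longrightarrow> \<exists>T\<in>\<T>. x \<in> interior T"
proof -
  assume x: "x \<in> \<Omega> - skeleton"
  then obtain T where T: "T \<in> \<T>" "x \<in> T" using Union_mesh closure_subset by blast
  then have "x \<notin> frontier T" using x by (auto simp: skeleton_def)
  then show ?thesis using T mesh_compact_convex(1)[OF T(1)] by (auto simp: frontier_def compact_imp_closed)
qed

text \<open>Two elements meet in a face of each, and a proper face misses the interior.\<close>

lemma interior_disjoint:
  assumes "T \<in> \<T>" "T' \<in> \<T>" "x \<in> interior T" "x \<in> interior T'"
  shows "T = T'"
proof -
  have a: "T1 \<subseteq> T2" if "T1 \<in> \<T>" "T2 \<in> \<T>" "x \<in> interior T1" "x \<in> interior T2" for T1 T2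
  proof (rule ccontr)
    assume "\<not> T1 \<subseteq> T2"
    then have "T1 \<inter> T2 \<noteq> T1" by auto
    then have "(T1 \<inter> T2) \<inter> interior T1 = {}" by (intro face_of_disjoint_interior face_mesh that)
    moreover have "x \<in> T1 \<inter> T2" using that interior_subset by blast
    ultimately show False using that by blast
  qed
  show ?thesis using a[OF assms] a[OF assms(2,1,4,3)] by blast
qed

text \<open>Along a segment the elements cut the parameter interval into finitely many closed sets,
  and a function that is Lipschitz on each of them is Lipschitz on the interval. The sum of the
  local constants depends on the mesh, which is harmless because it enters no norm estimate.\<close>

lemma lip_rep_piecewise:
  fixes u :: "real^'d \<Rightarrow> real"
  assumes bl: "\<And>T. T \<in> \<T> \<Longrightarrow> \<exists>L\<ge>0. (\<forall>x\<in>T. \<bar>u x\<bar> \<le> L) \<and> (\<forall>x\<in>T. \<forall>y\<in>T. \<bar>u x - u y\<bar> \<le> L * norm (x - y))"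
    and d: "\<And>T x. T \<in> \<T> \<Longrightarrow> x \<in> interior T \<Longrightarrow> (u has_derivative D x) (at x)"
  shows "lip_rep \<Omega> u D"
proof -
  obtain L where L: "\<And>T. T \<in> \<T> \<Longrightarrow> L T \<ge> 0" "\<And>T x. T \<in> \<T> \<Longrightarrow> x \<in> T \<Longrightarrow> \<bar>u x\<bar> \<le> L T"
    "\<And>T x y. T \<in> \<T> \<Longrightarrow> x \<in> T \<Longrightarrow> y \<in> T \<Longrightarrow> \<bar>u x - u y\<bar> \<le> L T * norm (x - y)"
    using bl by metis
  define M where "M = (\<Sum>T\<in>\<T>. L T)"
  have LM: "L T \<le> M" if "T \<in> \<T>" for T
    unfolding M_def using finite_mesh L(1) that by (intro member_le_sum) auto
  have M0: "M \<ge> 0" unfolding M_def using L(1) by (intro sum_nonneg) auto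
  show ?thesis
  proof (rule lip_repI[OF negligible_skeleton refl, where M=M])
    fix x assume "x \<in> \<Omega> - skeleton"
    then obtain T where "T \<in> \<T>" "x \<in> interior T" using off_skeleton by blast
    then show "(u has_derivative D x) (at x)" by (rule d)
  next
    fix x assume "x \<in> \<Omega>"
    then obtain T where "T \<in> \<T>" "x \<in> T" using Union_mesh closure_subset by blast
    then show "norm (u x) \<le> M" using L(2)[of T x] LM[of T] by simp
  next
    fix x y assume s: "closed_segment x y \<subseteq> \<Omega>"
    \<comment> \<open>Parametrised over the whole real line, so that preimages of the elements are
      closed sets.\<close>
    define \<gamma> where "\<gamma> t = x + t *\<^sub>R (y - x)" for t :: real
    have "(M * norm (x - y))-lipschitz_on {0..1} (\<lambda>t. u (\<gamma> t))"
    proof (rule lipschitz_on_closed_Union[where I=\<T> and U="\<lambda>T. \<gamma> -` T"])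
      fix T assume T: "T \<in> \<T>"
      show "(M * norm (x - y))-lipschitz_on (\<gamma> -` T) (\<lambda>t. u (\<gamma> t))"
      proof (rule lipschitz_onI)
        fix t r assume tr: "t \<in> \<gamma> -` T" "r \<in> \<gamma> -` T"
        have "\<bar>u (\<gamma> t) - u (\<gamma> r)\<bar> \<le> L T * norm (\<gamma> t - \<gamma> r)" using tr by (intro L(3)[OF T]) auto
        also have "\<dots> \<le> M * norm (\<gamma> t - \<gamma> r)" by (intro mult_right_mono LM T) simp
        also have "\<gamma> t - \<gamma> r = (t - r) *\<^sub>R (y - x)" by (simp add: \<gamma>_def algebra_simps)
        finally show "dist (u (\<gamma> t)) (u (\<gamma> r)) \<le> M * norm (x - y) * dist t r"
          by (simp add: dist_real_def norm_minus_commute mult_ac)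
      qed (use M0 in simp)
      show "closed (\<gamma> -` T)"
        unfolding \<gamma>_def using mesh_compact_convex(1)[OF T]
        by (intro continuous_closed_vimage continuous_intros) (auto intro: compact_imp_closed)
    next
      show "{0..1} \<subseteq> (\<Union>T\<in>\<T>. \<gamma> -` T)"
      proof
        fix t :: real assume "t \<in> {0..1}"
        then have "\<gamma> t \<in> closed_segment x y" unfolding in_segment \<gamma>_def by (intro exI[of _ t]) (auto simp: algebra_simps)
        then have "\<gamma> t \<in> \<Union>\<T>" using s Union_mesh closure_subset by blast
        then show "t \<in> (\<Union>T\<in>\<T>. \<gamma> -` T)" by auto
      qed
    qed (use finite_mesh M0 in auto)
    from lipschitz_onD[OF this, of 0 1] show "norm (u x - u y) \<le> M * norm (x - y)"
      by (simp add: \<gamma>_def dist_real_def)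
  qed
qed

lemma fe_piece:
  assumes "u \<in> fe_space \<Omega> k \<T>" "T \<in> \<T>"
  obtains p where "p \<in> polys_of_degree_le k" "\<And>x. x \<in> T \<Longrightarrow> u x = p x"
  using assms unfolding fe_space_def by blast

lemma fe_derivative_interior:
  assumes "x \<in> interior T" "\<And>x. x \<in> T \<Longrightarrow> u x = p x" "(p has_derivative D) (at x)"
  shows "(u has_derivative D) (at x)"
  by (rule has_derivative_transform_within_open[OF assms(3) open_interior assms(1)])
    (metis assms(2) interior_subset subsetD)

lemma fe_lip_rep:
  assumes u: "u \<in> fe_space \<Omega> k \<T>"
  obtains D where "lip_rep \<Omega> u D" "\<And>T x. T \<in> \<T> \<Longrightarrow> x \<in> interior T \<Longrightarrow> (u has_derivative D x) (at x)"
proof -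
  have bl: "\<exists>L\<ge>0. (\<forall>x\<in>T. \<bar>u x\<bar> \<le> L) \<and> (\<forall>x\<in>T. \<forall>y\<in>T. \<bar>u x - u y\<bar> \<le> L * norm (x - y))" if T: "T \<in> \<T>" for T
  proof -
    obtain p where p: "p \<in> polys_of_degree_le k" "\<And>x. x \<in> T \<Longrightarrow> u x = p x" by (rule fe_piece[OF u T], rule that)
    obtain L where "L \<ge> 0" "\<And>x. x \<in> T \<Longrightarrow> \<bar>p x\<bar> \<le> L" "\<And>x y. x \<in> T \<Longrightarrow> y \<in> T \<Longrightarrow> \<bar>p x - p y\<bar> \<le> L * norm (x - y)"
      by (rule polys_lipschitz_on_compact[OF p(1) k mesh_compact_convex[OF T]], rule that)
    then show ?thesis using p(2) by auto
  qed
  \<comment> \<open>\<open>frechet_derivative\<close> serves as a single D for all elements; on the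
    skeleton its value does not matter.\<close>
  have d: "(u has_derivative frechet_derivative u (at x)) (at x)" if T: "T \<in> \<T>" and x: "x \<in> interior T" for T x
  proof -
    obtain p where p: "p \<in> polys_of_degree_le k" "\<And>x. x \<in> T \<Longrightarrow> u x = p x" by (rule fe_piece[OF u T], rule that)
    obtain q where q: "\<And>x. (p has_derivative (\<lambda>h. \<Sum>j\<in>UNIV. h $ j * q j x)) (at x)"
      by (rule polys_gradient[OF p(1) k], rule that)
    from fe_derivative_interior[OF x p(2) q] have "u differentiable (at x)" by (auto simp: differentiable_def)
    then show ?thesis by (simp add: frechet_derivative_works)
  qed
  show ?thesis by (rule that[OF lip_rep_piecewise[OF bl d] d])
qed

lemma fe_space_lincomb:
  assumes "u \<in> fe_space \<Omega> k \<T>" "v \<in> fe_space \<Omega> k \<T>"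
  shows "(\<lambda>x. a * u x + b * v x) \<in> fe_space \<Omega> k \<T>"
  unfolding fe_space_def
proof (intro CollectI conjI ballI)
  show "continuous_on (closure \<Omega>) (\<lambda>x. a * u x + b * v x)"
    using assms by (intro continuous_intros) (auto simp: fe_space_def)
  fix T assume T: "T \<in> \<T>"
  obtain p where p: "p \<in> polys_of_degree_le k" "\<And>x. x \<in> T \<Longrightarrow> u x = p x" by (rule fe_piece[OF assms(1) T], rule that)
  obtain q where q: "q \<in> polys_of_degree_le k" "\<And>x. x \<in> T \<Longrightarrow> v x = q x" by (rule fe_piece[OF assms(2) T], rule that)
  show "\<exists>w\<in>polys_of_degree_le k. \<forall>x\<in>T. a * u x + b * v x = w x"
    by (rule bexI[of _ "\<lambda>x. a * p x + b * q x"]) (simp_all add: p q polys_lincomb)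
qed

end

section \<open>The operator preserving continuity across faces\<close>

text \<open>On a face only the vertices of that face enter, with weights that do not mention the
  simplex; both neighbours of a face therefore give the same interpolant and the same shift.\<close>

lemma (in barycentric) coord_of_subset:
  assumes "D \<subseteq> C" "sum u D = 1" "(\<Sum>a\<in>D. u a *\<^sub>R a) = x"
  shows "interp \<zeta> x = (\<Sum>a\<in>D. u a * \<zeta> a)"
    and "shift \<zeta> x = (\<Sum>a\<in>D. (u a * (\<zeta> a - (\<Sum>a\<in>D. u a * \<zeta> a))) *\<^sub>R a)"
proof -
  define v where "v a = (if a \<in> D then u a else 0)" for a
  have "sum v C = sum u D" "(\<Sum>a\<in>C. v a *\<^sub>R a) = (\<Sum>a\<in>D. u a *\<^sub>R a)"
    unfolding v_def using assms(1) fin by (auto intro!: sum.mono_neutral_cong_right)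
  then have v: "sum v C = 1" "(\<Sum>a\<in>C. v a *\<^sub>R a) = x" using assms by simp_all
  have c: "coord a x = v a" if "a \<in> C" for a by (rule coord_unique[OF v that])
  show i: "interp \<zeta> x = (\<Sum>a\<in>D. u a * \<zeta> a)"
    unfolding interp_def using assms(1) fin c by (intro sum.mono_neutral_cong_right) (auto simp: v_def)
  show "shift \<zeta> x = (\<Sum>a\<in>D. (u a * (\<zeta> a - (\<Sum>a\<in>D. u a * \<zeta> a))) *\<^sub>R a)"
    unfolding shift_def i using assms(1) fin c by (intro sum.mono_neutral_cong_right) (auto simp: v_def)
qed

text \<open>Agreement is assumed only along the line through x in direction w, so only that
  component of the gradients is shared; a common face of two elements gives no more.\<close>

lemma directional_derivative_eq:
  fixes p p' :: "real^'d::finite \<Rightarrow> real"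
  assumes "(p has_derivative (\<lambda>h. q \<bullet> h)) (at x)" "(p' has_derivative (\<lambda>h. q' \<bullet> h)) (at x)"
    "\<epsilon> > 0" "\<And>t. \<bar>t\<bar> < \<epsilon> \<Longrightarrow> p (x + t *\<^sub>R w) = p' (x + t *\<^sub>R w)"
  shows "w \<bullet> q = w \<bullet> q'"
proof -
  have l: "((\<lambda>t. f (x + t *\<^sub>R w)) has_derivative (\<lambda>t. r \<bullet> (t *\<^sub>R w))) (at 0)"
    if f: "(f has_derivative (\<lambda>h. r \<bullet> h)) (at x)" for f :: "real^'d \<Rightarrow> real" and r
  proof (rule has_derivative_compose[where f="\<lambda>t. x + t *\<^sub>R w"])
    show "((\<lambda>t. x + t *\<^sub>R w) has_derivative (\<lambda>t. t *\<^sub>R w)) (at 0)" by (auto intro!: derivative_eq_intros)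
  qed (use f in simp)
  have o: "open {-\<epsilon><..<\<epsilon>}" "0 \<in> {-\<epsilon><..<\<epsilon>}" using assms(3) by auto
  have "((\<lambda>t. p' (x + t *\<^sub>R w)) has_derivative (\<lambda>t. q \<bullet> (t *\<^sub>R w))) (at 0)"
    by (rule has_derivative_transform_within_open[OF l[OF assms(1)] o]) (use assms(4) in auto)
  from has_derivative_unique[OF this l[OF assms(2)]]
  have "(\<lambda>t. q \<bullet> (t *\<^sub>R w)) = (\<lambda>t. q' \<bullet> (t *\<^sub>R w))" .
  from fun_cong[OF this, of 1] show ?thesis by (simp add: inner_commute)
qed

text \<open>At a point of a face the shift vector is tangential to the face, so moving along it in either
  direction does not leave the face.\<close>

lemma local_op_face_eq:
  fixes D :: "(real^'d::finite) set"
  assumes b: "barycentric C g e" "barycentric C' g' e'" and D: "D \<subseteq> C" "D \<subseteq> C'" and x: "x \<in> convex hull D"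
    and p: "(p has_derivative (\<lambda>h. q x \<bullet> h)) (at x)" "(p' has_derivative (\<lambda>h. q' x \<bullet> h)) (at x)"
    and eq: "\<And>y. y \<in> convex hull D \<Longrightarrow> p y = p' y"
  shows "barycentric.local_op C g e \<kappa> \<zeta> p q x = barycentric.local_op C' g' e' \<kappa> \<zeta> p' q' x"
proof -
  interpret A: barycentric C g e by fact
  interpret B: barycentric C' g' e' by fact
  have fD: "finite D" using D(1) A.fin by (rule finite_subset)
  obtain u where u: "\<forall>a\<in>D. 0 \<le> u a" "sum u D = 1" "(\<Sum>a\<in>D. u a *\<^sub>R a) = x"
    using x unfolding convex_hull_finite[OF fD] by blast
  define Z where "Z = (\<Sum>a\<in>D. u a * \<zeta> a)"
  define w where "w = (\<Sum>a\<in>D. (u a * (\<zeta> a - Z)) *\<^sub>R a)"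
  have A: "A.interp \<zeta> x = Z" "A.shift \<zeta> x = w" unfolding Z_def w_def by (rule A.coord_of_subset[OF D(1) u(2,3)])+
  have B: "B.interp \<zeta> x = Z" "B.shift \<zeta> x = w" unfolding Z_def w_def by (rule B.coord_of_subset[OF D(2) u(2,3)])+
  \<comment> \<open>For |t| < 1/R the weights \<open>u a * (1 + t * (\<zeta> a - Z))\<close> stay
    nonnegative; the added 1 keeps R positive when all nodal values agree.\<close>
  define R where "R = (\<Sum>a\<in>D. \<bar>\<zeta> a - Z\<bar>) + 1"
  have R: "R > 0" "\<And>a. a \<in> D \<Longrightarrow> \<bar>\<zeta> a - Z\<bar> \<le> R"
  proof -
    have "(\<Sum>a\<in>D. \<bar>\<zeta> a - Z\<bar>) \<ge> 0" by (intro sum_nonneg) simp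
    then show "R > 0" unfolding R_def by linarith
    fix a assume "a \<in> D"
    then have "\<bar>\<zeta> a - Z\<bar> \<le> (\<Sum>a\<in>D. \<bar>\<zeta> a - Z\<bar>)" using fD by (intro member_le_sum) auto
    then show "\<bar>\<zeta> a - Z\<bar> \<le> R" unfolding R_def by linarith
  qed
  have "w \<bullet> q x = w \<bullet> q' x"
  proof (rule directional_derivative_eq[OF p])
    show "1 / R > 0" using R(1) by simp
    fix t :: real assume t: "\<bar>t\<bar> < 1 / R"
    have "x + t *\<^sub>R w \<in> convex hull D"
      unfolding convex_hull_finite[OF fD]
    proof (intro CollectI exI[of _ "\<lambda>a. u a * (1 + t * (\<zeta> a - Z))"] conjI ballI)
      fix a assume a: "a \<in> D"
      have "\<bar>t * (\<zeta> a - Z)\<bar> \<le> (1 / R) * R" unfolding abs_mult using t R(2)[OF a] R(1) by (intro mult_mono) auto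
      then have "1 + t * (\<zeta> a - Z) \<ge> 0" using R(1) by simp
      then show "0 \<le> u a * (1 + t * (\<zeta> a - Z))" using u(1) a by simp
    next
      have "(\<Sum>a\<in>D. u a * (1 + t * (\<zeta> a - Z))) = sum u D + t * ((\<Sum>a\<in>D. u a * \<zeta> a) - sum u D * Z)"
      proof -
        have "u a * (1 + t * (\<zeta> a - Z)) = u a + (t * (u a * \<zeta> a) - t * (u a * Z))" for a
          by (simp add: algebra_simps)
        then have "(\<Sum>a\<in>D. u a * (1 + t * (\<zeta> a - Z))) = (\<Sum>a\<in>D. u a + (t * (u a * \<zeta> a) - t * (u a * Z)))"
          by (simp only:)
        then show ?thesis
          unfolding sum.distrib sum_subtractf sum_distrib_left[symmetric] sum_distrib_right[symmetric] right_diff_distrib .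
      qed
      then show "(\<Sum>a\<in>D. u a * (1 + t * (\<zeta> a - Z))) = 1" using u(2) by (simp add: Z_def)
    next
      have "(\<Sum>a\<in>D. (u a * (1 + t * (\<zeta> a - Z))) *\<^sub>R a) = (\<Sum>a\<in>D. u a *\<^sub>R a) + t *\<^sub>R w"
      proof -
        have "(u a * (1 + t * (\<zeta> a - Z))) *\<^sub>R a = u a *\<^sub>R a + t *\<^sub>R ((u a * (\<zeta> a - Z)) *\<^sub>R a)" for a
          by (simp add: algebra_simps)
        then show ?thesis unfolding w_def scaleR_sum_right sum.distrib[symmetric] by (simp only:)
      qed
      then show "(\<Sum>a\<in>D. (u a * (1 + t * (\<zeta> a - Z))) *\<^sub>R a) = x + t *\<^sub>R w" using u(3) by simp
    qed
    then show "p (x + t *\<^sub>R w) = p' (x + t *\<^sub>R w)" by (rule eq)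
  qed
  then show ?thesis unfolding A.local_op_def B.local_op_def A B using eq[OF x] by simp
qed

context fe_mesh
begin

text \<open>Each simplex describes the common face as the hull of some of its own vertices; the two
  vertex sets coincide because both are the extreme points of that face.\<close>

lemma mesh_face:
  assumes T: "T \<in> \<T>" "T' \<in> \<T>" and C: "\<not> affine_dependent C" "T = convex hull C" and C': "\<not> affine_dependent C'" "T' = convex hull C'"
  obtains D where "D \<subseteq> C" "D \<subseteq> C'" "T \<inter> T' = convex hull D"
proof -
  obtain D where D: "D \<subseteq> C" "T \<inter> T' = convex hull D"
    using face_mesh[OF T] face_of_convex_hull_affine_independent[OF C(1)] C(2) by auto
  obtain D' where D': "D' \<subseteq> C'" "T' \<inter> T = convex hull D'"
    using face_mesh[OF T(2,1)] face_of_convex_hull_affine_independent[OF C'(1)] C'(2) by auto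
  have i: "\<not> affine_dependent D" "\<not> affine_dependent D'"
    using affine_independent_subset C(1) C'(1) D(1) D'(1) by blast+
  have "convex hull D = convex hull D'" using D(2) D'(2) by (simp add: Int_commute)
  then have "D = D'"
    using extreme_point_of_convex_hull_affine_independent[OF i(1)] extreme_point_of_convex_hull_affine_independent[OF i(2)] by auto
  then show ?thesis using that D D' by blast
qed

text \<open>The nodal values \<zeta> belong to points, not to elements, so the elementwise
  definitions can be glued. The polynomial data of each element are kept in the conclusion for the
  local error estimate.\<close>

lemma operator_exists:
  assumes u: "u \<in> fe_space \<Omega> k \<T>"
  obtains v where "v \<in> fe_space \<Omega> k \<T>"
    "\<And>T. T \<in> \<T> \<Longrightarrow> \<exists>C g e p q. barycentric C g e \<and> card C = CARD('d) + 1 \<and> T = convex hull C \<and> p \<in> polys_of_degree_le k \<and>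
        (\<forall>x\<in>T. u x = p x) \<and> (\<forall>x. (p has_derivative (\<lambda>h. (\<chi> j. q j x) \<bullet> h)) (at x)) \<and> (\<forall>j. q j \<in> polys_of_degree_le (k - 1)) \<and>
        (\<forall>x\<in>T. v x = barycentric.local_op C g e (1 / real k) \<zeta> p (\<lambda>x. \<chi> j. q j x) x)"
proof -
  define good where "good T C g e p q \<longleftrightarrow> \<not> affine_dependent C \<and> barycentric C g e \<and> card C = CARD('d) + 1 \<and> T = convex hull C \<and> p \<in> polys_of_degree_le k \<and>
        (\<forall>x\<in>T. u x = p x) \<and> (\<forall>x. (p has_derivative (\<lambda>h. (\<chi> j. q j x) \<bullet> h)) (at x)) \<and> (\<forall>j. q j \<in> polys_of_degree_le (k - 1)) \<and>
        barycentric.local_op C g e (1 / real k) \<zeta> p (\<lambda>x. \<chi> j. q j x) \<in> polys_of_degree_le k"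
    for T C g e p and q :: "'d \<Rightarrow> real^'d \<Rightarrow> real"
  have ex: "\<exists>C g e p q. good T C g e p q" if T: "T \<in> \<T>" for T
  proof -
    obtain C g e where C: "\<not> affine_dependent C" "card C = CARD('d) + 1" "T = convex hull C" "barycentric C g e"
      by (rule simplex_mesh[OF T])
    interpret barycentric C g e by (rule C(4))
    obtain p where p: "p \<in> polys_of_degree_le k" "\<And>x. x \<in> T \<Longrightarrow> u x = p x" by (rule fe_piece[OF u T], rule that)
    define A where "A x = (\<Sum>a\<in>C. (coord a x * \<zeta> a) *\<^sub>R a)" for x
    have A: "\<forall>j. A x $ j = (\<Sum>a\<in>C. e a * \<zeta> a * a $ j) + (\<Sum>a\<in>C. (\<zeta> a * a $ j) *\<^sub>R g a) \<bullet> x" for x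
      by (auto simp: A_def coord_def inner_sum_left sum.distrib[symmetric] algebra_simps)
    have Z: "interp \<zeta> x = (\<Sum>a\<in>C. e a * \<zeta> a) + (\<Sum>a\<in>C. \<zeta> a *\<^sub>R g a) \<bullet> x" for x
      by (auto simp: interp_def coord_def inner_sum_left sum.distrib[symmetric] algebra_simps)
    obtain q where q: "\<forall>x. (p has_derivative (\<lambda>h. \<Sum>j\<in>UNIV. h $ j * q j x)) (at x)" "\<forall>j. q j \<in> polys_of_degree_le (k - 1)"
        "(\<lambda>x. interp \<zeta> x * p x + (1 / real k) * (\<Sum>j\<in>UNIV. (A x - interp \<zeta> x *\<^sub>R x) $ j * q j x)) \<in> polys_of_degree_le k"
      using euler_degree_reduction[OF p(1) k A Z] by blast
    have "local_op (1 / real k) \<zeta> p (\<lambda>x. \<chi> j. q j x) = (\<lambda>x. interp \<zeta> x * p x + (1 / real k) * (\<Sum>j\<in>UNIV. (A x - interp \<zeta> x *\<^sub>R x) $ j * q j x))"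
      unfolding local_op_def[abs_def] shift_eq A_def[symmetric] inner_vec_def by simp
    moreover have "(\<lambda>h. (\<chi> j. q j x) \<bullet> h) = (\<lambda>h. \<Sum>j\<in>UNIV. h $ j * q j x)" for x
      by (simp add: inner_vec_def mult.commute)
    ultimately have "good T C g e p q" unfolding good_def using C p q by simp
    then show ?thesis by blast
  qed
  then obtain C g e p q where G: "\<And>T. T \<in> \<T> \<Longrightarrow> good T (C T) (g T) (e T) (p T) (q T)" by metis
  define F where "F T = barycentric.local_op (C T) (g T) (e T) (1 / real k) \<zeta> (p T) (\<lambda>x. \<chi> j. q T j x)" for T
  have same: "F T x = F T' x" if T: "T \<in> \<T>" "T' \<in> \<T>" and x: "x \<in> T" "x \<in> T'" for T T' x
  proof -
    note g1 = G[OF T(1), unfolded good_def] and g2 = G[OF T(2), unfolded good_def]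
    obtain D where D: "D \<subseteq> C T" "D \<subseteq> C T'" "T \<inter> T' = convex hull D"
      by (rule mesh_face[OF T, of "C T" "C T'"]) (use g1 g2 in blast)+
    have b: "barycentric (C T) (g T) (e T)" "barycentric (C T') (g T') (e T')" using g1 g2 by blast+
    have xD: "x \<in> convex hull D" using x D(3) by blast
    show ?thesis
      unfolding F_def
    proof (rule local_op_face_eq[OF b D(1,2) xD])
      show "p T y = p T' y" if "y \<in> convex hull D" for y
        using that D(3) g1 g2 by (metis IntE)
    qed (use g1 g2 in blast)+
  qed
  \<comment> \<open>Any element containing x will do, by \<open>same\<close>.\<close>
  define v where "v x = F (SOME T. T \<in> \<T> \<and> x \<in> T) x" for x
  have v: "v x = F T x" if "T \<in> \<T>" "x \<in> T" for T x
    unfolding v_def using someI[of "\<lambda>T. T \<in> \<T> \<and> x \<in> T" T] that by (intro same) auto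
  have FP: "F T \<in> polys_of_degree_le k" if "T \<in> \<T>" for T
    using G[OF that] unfolding good_def F_def by blast
  show ?thesis
  proof (rule that)
    show "v \<in> fe_space \<Omega> k \<T>"
      unfolding fe_space_def
    proof (intro CollectI conjI ballI)
      have "continuous_on (\<Union>T\<in>\<T>. T) v"
      proof (rule continuous_on_closed_Union[OF finite_mesh])
        fix T assume T: "T \<in> \<T>"
        show "closed T" using mesh_compact_convex(1)[OF T] by (rule compact_imp_closed)
        show "continuous_on T v"
          by (rule continuous_on_eq[OF polys_continuous[OF FP[OF T]]]) (simp add: v[OF T])
      qed
      then show "continuous_on (closure \<Omega>) v" using Union_mesh by simp
      show "\<exists>p\<in>polys_of_degree_le k. \<forall>x\<in>T. v x = p x" if "T \<in> \<T>" for T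
        using FP[OF that] v[OF that] by blast
    qed
    fix T assume T: "T \<in> \<T>"
    show "\<exists>C g e p q. barycentric C g e \<and> card C = CARD('d) + 1 \<and> T = convex hull C \<and> p \<in> polys_of_degree_le k \<and>
        (\<forall>x\<in>T. u x = p x) \<and> (\<forall>x. (p has_derivative (\<lambda>h. (\<chi> j. q j x) \<bullet> h)) (at x)) \<and> (\<forall>j. q j \<in> polys_of_degree_le (k - 1)) \<and>
        (\<forall>x\<in>T. v x = barycentric.local_op C g e (1 / real k) \<zeta> p (\<lambda>x. \<chi> j. q j x) x)"
    proof (intro exI conjI)
      show "\<forall>x\<in>T. v x = barycentric.local_op (C T) (g T) (e T) (1 / real k) \<zeta> (p T) (\<lambda>x. \<chi> j. q T j x) x"
        using v[OF T] by (simp add: F_def)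
    qed (use G[OF T, unfolded good_def] in blast)+
  qed
qed

end

section \<open>Superapproximation\<close>

text \<open>The supremum in \<open>inball_diameter\<close> need not be attained: a ball whose
  diameter exceeds half of it is taken, and its radius is halved to place the closed ball in the
  interior. These two losses and the passage from diameter to radius account for the 8.\<close>

lemma inscribed_ball:
  fixes T :: "(real^'d::finite) set"
  assumes "diameter T > 0" "bounded T" "diameter T \<le> \<sigma> * inball_diameter T"
  obtains c r where "r > 0" "cball c r \<subseteq> interior T" "diameter T \<le> 8 * \<sigma> * r" "\<sigma> > 0"
proof -
  define S where "S = {2 * r | r. 0 \<le> r \<and> (\<exists>x. cball x r \<subseteq> T)}"
  have "T \<noteq> {}" using assms(1) by (auto simp: diameter_def)
  then obtain x0 where "x0 \<in> T" by blast
  then have S0: "0 \<in> S" unfolding S_def by (intro CollectI exI[of _ 0]) auto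
  \<comment> \<open>A ball inside T contains two points at distance twice its radius, so the
    supremum is taken over a bounded set.\<close>
  have bdd: "bdd_above S"
  proof (rule bdd_aboveI[of _ "diameter T"])
    fix s assume "s \<in> S"
    then obtain r x where r: "s = 2 * r" "0 \<le> r" "cball x r \<subseteq> T" by (auto simp: S_def)
    obtain i :: 'd where True by blast
    have "x + r *\<^sub>R axis i 1 \<in> cball x r" "x - r *\<^sub>R axis i 1 \<in> cball x r" using r(2) by (auto simp: dist_norm)
    then have "dist (x + r *\<^sub>R axis i 1) (x - r *\<^sub>R axis i 1) \<le> diameter T"
      using r(3) assms(2) by (intro diameter_bounded_bound) auto
    moreover have "(x + r *\<^sub>R axis i 1) - (x - r *\<^sub>R axis i 1) = (2 * r) *\<^sub>R axis i 1"
      by (simp add: algebra_simps scaleR_2[symmetric])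
    then have "dist (x + r *\<^sub>R axis i 1) (x - r *\<^sub>R axis i 1) = 2 * r" using r(2) by (simp add: dist_norm)
    ultimately show "s \<le> diameter T" using r(1) by simp
  qed
  have Sup0: "Sup S \<ge> 0" by (rule cSup_upper[OF S0 bdd])
  have d: "diameter T \<le> \<sigma> * Sup S" using assms(3) by (simp add: inball_diameter_def S_def)
  have \<sigma>: "\<sigma> > 0"
  proof (rule ccontr)
    assume "\<not> \<sigma> > 0"
    then have "\<sigma> * Sup S \<le> 0" using Sup0 by (intro mult_nonpos_nonneg) auto
    then show False using d assms(1) by linarith
  qed
  have "Sup S \<noteq> 0" using d assms(1) by auto
  then have "Sup S / 2 < Sup S" using Sup0 by auto
  then obtain s where s: "s \<in> S" "Sup S / 2 < s" using less_cSupE[of "Sup S / 2" S] S0 by blast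
  then obtain r x where r: "s = 2 * r" "0 \<le> r" "cball x r \<subseteq> T" by (auto simp: S_def)
  have r0: "r > 0" using s(2) Sup0 r by simp
  show ?thesis
  proof (rule that[of "r / 2" x])
    have "cball x (r / 2) \<subseteq> ball x r" using r0 by auto
    also have "\<dots> \<subseteq> interior T" using r(3) by (intro interior_maximal) auto
    finally show "cball x (r / 2) \<subseteq> interior T" .
    have "\<sigma> * Sup S \<le> \<sigma> * (4 * r)" using s(2) r(1) \<sigma> by (intro mult_left_mono) auto
    then show "diameter T \<le> 8 * \<sigma> * (r / 2)" using d by simp
  qed (use r0 \<sigma> in auto)
qed

text \<open>The vertex a may lie on the boundary of \<Omega>, where only the limit l is available.
  The Taylor estimate is applied at points of the segment from x towards a, which are interior by
  convexity, and the points then tend to a.\<close>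

lemma vertex_taylor_estimate:
  fixes f :: "real^'d::finite \<Rightarrow> real"
  assumes \<Omega>: "open \<Omega>" and T: "convex T" "closed T" "interior T \<subseteq> \<Omega>" and x: "x \<in> interior T" and a: "a \<in> T"
    and l: "(f \<longlongrightarrow> l) (at a within \<Omega>)"
    and f: "\<And>x. x \<in> \<Omega> \<Longrightarrow> (f has_derivative (\<lambda>k. \<Sum>i\<in>UNIV. k $ i * g i x)) (at x)" "M \<ge> 0"
    and g: "\<And>i x y. closed_segment x y \<subseteq> \<Omega> \<Longrightarrow> \<bar>g i x - g i y\<bar> \<le> M * norm (x - y)"
  shows "\<bar>l - f x - (\<chi> i. g i x) \<bullet> (a - x)\<bar> \<le> (real CARD('d) * M) * (norm (a - x))\<^sup>2"
proof (cases "x = a")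
  \<comment> \<open>Split off because limits at a ignore the point a itself, where the approximating
    sequence would be constant.\<close>
  case True
  have "a \<in> \<Omega>" by (rule subsetD[OF T(3) x[unfolded True]])
  then have fa: "(f has_derivative (\<lambda>k. \<Sum>i\<in>UNIV. k $ i * g i a)) (at a)" by (rule f(1))
  have c: "isCont f a" using fa by (rule has_derivative_continuous)
  have c1: "(f \<longlongrightarrow> f a) (at a)" using c unfolding isCont_def .
  have c2: "(f \<longlongrightarrow> f a) (at a within \<Omega>)" by (rule tendsto_within_subset[OF c1]) simp
  moreover have "at a within \<Omega> \<noteq> bot" unfolding at_within_open[OF \<open>a \<in> \<Omega>\<close> \<Omega>] by simp
  ultimately have "l = f a" using tendsto_unique[OF _ l c2] by blast
  then show ?thesis using True by simp
next
  case False
  define y where "y n = a - inverse (real (Suc n)) *\<^sub>R (a - x)" for n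
  have yi: "y n \<in> interior T" for n
    unfolding y_def by (rule mem_interior_convex_shrink[OF T(1) x a]) (auto simp: inverse_le_1_iff)
  have ylim: "y \<longlonglongrightarrow> a"
  proof -
    have "(\<lambda>n. a - inverse (real (Suc n)) *\<^sub>R (a - x)) \<longlonglongrightarrow> a - 0 *\<^sub>R (a - x)"
      by (intro tendsto_intros LIMSEQ_inverse_real_of_nat)
    then show ?thesis unfolding y_def[abs_def] by simp
  qed
  have ya: "y n \<noteq> a" for n using False by (simp add: y_def)
  have "filterlim y (at a within \<Omega>) sequentially"
    unfolding filterlim_at using ylim yi ya T(3) by (intro conjI always_eventually) auto
  then have fl: "(\<lambda>n. f (y n)) \<longlonglongrightarrow> l" by (rule filterlim_compose[OF l])
  have b: "\<bar>f (y n) - f x - (\<Sum>i\<in>UNIV. (y n - x) $ i * g i x)\<bar> \<le> (\<Sum>i\<in>(UNIV::'d set). M) * (norm (y n - x))\<^sup>2" for n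
  proof (rule taylor_lipschitz_gradient[OF convex_closed_segment[of x "y n"]])
    have s: "closed_segment x (y n) \<subseteq> \<Omega>"
      using closed_segment_subset[OF x yi convex_interior[OF T(1)]] T(3) by blast
    fix u assume u: "u \<in> closed_segment x (y n)"
    show "(f has_derivative (\<lambda>h. \<Sum>i\<in>UNIV. h $ i * g i u)) (at u within closed_segment x (y n))"
      using u s by (intro has_derivative_at_withinI[OF f(1)]) auto
    have "closed_segment u x \<subseteq> closed_segment x (y n)" using u by (intro closed_segment_subset) auto
    then show "\<bar>g i u - g i x\<bar> \<le> M * norm (u - x)" for i using s by (intro g) auto
  qed (use f(2) in auto)
  have "(\<lambda>n. \<bar>f (y n) - f x - (\<Sum>i\<in>UNIV. (y n - x) $ i * g i x)\<bar>) \<longlonglongrightarrow> \<bar>l - f x - (\<Sum>i\<in>UNIV. (a - x) $ i * g i x)\<bar>"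
    by (intro tendsto_rabs tendsto_diff fl tendsto_const tendsto_sum tendsto_mult tendsto_vec_nth ylim)
  moreover have "(\<lambda>n. (\<Sum>i\<in>(UNIV::'d set). M) * (norm (y n - x))\<^sup>2) \<longlonglongrightarrow> (\<Sum>i\<in>(UNIV::'d set). M) * (norm (a - x))\<^sup>2"
    by (intro tendsto_mult tendsto_const tendsto_power tendsto_norm tendsto_diff ylim)
  ultimately have "\<bar>l - f x - (\<Sum>i\<in>UNIV. (a - x) $ i * g i x)\<bar> \<le> (\<Sum>i\<in>(UNIV::'d set). M) * (norm (a - x))\<^sup>2"
    by (rule LIMSEQ_le) (use b in auto)
  then show ?thesis by (simp add: inner_vec_def mult.commute)
qed

lemma sum_square_le:
  fixes f :: "'i \<Rightarrow> real"
  shows "(\<Sum>i\<in>A. f i)\<^sup>2 \<le> real (card A) * (\<Sum>i\<in>A. (f i)\<^sup>2)"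
  using Cauchy_Schwarz_ineq_sum[of "\<lambda>_. 1" f A] by simp

context fe_mesh
begin

text \<open>The skeleton is a null set and the open elements are pairwise disjoint.\<close>

lemma integral_mesh:
  fixes \<phi> :: "real^'d \<Rightarrow> real"
  assumes "\<phi> \<in> Linf_space \<Omega>"
  shows "\<And>T. T \<in> \<T> \<Longrightarrow> integrable lebesgue (\<lambda>x. indicator (interior T) x * \<phi> x)"
    and "integral\<^sup>L (lebesgue_on \<Omega>) \<phi> = (\<Sum>T\<in>\<T>. integral\<^sup>L lebesgue (\<lambda>x. indicator (interior T) x * \<phi> x))"
proof -
  have i: "integrable lebesgue (\<lambda>x. indicator \<Omega> x *\<^sub>R \<phi> x)"
    using Linf_integrable[OF assms \<Omega>(1,2)] unfolding integrable_lebesgue_on_iff[OF sets_lebesgue_open[OF \<Omega>(1)]] .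
  show iT: "integrable lebesgue (\<lambda>x. indicator (interior T) x * \<phi> x)" if "T \<in> \<T>" for T
  proof -
    have "integrable lebesgue (\<lambda>x. indicator (interior T) x *\<^sub>R (indicator \<Omega> x *\<^sub>R \<phi> x))"
      by (rule integrable_mult_indicator[OF _ i]) auto
    also have "(\<lambda>x. indicator (interior T) x *\<^sub>R (indicator \<Omega> x *\<^sub>R \<phi> x)) = (\<lambda>x. indicator (interior T) x * \<phi> x)"
      using interior_mesh[OF that] by (auto simp: indicator_def fun_eq_iff)
    finally show ?thesis .
  qed
  have "AE x in lebesgue. x \<notin> skeleton"
    using negligible_skeleton by (intro AE_not_in) (simp add: negligible_iff_null_sets)
  then have ae: "AE x in lebesgue. indicator \<Omega> x *\<^sub>R \<phi> x = (\<Sum>T\<in>\<T>. indicator (interior T) x * \<phi> x)"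
  proof (rule eventually_mono)
    fix x assume ns: "x \<notin> skeleton"
    show "indicator \<Omega> x *\<^sub>R \<phi> x = (\<Sum>T\<in>\<T>. indicator (interior T) x * \<phi> x)"
    proof (cases "x \<in> \<Omega>")
      case True
      then obtain T0 where T0: "T0 \<in> \<T>" "x \<in> interior T0" using off_skeleton ns by blast
      have "(\<Sum>T\<in>\<T>. indicator (interior T) x * \<phi> x) = (\<Sum>T\<in>\<T>. if T = T0 then \<phi> x else 0)"
        by (rule sum.cong) (use T0 interior_disjoint in \<open>auto simp: indicator_def\<close>)
      then show ?thesis using True T0 finite_mesh by simp
    next
      case False
      then have "(\<Sum>T\<in>\<T>. indicator (interior T) x * \<phi> x) = 0"
        using interior_mesh by (intro sum.neutral) (auto simp: indicator_def)
      then show ?thesis using False by simp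
    qed
  qed
  have "integral\<^sup>L (lebesgue_on \<Omega>) \<phi> = integral\<^sup>L lebesgue (\<lambda>x. \<Sum>T\<in>\<T>. indicator (interior T) x * \<phi> x)"
    unfolding integral_lebesgue_on_eq[OF sets_lebesgue_open[OF \<Omega>(1)]]
    by (rule integral_cong_AE[OF borel_measurable_integrable[OF i] _ ae]) (auto intro!: borel_measurable_sum borel_measurable_integrable iT)
  also have "\<dots> = (\<Sum>T\<in>\<T>. integral\<^sup>L lebesgue (\<lambda>x. indicator (interior T) x * \<phi> x))"
    by (rule Bochner_Integration.integral_sum) (rule iT)
  finally show "integral\<^sup>L (lebesgue_on \<Omega>) \<phi> = (\<Sum>T\<in>\<T>. integral\<^sup>L lebesgue (\<lambda>x. indicator (interior T) x * \<phi> x))" .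
qed

end

lemma integrable_indicator_interior:
  fixes \<phi> :: "real^'d::finite \<Rightarrow> real"
  assumes "compact T" "continuous_on UNIV \<phi>"
  shows "integrable lborel (\<lambda>x. indicator (interior T) x * \<phi> x)"
    and "integrable lebesgue (\<lambda>x. indicator (interior T) x * \<phi> x)"
    and "integral\<^sup>L lebesgue (\<lambda>x. indicator (interior T) x * \<phi> x) = integral\<^sup>L lborel (\<lambda>x. indicator (interior T) x * \<phi> x)"
proof -
  have "integrable lborel (\<lambda>x. indicat_real T x *\<^sub>R \<phi> x)"
    by (rule borel_integrable_compact[OF assms(1)]) (auto intro: continuous_on_subset[OF assms(2)])
  then have "integrable lborel (\<lambda>x. indicat_real (interior T) x *\<^sub>R (indicat_real T x *\<^sub>R \<phi> x))"
    by (rule integrable_mult_indicator[rotated]) auto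
  also have "(\<lambda>x. indicat_real (interior T) x *\<^sub>R (indicat_real T x *\<^sub>R \<phi> x)) = (\<lambda>x. indicator (interior T) x * \<phi> x)"
    using interior_subset by (fastforce simp: indicator_def fun_eq_iff)
  finally show i: "integrable lborel (\<lambda>x. indicator (interior T) x * \<phi> x)" .
  then have m: "(\<lambda>x. indicator (interior T) x * \<phi> x) \<in> borel_measurable lborel" by auto
  show "integrable lebesgue (\<lambda>x. indicator (interior T) x * \<phi> x)" using i integrable_completion[OF m] by simp
  show "integral\<^sup>L lebesgue (\<lambda>x. indicator (interior T) x * \<phi> x) = integral\<^sup>L lborel (\<lambda>x. indicator (interior T) x * \<phi> x)"
    by (rule integral_completion[OF m])
qed

text \<open>The simplex is squeezed between the two concentric balls.\<close>

lemma inverse_inequality_simplex: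
  fixes p :: "real^'d::finite \<Rightarrow> real"
  assumes inv: "integral\<^sup>L lborel (\<lambda>x. indicat_real (cball c \<delta>) x * (\<delta> * q x)\<^sup>2)
       \<le> C * integral\<^sup>L lborel (\<lambda>x. indicat_real (cball c r) x * (p x)\<^sup>2)"
    and T: "compact T" "cball c r \<subseteq> interior T" "T \<subseteq> cball c \<delta>" and c: "continuous_on UNIV p" "continuous_on UNIV q" "C \<ge> 0"
  shows "integral\<^sup>L lebesgue (\<lambda>x. indicator (interior T) x * (\<delta> * q x)\<^sup>2) \<le> C * integral\<^sup>L lebesgue (\<lambda>x. indicator (interior T) x * (p x)\<^sup>2)"
proof -
  have cq: "continuous_on UNIV (\<lambda>x. (\<delta> * q x)\<^sup>2)" and cp: "continuous_on UNIV (\<lambda>x. (p x)\<^sup>2)"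
    by (intro continuous_intros c)+
  have "integral\<^sup>L lborel (\<lambda>x. indicator (interior T) x * (\<delta> * q x)\<^sup>2) \<le> integral\<^sup>L lborel (\<lambda>x. indicat_real (cball c \<delta>) x * (\<delta> * q x)\<^sup>2)"
  proof (rule integral_mono[OF integrable_indicator_interior(1)[OF T(1) cq] integrable_on_cball[OF cq]])
    fix x
    show "indicator (interior T) x * (\<delta> * q x)\<^sup>2 \<le> indicat_real (cball c \<delta>) x * (\<delta> * q x)\<^sup>2"
      using T(3) interior_subset[of T] by (intro mult_right_mono) (auto simp: indicator_def)
  qed
  also note inv
  also have "C * integral\<^sup>L lborel (\<lambda>x. indicat_real (cball c r) x * (p x)\<^sup>2) \<le> C * integral\<^sup>L lborel (\<lambda>x. indicator (interior T) x * (p x)\<^sup>2)"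
  proof (intro mult_left_mono integral_mono[OF integrable_on_cball[OF cp] integrable_indicator_interior(1)[OF T(1) cp]] c(3))
    fix x
    show "indicat_real (cball c r) x * (p x)\<^sup>2 \<le> indicator (interior T) x * (p x)\<^sup>2"
      using T(2) by (intro mult_right_mono) (auto simp: indicator_def)
  qed
  finally show ?thesis unfolding integrable_indicator_interior(3)[OF T(1) cq] integrable_indicator_interior(3)[OF T(1) cp] .
qed


context fe_mesh
begin

text \<open>Squares the local estimate into a form that can be integrated. The factor 1 + d counts
  the value and the d partial derivatives, 3 comes from squaring a sum of three terms, and d * d
  from two uses of Cauchy-Schwarz on the double sum of second derivatives.\<close>

lemma superapproximation_pointwise:
  fixes f :: "real^'d \<Rightarrow> real"
  assumes f: "(f has_derivative (\<lambda>h. G \<bullet> h)) (at x)" and G: "norm G \<le> M"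
    and T: "T \<in> \<T>" "x \<in> interior T" and \<delta>: "\<delta> = diameter T" "0 < \<delta>" "\<delta> \<le> 1"
    and C: "barycentric C g e" "card C = CARD('d) + 1" "T = convex hull C"
    and \<zeta>: "\<And>a. a \<in> T \<Longrightarrow> \<bar>\<zeta> a - f x - G \<bullet> (a - x)\<bar> \<le> M * (norm (a - x))\<^sup>2"
    and r: "r > 0" "cball c r \<subseteq> T" "\<delta> \<le> K * r" "K \<ge> 0"
    and p: "(p has_derivative (\<lambda>h. (\<chi> j. q j x) \<bullet> h)) (at x)"
    and q: "\<And>j. (q j has_derivative (\<lambda>h. \<Sum>i\<in>UNIV. h $ i * Q j i x)) (at x)"
    and up: "\<And>y. y \<in> T \<Longrightarrow> u y = p y"
    and v: "\<And>y. y \<in> T \<Longrightarrow> v y = barycentric.local_op C g e (1 / real k) \<zeta> p (\<lambda>x. \<chi> j. q j x) y"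
    and Dv: "(v has_derivative Dv) (at x)" and Du: "(u has_derivative Du) (at x)"
    and c1: "c1 = (3 * real (CARD('d) + 1) * K + 3) * M"
  shows "(v x - f x * u x)\<^sup>2 + (\<Sum>i\<in>UNIV. (Dv (axis i 1) - (f x * Du (axis i 1) + (G \<bullet> axis i 1) * u x))\<^sup>2)
     \<le> (1 + real CARD('d)) * (3 * c1\<^sup>2) * (\<delta>\<^sup>2 * ((u x)\<^sup>2 + (\<Sum>i\<in>UNIV. (Du (axis i 1))\<^sup>2)
           + real CARD('d) * real CARD('d) * (\<Sum>j\<in>UNIV. \<Sum>i\<in>UNIV. (\<delta> * Q j i x)\<^sup>2)))"
proof -
  interpret barycentric C g e by fact
  define s where "s = (\<Sum>j\<in>UNIV. \<Sum>i\<in>UNIV. \<bar>Q j i x\<bar>)"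
  have s0: "s \<ge> 0" unfolding s_def by (intro sum_nonneg) simp
  have xT: "x \<in> T" using T(2) interior_subset by blast
  have CT: "a \<in> T" if "a \<in> C" for a unfolding C(3) by (rule hull_inc[OF that])
  have bT: "bounded T" using mesh_compact_convex(1)[OF T(1)] compact_imp_bounded by blast
  have dist: "norm (a - x) \<le> \<delta>" if "a \<in> C" for a
    using diameter_bounded_bound[OF bT CT[OF that] xT] by (simp add: \<delta>(1) dist_norm)
  have M: "M \<ge> 0" using order_trans[OF norm_ge_zero G] .
  have \<zeta>': "\<bar>\<zeta> a - f x - G \<bullet> (a - x)\<bar> \<le> M * \<delta>\<^sup>2" if "a \<in> C" for a
  proof -
    have "(norm (a - x))\<^sup>2 \<le> \<delta>\<^sup>2" using dist[OF that] by (intro power_mono) auto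
    then show ?thesis using \<zeta>[OF CT[OF that]] mult_left_mono[OF _ M, of "(norm (a - x))\<^sup>2" "\<delta>\<^sup>2"] by linarith
  qed
  have gK: "norm (g a) \<le> K / \<delta>" if "a \<in> C" for a
  proof -
    have "norm (g a) \<le> 1 / r" using gradient_bound[OF that _ r(1)] r(2) C(3) by blast
    also have "\<dots> \<le> K / \<delta>" using r \<delta>(2) by (simp add: field_simps)
    finally show ?thesis .
  qed
  have Qd: "((\<lambda>x. \<chi> j. q j x) has_derivative (\<lambda>h. \<chi> j. \<Sum>i\<in>UNIV. h $ i * Q j i x)) (at x)"
    using q by (subst has_derivative_componentwise_within) (auto simp: Basis_vec_def inner_axis)
  have Qn: "norm (\<chi> j. \<Sum>i\<in>UNIV. h $ i * Q j i x) \<le> s * norm h" for h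
  proof -
    have "norm (\<chi> j. \<Sum>i\<in>UNIV. h $ i * Q j i x) \<le> (\<Sum>j\<in>UNIV. \<bar>\<Sum>i\<in>UNIV. h $ i * Q j i x\<bar>)"
      using norm_le_l1_cart[of "\<chi> j. \<Sum>i\<in>UNIV. h $ i * Q j i x"] by simp
    also have "\<dots> \<le> (\<Sum>j\<in>UNIV. \<Sum>i\<in>UNIV. \<bar>Q j i x\<bar> * norm h)"
    proof (intro sum_mono order_trans[OF sum_abs])
      fix j i
      show "\<bar>h $ i * Q j i x\<bar> \<le> \<bar>Q j i x\<bar> * norm h"
        unfolding abs_mult using component_le_norm_cart[of h i] by (simp add: mult.commute mult_right_mono)
    qed
    also have "\<dots> = s * norm h" by (simp add: s_def sum_distrib_right)
    finally show ?thesis .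
  qed
  have xC: "x \<in> convex hull C" using xT C(3) by simp
  have kk: "0 \<le> 1 / real k" "1 / real k \<le> 1" using k by auto
  define B where "B = \<bar>p x\<bar> + norm (\<chi> j. q j x) + \<delta> * s"
  obtain D where D0: "(local_op (1 / real k) \<zeta> p (\<lambda>x. \<chi> j. q j x) has_derivative D) (at x)"
    "\<bar>local_op (1 / real k) \<zeta> p (\<lambda>x. \<chi> j. q j x) x - f x * p x\<bar>
        \<le> (3 * real (card C) * K + 3) * M * \<delta> * (\<bar>p x\<bar> + norm (\<chi> j. q j x) + \<delta> * s)"
    "\<And>h. \<bar>D h - (f x * ((\<chi> j. q j x) \<bullet> h) + (G \<bullet> h) * p x)\<bar>
        \<le> (3 * real (card C) * K + 3) * M * \<delta> * (\<bar>p x\<bar> + norm (\<chi> j. q j x) + \<delta> * s) * norm h"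
    by (rule local_op_estimate[where K=K and Q="\<lambda>h. \<chi> j. \<Sum>i\<in>UNIV. h $ i * Q j i x" and q="\<lambda>x. \<chi> j. q j x",
        OF xC \<zeta>' dist \<delta>(2,3) G gK r(4) kk p Qd Qn s0], assumption, assumption, assumption, rule that)
  note D = D0(1) D0(2)[folded B_def] D0(3)[folded B_def]
  have vD: "Dv = D"
    by (rule has_derivative_unique[OF Dv fe_derivative_interior[OF T(2) v D(1)]])
  have uD: "Du = (\<lambda>h. (\<chi> j. q j x) \<bullet> h)"
    by (rule has_derivative_unique[OF Du fe_derivative_interior[OF T(2) up p]])
  have E0: "\<bar>v x - f x * u x\<bar> \<le> c1 * \<delta> * B" using D(2) v[OF xT] up[OF xT] by (simp add: c1 C(2))
  have Ei: "\<bar>Dv (axis i 1) - (f x * Du (axis i 1) + (G \<bullet> axis i 1) * u x)\<bar> \<le> c1 * \<delta> * B" for i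
    using D(3)[of "axis i 1"] up[OF xT] by (simp add: vD uD c1 C(2))
  have "(v x - f x * u x)\<^sup>2 \<le> (c1 * \<delta> * B)\<^sup>2" using power_mono[OF E0 abs_ge_zero, of 2] by simp
  moreover have "(\<Sum>i\<in>(UNIV::'d set). (Dv (axis i 1) - (f x * Du (axis i 1) + (G \<bullet> axis i 1) * u x))\<^sup>2)
      \<le> (\<Sum>i\<in>(UNIV::'d set). (c1 * \<delta> * B)\<^sup>2)"
  proof (rule sum_mono)
    fix i :: 'd
    show "(Dv (axis i 1) - (f x * Du (axis i 1) + (G \<bullet> axis i 1) * u x))\<^sup>2 \<le> (c1 * \<delta> * B)\<^sup>2"
      using power_mono[OF Ei[of i] abs_ge_zero, of 2] by simp
  qed
  ultimately have 1: "(v x - f x * u x)\<^sup>2 + (\<Sum>i\<in>UNIV. (Dv (axis i 1) - (f x * Du (axis i 1) + (G \<bullet> axis i 1) * u x))\<^sup>2)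
      \<le> (1 + real CARD('d)) * (c1 * \<delta> * B)\<^sup>2"
    by (simp add: distrib_right)
  have B2: "B\<^sup>2 \<le> 3 * ((u x)\<^sup>2 + (\<Sum>i\<in>UNIV. (Du (axis i 1))\<^sup>2)
           + real CARD('d) * real CARD('d) * (\<Sum>j\<in>UNIV. \<Sum>i\<in>UNIV. (\<delta> * Q j i x)\<^sup>2))"
  proof -
    have three: "(a + b + c)\<^sup>2 \<le> 3 * (a\<^sup>2 + b\<^sup>2 + c\<^sup>2)" for a b c :: real
    proof -
      have "0 \<le> (a - b)\<^sup>2 + (b - c)\<^sup>2 + (a - c)\<^sup>2" by simp
      then show ?thesis by (simp add: power2_eq_square algebra_simps)
    qed
    have n: "(norm (\<chi> j. q j x))\<^sup>2 = (\<Sum>i\<in>UNIV. (Du (axis i 1))\<^sup>2)"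
      unfolding uD power2_norm_eq_inner inner_axis by (simp add: inner_vec_def power2_eq_square)
    have "(\<delta> * s)\<^sup>2 = (\<Sum>j\<in>UNIV. \<Sum>i\<in>UNIV. \<bar>\<delta> * Q j i x\<bar>)\<^sup>2"
      using \<delta>(2) by (simp add: s_def sum_distrib_left abs_mult)
    also have "\<dots> \<le> real CARD('d) * (\<Sum>j\<in>UNIV. (\<Sum>i\<in>UNIV. \<bar>\<delta> * Q j i x\<bar>)\<^sup>2)" by (rule sum_square_le)
    also have "\<dots> \<le> real CARD('d) * (\<Sum>j\<in>UNIV. real CARD('d) * (\<Sum>i\<in>UNIV. \<bar>\<delta> * Q j i x\<bar>\<^sup>2))"
      by (intro mult_left_mono sum_mono sum_square_le) simp
    also have "\<dots> = real CARD('d) * real CARD('d) * (\<Sum>j\<in>UNIV. \<Sum>i\<in>UNIV. (\<delta> * Q j i x)\<^sup>2)"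
      by (simp add: sum_distrib_left mult.assoc)
    finally show ?thesis
      using three[of "\<bar>p x\<bar>" "norm (\<chi> j. q j x)" "\<delta> * s"] n up[OF xT] unfolding B_def by simp
  qed
  have "(c1 * \<delta> * B)\<^sup>2 = (c1\<^sup>2 * \<delta>\<^sup>2) * B\<^sup>2" by (simp add: power_mult_distrib)
  also have "\<dots> \<le> (c1\<^sup>2 * \<delta>\<^sup>2) * (3 * ((u x)\<^sup>2 + (\<Sum>i\<in>UNIV. (Du (axis i 1))\<^sup>2)
           + real CARD('d) * real CARD('d) * (\<Sum>j\<in>UNIV. \<Sum>i\<in>UNIV. (\<delta> * Q j i x)\<^sup>2)))"
    by (intro mult_left_mono B2) simp
  finally have "(c1 * \<delta> * B)\<^sup>2 \<le> 3 * c1\<^sup>2 * (\<delta>\<^sup>2 * ((u x)\<^sup>2 + (\<Sum>i\<in>UNIV. (Du (axis i 1))\<^sup>2)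
           + real CARD('d) * real CARD('d) * (\<Sum>j\<in>UNIV. \<Sum>i\<in>UNIV. (\<delta> * Q j i x)\<^sup>2)))"
    by (simp only: mult_ac)
  then have "(1 + real CARD('d)) * (c1 * \<delta> * B)\<^sup>2 \<le> (1 + real CARD('d)) * (3 * c1\<^sup>2 * (\<delta>\<^sup>2 * ((u x)\<^sup>2 + (\<Sum>i\<in>UNIV. (Du (axis i 1))\<^sup>2)
           + real CARD('d) * real CARD('d) * (\<Sum>j\<in>UNIV. \<Sum>i\<in>UNIV. (\<delta> * Q j i x)\<^sup>2))))"
    by (intro mult_left_mono) auto
  then show ?thesis using 1 by (simp only: mult.assoc)
qed

text \<open>The inverse inequality is used on each element with that element's own diameter, for the
  gradient components of u, and turns \<delta> times the Hessian into the gradient. It enters as an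
  assumption so that CI is fixed before the mesh; the final constant depends on \<sigma>, CI, M and
  the dimension alone.\<close>

lemma superapproximation:
  fixes f :: "real^'d \<Rightarrow> real" and \<sigma> CI M h c1 d :: real
  assumes inv: "\<And>(p :: real^'d \<Rightarrow> real) q c r \<delta> i. p \<in> polys_of_degree_le k \<Longrightarrow>
       (\<And>x. (p has_derivative (\<lambda>h. \<Sum>j\<in>UNIV. h $ j * q j x)) (at x)) \<Longrightarrow> continuous_on UNIV (q i) \<Longrightarrow>
       0 < r \<Longrightarrow> 0 < \<delta> \<Longrightarrow> \<delta> \<le> (8 * \<sigma>) * r \<Longrightarrow>
       integral\<^sup>L lborel (\<lambda>x. indicat_real (cball c \<delta>) x * (\<delta> * q i x)\<^sup>2)
       \<le> CI * integral\<^sup>L lborel (\<lambda>x. indicat_real (cball c r) x * (p x)\<^sup>2)" "CI \<ge> 0"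
    and f: "\<And>x. x \<in> \<Omega> \<Longrightarrow> (f has_derivative (\<lambda>k. \<Sum>i\<in>UNIV. k $ i * gr i x)) (at x)" "M \<ge> 0"
      "\<And>x. x \<in> \<Omega> \<Longrightarrow> \<bar>f x\<bar> \<le> M" "\<And>i x. x \<in> \<Omega> \<Longrightarrow> \<bar>gr i x\<bar> \<le> M"
      "\<And>x y. closed_segment x y \<subseteq> \<Omega> \<Longrightarrow> \<bar>f x - f y\<bar> \<le> M * norm (x - y)"
      "\<And>i x y. closed_segment x y \<subseteq> \<Omega> \<Longrightarrow> \<bar>gr i x - gr i y\<bar> \<le> M * norm (x - y)"
    and shape: "\<And>T. T \<in> \<T> \<Longrightarrow> diameter T \<le> \<sigma> * inball_diameter T"
    and h: "\<And>T. T \<in> \<T> \<Longrightarrow> diameter T \<le> h" "h \<le> 1"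
    and u: "u \<in> fe_space \<Omega> k \<T>"
    and d: "d = real CARD('d)" and c1: "c1 = (3 * (d + 1) * (8 * \<sigma>) + 3) * (d * M)"
  obtains v where "v \<in> fe_space \<Omega> k \<T>" "(\<lambda>x. v x - f x * u x) \<in> H1_lip \<Omega>"
    "H1_inner \<Omega> (\<lambda>x. v x - f x * u x) (\<lambda>x. v x - f x * u x) \<le> ((1 + d) * (3 * c1\<^sup>2) * (1 + d * d * (d * CI))) * h\<^sup>2 * H1_inner \<Omega> u u"
proof -
  \<comment> \<open>Nodal values are limits from inside \<Omega>, which exist at vertices on the
    boundary as well.\<close>
  define \<zeta> where "\<zeta> a = (SOME l. (f \<longlongrightarrow> l) (at a within \<Omega>))" for a
  have \<zeta>: "(f \<longlongrightarrow> \<zeta> a) (at a within \<Omega>)" if "a \<in> closure \<Omega>" for a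
    unfolding \<zeta>_def by (rule someI_ex[OF lipschitz_domain_limit_exists[OF \<Omega>(1,3) f(2) that f(5)]])
  obtain v where v: "v \<in> fe_space \<Omega> k \<T>"
    "\<And>T. T \<in> \<T> \<Longrightarrow> \<exists>C g e p q. barycentric C g e \<and> card C = CARD('d) + 1 \<and> T = convex hull C \<and> p \<in> polys_of_degree_le k \<and>
        (\<forall>x\<in>T. u x = p x) \<and> (\<forall>x. (p has_derivative (\<lambda>h. (\<chi> j. q j x) \<bullet> h)) (at x)) \<and> (\<forall>j. q j \<in> polys_of_degree_le (k - 1)) \<and>
        (\<forall>x\<in>T. v x = barycentric.local_op C g e (1 / real k) \<zeta> p (\<lambda>x. \<chi> j. q j x) x)"
    by (rule operator_exists[OF u, of \<zeta>], rule that)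
  obtain Dv where Dv: "lip_rep \<Omega> v Dv" "\<And>T x. T \<in> \<T> \<Longrightarrow> x \<in> interior T \<Longrightarrow> (v has_derivative Dv x) (at x)"
    by (rule fe_lip_rep[OF v(1)], rule that)
  obtain Du where Du: "lip_rep \<Omega> u Du" "\<And>T x. T \<in> \<T> \<Longrightarrow> x \<in> interior T \<Longrightarrow> (u has_derivative Du x) (at x)"
    by (rule fe_lip_rep[OF u], rule that)
  define Gv where "Gv x = (\<chi> i. gr i x)" for x
  have fD: "(f has_derivative (\<lambda>k. Gv x \<bullet> k)) (at x)" if "x \<in> \<Omega>" for x
    using f(1)[OF that] by (simp add: Gv_def inner_vec_def mult.commute)
  have fl: "lip_rep \<Omega> f (\<lambda>x k. Gv x \<bullet> k)"
    by (rule lip_repI[OF negligible_empty refl, where M=M]) (use fD f(3,5) in auto)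
  define r where "r x = v x - f x * u x" for x
  define Dr where "Dr x k = Dv x k - (f x * Du x k + (Gv x \<bullet> k) * u x)" for x k
  have rl: "lip_rep \<Omega> r Dr"
  proof -
    have "lip_rep \<Omega> (\<lambda>x. v x + (-1) *\<^sub>R (f x * u x)) (\<lambda>x k. Dv x k + (-1) *\<^sub>R (f x * Du x k + (Gv x \<bullet> k) * u x))"
      by (intro lip_rep_add lip_rep_scaleR Dv lip_rep_bilinear[OF bounded_bilinear_mult fl Du(1)])
    moreover have "(\<lambda>x. v x + (-1) *\<^sub>R (f x * u x)) = r" "(\<lambda>x k. Dv x k + (-1) *\<^sub>R (f x * Du x k + (Gv x \<bullet> k) * u x)) = Dr"
      by (simp_all add: fun_eq_iff r_def Dr_def)
    ultimately show ?thesis by (simp only:)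
  qed
  have GM: "norm (Gv x) \<le> d * M" if "x \<in> \<Omega>" for x
  proof -
    have "norm (Gv x) \<le> (\<Sum>i\<in>(UNIV::'d set). \<bar>gr i x\<bar>)" using norm_le_l1_cart[of "Gv x"] by (simp add: Gv_def)
    also have "\<dots> \<le> (\<Sum>i\<in>(UNIV::'d set). M)" by (intro sum_mono f(4) that)
    finally show ?thesis by (simp add: d)
  qed
  define dr where "dr = H1_density r Dr r Dr"
  define du where "du = H1_density u Du u Du"
  have drL: "dr \<in> Linf_space \<Omega>" and duL: "du \<in> Linf_space \<Omega>"
    unfolding dr_def du_def by (rule H1_density_Linf[OF \<Omega>(1) rl rl], rule H1_density_Linf[OF \<Omega>(1) Du(1) Du(1)])
  define K where "K = (1 + d) * (3 * c1\<^sup>2)"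
  have K0: "K \<ge> 0" by (simp add: K_def d)
  have loc: "integral\<^sup>L lebesgue (\<lambda>x. indicator (interior T) x * dr x)
      \<le> (K * (1 + d * d * (d * CI))) * h\<^sup>2 * integral\<^sup>L lebesgue (\<lambda>x. indicator (interior T) x * du x)" if T: "T \<in> \<T>" for T
  proof -
    obtain C g e p q where C: "barycentric C g e" "card C = CARD('d) + 1" "T = convex hull C" "p \<in> polys_of_degree_le k"
        "\<And>x. x \<in> T \<Longrightarrow> u x = p x" "\<And>x. (p has_derivative (\<lambda>h. (\<chi> j. q j x) \<bullet> h)) (at x)" "\<And>j. q j \<in> polys_of_degree_le (k - 1)"
        "\<And>x. x \<in> T \<Longrightarrow> v x = barycentric.local_op C g e (1 / real k) \<zeta> p (\<lambda>x. \<chi> j. q j x) x"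
      using v(2)[OF T] by metis
    note Tc = mesh_compact_convex[OF T]
    have bT: "bounded T" using Tc(1) by (rule compact_imp_bounded)
    define \<delta> where "\<delta> = diameter T"
    \<comment> \<open>Two distinct vertices give a positive diameter, by which the estimates
      divide.\<close>
    have "card C \<ge> 2" using C(2) by (simp add: Suc_leI)
    then obtain D where D: "D \<subseteq> C" "card D = 2" by (rule obtain_subset_with_card_n)
    then obtain a b where ab: "a \<in> C" "b \<in> C" "a \<noteq> b" unfolding card_2_iff by auto
    have "a \<in> T" "b \<in> T" unfolding C(3) using ab by (auto intro: hull_inc)
    then have "dist a b \<le> \<delta>" unfolding \<delta>_def by (rule diameter_bounded_bound[OF bT])
    then have \<delta>0: "\<delta> > 0" using ab(3) zero_less_dist_iff[of a b] by linarith
    have \<delta>h: "\<delta> \<le> h" "\<delta> \<le> 1" using h(1)[OF T] h(2) by (auto simp: \<delta>_def)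
    have dT: "diameter T > 0" using \<delta>0 by (simp add: \<delta>_def)
    obtain c r0 where r0': "r0 > 0" "cball c r0 \<subseteq> interior T" "diameter T \<le> 8 * \<sigma> * r0" "\<sigma> > 0"
      by (rule inscribed_ball[OF dT bT shape[OF T]], rule that)
    note r0 = r0'(1,2) r0'(3)[folded \<delta>_def] r0'(4)
    have cT: "c \<in> T" using r0(1,2) interior_subset by fastforce
    have sub: "T \<subseteq> cball c \<delta>" unfolding \<delta>_def using diameter_bounded_bound[OF bT cT] by auto
    have qk: "q j \<in> polys_of_degree_le k" for j by (rule polys_degree_mono[OF C(7)]) simp
    have ex: "\<exists>Qj. (\<forall>x. (q j has_derivative (\<lambda>h. \<Sum>i\<in>UNIV. h $ i * Qj i x)) (at x)) \<and> (\<forall>i. Qj i \<in> polys_of_degree_le (k - 1))" for j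
      by (rule polys_gradient[OF qk k]) blast
    define Q where "Q j = (SOME Qj. (\<forall>x. (q j has_derivative (\<lambda>h. \<Sum>i\<in>UNIV. h $ i * Qj i x)) (at x)) \<and> (\<forall>i. Qj i \<in> polys_of_degree_le (k - 1)))" for j
    note Q0 = someI_ex[OF ex, folded Q_def]
    have Q: "(q j has_derivative (\<lambda>h. \<Sum>i\<in>UNIV. h $ i * Q j i x)) (at x)" "Q j i \<in> polys_of_degree_le (k - 1)" for j i x
      using Q0[of j] by simp_all
    define qs where "qs x = (\<Sum>j\<in>UNIV. \<Sum>i\<in>UNIV. (\<delta> * Q j i x)\<^sup>2)" for x
    have cQ: "continuous_on UNIV (\<lambda>x. (\<delta> * Q j i x)\<^sup>2)" for j i by (intro continuous_intros polys_continuous[OF Q(2)])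
    have cq: "continuous_on UNIV (\<lambda>x. (q j x)\<^sup>2)" for j by (intro continuous_intros polys_continuous[OF qk])
    have cqs: "continuous_on UNIV qs" unfolding qs_def[abs_def] by (intro continuous_on_sum cQ)
    have dux: "du x = (p x)\<^sup>2 + (\<Sum>j\<in>UNIV. (q j x)\<^sup>2)" if x: "x \<in> interior T" for x
    proof -
      have "Du x = (\<lambda>h. (\<chi> j. q j x) \<bullet> h)"
        by (rule has_derivative_unique[OF Du(2)[OF T x] fe_derivative_interior[OF x C(5) C(6)]])
      moreover have "u x = p x" using x interior_subset by (intro C(5)) blast
      ultimately show ?thesis unfolding du_def H1_density_def by (simp add: inner_axis power2_eq_square)
    qed
    have pw: "indicator (interior T) x * dr x \<le> K * h\<^sup>2 * (indicator (interior T) x * du x + d * d * (indicator (interior T) x * qs x))" for x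
    proof (cases "x \<in> interior T")
      case x: True
      have x\<Omega>: "x \<in> \<Omega>" using x interior_mesh[OF T] by blast
      have \<zeta>a: "\<bar>\<zeta> a - f x - Gv x \<bullet> (a - x)\<bar> \<le> (d * M) * (norm (a - x))\<^sup>2" if a: "a \<in> T" for a
        unfolding Gv_def d
        by (rule vertex_taylor_estimate[OF \<Omega>(1) Tc(2) compact_imp_closed[OF Tc(1)] interior_mesh[OF T] x a \<zeta> f(1) f(2) f(6)])
          (use a T Union_mesh in auto)
      have cb: "cball c r0 \<subseteq> T" using r0(2) interior_subset by blast
      have "dr x = (v x - f x * u x)\<^sup>2 + (\<Sum>i\<in>UNIV. (Dv x (axis i 1) - (f x * Du x (axis i 1) + (Gv x \<bullet> axis i 1) * u x))\<^sup>2)"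
        unfolding dr_def H1_density_def r_def Dr_def by (simp add: power2_eq_square)
      also have "\<dots> \<le> (1 + real CARD('d)) * (3 * c1\<^sup>2) * (\<delta>\<^sup>2 * ((u x)\<^sup>2 + (\<Sum>i\<in>UNIV. (Du x (axis i 1))\<^sup>2)
           + real CARD('d) * real CARD('d) * (\<Sum>j\<in>UNIV. \<Sum>i\<in>UNIV. (\<delta> * Q j i x)\<^sup>2)))"
        by (rule superapproximation_pointwise[where f=f and G="Gv x" and x=x and T=T and \<delta>=\<delta> and C=C and g=g and e=e and \<zeta>=\<zeta> and r=r0 and c=c
              and M="d * M" and K="8 * \<sigma>" and p=p and q=q and Q=Q and u=u and v=v and Dv="Dv x" and Du="Du x" and ?c1.0=c1, OF fD[OF x\<Omega>] GM[OF x\<Omega>] T x \<delta>_def \<delta>0 \<delta>h(2) C(1,2,3) \<zeta>a r0(1) cb r0(3) _ C(6) Q(1) C(5) C(8)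
              Dv(2)[OF T x] Du(2)[OF T x]])
          (use r0(4) in \<open>simp_all add: c1 d\<close>)
      also have "\<dots> = K * \<delta>\<^sup>2 * (du x + d * d * qs x)"
        unfolding K_def du_def H1_density_def qs_def d by (simp add: power2_eq_square mult.assoc)
      also have "\<dots> \<le> K * h\<^sup>2 * (du x + d * d * qs x)"
      proof (intro mult_right_mono mult_left_mono K0)
        show "\<delta>\<^sup>2 \<le> h\<^sup>2" using \<delta>h(1) \<delta>0 by (intro power_mono) auto
        have "du x \<ge> 0" unfolding du_def by (rule H1_density_nonneg[OF \<Omega>(1,2)])
        moreover have "qs x \<ge> 0" unfolding qs_def by (intro sum_nonneg) simp
        ultimately show "0 \<le> du x + d * d * qs x" by (simp add: d)
      qed
      finally show ?thesis using x by simp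
    qed simp
    note idu = integral_mesh(1)[OF duL T]
    note iqs = integrable_indicator_interior(2)[OF Tc(1) cqs]
    have "integral\<^sup>L lebesgue (\<lambda>x. indicator (interior T) x * dr x)
        \<le> integral\<^sup>L lebesgue (\<lambda>x. K * h\<^sup>2 * (indicator (interior T) x * du x + d * d * (indicator (interior T) x * qs x)))"
      using integral_mesh(1)[OF drL T] idu iqs pw by (intro integral_mono) auto
    also have "\<dots> = K * h\<^sup>2 * (integral\<^sup>L lebesgue (\<lambda>x. indicator (interior T) x * du x) + d * d * integral\<^sup>L lebesgue (\<lambda>x. indicator (interior T) x * qs x))"
      using idu iqs by simp
    also have "\<dots> \<le> K * h\<^sup>2 * (integral\<^sup>L lebesgue (\<lambda>x. indicator (interior T) x * du x)
        + d * d * (d * CI * integral\<^sup>L lebesgue (\<lambda>x. indicator (interior T) x * du x)))"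
    proof (intro mult_left_mono add_left_mono)
      have "integral\<^sup>L lebesgue (\<lambda>x. indicator (interior T) x * qs x) = (\<Sum>j\<in>UNIV. \<Sum>i\<in>UNIV. integral\<^sup>L lebesgue (\<lambda>x. indicator (interior T) x * (\<delta> * Q j i x)\<^sup>2))"
      proof -
        have "integral\<^sup>L lebesgue (\<lambda>x. indicator (interior T) x * qs x) = integral\<^sup>L lebesgue (\<lambda>x. \<Sum>j\<in>UNIV. \<Sum>i\<in>UNIV. indicator (interior T) x * (\<delta> * Q j i x)\<^sup>2)"
          by (simp add: qs_def sum_distrib_left)
        also have "\<dots> = (\<Sum>j\<in>UNIV. \<Sum>i\<in>UNIV. integral\<^sup>L lebesgue (\<lambda>x. indicator (interior T) x * (\<delta> * Q j i x)\<^sup>2))"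
          by (subst Bochner_Integration.integral_sum, intro Bochner_Integration.integrable_sum integrable_indicator_interior(2)[OF Tc(1) cQ],
              rule sum.cong[OF refl], rule Bochner_Integration.integral_sum, rule integrable_indicator_interior(2)[OF Tc(1) cQ])
        finally show ?thesis .
      qed
      \<comment> \<open>Inverse inequality for the polynomial \<open>q j\<close>, whose partial
        derivatives are the \<open>Q j i\<close>: the inscribed ball lies in T, and T lies in the
        ball of radius \<delta> about the same centre.\<close>
      also have "\<dots> \<le> (\<Sum>j\<in>(UNIV::'d set). \<Sum>i\<in>(UNIV::'d set). CI * integral\<^sup>L lebesgue (\<lambda>x. indicator (interior T) x * (q j x)\<^sup>2))"
      proof (intro sum_mono)
        fix j i :: 'd
        show "integral\<^sup>L lebesgue (\<lambda>x. indicator (interior T) x * (\<delta> * Q j i x)\<^sup>2) \<le> CI * integral\<^sup>L lebesgue (\<lambda>x. indicator (interior T) x * (q j x)\<^sup>2)"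
          by (rule inverse_inequality_simplex[OF inv(1)[of "q j" "Q j" i r0 \<delta> c] Tc(1) r0(2) sub])
            (use qk Q polys_continuous[OF qk] polys_continuous[OF Q(2)] r0 \<delta>0 inv(2) in auto)
      qed
      also have "\<dots> = d * CI * (\<Sum>j\<in>(UNIV::'d set). integral\<^sup>L lebesgue (\<lambda>x. indicator (interior T) x * (q j x)\<^sup>2))"
        by (simp add: d sum_distrib_left mult.assoc)
      also have "\<dots> \<le> d * CI * integral\<^sup>L lebesgue (\<lambda>x. indicator (interior T) x * du x)"
      proof (intro mult_left_mono)
        have "(\<Sum>j\<in>(UNIV::'d set). integral\<^sup>L lebesgue (\<lambda>x. indicator (interior T) x * (q j x)\<^sup>2))
            = integral\<^sup>L lebesgue (\<lambda>x. \<Sum>j\<in>UNIV. indicator (interior T) x * (q j x)\<^sup>2)"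
          by (rule Bochner_Integration.integral_sum[symmetric]) (rule integrable_indicator_interior(2)[OF Tc(1) cq])
        also have "\<dots> \<le> integral\<^sup>L lebesgue (\<lambda>x. indicator (interior T) x * du x)"
        proof (rule integral_mono[OF Bochner_Integration.integrable_sum[OF integrable_indicator_interior(2)[OF Tc(1) cq]] idu])
          fix x
          show "(\<Sum>j\<in>UNIV. indicator (interior T) x * (q j x)\<^sup>2) \<le> indicator (interior T) x * du x"
            by (cases "x \<in> interior T") (simp_all add: dux)
        qed
        finally show "(\<Sum>j\<in>(UNIV::'d set). integral\<^sup>L lebesgue (\<lambda>x. indicator (interior T) x * (q j x)\<^sup>2))
            \<le> integral\<^sup>L lebesgue (\<lambda>x. indicator (interior T) x * du x)" .
      qed (use inv(2) in \<open>simp add: d\<close>)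
      finally show "integral\<^sup>L lebesgue (\<lambda>x. indicator (interior T) x * qs x) \<le> d * CI * integral\<^sup>L lebesgue (\<lambda>x. indicator (interior T) x * du x)" .
    qed (use K0 in \<open>auto simp: d\<close>)
    finally show ?thesis by (simp add: algebra_simps)
  qed
  show ?thesis
  proof (rule that[OF v(1)])
    have re: "(\<lambda>x. v x - f x * u x) = r" by (auto simp: r_def)
    show "(\<lambda>x. v x - f x * u x) \<in> H1_lip \<Omega>" unfolding re by (rule H1_lipI[OF rl])
    have "H1_inner \<Omega> r r = (\<Sum>T\<in>\<T>. integral\<^sup>L lebesgue (\<lambda>x. indicator (interior T) x * dr x))"
      unfolding H1_inner_eq[OF \<Omega>(1,2) rl rl] dr_def[symmetric] by (rule integral_mesh(2)[OF drL])
    also have "\<dots> \<le> (\<Sum>T\<in>\<T>. (K * (1 + d * d * (d * CI))) * h\<^sup>2 * integral\<^sup>L lebesgue (\<lambda>x. indicator (interior T) x * du x))"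
      by (intro sum_mono loc)
    also have "\<dots> = (K * (1 + d * d * (d * CI))) * h\<^sup>2 * integral\<^sup>L (lebesgue_on \<Omega>) du"
      unfolding integral_mesh(2)[OF duL] by (simp add: sum_distrib_left)
    also have "integral\<^sup>L (lebesgue_on \<Omega>) du = H1_inner \<Omega> u u"
      unfolding H1_inner_eq[OF \<Omega>(1,2) Du(1) Du(1)] du_def ..
    finally show "H1_inner \<Omega> (\<lambda>x. v x - f x * u x) (\<lambda>x. v x - f x * u x) \<le> ((1 + d) * (3 * c1\<^sup>2) * (1 + d * d * (d * CI))) * h\<^sup>2 * H1_inner \<Omega> u u"
      unfolding re K_def .
  qed
qed

end

section \<open>Estimates in the \<open>H\<^sup>1\<close> norm\<close>

lemma H1_inner_mono:
  fixes f :: "real^'d::finite \<Rightarrow> 'b::euclidean_space" and g :: "real^'d \<Rightarrow> 'c::euclidean_space"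
  assumes \<Omega>: "open \<Omega>" "bounded \<Omega>" and f: "lip_rep \<Omega> f Df" and g: "lip_rep \<Omega> g Dg"
    and ae: "AE x in lebesgue_on \<Omega>. H1_density f Df f Df x \<le> C * H1_density g Dg g Dg x"
  shows "H1_inner \<Omega> f f \<le> C * H1_inner \<Omega> g g"
proof -
  have "integral\<^sup>L (lebesgue_on \<Omega>) (H1_density f Df f Df) \<le> integral\<^sup>L (lebesgue_on \<Omega>) (\<lambda>x. C * H1_density g Dg g Dg x)"
    using Linf_integrable[OF H1_density_Linf[OF \<Omega>(1) f f] \<Omega>] Linf_integrable[OF H1_density_Linf[OF \<Omega>(1) g g] \<Omega>] ae
    by (intro integral_mono_AE) auto
  then show ?thesis unfolding H1_inner_eq[OF \<Omega> f f] H1_inner_eq[OF \<Omega> g g] by simp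
qed

text \<open>Leibniz rule and (a + b)^2 \<le> 2 a^2 + 2 b^2. The dependence on f is through M only,
  which matters because this constant enters \<beta>.\<close>

lemma H1_inner_mult_bound:
  fixes f w :: "real^'d::finite \<Rightarrow> real"
  assumes \<Omega>: "open \<Omega>" "bounded \<Omega>" and f: "lip_rep \<Omega> f Df" "\<And>x. x \<in> \<Omega> \<Longrightarrow> \<bar>f x\<bar> \<le> M"
      "\<And>x i. x \<in> \<Omega> \<Longrightarrow> \<bar>Df x (axis i 1)\<bar> \<le> M" and w: "w \<in> H1_lip \<Omega>"
  shows "(\<lambda>x. f x * w x) \<in> H1_lip \<Omega>"
    and "H1_inner \<Omega> (\<lambda>x. f x * w x) (\<lambda>x. f x * w x) \<le> ((3 + 2 * real CARD('d)) * M\<^sup>2) * H1_inner \<Omega> w w"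
proof -
  obtain Dw where Dw: "lip_rep \<Omega> w Dw" using w by (auto simp: H1_lip_def)
  note p = lip_rep_bilinear[OF bounded_bilinear_mult f(1) Dw]
  show "(\<lambda>x. f x * w x) \<in> H1_lip \<Omega>" by (rule H1_lipI[OF p])
  show "H1_inner \<Omega> (\<lambda>x. f x * w x) (\<lambda>x. f x * w x) \<le> ((3 + 2 * real CARD('d)) * M\<^sup>2) * H1_inner \<Omega> w w"
  proof (rule H1_inner_mono[OF \<Omega> p Dw], rule AE_I2)
    fix x assume "x \<in> space (lebesgue_on \<Omega>)"
    then have x: "x \<in> \<Omega>" by simp
    have sq: "a\<^sup>2 \<le> M\<^sup>2" if "\<bar>a\<bar> \<le> M" for a using power_mono[OF that abs_ge_zero, of 2] by simp
    have t: "(f x * Dw x (axis i 1) + Df x (axis i 1) * w x)\<^sup>2 \<le> 2 * (M\<^sup>2 * (Dw x (axis i 1))\<^sup>2) + 2 * (M\<^sup>2 * (w x)\<^sup>2)" for i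
    proof -
      have "(a + b)\<^sup>2 \<le> 2 * a\<^sup>2 + 2 * b\<^sup>2" for a b :: real
        using zero_le_power2[of "a - b"] by (simp add: power2_eq_square algebra_simps)
      from this[of "f x * Dw x (axis i 1)" "Df x (axis i 1) * w x"]
      have "(f x * Dw x (axis i 1) + Df x (axis i 1) * w x)\<^sup>2 \<le> 2 * ((f x)\<^sup>2 * (Dw x (axis i 1))\<^sup>2) + 2 * ((Df x (axis i 1))\<^sup>2 * (w x)\<^sup>2)"
        by (simp add: power_mult_distrib)
      moreover have "(f x)\<^sup>2 * (Dw x (axis i 1))\<^sup>2 \<le> M\<^sup>2 * (Dw x (axis i 1))\<^sup>2" by (intro mult_right_mono sq f(2) x) simp
      moreover have "(Df x (axis i 1))\<^sup>2 * (w x)\<^sup>2 \<le> M\<^sup>2 * (w x)\<^sup>2" by (intro mult_right_mono sq f(3) x) simp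
      ultimately show ?thesis by linarith
    qed
    define W where "W = M\<^sup>2 * (w x)\<^sup>2"
    define S where "S = M\<^sup>2 * (\<Sum>i\<in>UNIV. (Dw x (axis i 1))\<^sup>2)"
    have WS: "W \<ge> 0" "S \<ge> 0" unfolding W_def S_def by (intro mult_nonneg_nonneg sum_nonneg zero_le_power2)+
    have "(\<Sum>i\<in>UNIV. (f x * Dw x (axis i 1) + Df x (axis i 1) * w x)\<^sup>2) \<le> (\<Sum>i\<in>(UNIV::'d set). 2 * (M\<^sup>2 * (Dw x (axis i 1))\<^sup>2) + 2 * W)"
      unfolding W_def by (intro sum_mono t)
    also have "\<dots> = 2 * S + real CARD('d) * (2 * W)" by (simp add: S_def sum.distrib sum_distrib_left)
    finally have 1: "(\<Sum>i\<in>UNIV. (f x * Dw x (axis i 1) + Df x (axis i 1) * w x)\<^sup>2) \<le> 2 * S + real CARD('d) * (2 * W)" .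
    have "(f x)\<^sup>2 * (w x)\<^sup>2 \<le> W" unfolding W_def by (intro mult_right_mono sq f(2) x) simp
    then have "(f x * w x)\<^sup>2 \<le> W" by (simp add: power_mult_distrib)
    then have "H1_density (\<lambda>x. f x * w x) (\<lambda>x h. f x * Dw x h + Df x h * w x) (\<lambda>x. f x * w x) (\<lambda>x h. f x * Dw x h + Df x h * w x) x
        \<le> W + (2 * S + real CARD('d) * (2 * W))"
      using 1 by (simp add: H1_density_def power2_eq_square)
    also have "\<dots> \<le> (3 + 2 * real CARD('d)) * (W + S)"
      using WS by (simp add: algebra_simps)
    also have "\<dots> = (3 + 2 * real CARD('d)) * M\<^sup>2 * H1_density w Dw w Dw x"
      by (simp add: W_def S_def H1_density_def power2_eq_square algebra_simps)
    finally show "H1_density (\<lambda>x. f x * w x) (\<lambda>x h. f x * Dw x h + Df x h * w x) (\<lambda>x. f x * w x) (\<lambda>x h. f x * Dw x h + Df x h * w x) x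
        \<le> (3 + 2 * real CARD('d)) * M\<^sup>2 * H1_density w Dw w Dw x" .
  qed
qed

lemma H1_inner_sum_bound:
  fixes w :: "'i \<Rightarrow> real^'d::finite \<Rightarrow> real"
  assumes \<Omega>: "open \<Omega>" "bounded \<Omega>" and A: "finite A" and w: "\<And>j. j \<in> A \<Longrightarrow> w j \<in> H1_lip \<Omega>"
  shows "(\<lambda>x. \<Sum>j\<in>A. w j x) \<in> H1_lip \<Omega>"
    and "H1_inner \<Omega> (\<lambda>x. \<Sum>j\<in>A. w j x) (\<lambda>x. \<Sum>j\<in>A. w j x) \<le> real (card A) * (\<Sum>j\<in>A. H1_inner \<Omega> (w j) (w j))"
proof -
  define D where "D j = (SOME D. lip_rep \<Omega> (w j) D)" for j
  have D: "lip_rep \<Omega> (w j) (D j)" if "j \<in> A" for j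
    using w[OF that] unfolding D_def H1_lip_def mem_Collect_eq by (rule someI_ex)
  have s: "lip_rep \<Omega> (\<lambda>x. \<Sum>j\<in>A. w j x) (\<lambda>x h. \<Sum>j\<in>A. D j x h)" by (rule lip_rep_sum[OF A D])
  show "(\<lambda>x. \<Sum>j\<in>A. w j x) \<in> H1_lip \<Omega>" by (rule H1_lipI[OF s])
  have i: "integrable (lebesgue_on \<Omega>) (H1_density (w j) (D j) (w j) (D j))" if "j \<in> A" for j
    by (rule Linf_integrable[OF H1_density_Linf[OF \<Omega>(1) D[OF that] D[OF that]] \<Omega>])
  have le: "H1_density (\<lambda>x. \<Sum>j\<in>A. w j x) (\<lambda>x h. \<Sum>j\<in>A. D j x h) (\<lambda>x. \<Sum>j\<in>A. w j x) (\<lambda>x h. \<Sum>j\<in>A. D j x h) x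
      \<le> real (card A) * (\<Sum>j\<in>A. H1_density (w j) (D j) (w j) (D j) x)" for x
  proof -
    have "(\<Sum>i\<in>UNIV. (\<Sum>j\<in>A. D j x (axis i 1))\<^sup>2) \<le> (\<Sum>i\<in>UNIV. real (card A) * (\<Sum>j\<in>A. (D j x (axis i 1))\<^sup>2))"
      by (intro sum_mono sum_square_le)
    also have "\<dots> = real (card A) * (\<Sum>j\<in>A. \<Sum>i\<in>UNIV. (D j x (axis i 1))\<^sup>2)"
      unfolding sum_distrib_left[symmetric] by (subst sum.swap) (rule refl)
    finally show ?thesis
      using sum_square_le[of "\<lambda>j. w j x" A] by (simp add: H1_density_def power2_eq_square sum.distrib distrib_left)
  qed
  have "H1_inner \<Omega> (\<lambda>x. \<Sum>j\<in>A. w j x) (\<lambda>x. \<Sum>j\<in>A. w j x) \<le> integral\<^sup>L (lebesgue_on \<Omega>) (\<lambda>x. real (card A) * (\<Sum>j\<in>A. H1_density (w j) (D j) (w j) (D j) x))"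
    unfolding H1_inner_eq[OF \<Omega> s s]
    by (rule integral_mono[OF Linf_integrable[OF H1_density_Linf[OF \<Omega>(1) s s] \<Omega>] _ le]) (use i in auto)
  also have "\<dots> = real (card A) * (\<Sum>j\<in>A. integral\<^sup>L (lebesgue_on \<Omega>) (H1_density (w j) (D j) (w j) (D j)))"
    using i by (simp add: Bochner_Integration.integral_sum)
  also have "\<dots> = real (card A) * (\<Sum>j\<in>A. H1_inner \<Omega> (w j) (w j))"
    using H1_inner_eq[OF \<Omega> D D] by simp
  finally show "H1_inner \<Omega> (\<lambda>x. \<Sum>j\<in>A. w j x) (\<lambda>x. \<Sum>j\<in>A. w j x) \<le> real (card A) * (\<Sum>j\<in>A. H1_inner \<Omega> (w j) (w j))" .
qed

lemma H1_lip_vec: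
  fixes v :: "real^'d::finite \<Rightarrow> real^'n::finite"
  assumes "\<And>j. (\<lambda>x. v x $ j) \<in> H1_lip \<Omega>"
  shows "v \<in> H1_lip \<Omega>"
proof -
  define D where "D j = (SOME D. lip_rep \<Omega> (\<lambda>x. v x $ j) D)" for j
  have "lip_rep \<Omega> (\<lambda>x. v x $ j) (D j)" for j
    using assms[of j] unfolding D_def H1_lip_def mem_Collect_eq by (rule someI_ex)
  from lip_rep_vec[of \<Omega> v D, OF this] show ?thesis by (rule H1_lipI)
qed

lemma H1_inner_vec:
  fixes v :: "real^'d::finite \<Rightarrow> real^'n::finite"
  assumes \<Omega>: "open \<Omega>" "bounded \<Omega>" and v: "v \<in> H1_lip \<Omega>"
  shows "H1_inner \<Omega> v v = (\<Sum>j\<in>UNIV. H1_inner \<Omega> (\<lambda>x. v x $ j) (\<lambda>x. v x $ j))"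
proof -
  obtain D where D: "lip_rep \<Omega> v D" using v by (auto simp: H1_lip_def)
  note Dj = lip_rep_component[OF D]
  have "H1_density v D v D x = (\<Sum>j\<in>UNIV. H1_density (\<lambda>x. v x $ j) (\<lambda>x h. D x h $ j) (\<lambda>x. v x $ j) (\<lambda>x h. D x h $ j) x)" for x
  proof -
    have "(\<Sum>i\<in>UNIV. D x (axis i 1) \<bullet> D x (axis i 1)) = (\<Sum>j\<in>UNIV. \<Sum>i\<in>UNIV. D x (axis i 1) $ j * D x (axis i 1) $ j)"
      unfolding inner_vec_def by (subst sum.swap) simp
    then show ?thesis by (simp add: H1_density_def inner_vec_def[of "v x"] sum.distrib)
  qed
  then have "H1_inner \<Omega> v v = integral\<^sup>L (lebesgue_on \<Omega>) (\<lambda>x. \<Sum>j\<in>UNIV. H1_density (\<lambda>x. v x $ j) (\<lambda>x h. D x h $ j) (\<lambda>x. v x $ j) (\<lambda>x h. D x h $ j) x)"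
    unfolding H1_inner_eq[OF \<Omega> D D] by presburger
  also have "\<dots> = (\<Sum>j\<in>UNIV. integral\<^sup>L (lebesgue_on \<Omega>) (H1_density (\<lambda>x. v x $ j) (\<lambda>x h. D x h $ j) (\<lambda>x. v x $ j) (\<lambda>x h. D x h $ j)))"
    by (rule Bochner_Integration.integral_sum) (rule Linf_integrable[OF H1_density_Linf[OF \<Omega>(1) Dj Dj] \<Omega>])
  also have "\<dots> = (\<Sum>j\<in>UNIV. H1_inner \<Omega> (\<lambda>x. v x $ j) (\<lambda>x. v x $ j))"
    using H1_inner_eq[OF \<Omega> Dj Dj] by simp
  finally show ?thesis .
qed

text \<open>The inequalities express that the square of s a + t b is nonnegative, for (s, t) = (1,
  -1) and (1/2, 1). The weight 1/4 on a is what allows a small perturbation b to be absorbed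
  later.\<close>

lemma H1_inner_add_bounds:
  fixes a b :: "real^'d::finite \<Rightarrow> 'b::euclidean_space"
  assumes \<Omega>: "open \<Omega>" "bounded \<Omega>" and ab: "a \<in> H1_lip \<Omega>" "b \<in> H1_lip \<Omega>"
  shows "H1_inner \<Omega> (\<lambda>x. a x + b x) (\<lambda>x. a x + b x) \<le> 2 * H1_inner \<Omega> a a + 2 * H1_inner \<Omega> b b"
    and "H1_inner \<Omega> a b \<ge> - (H1_inner \<Omega> a a / 4 + H1_inner \<Omega> b b)"
    and "H1_inner \<Omega> a (\<lambda>x. a x + b x) = H1_inner \<Omega> a a + H1_inner \<Omega> a b"
proof -
  have ex: "H1_inner \<Omega> (\<lambda>x. s *\<^sub>R a x + t *\<^sub>R b x) (\<lambda>x. s *\<^sub>R a x + t *\<^sub>R b x)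
      = s\<^sup>2 * H1_inner \<Omega> a a + 2 * s * t * H1_inner \<Omega> a b + t\<^sup>2 * H1_inner \<Omega> b b" for s t
  proof -
    note m = H1_lip_lincomb[OF ab, of s t]
    show ?thesis
      unfolding H1_inner_lincomb_right[OF \<Omega> m ab] H1_inner_commute[OF \<Omega>, of "\<lambda>x. s *\<^sub>R a x + t *\<^sub>R b x"]
        H1_inner_lincomb_right[OF \<Omega> ab(1) ab] H1_inner_lincomb_right[OF \<Omega> ab(2) ab] H1_inner_commute[OF \<Omega>, of b a]
      by (simp add: power2_eq_square algebra_simps)
  qed
  have nn: "0 \<le> s\<^sup>2 * H1_inner \<Omega> a a + 2 * s * t * H1_inner \<Omega> a b + t\<^sup>2 * H1_inner \<Omega> b b" for s t
    using H1_inner_self_nonneg[OF \<Omega> H1_lip_lincomb[OF ab, of s t]] unfolding ex .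
  show "H1_inner \<Omega> (\<lambda>x. a x + b x) (\<lambda>x. a x + b x) \<le> 2 * H1_inner \<Omega> a a + 2 * H1_inner \<Omega> b b"
    using ex[of 1 1] nn[of 1 "-1"] by simp
  show "H1_inner \<Omega> a b \<ge> - (H1_inner \<Omega> a a / 4 + H1_inner \<Omega> b b)"
    using nn[of "1/2" 1] by (simp add: power2_eq_square)
  show "H1_inner \<Omega> a (\<lambda>x. a x + b x) = H1_inner \<Omega> a a + H1_inner \<Omega> a b"
    using H1_inner_lincomb_right[OF \<Omega> ab(1) ab, of 1 1] by simp
qed

lemma H1_inner_cong_right:
  fixes a b f :: "real^'d::finite \<Rightarrow> 'b::euclidean_space"
  assumes \<Omega>: "open \<Omega>" "bounded \<Omega>" and "a \<in> H1_lip \<Omega>" "b \<in> H1_lip \<Omega>" "f \<in> H1_lip \<Omega>"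
    and N: "negligible N" "\<And>x. x \<in> \<Omega> - N \<Longrightarrow> a x = b x"
  shows "H1_inner \<Omega> f a = H1_inner \<Omega> f b"
proof -
  have "H1_inner \<Omega> (\<lambda>x. 1 *\<^sub>R a x + (-1) *\<^sub>R b x) f = 0"
    by (rule H1_inner_zero[OF \<Omega> N(1)]) (use assms in auto)
  then show ?thesis
    using H1_inner_lincomb_right[OF \<Omega> assms(5,3,4), of 1 "-1"] H1_inner_commute[OF \<Omega>, of f] by simp
qed

lemma AE_negligible:
  assumes "open \<Omega>" "AE x in lebesgue_on \<Omega>. P x"
  obtains N where "negligible N" "\<And>x. x \<in> \<Omega> - N \<Longrightarrow> P x"
proof -
  have "AE x in lebesgue. x \<in> \<Omega> \<longrightarrow> P x"
    using assms(2) unfolding AE_lebesgue_on_iff[OF sets_lebesgue_open[OF assms(1)]] .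
  then obtain N where "N \<in> null_sets lebesgue" "{x \<in> space lebesgue. \<not> (x \<in> \<Omega> \<longrightarrow> P x)} \<subseteq> N"
    by (elim AE_E3) auto
  then show ?thesis by (intro that[of N]) (auto simp: negligible_iff_null_sets)
qed

section \<open>The projected finite element space\<close>

context fe_mesh
begin

lemma vec_fe_H1_lip: "v \<in> vec_fe_space \<Omega> k \<T> \<Longrightarrow> v \<in> H1_lip \<Omega>"
proof (rule H1_lip_vec)
  fix j assume "v \<in> vec_fe_space \<Omega> k \<T>"
  then have vj: "(\<lambda>x. v x $ j) \<in> fe_space \<Omega> k \<T>" by (simp add: vec_fe_space_def)
  show "(\<lambda>x. v x $ j) \<in> H1_lip \<Omega>" by (rule fe_lip_rep[OF vj]) (rule H1_lipI)
qed

lemma vec_fe_lincomb: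
  assumes "u \<in> vec_fe_space \<Omega> k \<T>" "v \<in> vec_fe_space \<Omega> k \<T>"
  shows "(\<lambda>x. a *\<^sub>R u x + b *\<^sub>R v x) \<in> vec_fe_space \<Omega> k \<T>"
  using assms fe_space_lincomb unfolding vec_fe_space_def by simp

text \<open>Monomials cut off to open elements, times unit vectors. They are discontinuous in
  general, but off the skeleton they represent the whole space, which is what
  \<open>projection_exists\<close> asks for; no basis has to be constructed.\<close>

lemma vec_fe_spanned:
  obtains S :: "(real^'d \<Rightarrow> real^'d) set" where "finite S"
    "\<And>v. v \<in> vec_fe_space \<Omega> k \<T> \<Longrightarrow> \<exists>c. \<forall>x\<in>\<Omega> - skeleton. v x = (\<Sum>s\<in>S. c s *\<^sub>R s x)"
proof -
  define I where "I = \<T> \<times> {\<alpha> :: 'd \<Rightarrow> nat. (\<Sum>i\<in>UNIV. \<alpha> i) \<le> k} \<times> (UNIV :: 'd set)"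
  define F where "F = (\<lambda>(T :: (real^'d) set, \<alpha> :: 'd \<Rightarrow> nat, j :: 'd) (x :: real^'d). (indicat_real (interior T) x * monomial \<alpha> x) *\<^sub>R (axis j 1 :: real^'d))"
  have fI: "finite I" unfolding I_def by (intro finite_cartesian_product finite_mesh finite_multi_indices finite)
  show ?thesis
  proof (rule that[of "F ` I"])
    show "finite (F ` I)" using fI by simp
    fix v assume v: "v \<in> vec_fe_space \<Omega> k \<T>"
    have "\<exists>c. \<forall>x\<in>T. v x $ j = (\<Sum>\<alpha> | (\<Sum>i\<in>UNIV. \<alpha> i) \<le> k. c \<alpha> * monomial \<alpha> x)" if T: "T \<in> \<T>" for T j
    proof -
      have vj: "(\<lambda>x. v x $ j) \<in> fe_space \<Omega> k \<T>" using v by (simp add: vec_fe_space_def)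
      obtain p where p: "p \<in> polys_of_degree_le k" "\<And>x. x \<in> T \<Longrightarrow> v x $ j = p x" by (rule fe_piece[OF vj T], rule that)
      then show ?thesis unfolding polys_altdef by auto
    qed
    then obtain c where c: "\<And>T j x. T \<in> \<T> \<Longrightarrow> x \<in> T \<Longrightarrow> v x $ j = (\<Sum>\<alpha> | (\<Sum>i\<in>UNIV. \<alpha> i) \<le> k. c T j \<alpha> * monomial \<alpha> x)"
      by metis
    define h where "h = (\<lambda>(T, \<alpha>, j). c T j \<alpha>)"
    have rep: "v x = (\<Sum>i\<in>I. h i *\<^sub>R F i x)" if x: "x \<in> \<Omega> - skeleton" for x
    proof -
      obtain T0 where T0: "T0 \<in> \<T>" "x \<in> interior T0" using off_skeleton[OF x] by blast
      have xT: "x \<in> T0" using T0(2) interior_subset by blast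
      define P :: "('d \<Rightarrow> nat) set" where "P = {\<alpha>. (\<Sum>i\<in>UNIV. \<alpha> i) \<le> k}"
      define R where "R T \<alpha> j = (c T j \<alpha> * (indicat_real (interior T) x * monomial \<alpha> x)) *\<^sub>R (axis j 1 :: real^'d)" for T \<alpha> j
      have off: "R T \<alpha> j = (if T = T0 then (c T0 j \<alpha> * monomial \<alpha> x) *\<^sub>R axis j 1 else 0)" if "T \<in> \<T>" for T \<alpha> j
      proof (cases "T = T0")
        case False
        have "x \<notin> interior T" using interior_disjoint[OF that T0(1) _ T0(2)] False by blast
        then show ?thesis using False by (simp add: R_def)
      qed (simp add: R_def T0(2))
      have "(\<Sum>i\<in>I. h i *\<^sub>R F i x) = (\<Sum>(T, \<alpha>, j)\<in>\<T> \<times> P \<times> UNIV. R T \<alpha> j)"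
        unfolding I_def P_def by (rule sum.cong) (auto simp: h_def F_def R_def)
      also have "\<dots> = (\<Sum>T\<in>\<T>. \<Sum>\<alpha>\<in>P. \<Sum>j\<in>UNIV. R T \<alpha> j)"
        by (simp only: sum.cartesian_product)
      also have "\<dots> = (\<Sum>T\<in>\<T>. if T = T0 then \<Sum>\<alpha>\<in>P. \<Sum>j\<in>UNIV. (c T0 j \<alpha> * monomial \<alpha> x) *\<^sub>R axis j 1 else 0)"
        by (rule sum.cong[OF refl]) (simp add: off)
      also have "\<dots> = (\<Sum>\<alpha>\<in>P. \<Sum>j\<in>UNIV. (c T0 j \<alpha> * monomial \<alpha> x) *\<^sub>R axis j 1)"
        using T0(1) finite_mesh by simp
      also have "\<dots> = (\<Sum>j\<in>UNIV. \<Sum>\<alpha>\<in>P. (c T0 j \<alpha> * monomial \<alpha> x) *\<^sub>R axis j 1)" by (rule sum.swap)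
      also have "\<dots> = (\<Sum>j\<in>UNIV. v x $ j *\<^sub>R axis j 1)"
        unfolding c[OF T0(1) xT] P_def scaleR_sum_left by (rule refl)
      also have "\<dots> = v x"
        by (simp add: vec_eq_iff axis_def if_distrib cong: if_cong)
      finally show ?thesis by (rule sym)
    qed
    \<comment> \<open>Distinct indices may give the same function, so the coefficients are collected
      over the fibres of F.\<close>
    have "v x = (\<Sum>s\<in>F ` I. (\<Sum>i | i \<in> I \<and> F i = s. h i) *\<^sub>R s x)" if x: "x \<in> \<Omega> - skeleton" for x
    proof -
      have "v x = (\<Sum>s\<in>F ` I. \<Sum>i | i \<in> I \<and> F i = s. h i *\<^sub>R F i x)"
        unfolding rep[OF x] by (rule sum.image_gen[OF fI])
      also have "\<dots> = (\<Sum>s\<in>F ` I. (\<Sum>i | i \<in> I \<and> F i = s. h i) *\<^sub>R s x)"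
        unfolding scaleR_sum_left by (intro sum.cong refl) auto
      finally show ?thesis .
    qed
    then show "\<exists>c. \<forall>x\<in>\<Omega> - skeleton. v x = (\<Sum>s\<in>F ` I. c s *\<^sub>R s x)"
      by (intro exI[of _ "\<lambda>s. \<Sum>i | i \<in> I \<and> F i = s. h i"] ballI)
  qed
qed

lemma H1_lip_imp_H1_space:
  fixes f :: "real^'d \<Rightarrow> 'b::euclidean_space"
  assumes "lip_rep \<Omega> f D"
  shows "f \<in> H1_space \<Omega>"
proof -
  have L2: "g \<in> L2_space \<Omega>" if "g \<in> Linf_space \<Omega>" for g :: "real^'d \<Rightarrow> 'b"
  proof -
    have "integrable (lebesgue_on \<Omega>) (\<lambda>x. g x \<bullet> g x)"
      by (intro Linf_integrable[OF _ \<Omega>(1,2)] Linf_bilinear[OF bounded_bilinear_inner] that)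
    then show ?thesis using that by (simp add: L2_space_def Linf_space_def power2_norm_eq_inner)
  qed
  show ?thesis
    unfolding H1_space_def
    using L2[OF lip_rep_Linf[OF \<Omega>(1) assms]] L2[OF lip_rep_derivative_Linf[OF \<Omega>(1) assms]] lip_rep_weak_deriv[OF \<Omega>(1,2) assms]
    by blast
qed

lemma rigid_motions_lincomb:
  assumes u: "u \<in> H1_lip \<Omega>" "u \<in> rigid_motions \<Omega>" and v: "v \<in> H1_lip \<Omega>" "v \<in> rigid_motions \<Omega>"
  shows "(\<lambda>x. a *\<^sub>R u x + b *\<^sub>R v x) \<in> rigid_motions \<Omega>"
proof -
  obtain Du Dv where D: "lip_rep \<Omega> u Du" "lip_rep \<Omega> v Dv" using u v by (auto simp: H1_lip_def)
  note s = lip_rep_add[OF lip_rep_scaleR[OF D(1), of a] lip_rep_scaleR[OF D(2), of b]]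
  have "AE x in lebesgue_on \<Omega>. weak_partial \<Omega> i (\<lambda>x. a *\<^sub>R u x + b *\<^sub>R v x) x $ j + weak_partial \<Omega> j (\<lambda>x. a *\<^sub>R u x + b *\<^sub>R v x) x $ i = 0" for i j
  proof -
    have 1: "AE x in lebesgue_on \<Omega>. weak_partial \<Omega> i u x $ j + weak_partial \<Omega> j u x $ i = 0"
      and 2: "AE x in lebesgue_on \<Omega>. weak_partial \<Omega> i v x $ j + weak_partial \<Omega> j v x $ i = 0"
      using u(2) v(2) by (auto simp: rigid_motions_def)
    note w = lip_rep_weak_partial[OF \<Omega>(1,2)]
    from 1 2 w[OF D(1), of i] w[OF D(1), of j] w[OF D(2), of i] w[OF D(2), of j] w[OF s, of i] w[OF s, of j]
    show ?thesis
    proof eventually_elim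
      case (elim x)
      have "weak_partial \<Omega> i (\<lambda>x. a *\<^sub>R u x + b *\<^sub>R v x) x $ j + weak_partial \<Omega> j (\<lambda>x. a *\<^sub>R u x + b *\<^sub>R v x) x $ i
         = a * (Du x (axis i 1) $ j + Du x (axis j 1) $ i) + b * (Dv x (axis i 1) $ j + Dv x (axis j 1) $ i)"
        using elim(7,8) by (simp add: algebra_simps)
      then show ?case using elim(1-6) by simp
    qed
  qed
  then show ?thesis unfolding rigid_motions_def using H1_lip_imp_H1_space[OF s] by blast
qed

lemma star_projection:
  assumes z: "z \<in> H1_lip \<Omega>" and v: "v \<in> vec_fe_space \<Omega> k \<T>"
  obtains v' where "v' \<in> vec_fe_space_star \<Omega> k z \<T>" "\<And>\<mu>. \<mu> \<in> fe_space \<Omega> k \<T> \<Longrightarrow> b_form \<Omega> z \<mu> v' = b_form \<Omega> z \<mu> v"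
    "H1_inner \<Omega> v' v' \<le> H1_inner \<Omega> v v"
proof -
  let ?V = "vec_fe_space \<Omega> k \<T>"
  define N where "N = discrete_kernel \<Omega> k z \<T> \<inter> rigid_motions \<Omega>"
  note lip = vec_fe_H1_lip
  have NV: "N \<subseteq> ?V" by (auto simp: N_def discrete_kernel_def)
  have b_lin: "b_form \<Omega> z \<mu> (\<lambda>x. a *\<^sub>R u x + b *\<^sub>R w x) = a * b_form \<Omega> z \<mu> u + b * b_form \<Omega> z \<mu> w"
    if "\<mu> \<in> fe_space \<Omega> k \<T>" "u \<in> ?V" "w \<in> ?V" for \<mu> u w a b
  proof -
    have "\<mu> \<in> H1_lip \<Omega>" by (rule fe_lip_rep[OF that(1)]) (rule H1_lipI)
    from H1_inner_lincomb_right[OF \<Omega>(1,2) this H1_lip_inner[OF lip[OF that(2)] z] H1_lip_inner[OF lip[OF that(3)] z], of a b]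
    show ?thesis by (simp add: b_form_def inner_add_left)
  qed
  have Nlin: "(\<lambda>x. a *\<^sub>R u x + b *\<^sub>R w x) \<in> N" if "u \<in> N" "w \<in> N" for u w a b
  proof -
    have uw: "u \<in> ?V" "w \<in> ?V" using that NV by auto
    have "(\<lambda>x. a *\<^sub>R u x + b *\<^sub>R w x) \<in> discrete_kernel \<Omega> k z \<T>"
      using that vec_fe_lincomb[OF uw] b_lin[OF _ uw] by (auto simp: N_def discrete_kernel_def)
    moreover have "(\<lambda>x. a *\<^sub>R u x + b *\<^sub>R w x) \<in> rigid_motions \<Omega>"
      using that by (intro rigid_motions_lincomb lip uw) (auto simp: N_def)
    ultimately show ?thesis by (simp add: N_def)
  qed
  have zero: "(\<lambda>x. 0) \<in> N"
  proof -
    have zV: "(\<lambda>x. 0) \<in> ?V" using vec_fe_lincomb[OF v v, of 0 0] by simp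
    have l0: "lip_rep \<Omega> (\<lambda>x. 0 :: real^'d) (\<lambda>x h. 0)" by (rule lip_rep_zero[OF negligible_empty]) simp
    have "AE x in lebesgue_on \<Omega>. weak_partial \<Omega> i (\<lambda>x. 0 :: real^'d) x $ j + weak_partial \<Omega> j (\<lambda>x. 0 :: real^'d) x $ i = 0" for i j
      using lip_rep_weak_partial[OF \<Omega>(1,2) l0, of i] lip_rep_weak_partial[OF \<Omega>(1,2) l0, of j] by eventually_elim simp
    moreover have "b_form \<Omega> z \<mu> (\<lambda>x. 0) = 0" if "\<mu> \<in> fe_space \<Omega> k \<T>" for \<mu>
      using b_lin[OF that v v, of 0 0] by simp
    ultimately show ?thesis
      using zV H1_lip_imp_H1_space[OF l0] by (simp add: N_def discrete_kernel_def rigid_motions_def)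
  qed
  \<comment> \<open>The relevant points are those off the skeleton, where the spanning functions
    represent the space; the skeleton is null and invisible to the form.\<close>
  interpret semi_inner ?V "H1_inner \<Omega>" "\<Omega> - skeleton"
  proof
    show "H1_inner \<Omega> u w = 0" if "u \<in> ?V" "w \<in> ?V" "\<And>x. x \<in> \<Omega> - skeleton \<Longrightarrow> u x = 0" for u w
      by (rule H1_inner_zero[OF \<Omega>(1,2) negligible_skeleton that(3) lip[OF that(2)]])
  qed (auto intro: vec_fe_lincomb H1_inner_commute[OF \<Omega>(1,2)] H1_inner_lincomb_right[OF \<Omega>(1,2)] H1_inner_self_nonneg[OF \<Omega>(1,2)] lip)
  obtain S :: "(real^'d \<Rightarrow> real^'d) set" where S: "finite S"
    "\<And>v. v \<in> ?V \<Longrightarrow> \<exists>c. \<forall>x\<in>\<Omega> - skeleton. v x = (\<Sum>s\<in>S. c s *\<^sub>R s x)"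
    by (rule vec_fe_spanned, rule that)
  have "\<exists>w\<in>N. \<forall>n\<in>N. H1_inner \<Omega> v n = H1_inner \<Omega> w n"
  proof (rule projection_exists[OF S(1) NV _ Nlin _ v])
    show "N \<noteq> {}" using zero by auto
    show "\<exists>c. \<forall>x\<in>\<Omega> - skeleton. u x = (\<Sum>s\<in>S. c s *\<^sub>R s x)" if "u \<in> N" for u using S(2) that NV by blast
  qed
  then obtain w where w: "w \<in> N" "\<And>n. n \<in> N \<Longrightarrow> H1_inner \<Omega> v n = H1_inner \<Omega> w n" by blast
  have wV: "w \<in> ?V" using w NV by auto
  define v' where "v' = (\<lambda>x. 1 *\<^sub>R v x + (-1) *\<^sub>R w x)"
  have v'V: "v' \<in> ?V" unfolding v'_def by (rule vec_fe_lincomb[OF v wV])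
  have ip': "H1_inner \<Omega> v' n = H1_inner \<Omega> v n - H1_inner \<Omega> w n" if "n \<in> ?V" for n
    unfolding v'_def using ip_lin'[OF v wV that, of 1 "-1"] by simp
  show ?thesis
  proof (rule that[of v'])
    show "v' \<in> vec_fe_space_star \<Omega> k z \<T>"
      unfolding vec_fe_space_star_def using v'V ip' w(2) NV by (auto simp: N_def)
    show "b_form \<Omega> z \<mu> v' = b_form \<Omega> z \<mu> v" if "\<mu> \<in> fe_space \<Omega> k \<T>" for \<mu>
      using b_lin[OF that v wV, of 1 "-1"] w(1) that by (simp add: v'_def N_def discrete_kernel_def)
    \<comment> \<open>Pythagoras: the square of v' is the square of v minus that of its projection
      w.\<close>
    have "H1_inner \<Omega> v' v' = H1_inner \<Omega> v v' - H1_inner \<Omega> w v'" by (rule ip'[OF v'V])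
    also have "H1_inner \<Omega> w v' = 0" using sym[of w v'] ip'[OF wV] w(2)[OF w(1)] by simp
    also have "H1_inner \<Omega> v v' = H1_inner \<Omega> v v - H1_inner \<Omega> w v" using sym[of v v'] ip'[OF v] by simp
    also have "H1_inner \<Omega> w v = H1_inner \<Omega> w w" using sym[of w v] w(2)[OF w(1)] by simp
    finally show "H1_inner \<Omega> v' v' \<le> H1_inner \<Omega> v v" using nn[OF wV] by simp
  qed
qed

end

section \<open>The inf-sup condition\<close>

context fe_mesh
begin

text \<open>Let \<open>r j\<close> be the error of \<open>w j\<close> against \<open>f j\<close>
  times \<mu>. Since z has norm 1, v . z equals \<mu> + e with e the sum of the products of
  \<open>f j\<close> and \<open>r j\<close>. The smallness condition bounds the square of e by a
  quarter of that of \<mu>, so the cross term costs at most 1/4 + 1/4 and half of the square of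
  \<mu> remains.\<close>

lemma stable_test_function:
  fixes z :: "real^'d \<Rightarrow> real^'d" and f :: "'d \<Rightarrow> real^'d \<Rightarrow> real" and \<sigma> CI M h c1 d C Cm :: real
  assumes inv: "\<And>(p :: real^'d \<Rightarrow> real) q c r \<delta> i. p \<in> polys_of_degree_le k \<Longrightarrow>
       (\<And>x. (p has_derivative (\<lambda>h. \<Sum>j\<in>UNIV. h $ j * q j x)) (at x)) \<Longrightarrow> continuous_on UNIV (q i) \<Longrightarrow>
       0 < r \<Longrightarrow> 0 < \<delta> \<Longrightarrow> \<delta> \<le> (8 * \<sigma>) * r \<Longrightarrow>
       integral\<^sup>L lborel (\<lambda>x. indicat_real (cball c \<delta>) x * (\<delta> * q i x)\<^sup>2)
       \<le> CI * integral\<^sup>L lborel (\<lambda>x. indicat_real (cball c r) x * (p x)\<^sup>2)" "CI \<ge> 0"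
    and f: "\<And>j x. x \<in> \<Omega> \<Longrightarrow> (f j has_derivative (\<lambda>k. \<Sum>i\<in>UNIV. k $ i * gr j i x)) (at x)" "M \<ge> 0"
      "\<And>j x. x \<in> \<Omega> \<Longrightarrow> \<bar>f j x\<bar> \<le> M" "\<And>j i x. x \<in> \<Omega> \<Longrightarrow> \<bar>gr j i x\<bar> \<le> M"
      "\<And>j x y. closed_segment x y \<subseteq> \<Omega> \<Longrightarrow> \<bar>f j x - f j y\<bar> \<le> M * norm (x - y)"
      "\<And>j i x y. closed_segment x y \<subseteq> \<Omega> \<Longrightarrow> \<bar>gr j i x - gr j i y\<bar> \<le> M * norm (x - y)"
    and z: "z \<in> H1_lip \<Omega>" "negligible N" "\<And>j x. x \<in> \<Omega> - N \<Longrightarrow> z x $ j = f j x" "\<And>x. x \<in> \<Omega> - N \<Longrightarrow> norm (z x) = 1"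
    and shape: "\<And>T. T \<in> \<T> \<Longrightarrow> diameter T \<le> \<sigma> * inball_diameter T"
    and h: "\<And>T. T \<in> \<T> \<Longrightarrow> diameter T \<le> h" "0 \<le> h" "h \<le> 1"
    and d: "d = real CARD('d)" and c1: "c1 = (3 * (d + 1) * (8 * \<sigma>) + 3) * (d * M)"
    and C: "C = (1 + d) * (3 * c1\<^sup>2) * (1 + d * d * (d * CI))" and Cm: "Cm = (3 + 2 * d) * M\<^sup>2"
    and small: "d * (d * (Cm * C)) * h\<^sup>2 \<le> 1 / 4"
    and \<mu>: "\<mu> \<in> fe_space \<Omega> k \<T>"
  obtains v where "v \<in> vec_fe_space \<Omega> k \<T>" "b_form \<Omega> z \<mu> v \<ge> H1_inner \<Omega> \<mu> \<mu> / 2"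
    "H1_inner \<Omega> v v \<le> d * (2 * C + 2 * Cm) * H1_inner \<Omega> \<mu> \<mu>"
proof -
  define m where "m = H1_inner \<Omega> \<mu> \<mu>"
  have \<mu>l: "\<mu> \<in> H1_lip \<Omega>" by (rule fe_lip_rep[OF \<mu>]) (rule H1_lipI)
  have m0: "m \<ge> 0" unfolding m_def by (rule H1_inner_self_nonneg[OF \<Omega>(1,2) \<mu>l])
  have d0: "d \<ge> 0" by (simp add: d)
  have C0: "C \<ge> 0" unfolding C using d0 inv(2) by (intro mult_nonneg_nonneg add_nonneg_nonneg) auto
  have Cm0: "Cm \<ge> 0" unfolding Cm using d0 by simp
  have fl: "lip_rep \<Omega> (f j) (\<lambda>x k. \<Sum>i\<in>UNIV. k $ i * gr j i x)" for j
    by (rule lip_repI[OF negligible_empty refl, where M = M]) (simp_all add: f(1,3,5))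
  have fax: "(\<Sum>i\<in>UNIV. axis l 1 $ i * gr j i x) = gr j l x" for j l :: 'd and x
    by (rule sum_axis)
  have ex: "\<forall>j. \<exists>w. w \<in> fe_space \<Omega> k \<T> \<and> (\<lambda>x. w x - f j x * \<mu> x) \<in> H1_lip \<Omega> \<and>
      H1_inner \<Omega> (\<lambda>x. w x - f j x * \<mu> x) (\<lambda>x. w x - f j x * \<mu> x) \<le> C * h\<^sup>2 * m"
  proof
    fix j
    show "\<exists>w. w \<in> fe_space \<Omega> k \<T> \<and> (\<lambda>x. w x - f j x * \<mu> x) \<in> H1_lip \<Omega> \<and>
      H1_inner \<Omega> (\<lambda>x. w x - f j x * \<mu> x) (\<lambda>x. w x - f j x * \<mu> x) \<le> C * h\<^sup>2 * m"
    proof (rule superapproximation[of \<sigma> CI "f j" "gr j" M h \<mu> d c1])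
      show "integral\<^sup>L lborel (\<lambda>x. indicat_real (cball c \<delta>) x * (\<delta> * q i x)\<^sup>2)
        \<le> CI * integral\<^sup>L lborel (\<lambda>x. indicat_real (cball c r) x * (p x)\<^sup>2)"
        if "p \<in> polys_of_degree_le k" "\<And>x. (p has_derivative (\<lambda>h. \<Sum>j\<in>UNIV. h $ j * q j x)) (at x)"
          "continuous_on UNIV (q i)" "0 < r" "0 < \<delta>" "\<delta> \<le> (8 * \<sigma>) * r" for p :: "real^'d \<Rightarrow> real" and q c r \<delta> i
        using that by (rule inv(1)[of p q i r \<delta> c])
      show "\<exists>w. w \<in> fe_space \<Omega> k \<T> \<and> (\<lambda>x. w x - f j x * \<mu> x) \<in> H1_lip \<Omega> \<and>
      H1_inner \<Omega> (\<lambda>x. w x - f j x * \<mu> x) (\<lambda>x. w x - f j x * \<mu> x) \<le> C * h\<^sup>2 * m"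
        if "w \<in> fe_space \<Omega> k \<T>" "(\<lambda>x. w x - f j x * \<mu> x) \<in> H1_lip \<Omega>"
          "H1_inner \<Omega> (\<lambda>x. w x - f j x * \<mu> x) (\<lambda>x. w x - f j x * \<mu> x) \<le> ((1 + d) * (3 * c1\<^sup>2) * (1 + d * d * (d * CI))) * h\<^sup>2 * H1_inner \<Omega> \<mu> \<mu>" for w
        using that unfolding C m_def by (intro exI conjI)
    qed ((rule inv(2) f shape h \<mu> d c1 | assumption)+)
  qed
  obtain w where w: "\<And>j. w j \<in> fe_space \<Omega> k \<T>" "\<And>j. (\<lambda>x. w j x - f j x * \<mu> x) \<in> H1_lip \<Omega>"
      "\<And>j. H1_inner \<Omega> (\<lambda>x. w j x - f j x * \<mu> x) (\<lambda>x. w j x - f j x * \<mu> x) \<le> C * h\<^sup>2 * m"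
    using choice[OF ex] by blast
  define r where "r j = (\<lambda>x. w j x - f j x * \<mu> x)" for j
  define e where "e = (\<lambda>x. \<Sum>j\<in>UNIV. f j x * r j x)"
  define v where "v = (\<lambda>x. \<chi> j. w j x)"
  have rl: "r j \<in> H1_lip \<Omega>" and rn: "H1_inner \<Omega> (r j) (r j) \<le> C * h\<^sup>2 * m" for j
    unfolding r_def by (rule w)+
  have mult1: "(\<lambda>x. f j x * g x) \<in> H1_lip \<Omega>" if "g \<in> H1_lip \<Omega>" for j g
    by (rule H1_inner_mult_bound(1)[OF \<Omega>(1,2) fl f(3) _ that]) (simp_all add: fax f(3,4))
  have mult2: "H1_inner \<Omega> (\<lambda>x. f j x * g x) (\<lambda>x. f j x * g x) \<le> Cm * H1_inner \<Omega> g g" if "g \<in> H1_lip \<Omega>" for j g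
    unfolding Cm d by (rule H1_inner_mult_bound(2)[OF \<Omega>(1,2) fl _ _ that]) (simp_all add: fax f(3,4))
  have vV: "v \<in> vec_fe_space \<Omega> k \<T>" using w(1) by (simp add: v_def vec_fe_space_def)
  have el: "e \<in> H1_lip \<Omega>" unfolding e_def by (rule H1_inner_sum_bound(1)[OF \<Omega>(1,2) finite mult1[OF rl]])
  \<comment> \<open>One factor d comes from squaring the sum, the other from its number of terms; Cm
    pays for multiplication by \<open>f j\<close> and C h^2 for \<open>r j\<close>.\<close>
  have "H1_inner \<Omega> e e \<le> d * (\<Sum>j\<in>UNIV. H1_inner \<Omega> (\<lambda>x. f j x * r j x) (\<lambda>x. f j x * r j x))"
    unfolding e_def d by (rule H1_inner_sum_bound(2)[OF \<Omega>(1,2) finite mult1[OF rl]])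
  also have "\<dots> \<le> d * (\<Sum>j\<in>(UNIV :: 'd set). Cm * (C * h\<^sup>2 * m))"
    by (intro mult_left_mono[OF _ d0] sum_mono order_trans[OF mult2[OF rl] mult_left_mono[OF rn Cm0]])
  also have "\<dots> = (d * (d * (Cm * C)) * h\<^sup>2) * m" by (simp add: d mult_ac)
  also have "\<dots> \<le> 1 / 4 * m" by (rule mult_right_mono[OF small m0])
  finally have en: "H1_inner \<Omega> e e \<le> m / 4" by simp
  have vz: "v x \<bullet> z x = \<mu> x + e x" if x: "x \<in> \<Omega> - N" for x
  proof -
    have "(\<Sum>j\<in>UNIV. f j x * f j x) = 1"
      using z(4)[OF x] z(3)[OF x] by (simp add: norm_eq_1 inner_vec_def)
    then have "\<mu> x = (\<Sum>j\<in>UNIV. f j x * f j x * \<mu> x)" by (simp add: sum_distrib_right[symmetric])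
    then have "\<mu> x + e x = (\<Sum>j\<in>UNIV. f j x * f j x * \<mu> x + f j x * r j x)" by (simp add: e_def sum.distrib)
    also have "\<dots> = v x \<bullet> z x"
      unfolding inner_vec_def by (rule sum.cong) (simp_all add: z(3)[OF x] v_def r_def algebra_simps)
    finally show ?thesis by (rule sym)
  qed
  show ?thesis
  proof (rule that[OF vV])
    have s: "(\<lambda>x. \<mu> x + e x) \<in> H1_lip \<Omega>" using H1_lip_lincomb[OF \<mu>l el, of 1 1] by simp
    \<comment> \<open>z equals f only off N, so v . z = \<mu> + e is an equality a.e., which is
      enough for the inner product.\<close>
    have "b_form \<Omega> z \<mu> v = H1_inner \<Omega> \<mu> (\<lambda>x. \<mu> x + e x)"
      unfolding b_form_def by (rule H1_inner_cong_right[OF \<Omega>(1,2) H1_lip_inner[OF vec_fe_H1_lip[OF vV] z(1)] s \<mu>l z(2) vz])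
    then show "b_form \<Omega> z \<mu> v \<ge> H1_inner \<Omega> \<mu> \<mu> / 2"
      using H1_inner_add_bounds(2,3)[OF \<Omega>(1,2) \<mu>l el] en by (simp add: m_def)
    have wn: "H1_inner \<Omega> (w j) (w j) \<le> (2 * C + 2 * Cm) * m" for j
    proof -
      have "C * h\<^sup>2 * m \<le> C * 1 * m"
        by (intro mult_right_mono mult_left_mono C0 m0 power_le_one h)
      moreover have "(\<lambda>x. r j x + f j x * \<mu> x) = w j" by (simp add: r_def)
      ultimately show ?thesis
        using H1_inner_add_bounds(1)[OF \<Omega>(1,2) rl mult1[OF \<mu>l], of j j] rn[of j] mult2[OF \<mu>l, of j]
        by (simp add: m_def algebra_simps)
    qed
    have "H1_inner \<Omega> v v = (\<Sum>j\<in>UNIV. H1_inner \<Omega> (w j) (w j))"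
      using H1_inner_vec[OF \<Omega>(1,2) vec_fe_H1_lip[OF vV]] by (simp add: v_def)
    also have "\<dots> \<le> (\<Sum>j\<in>(UNIV :: 'd set). (2 * C + 2 * Cm) * m)" by (intro sum_mono wn)
    also have "\<dots> = d * (2 * C + 2 * Cm) * m" by (simp add: d)
    finally show "H1_inner \<Omega> v v \<le> d * (2 * C + 2 * Cm) * H1_inner \<Omega> \<mu> \<mu>" unfolding m_def .
  qed
qed

text \<open>A single test function with large b and controlled norm already bounds the supremum from
  below. Using Cv + 1 instead of Cv keeps the square root positive.\<close>

lemma inf_sup_bound:
  assumes ne: "\<Omega> \<noteq> {}" and z: "z \<in> H1_lip \<Omega>" and Cv: "Cv \<ge> 0"
    and test: "\<And>\<mu>. \<mu> \<in> fe_space \<Omega> k \<T> \<Longrightarrow> \<exists>v\<in>vec_fe_space \<Omega> k \<T>. b_form \<Omega> z \<mu> v \<ge> H1_inner \<Omega> \<mu> \<mu> / 2 \<and> H1_inner \<Omega> v v \<le> Cv * H1_inner \<Omega> \<mu> \<mu>"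
    and \<mu>: "\<mu> \<in> fe_space \<Omega> k \<T>"
  shows "(SUP v\<in>{v \<in> vec_fe_space_star \<Omega> k z \<T>. \<exists>x\<in>\<Omega>. v x \<noteq> 0}. ereal (b_form \<Omega> z \<mu> v / H1_norm \<Omega> v))
      \<ge> ereal (1 / (2 * sqrt (Cv + 1)) * H1_norm \<Omega> \<mu>)"
proof -
  have lip: "\<nu> \<in> H1_lip \<Omega>" if "\<nu> \<in> fe_space \<Omega> k \<T>" for \<nu>
    by (rule fe_lip_rep[OF that]) (rule H1_lipI)
  have key: "\<exists>v\<in>{v \<in> vec_fe_space_star \<Omega> k z \<T>. \<exists>x\<in>\<Omega>. v x \<noteq> 0}. H1_inner \<Omega> v v > 0 \<and>
      b_form \<Omega> z \<nu> v \<ge> H1_inner \<Omega> \<nu> \<nu> / 2 \<and> H1_inner \<Omega> v v \<le> Cv * H1_inner \<Omega> \<nu> \<nu>"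
    if \<nu>: "\<nu> \<in> fe_space \<Omega> k \<T>" "H1_inner \<Omega> \<nu> \<nu> > 0" for \<nu>
  proof -
    obtain v0 where v0: "v0 \<in> vec_fe_space \<Omega> k \<T>" "b_form \<Omega> z \<nu> v0 \<ge> H1_inner \<Omega> \<nu> \<nu> / 2" "H1_inner \<Omega> v0 v0 \<le> Cv * H1_inner \<Omega> \<nu> \<nu>"
      using test[OF \<nu>(1)] by blast
    obtain v where v: "v \<in> vec_fe_space_star \<Omega> k z \<T>" "\<And>\<mu>. \<mu> \<in> fe_space \<Omega> k \<T> \<Longrightarrow> b_form \<Omega> z \<mu> v = b_form \<Omega> z \<mu> v0"
      "H1_inner \<Omega> v v \<le> H1_inner \<Omega> v0 v0"
      by (rule star_projection[OF z v0(1)], rule that)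
    have vl: "v \<in> H1_lip \<Omega>" using v(1) vec_fe_H1_lip by (simp add: vec_fe_space_star_def)
    have b: "b_form \<Omega> z \<nu> v \<ge> H1_inner \<Omega> \<nu> \<nu> / 2" using v(2)[OF \<nu>(1)] v0(2) by simp
    \<comment> \<open>If v were null, v . z would be null too and b would vanish. Nullity must be
      excluded because the quotient divides by the norm.\<close>
    have "H1_inner \<Omega> v v \<noteq> 0"
    proof
      assume v0: "H1_inner \<Omega> v v = 0"
      obtain N where N: "negligible N" "\<And>x. x \<in> \<Omega> - N \<Longrightarrow> v x = 0"
        by (rule H1_inner_self_zero_imp[OF \<Omega>(1,2) vl v0], rule that)
      have "H1_inner \<Omega> (\<lambda>x. v x \<bullet> z x) \<nu> = 0"
        by (rule H1_inner_zero[OF \<Omega>(1,2) N(1) _ lip[OF \<nu>(1)]]) (simp add: N(2))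
      then have "b_form \<Omega> z \<nu> v = 0" unfolding b_form_def by (subst H1_inner_commute[OF \<Omega>(1,2)])
      then show False using b \<nu>(2) by simp
    qed
    then have pos: "H1_inner \<Omega> v v > 0" using H1_inner_self_nonneg[OF \<Omega>(1,2) vl] by simp
    have "\<exists>x\<in>\<Omega>. v x \<noteq> 0"
    proof (rule ccontr)
      assume "\<not> (\<exists>x\<in>\<Omega>. v x \<noteq> 0)"
      then have "H1_inner \<Omega> v v = 0" by (intro H1_inner_zero[OF \<Omega>(1,2) negligible_empty _ vl]) auto
      then show False using pos by simp
    qed
    then show ?thesis using v(1,3) v0(3) b pos by (intro bexI[of _ v]) auto
  qed
  show ?thesis
  proof (cases "H1_inner \<Omega> \<mu> \<mu> > 0")
    case True
    define m where "m = H1_inner \<Omega> \<mu> \<mu>"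
    have m: "m > 0" using True by (simp add: m_def)
    obtain v where v: "v \<in> {v \<in> vec_fe_space_star \<Omega> k z \<T>. \<exists>x\<in>\<Omega>. v x \<noteq> 0}" "H1_inner \<Omega> v v > 0"
      "b_form \<Omega> z \<mu> v \<ge> m / 2" "H1_inner \<Omega> v v \<le> Cv * m"
      using key[OF \<mu> True] unfolding m_def by blast
    have "Cv * m \<le> (Cv + 1) * m" using m by (simp add: algebra_simps)
    then have "sqrt (H1_inner \<Omega> v v) \<le> sqrt (Cv + 1) * sqrt m" using v(4) by (simp add: real_sqrt_mult[symmetric])
    then have "1 / (2 * sqrt (Cv + 1)) * sqrt m * sqrt (H1_inner \<Omega> v v) \<le> 1 / (2 * sqrt (Cv + 1)) * sqrt m * (sqrt (Cv + 1) * sqrt m)"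
      using Cv m by (intro mult_left_mono mult_nonneg_nonneg) auto
    also have "\<dots> = m / 2" using Cv m by (simp add: field_simps)
    also have "\<dots> \<le> b_form \<Omega> z \<mu> v" by (rule v(3))
    finally have "1 / (2 * sqrt (Cv + 1)) * sqrt m \<le> b_form \<Omega> z \<mu> v / sqrt (H1_inner \<Omega> v v)"
      using v(2) by (subst pos_le_divide_eq) auto
    then show ?thesis
      by (intro SUP_upper2[OF v(1)]) (simp only: ereal_less_eq(3) H1_norm_def m_def)
  next
    \<comment> \<open>Here \<mu> vanishes a.e. and the bound to prove is 0. A supremum over the
      empty set would be minus infinity, so a nonzero member of the space is still required; the
      test function for the constant 1 supplies it.\<close>
    case False
    then have z0: "H1_inner \<Omega> \<mu> \<mu> = 0" using H1_inner_self_nonneg[OF \<Omega>(1,2) lip[OF \<mu>]] by simp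
    obtain N where N: "negligible N" "\<And>x. x \<in> \<Omega> - N \<Longrightarrow> \<mu> x = 0"
      by (rule H1_inner_self_zero_imp[OF \<Omega>(1,2) lip[OF \<mu>] z0], rule that)
    have 1: "(\<lambda>x. 1) \<in> fe_space \<Omega> k \<T>"
    proof -
      have "monomial (\<lambda>i :: 'd. 0) = (\<lambda>x. 1)" by (simp add: monomial_def fun_eq_iff)
      then have "(\<lambda>x :: real^'d. 1) \<in> polys_of_degree_le k"
        using monomial_in_polys[of "\<lambda>i :: 'd. 0" k] by simp
      then show ?thesis by (auto simp: fe_space_def)
    qed
    have "H1_inner \<Omega> (\<lambda>x. 1 :: real) (\<lambda>x. 1) \<noteq> 0"
    proof
      assume 0: "H1_inner \<Omega> (\<lambda>x. 1 :: real) (\<lambda>x. 1) = 0"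
      obtain N where N: "negligible N" "\<And>x. x \<in> \<Omega> - N \<Longrightarrow> (1 :: real) = 0"
        by (rule H1_inner_self_zero_imp[OF \<Omega>(1,2) lip[OF 1] 0], rule that)
      have "\<Omega> \<subseteq> N" using N(2) by fastforce
      then have "negligible \<Omega>" by (rule negligible_subset[OF N(1)])
      then show False using open_not_negligible[OF \<Omega>(1) ne] by simp
    qed
    then have "H1_inner \<Omega> (\<lambda>x. 1 :: real) (\<lambda>x. 1) > 0" using H1_inner_self_nonneg[OF \<Omega>(1,2) lip[OF 1]] by simp
    from key[OF 1 this] obtain v where v: "v \<in> {v \<in> vec_fe_space_star \<Omega> k z \<T>. \<exists>x\<in>\<Omega>. v x \<noteq> 0}" by blast
    then have vl: "v \<in> H1_lip \<Omega>" using vec_fe_H1_lip by (simp add: vec_fe_space_star_def)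
    have "b_form \<Omega> z \<mu> v = 0" unfolding b_form_def by (rule H1_inner_zero[OF \<Omega>(1,2) N H1_lip_inner[OF vl z]])
    then show ?thesis by (intro SUP_upper2[OF v]) (simp add: H1_norm_def z0)
  qed
qed

end

theorem lemma5p5:
  fixes \<Omega> :: "(real^'d::finite) set"
    and z :: "real^'d \<Rightarrow> real^'d"
    and k :: nat
    and H :: "real set"
    and \<T> :: "real \<Rightarrow> (real^'d) set set"
  assumes dim: "CARD('d) \<in> {2, 3}"
    and domain: "open \<Omega>" "connected \<Omega>" "bounded \<Omega>" "\<Omega> \<noteq> {}"
    and boundary: "polyhedral_boundary \<Omega>" "lipschitz_boundary \<Omega>"
    and k: "k \<ge> 1"
    and z: "z \<in> Winf_space (k + 1) \<Omega>" "AE x in lebesgue_on \<Omega>. norm (z x) = 1"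
    and H: "H \<subseteq> {0<..}"
    and mesh: "\<And>h. h \<in> H \<Longrightarrow> triangulation_of \<Omega> (\<T> h)"
              "\<And>h. h \<in> H \<Longrightarrow> mesh_size (\<T> h) = h"
    and regular: "shape_regular (\<T> ` H)"
  shows "\<exists>\<beta>>0. \<exists>h0>0. \<forall>h\<in>H. h \<le> h0 \<longrightarrow>
           (\<forall>\<mu>\<in>fe_space \<Omega> k (\<T> h).
              (SUP v\<in>{v \<in> vec_fe_space_star \<Omega> k z (\<T> h). \<exists>x\<in>\<Omega>. v x \<noteq> 0}.
                 ereal (b_form \<Omega> z \<mu> v / H1_norm \<Omega> v))
              \<ge> ereal (\<beta> * H1_norm \<Omega> \<mu>))"
proof -
  \<comment> \<open>The representative, its gradient and its bound for each component are packed
    into one triple, so that a single use of \<open>choice\<close> selects all of them.\<close>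
  let ?P = "\<lambda>j u g M. M \<ge> 0 \<and> (AE x in lebesgue_on \<Omega>. z x $ j = u x) \<and>
    (\<forall>x\<in>\<Omega>. (u has_derivative (\<lambda>k. \<Sum>i\<in>UNIV. k $ i * g i x)) (at x)) \<and>
    (\<forall>x\<in>\<Omega>. \<bar>u x\<bar> \<le> M) \<and> (\<forall>i. \<forall>x\<in>\<Omega>. \<bar>g i x\<bar> \<le> M) \<and>
    (\<forall>x y. closed_segment x y \<subseteq> \<Omega> \<longrightarrow> \<bar>u x - u y\<bar> \<le> M * norm (x - y)) \<and>
    (\<forall>i x y. closed_segment x y \<subseteq> \<Omega> \<longrightarrow> \<bar>g i x - g i y\<bar> \<le> M * norm (x - y))"
  have ex: "\<forall>j. \<exists>t. ?P j (fst t) (fst (snd t)) (snd (snd t))"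
  proof
    fix j
    obtain u g M where "M \<ge> 0" "AE x in lebesgue_on \<Omega>. z x $ j = u x"
      "\<And>x. x \<in> \<Omega> \<Longrightarrow> (u has_derivative (\<lambda>k. \<Sum>i\<in>UNIV. k $ i * g i x)) (at x)"
      "\<And>x. x \<in> \<Omega> \<Longrightarrow> \<bar>u x\<bar> \<le> M" "\<And>i x. x \<in> \<Omega> \<Longrightarrow> \<bar>g i x\<bar> \<le> M"
      "\<And>x y. closed_segment x y \<subseteq> \<Omega> \<Longrightarrow> \<bar>u x - u y\<bar> \<le> M * norm (x - y)"
      "\<And>i x y. closed_segment x y \<subseteq> \<Omega> \<Longrightarrow> \<bar>g i x - g i y\<bar> \<le> M * norm (x - y)"
      by (rule Winf_2_representative[OF domain(1,3) Winf_bounded_linear[OF domain(1) bounded_linear_vec_nth[of j] z(1)]])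
        (use k in simp, rule that)
    then have P: "?P j u g M" by (intro conjI ballI allI impI)
    show "\<exists>t. ?P j (fst t) (fst (snd t)) (snd (snd t))" by (rule exI[of _ "(u, g, M)"], unfold fst_conv snd_conv, rule P)
  qed
  from choice[OF ex] obtain t where t: "\<forall>j. ?P j (fst (t j)) (fst (snd (t j))) (snd (snd (t j)))" ..
  define f where "f j = fst (t j)" for j
  define gr where "gr j = fst (snd (t j))" for j
  define B where "B j = snd (snd (t j))" for j
  note P = spec[OF t, folded f_def gr_def B_def]
  have B0: "B j \<ge> 0" for j using P[of j] by simp
  \<comment> \<open>The sum of the bounds works for all components at once.\<close>
  define M where "M = (\<Sum>j\<in>UNIV. B j)"
  have M0: "M \<ge> 0" unfolding M_def by (intro sum_nonneg B0)
  have BM: "B j \<le> M" for j unfolding M_def by (rule member_le_sum) (use B0 in auto)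
  have fd: "(f j has_derivative (\<lambda>k. \<Sum>i\<in>UNIV. k $ i * gr j i x)) (at x)" if "x \<in> \<Omega>" for j x using P[of j] that by simp
  have fb: "\<bar>f j x\<bar> \<le> M" "\<bar>gr j i x\<bar> \<le> M" if "x \<in> \<Omega>" for j i x using P[of j] that order_trans[OF _ BM[of j]] by simp_all
  have mono: "a \<le> M * norm n" if "a \<le> B j * norm n" for a j and n :: "real^'d"
    by (rule order_trans[OF that]) (rule mult_right_mono[OF BM norm_ge_zero])
  have fL: "\<bar>f j x - f j y\<bar> \<le> M * norm (x - y)" "\<bar>gr j i x - gr j i y\<bar> \<le> M * norm (x - y)" if "closed_segment x y \<subseteq> \<Omega>" for j i x y
    using P[of j] that by (auto intro: mono[of _ j])
  have "AE x in lebesgue_on \<Omega>. z x $ j = f j x" for j using P[of j] by simp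
  then have "AE x in lebesgue_on \<Omega>. \<forall>j. z x $ j = f j x" by (rule eventually_all_finite)
  with z(2) have ae: "AE x in lebesgue_on \<Omega>. (\<forall>j. z x $ j = f j x) \<and> norm (z x) = 1" by eventually_elim simp
  obtain N where N: "negligible N" "\<And>x. x \<in> \<Omega> - N \<Longrightarrow> (\<forall>j. z x $ j = f j x) \<and> norm (z x) = 1"
    by (rule AE_negligible[OF domain(1) ae], rule that)
  have fl: "lip_rep \<Omega> (f j) (\<lambda>x k. \<Sum>i\<in>UNIV. k $ i * gr j i x)" for j
    by (rule lip_repI[OF negligible_empty refl, where M = M]) (simp_all add: fd fb fL)
  have "(\<lambda>x. z x $ j) \<in> H1_lip \<Omega>" for j
    by (rule H1_lipI[OF lip_rep_cong_AE[OF fl[of j] N(1)]]) (simp add: N(2))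
  then have zl: "z \<in> H1_lip \<Omega>" by (rule H1_lip_vec)
  \<comment> \<open>Fixed for the whole family before any h is chosen; the constants below are built
    from \<sigma>, the degree, the dimension and M, which makes \<beta> and h0 independent of the
    mesh.\<close>
  obtain \<sigma> where \<sigma>: "\<And>h T. h \<in> H \<Longrightarrow> T \<in> \<T> h \<Longrightarrow> diameter T \<le> \<sigma> * inball_diameter T"
    using regular by (auto simp: shape_regular_def)
  show ?thesis
  \<comment> \<open>The ratio of diameter to inscribed radius provided by
    \<open>inscribed_ball\<close> is 8 \<sigma>.\<close>
  proof (rule inverse_inequality[OF k, where \<kappa> = "8 * \<sigma>"])
    fix CI :: real
    assume CI: "CI \<ge> 0"
      "\<And>(p :: real^'d \<Rightarrow> real) q c r \<delta> i. p \<in> polys_of_degree_le k \<Longrightarrow>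
         (\<And>x. (p has_derivative (\<lambda>h. \<Sum>j\<in>UNIV. h $ j * q j x)) (at x)) \<Longrightarrow> continuous_on UNIV (q i) \<Longrightarrow>
         0 < r \<Longrightarrow> 0 < \<delta> \<Longrightarrow> \<delta> \<le> (8 * \<sigma>) * r \<Longrightarrow>
         integral\<^sup>L lborel (\<lambda>x. indicat_real (cball c \<delta>) x * (\<delta> * q i x)\<^sup>2)
         \<le> CI * integral\<^sup>L lborel (\<lambda>x. indicat_real (cball c r) x * (p x)\<^sup>2)"
    define d where "d = real CARD('d)"
    define c1 where "c1 = (3 * (d + 1) * (8 * \<sigma>) + 3) * (d * M)"
    define C where "C = (1 + d) * (3 * c1\<^sup>2) * (1 + d * d * (d * CI))"
    define Cm where "Cm = (3 + 2 * d) * M\<^sup>2"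
    define Ce where "Ce = d * (d * (Cm * C))"
    define Cv where "Cv = d * (2 * C + 2 * Cm)"
    have d0: "d \<ge> 0" by (simp add: d_def)
    have C0: "C \<ge> 0" unfolding C_def using d0 CI(1) by (intro mult_nonneg_nonneg add_nonneg_nonneg) auto
    have Cm0: "Cm \<ge> 0" unfolding Cm_def using d0 by simp
    have Ce0: "Ce \<ge> 0" unfolding Ce_def by (intro mult_nonneg_nonneg d0 C0 Cm0)
    have Cv0: "Cv \<ge> 0" unfolding Cv_def using d0 C0 Cm0 by simp
    \<comment> \<open>Gives Ce h^2 \<le> (Ce + 1) h0^2 = h0 / 2 \<le> 1/4 for h \<le> h0, together
      with h0 \<le> 1, which the superapproximation estimate needs.\<close>
    define h0 where "h0 = 1 / (2 * (Ce + 1))"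
    have h0: "h0 > 0" "h0 \<le> 1" "h0 * (Ce + 1) = 1 / 2" using Ce0 by (simp_all add: h0_def field_simps)
    have "(SUP v\<in>{v \<in> vec_fe_space_star \<Omega> k z (\<T> h). \<exists>x\<in>\<Omega>. v x \<noteq> 0}. ereal (b_form \<Omega> z \<mu> v / H1_norm \<Omega> v))
        \<ge> ereal (1 / (2 * sqrt (Cv + 1)) * H1_norm \<Omega> \<mu>)"
      if h: "h \<in> H" "h \<le> h0" and \<mu>: "\<mu> \<in> fe_space \<Omega> k (\<T> h)" for h \<mu>
    proof -
      interpret fe_mesh \<Omega> k "\<T> h" by unfold_locales (use domain boundary mesh(1)[OF h(1)] k in auto)
      have hp: "h > 0" using H h(1) by auto
      have dm: "diameter T \<le> h" if "T \<in> \<T> h" for T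
        using mesh(2)[OF h(1)] that finite_mesh unfolding mesh_size_def by (metis Max_ge finite_imageI imageI)
      have "Ce * h\<^sup>2 \<le> (Ce + 1) * (h0 * h0)"
        unfolding power2_eq_square using hp h(2) h0 Ce0 by (intro mult_mono) auto
      also have "\<dots> = (h0 * (Ce + 1)) * h0" by (simp only: mult_ac)
      also have "\<dots> = h0 / 2" unfolding h0(3) by simp
      also have "\<dots> \<le> h0 * (Ce + 1) / 2" using Ce0 h0(1) by (simp add: field_simps)
      finally have small: "d * (d * (Cm * C)) * h\<^sup>2 \<le> 1 / 4" using h0(3) by (simp add: Ce_def)
      have h1: "h \<le> 1" using h(2) h0(2) by simp
      have test: "\<exists>v\<in>vec_fe_space \<Omega> k (\<T> h). b_form \<Omega> z \<mu> v \<ge> H1_inner \<Omega> \<mu> \<mu> / 2 \<and> H1_inner \<Omega> v v \<le> Cv * H1_inner \<Omega> \<mu> \<mu>"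
        if \<mu>: "\<mu> \<in> fe_space \<Omega> k (\<T> h)" for \<mu>
      proof (rule stable_test_function[of \<sigma> CI f gr M z N h d c1 C Cm \<mu>])
        show "integral\<^sup>L lborel (\<lambda>x. indicat_real (cball c \<delta>) x * (\<delta> * q i x)\<^sup>2)
          \<le> CI * integral\<^sup>L lborel (\<lambda>x. indicat_real (cball c r) x * (p x)\<^sup>2)"
          if "p \<in> polys_of_degree_le k" "\<And>x. (p has_derivative (\<lambda>h. \<Sum>j\<in>UNIV. h $ j * q j x)) (at x)"
            "continuous_on UNIV (q i)" "0 < r" "0 < \<delta>" "\<delta> \<le> (8 * \<sigma>) * r" for p :: "real^'d \<Rightarrow> real" and q c r \<delta> i
          using that by (rule CI(2)[of p q i r \<delta> c])
        show "z x $ j = f j x" if "x \<in> \<Omega> - N" for j x using N(2)[OF that] by simp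
        show "norm (z x) = 1" if "x \<in> \<Omega> - N" for x using N(2)[OF that] by simp
        show "\<exists>v\<in>vec_fe_space \<Omega> k (\<T> h). b_form \<Omega> z \<mu> v \<ge> H1_inner \<Omega> \<mu> \<mu> / 2 \<and> H1_inner \<Omega> v v \<le> Cv * H1_inner \<Omega> \<mu> \<mu>"
          if "v \<in> vec_fe_space \<Omega> k (\<T> h)" "b_form \<Omega> z \<mu> v \<ge> H1_inner \<Omega> \<mu> \<mu> / 2"
            "H1_inner \<Omega> v v \<le> d * (2 * C + 2 * Cm) * H1_inner \<Omega> \<mu> \<mu>" for v
          using that unfolding Cv_def by (intro bexI conjI)
      qed ((rule CI(1) fd M0 fb fL zl N(1) \<sigma>[OF h(1)] dm less_imp_le[OF hp] h1 d_def c1_def C_def Cm_def small \<mu> | assumption)+)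
      show ?thesis by (rule inf_sup_bound[OF domain(4) zl Cv0 test \<mu>])
    qed
    moreover have "1 / (2 * sqrt (Cv + 1)) > 0" using Cv0 by simp
    ultimately show ?thesis using h0(1) by blast
  qed
qed

end
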